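(* Let $d\ge2$ be an integer and let $\mu$ be a probability distribution on $S_d$ whose single ball transition matrix $U$ is irreducible. Let $\gamma$ denote the spectral gap of $U$ and let $q=\min\{1-U(i,i):i\in[d]\}$. Then the following hold. (a) Consider the sequence $\{\mathbf X^{(n)}\}_{n\in\mathbb N}$ of multi-stack random-to-random shuffle chains where the $n$th chain has parameters $(d,n,\mu)$. Then, for any fixed $\varepsilon\in(0,1)$, $$\frac{n\log n}{2\gamma}-O(n)\le t^{(n)}_{\mathrm{mix}}(\varepsilon)\le\max\left\{\frac1{2\gamma},1\right\}\cdot n\log n+O(n\log\log n).$$ (b) Consider the sequence $\{\mathbf X^{(n)}\}_{n\in\mathbb N}$ of restricted multi-stack random-to-random shuffle chains where the $n$th chain has parameters $(d,n,\mu)$. Then, for any fixed $\varepsilon\in(0,1)$, $$\frac{n\log n}{2\gamma}-O(n)\le t^{(n)}_{\mathrm{mix}}(\varepsilon)\le\max\left\{\frac1{2\gamma},\frac1q\right\}\cdot n\log n+O(n\log\log n).$$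
   Context: $[d]=\{1,\dots,d\}$, $S_d$ is the symmetric group on $[d]$, and $U(i,j)=\mathbb P_{\sigma\sim\mu}(\sigma(i)=j)$. Spectral gap: $\gamma=\min\{1-\mathrm{Re}(\lambda):U\mathbf v=\lambda\mathbf v\text{ for some non-constant }\mathbf v\in\mathbb C^d\}$. Multi-stack random-to-random shuffle with parameters $(d,n,\mu)$: a deck of $dn$ distinct cards is split into $d$ ordered stacks of $n$ cards each. A state is a full arrangement (which card is in which position of which stack). In each step, $\sigma\sim\mu$ is sampled and, for each $i\in[d]$, a card drawn uniformly at random from stack $i$ is sent to a uniformly random position in stack $\sigma(i)$; within each stack, the relative order of the $n-1$ cards not picked in this step stays the same. All choices are independent. The restricted multi-stack random-to-random shuffle is the same, except that cards are only drawn from those stacks $i$ with $\sigma(i)\ne i$; the stacks with $\sigma(i)=i$ remain unaffected in that step. The chains are run in continuous time, making steps at rate $1$. The mixing time is $t^{(n)}_{\mathrm{mix}}(\varepsilon)=\inf\{t\ge0:\max_x\|\mathbb P(X^{(n)}_t\in\cdot\mid X^{(n)}_0=x)-\mathrm{Unif}\|_{\mathrm{TV}}\le\varepsilon\}$, where $\mathrm{Unif}$ is the uniform distribution on all $(dn)!$ arrangements. Asymptotic notation is as $n\to\infty$, with implied constants not depending on $n$. *)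

theory Defs
  imports
    "HOL-Probability.Probability"
    "HOL-Combinatorics.Permutations"
    "HOL-Library.Landau_Symbols"
begin

text \<open>
  The index set $[d]$ is a finite type \<open>'d\<close> with \<open>CARD('d) = d\<close>, and a distribution on $S_d$
  is a pmf on \<open>'d \<Rightarrow> 'd\<close> supported on permutations.
\<close>

definition single_ball_matrix :: "('d::finite \<Rightarrow> 'd) pmf \<Rightarrow> real ^ 'd ^ 'd" where
  "single_ball_matrix \<mu> = (\<chi> i j. measure_pmf.prob \<mu> {\<sigma>. \<sigma> i = j})"

text \<open>The power is iterated \<open>**\<close>, since \<open>^\<close> on vectors would be componentwise.\<close>

definition irreducible_matrix :: "real ^ 'd ^ ('d::finite) \<Rightarrow> bool" where
  "irreducible_matrix U \<longleftrightarrow> (\<forall>i j. \<exists>k::nat. (((**) U) ^^ k) (mat 1) $ i $ j > 0)"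

definition spectral_gap :: "real ^ 'd ^ ('d::finite) \<Rightarrow> real" where
  "spectral_gap U =
     Min {1 - Re l | l. \<exists>v :: complex ^ 'd.
            map_matrix complex_of_real U *v v = l *s v \<and> (\<exists>i j. v $ i \<noteq> v $ j)}"


text \<open>
  A state assigns to every stack the list of its cards. The \<open>d n\<close> cards are numbered, and
  every card occurs in exactly one position of exactly one stack.
\<close>

definition arrangements :: "nat \<Rightarrow> ('d::finite \<Rightarrow> nat list) set" where
  "arrangements n =
     {x. (\<forall>i. length (x i) = n) \<and>
         bij_betw (\<lambda>(i, k). x i ! k) (UNIV \<times> {..<n}) {..<CARD('d) * n}}"

definition remove_at :: "nat \<Rightarrow> 'a list \<Rightarrow> 'a list" where
  "remove_at k xs = take k xs @ drop (Suc k) xs"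

definition insert_at :: "nat \<Rightarrow> 'a \<Rightarrow> 'a list \<Rightarrow> 'a list" where
  "insert_at k c xs = take k xs @ c # drop k xs"

text \<open>
  Simultaneously for all \<open>i\<close> in \<open>A\<close>, the card in position \<open>p i\<close> of stack \<open>i\<close> is sent to
  position \<open>r i\<close> of stack \<open>\<sigma> i\<close>. Here \<open>\<sigma>\<close> is a permutation mapping \<open>A\<close> onto itself, so each
  stack \<open>j\<close> in \<open>A\<close> loses one card and receives one, from stack \<open>inv \<sigma> j\<close>; the new card has
  position \<open>r (inv \<sigma> j)\<close> in the resulting stack.
\<close>

definition move_cards ::
    "'d set \<Rightarrow> ('d \<Rightarrow> 'd) \<Rightarrow> ('d \<Rightarrow> nat) \<Rightarrow> ('d \<Rightarrow> nat) \<Rightarrow> ('d \<Rightarrow> 'a list) \<Rightarrow> ('d \<Rightarrow> 'a list)" where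
  "move_cards A \<sigma> p r x =
     (\<lambda>j. if j \<in> A
          then (let i = inv \<sigma> j in insert_at (r i) (x i ! p i) (remove_at (p j) (x j)))
          else x j)"

text \<open>In a step only the stacks in \<open>act \<sigma>\<close> take part.\<close>

definition shuffle_step ::
    "(('d \<Rightarrow> 'd) \<Rightarrow> 'd set) \<Rightarrow> nat \<Rightarrow> ('d::finite \<Rightarrow> 'd) pmf \<Rightarrow>
     ('d \<Rightarrow> nat list) \<Rightarrow> ('d \<Rightarrow> nat list) pmf" where
  "shuffle_step act n \<mu> x =
     bind_pmf \<mu> (\<lambda>\<sigma>.
     bind_pmf (Pi_pmf UNIV 0 (\<lambda>_. pmf_of_set {..<n})) (\<lambda>p.
     bind_pmf (Pi_pmf UNIV 0 (\<lambda>_. pmf_of_set {..<n})) (\<lambda>r.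
     return_pmf (move_cards (act \<sigma>) \<sigma> p r x))))"

definition multi_stack_step ::
    "nat \<Rightarrow> ('d::finite \<Rightarrow> 'd) pmf \<Rightarrow> ('d \<Rightarrow> nat list) \<Rightarrow> ('d \<Rightarrow> nat list) pmf" where
  "multi_stack_step = shuffle_step (\<lambda>\<sigma>. UNIV)"

definition restricted_multi_stack_step ::
    "nat \<Rightarrow> ('d::finite \<Rightarrow> 'd) pmf \<Rightarrow> ('d \<Rightarrow> nat list) \<Rightarrow> ('d \<Rightarrow> nat list) pmf" where
  "restricted_multi_stack_step = shuffle_step (\<lambda>\<sigma>. {i. \<sigma> i \<noteq> i})"


text \<open>
  The law at time \<open>t\<close> of the chain started in \<open>x\<close> that makes a \<open>K\<close>-step at each point of a
  rate 1 Poisson process. The case distinction is needed because \<open>poisson_pmf 0\<close> is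
  unspecified.
\<close>

definition continuous_time_law :: "('s \<Rightarrow> 's pmf) \<Rightarrow> 's \<Rightarrow> real \<Rightarrow> 's pmf" where
  "continuous_time_law K x t =
     (if t > 0
      then bind_pmf (poisson_pmf t) (\<lambda>k. ((\<lambda>p. bind_pmf p K) ^^ k) (return_pmf x))
      else return_pmf x)"

definition tv_dist :: "'s pmf \<Rightarrow> 's pmf \<Rightarrow> real" where
  "tv_dist p q = (SUP A. \<bar>measure_pmf.prob p A - measure_pmf.prob q A\<bar>)"

text \<open>
  The value is extended real, so that a chain that never comes within \<open>\<epsilon>\<close> of uniform has
  mixing time \<open>\<infinity>\<close>.
\<close>

definition mixing_time :: "('s \<Rightarrow> 's pmf) \<Rightarrow> 's set \<Rightarrow> real \<Rightarrow> ereal" where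
  "mixing_time K S \<epsilon> =
     (INF t \<in> {t::real. t \<ge> 0 \<and>
               (MAX x \<in> S. tv_dist (continuous_time_law K x t) (pmf_of_set S)) \<le> \<epsilon>}.
        ereal t)"

end

theory Submission
  imports Defs
    "HOL-Computational_Algebra.Fundamental_Theorem_Algebra"
    "HOL-Combinatorics.Multiset_Permutations"
    "HOL-Real_Asymp.Real_Asymp"
begin

text \<open>
  All estimates are made for the chain in discrete time; Chebyshev's inequality for the Poisson number
  of steps transfers them to continuous time at the cost of \<open>O(n)\<close> in the time.

  Lower bound. Let \<open>v\<close> be an eigenvector of \<open>U\<close> whose eigenvalue \<open>l\<close> attains the gap, and let \<open>B\<close> be the
  initial set of cards of one stack. In each step the mean of \<open>\<Sum>j. v j * card (B \<inter> stack j)\<close> is multiplied by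
  \<open>1 + (l - 1) / n\<close>, while its variance stays \<open>O(n)\<close>. Hence the statistic remains visible until the mean
  is of order \<open>sqrt n\<close>.

  Upper bound. The state consists of the contents of the stacks and of the order within each stack.
  The entropy of the order relative to the uniform order with the same contents decays by the factor
  \<open>1 - q / n\<close> in each step: this is Shearer's inequality, as each card is redrawn with probability
  at least \<open>q / n\<close>, and a redrawn card is inserted at a uniform position. For the contents only the
  numbers of cards of each colour in each stack matter, the colour of a card being its initial stack.
  Two copies are coupled by drawing cards of equal colours as often as possible. In a norm adapted to the
  Jordan structure of \<open>U\<close> the difference of their colour counts contracts at rate \<open>gap / n\<close>, until it is
  small compared with \<open>sqrt n\<close>. Another \<open>O(n)\<close> steps remove the rest, because a swap of two cards changes
  the law of the contents at that time by only \<open>O(1 / sqrt n)\<close>.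
\<close>

section \<open>Entropy and Shearer's inequality\<close>

text \<open>The two terms of the maximum have separate causes. The colour counts may differ by order
  \<open>n\<close> at the start and must come down to their natural fluctuation
  \<open>sqrt n\<close>, which takes \<open>n ln n / (2 gap)\<close> steps; the order must lose an
  entropy of up to order \<open>n ln n\<close>, which takes \<open>n ln n / q\<close> steps.
  \<open>U\<close> is not assumed symmetric or diagonalisable, so its powers are controlled through
  products of factors \<open>U - l\<close>, weighted by powers of \<open>L\<close>. The weights cost
  \<open>1 / (n L)\<close> in the rate and a power of \<open>L\<close> in the size of the norm. With
  \<open>L = ln n\<close> the first loss is a bounded factor over order \<open>n ln n\<close> steps,
  and the second is repaid by order \<open>n ln ln n\<close> further steps: this is the origin of
  the error term. The coupling is not run until both copies agree, since its noise keeps the bound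
  on the difference at a power of \<open>ln n\<close>; the swaps remove what is left. Shearer's
  inequality in turn needs independent coordinates and strictly positive weights, provided by
  auxiliary labels and by averaging with the uniform law.\<close>

lemma log_sum_inequality:
  fixes u v :: "'z \<Rightarrow> real"
  assumes fin: "finite Z" and u: "\<And>z. z \<in> Z \<Longrightarrow> u z > 0" and v: "\<And>z. z \<in> Z \<Longrightarrow> v z > 0"
  shows "(\<Sum>y\<in>g ` Z. (\<Sum>z\<in>{z\<in>Z. g z = y}. u z) *
            ln ((\<Sum>z\<in>{z\<in>Z. g z = y}. u z) / (\<Sum>z\<in>{z\<in>Z. g z = y}. v z)))
         \<le> (\<Sum>z\<in>Z. u z * ln (u z / v z))"
proof -
  define U where "U y = (\<Sum>z\<in>{z\<in>Z. g z = y}. u z)" for y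
  define W where "W y = (\<Sum>z\<in>{z\<in>Z. g z = y}. v z)" for y
  have Upos: "U y > 0" "W y > 0" if "y \<in> g ` Z" for y
    unfolding U_def W_def using that fin u v by (auto intro!: sum_pos)
  have a: "U y * ln (U y / W y) \<le> (\<Sum>z\<in>{z\<in>Z. g z = y}. u z * ln (u z / v z))" if y: "y \<in> g ` Z" for y
  proof -
    \<comment> \<open>These are the linear terms of \<open>ln t \<le> t - 1\<close>, where
      \<open>t\<close> is the ratio of the two conditional probabilities within the fibre; they
      cancel in the sum.\<close>
    have "0 = (\<Sum>z\<in>{z\<in>Z. g z = y}. u z - v z * (U y / W y))"
      using Upos[OF y] unfolding sum_subtractf sum_distrib_right[symmetric] U_def[symmetric] W_def[symmetric] by simp
    also have "\<dots> \<le> (\<Sum>z\<in>{z\<in>Z. g z = y}. u z * ln (u z / v z) - u z * ln (U y / W y))"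
    proof (rule sum_mono)
      fix z assume "z \<in> {z\<in>Z. g z = y}"
      then have uz: "u z > 0" "v z > 0" using u v by auto
      let ?t = "v z * (U y / W y) / u z"
      have t: "?t > 0" using uz Upos[OF y] by simp
      have "ln ?t \<le> ?t - 1" using ln_le_minus_one[OF t] .
      moreover have "ln ?t = ln (U y / W y) - ln (u z / v z)"
        using uz Upos[OF y] by (simp add: ln_mult ln_div)
      ultimately have "ln (U y / W y) - ln (u z / v z) \<le> ?t - 1" by simp
      then have "u z * (ln (U y / W y) - ln (u z / v z)) \<le> u z * (?t - 1)"
        using uz by (intro mult_left_mono) auto
      also have "\<dots> = v z * (U y / W y) - u z" using uz by (simp add: field_simps)
      finally show "u z - v z * (U y / W y) \<le> u z * ln (u z / v z) - u z * ln (U y / W y)"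
        by (simp add: algebra_simps)
    qed
    also have "\<dots> = (\<Sum>z\<in>{z\<in>Z. g z = y}. u z * ln (u z / v z)) - U y * ln (U y / W y)"
      by (simp add: sum_subtractf U_def flip: sum_distrib_right)
    finally show ?thesis by simp
  qed
  have "(\<Sum>y\<in>g ` Z. U y * ln (U y / W y)) \<le> (\<Sum>y\<in>g ` Z. \<Sum>z\<in>{z\<in>Z. g z = y}. u z * ln (u z / v z))"
    by (intro sum_mono a)
  also have "\<dots> = (\<Sum>z\<in>Z. u z * ln (u z / v z))"
    using fin by (rule sum.image_gen[symmetric])
  finally show ?thesis by (simp add: U_def W_def)
qed

text \<open>Pinsker's inequality up to the constant. The loss is harmless because the entropy is
  made to tend to zero.\<close>

lemma sum_abs_diff_le_relative_entropy:
  fixes u v :: "'z \<Rightarrow> real"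
  assumes fin: "finite Z" and u: "\<And>z. z \<in> Z \<Longrightarrow> u z > 0" and v: "\<And>z. z \<in> Z \<Longrightarrow> v z > 0"
    and su: "sum u Z = 1" and sv: "sum v Z = 1"
  shows "(\<Sum>z\<in>Z. \<bar>u z - v z\<bar>) \<le> 2 * sqrt (\<Sum>z\<in>Z. u z * ln (u z / v z))"
proof -
  \<comment> \<open>The entropy dominates the squared Hellinger distance, which controls the left-hand side by Cauchy-Schwarz.\<close>
  have "(\<Sum>z\<in>Z. (sqrt (u z) - sqrt (v z))\<^sup>2) \<le> (\<Sum>z\<in>Z. u z * ln (u z / v z) - u z + v z)"
  proof (rule sum_mono)
    fix z assume "z \<in> Z"
    then have uz: "u z > 0" "v z > 0" using u v by auto
    define s where "s = sqrt (v z) / sqrt (u z)"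
    have s: "s > 0" using uz by (simp add: s_def)
    have "ln s \<le> s - 1" by (rule ln_le_minus_one[OF s])
    moreover have "ln (u z / v z) = - 2 * ln s"
      using uz by (simp add: s_def ln_div ln_sqrt)
    ultimately have "ln (u z / v z) \<ge> 2 * (1 - s)" by simp
    then have "u z * ln (u z / v z) \<ge> u z * (2 * (1 - s))" using uz by (intro mult_left_mono) auto
    moreover have "u z * s = sqrt (u z) * sqrt (v z)"
      using uz by (simp add: s_def field_simps)
    ultimately show "(sqrt (u z) - sqrt (v z))\<^sup>2 \<le> u z * ln (u z / v z) - u z + v z"
      using uz by (simp add: power2_diff algebra_simps)
  qed
  also have "\<dots> = (\<Sum>z\<in>Z. u z * ln (u z / v z))"
    by (simp add: sum.distrib sum_subtractf su sv)
  finally have a: "(\<Sum>z\<in>Z. (sqrt (u z) - sqrt (v z))\<^sup>2) \<le> (\<Sum>z\<in>Z. u z * ln (u z / v z))" .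
  have "(\<Sum>z\<in>Z. (sqrt (u z) + sqrt (v z))\<^sup>2) \<le> (\<Sum>z\<in>Z. 2 * u z + 2 * v z)"
  proof (rule sum_mono)
    fix z assume "z \<in> Z"
    then have uz: "u z > 0" "v z > 0" using u v by auto
    have "(sqrt (u z) - sqrt (v z))\<^sup>2 \<ge> 0" by simp
    then show "(sqrt (u z) + sqrt (v z))\<^sup>2 \<le> 2 * u z + 2 * v z"
      using uz by (simp add: power2_diff power2_sum)
  qed
  also have "\<dots> = 4" by (simp add: sum.distrib su sv flip: sum_distrib_left)
  finally have b: "(\<Sum>z\<in>Z. (sqrt (u z) + sqrt (v z))\<^sup>2) \<le> 4" .
  have "(\<Sum>z\<in>Z. \<bar>u z - v z\<bar>) = (\<Sum>z\<in>Z. \<bar>sqrt (u z) - sqrt (v z)\<bar> * \<bar>sqrt (u z) + sqrt (v z)\<bar>)"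
  proof (rule sum.cong)
    fix z assume "z \<in> Z"
    then have uz: "u z > 0" "v z > 0" using u v by auto
    then show "\<bar>u z - v z\<bar> = \<bar>sqrt (u z) - sqrt (v z)\<bar> * \<bar>sqrt (u z) + sqrt (v z)\<bar>"
      by (subst abs_mult[symmetric]) (simp add: algebra_simps)
  qed simp
  also have "\<dots> \<le> L2_set (\<lambda>z. sqrt (u z) - sqrt (v z)) Z * L2_set (\<lambda>z. sqrt (u z) + sqrt (v z)) Z"
    by (rule L2_set_mult_ineq)
  also have "\<dots> \<le> sqrt (\<Sum>z\<in>Z. u z * ln (u z / v z)) * sqrt 4"
    unfolding L2_set_def using a b by (intro mult_mono real_sqrt_le_mono) (auto intro!: sum_nonneg order_trans[OF _ a])
  finally show ?thesis by (simp add: mult.commute)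
qed

section \<open>Independent coordinates and conditional expectation\<close>

definition mix :: "'c set \<Rightarrow> ('c \<Rightarrow> 'l) \<Rightarrow> ('c \<Rightarrow> 'l) \<Rightarrow> 'c \<Rightarrow> 'l" where
  "mix S L L' = (\<lambda>c. if c \<in> S then L c else L' c)"

text \<open>Closure under \<open>mix\<close> makes the finite set \<open>\<Omega>\<close> a product
  set, so the coordinates are independent under its uniform distribution. Conditional expectations
  become plain averages over resampled coordinates, without product measures.\<close>

locale mix_space =
  fixes \<Omega> :: "('c \<Rightarrow> 'l) set"
  assumes finite_space: "finite \<Omega>" and nonempty_space: "\<Omega> \<noteq> {}"
    and mix_closed: "\<And>S L L'. L \<in> \<Omega> \<Longrightarrow> L' \<in> \<Omega> \<Longrightarrow> mix S L L' \<in> \<Omega>"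
begin

lemma card_space_pos: "real (card \<Omega>) > 0"
  using finite_space nonempty_space by (simp add: card_gt_0_iff)

text \<open>Exchanging the coordinates outside \<open>S\<close> between two points is an involution
  of \<open>\<Omega> \<times> \<Omega>\<close>; hence a mixture of two independent uniform points is
  again uniform.\<close>

lemma sum_mix:
  fixes F :: "('c \<Rightarrow> 'l) \<Rightarrow> real"
  shows "(\<Sum>L\<in>\<Omega>. \<Sum>L'\<in>\<Omega>. F (mix S L L')) = card \<Omega> * (\<Sum>L\<in>\<Omega>. F L)"
proof -
  have "(\<Sum>L\<in>\<Omega>. \<Sum>L'\<in>\<Omega>. F (mix S L L')) = (\<Sum>(L, L')\<in>\<Omega>\<times>\<Omega>. F (mix S L L'))"
    by (simp add: sum.cartesian_product)
  also have "\<dots> = (\<Sum>(L, L')\<in>\<Omega>\<times>\<Omega>. F L)"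
    by (rule sum.reindex_bij_witness[where i = "\<lambda>(L, L'). (mix S L L', mix S L' L)"
          and j = "\<lambda>(L, L'). (mix S L L', mix S L' L)"])
       (auto simp: mix_closed, auto simp: mix_def fun_eq_iff)
  also have "\<dots> = card \<Omega> * (\<Sum>L\<in>\<Omega>. F L)"
    by (simp add: sum.cartesian_product[symmetric] sum_distrib_left)
  finally show ?thesis .
qed

text \<open>The conditional expectation of \<open>G\<close> given the coordinates in
  \<open>S\<close>, kept as a function on all of \<open>\<Omega>\<close>. For a density
  \<open>G\<close> it is the density of the marginal on \<open>S\<close>.\<close>

definition marg :: "(('c \<Rightarrow> 'l) \<Rightarrow> real) \<Rightarrow> 'c set \<Rightarrow> ('c \<Rightarrow> 'l) \<Rightarrow> real" where
  "marg G S L = (\<Sum>L'\<in>\<Omega>. G (mix S L L')) / card \<Omega>"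

lemma marg_pos: "(\<And>L. L \<in> \<Omega> \<Longrightarrow> G L > 0) \<Longrightarrow> L \<in> \<Omega> \<Longrightarrow> marg G S L > 0"
  unfolding marg_def using finite_space nonempty_space card_space_pos
  by (intro divide_pos_pos sum_pos) (auto simp: mix_closed)

lemma marg_mix: "S \<subseteq> T \<Longrightarrow> marg G S (mix T L L') = marg G S L"
  unfolding marg_def by (intro arg_cong2[where f = "(/)"] sum.cong) (auto simp: mix_def fun_eq_iff intro!: arg_cong[where f = G])

text \<open>The characteristic property of conditional expectation: a test function
  \<open>\<phi>\<close> that sees only the coordinates in \<open>S\<close> does not notice the
  averaging.\<close>

lemma sum_marg:
  assumes "\<And>L L'. L \<in> \<Omega> \<Longrightarrow> L' \<in> \<Omega> \<Longrightarrow> \<phi> (mix S L L') = \<phi> L"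
  shows "(\<Sum>L\<in>\<Omega>. marg F S L * \<phi> L) = (\<Sum>L\<in>\<Omega>. F L * \<phi> L)"
proof -
  have "(\<Sum>L\<in>\<Omega>. marg F S L * \<phi> L) = (\<Sum>L\<in>\<Omega>. \<Sum>L'\<in>\<Omega>. F (mix S L L') * \<phi> (mix S L L')) / card \<Omega>"
    by (simp add: marg_def sum_divide_distrib sum_distrib_right assms)
  also have "\<dots> = (\<Sum>L\<in>\<Omega>. F L * \<phi> L)"
    using sum_mix[of "\<lambda>L. F L * \<phi> L" S] card_space_pos by simp
  finally show ?thesis .
qed

text \<open>This is where the independence of the coordinates enters: for dependent coordinates,
  conditioning first on \<open>A\<close> and then on \<open>B\<close> would not reduce to the
  intersection.\<close>

lemma marg_marg: "L \<in> \<Omega> \<Longrightarrow> marg (marg G A) B L = marg G (A \<inter> B) L"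
proof -
  assume L: "L \<in> \<Omega>"
  have "mix A (mix B L L') L'' = mix (A \<inter> B) L (mix A L' L'')" for L' L''
    by (auto simp: mix_def)
  then have "marg (marg G A) B L = (\<Sum>L'\<in>\<Omega>. \<Sum>L''\<in>\<Omega>. G (mix (A \<inter> B) L (mix A L' L''))) / card \<Omega> / card \<Omega>"
    by (simp add: marg_def sum_divide_distrib)
  also have "\<dots> = marg G (A \<inter> B) L"
    using sum_mix[of "\<lambda>L'. G (mix (A \<inter> B) L L')" A] card_space_pos by (simp add: marg_def)
  finally show ?thesis .
qed

text \<open>Relative entropy of the marginal on \<open>S\<close> against the uniform distribution.
  Since \<open>G\<close> is not normalised, the value at the empty set is the mean of
  \<open>G\<close> times its logarithm and need not vanish; it is subtracted wherever entropies are
  compared.\<close>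

definition marg_ent :: "(('c \<Rightarrow> 'l) \<Rightarrow> real) \<Rightarrow> 'c set \<Rightarrow> real" where
  "marg_ent G S = (\<Sum>L\<in>\<Omega>. G L * ln (marg G S L)) / card \<Omega>"

text \<open>Strong subadditivity of entropy. The ratio \<open>t\<close> compares the marginal on
  \<open>A \<union> T\<close> with the law that makes \<open>A\<close> and \<open>T\<close>
  conditionally independent given \<open>A \<inter> T\<close>. Its total against \<open>G\<close>
  equals that of the constant 1, so \<open>ln t \<le> t - 1\<close> gives the sign.\<close>

lemma marg_ent_supermodular:
  assumes G: "\<And>L. L \<in> \<Omega> \<Longrightarrow> G L > 0"
  shows "marg_ent G A + marg_ent G T \<le> marg_ent G (A \<union> T) + marg_ent G (A \<inter> T)"
proof -
  note pos = marg_pos[of G, OF G]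
  define t where "t L = marg G T L * marg G A L / (marg G (A \<inter> T) L * marg G (A \<union> T) L)" for L
  have tpos: "t L > 0" if "L \<in> \<Omega>" for L using pos that by (simp add: t_def)
  \<comment> \<open>Conditioning on \<open>A \<union> T\<close> and then on \<open>T\<close> cancels
    one factor of the denominator each.\<close>
  have "(\<Sum>L\<in>\<Omega>. G L * t L) = (\<Sum>L\<in>\<Omega>. marg G (A \<union> T) L * t L)"
    by (rule sum_marg[symmetric]) (auto simp: t_def marg_mix le_infI1)
  also have "\<dots> = (\<Sum>L\<in>\<Omega>. marg G A L * (marg G T L / marg G (A \<inter> T) L))"
  proof (intro sum.cong refl)
    fix L assume "L \<in> \<Omega>"
    with pos have "marg G (A \<union> T) L > 0" by blast
    then show "marg G (A \<union> T) L * t L = marg G A L * (marg G T L / marg G (A \<inter> T) L)"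
      by (simp add: t_def field_simps)
  qed
  also have "\<dots> = (\<Sum>L\<in>\<Omega>. marg (marg G A) T L * (marg G T L / marg G (A \<inter> T) L))"
    by (rule sum_marg[symmetric]) (auto simp: marg_mix)
  also have "\<dots> = (\<Sum>L\<in>\<Omega>. marg G T L * 1)"
  proof (intro sum.cong refl)
    fix L assume L: "L \<in> \<Omega>"
    with pos have "marg G (A \<inter> T) L > 0" by blast
    then show "marg (marg G A) T L * (marg G T L / marg G (A \<inter> T) L) = marg G T L * 1"
      by (simp add: marg_marg[OF L])
  qed
  also have "\<dots> = (\<Sum>L\<in>\<Omega>. G L * 1)" by (rule sum_marg) auto
  finally have s: "(\<Sum>L\<in>\<Omega>. G L * t L) = (\<Sum>L\<in>\<Omega>. G L)" by simp
  have "(\<Sum>L\<in>\<Omega>. G L * ln (t L)) \<le> (\<Sum>L\<in>\<Omega>. G L * (t L - 1))"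
    using G tpos by (intro sum_mono mult_left_mono ln_le_minus_one) (auto intro: less_imp_le)
  also have "\<dots> = 0" using s by (simp add: algebra_simps sum_subtractf)
  finally have "(\<Sum>L\<in>\<Omega>. G L * ln (t L)) \<le> 0" .
  moreover have "(\<Sum>L\<in>\<Omega>. G L * ln (t L)) = (\<Sum>L\<in>\<Omega>. G L * ln (marg G A L)) + (\<Sum>L\<in>\<Omega>. G L * ln (marg G T L))
     - (\<Sum>L\<in>\<Omega>. G L * ln (marg G (A \<union> T) L)) - (\<Sum>L\<in>\<Omega>. G L * ln (marg G (A \<inter> T) L))"
    unfolding sum.distrib[symmetric] sum_subtractf[symmetric]
  proof (intro sum.cong refl)
    fix L assume L: "L \<in> \<Omega>"
    with pos have "marg G (A \<inter> T) L > 0" "marg G (A \<union> T) L > 0" "marg G T L > 0" "marg G A L > 0" by blast+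
    then show "G L * ln (t L) = G L * ln (marg G A L) + G L * ln (marg G T L) - G L * ln (marg G (A \<union> T) L)
        - G L * ln (marg G (A \<inter> T) L)"
      by (simp add: t_def ln_div ln_mult algebra_simps)
  qed
  ultimately have "(\<Sum>L\<in>\<Omega>. G L * ln (marg G A L)) + (\<Sum>L\<in>\<Omega>. G L * ln (marg G T L))
     \<le> (\<Sum>L\<in>\<Omega>. G L * ln (marg G (A \<union> T) L)) + (\<Sum>L\<in>\<Omega>. G L * ln (marg G (A \<inter> T) L))" by linarith
  then show ?thesis
    unfolding marg_ent_def add_divide_distrib[symmetric] using card_space_pos by (simp add: divide_right_mono)
qed

lemma marg_ent_mono:
  assumes G: "\<And>L. L \<in> \<Omega> \<Longrightarrow> G L > 0" and AB: "A \<subseteq> B"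
  shows "marg_ent G A \<le> marg_ent G B"
proof -
  note pos = marg_pos[of G, OF G]
  define t where "t L = marg G A L / marg G B L" for L
  have tpos: "t L > 0" if "L \<in> \<Omega>" for L using pos that by (simp add: t_def)
  have "(\<Sum>L\<in>\<Omega>. G L * t L) = (\<Sum>L\<in>\<Omega>. marg G B L * t L)"
    by (rule sum_marg[symmetric]) (use AB in \<open>auto simp: t_def marg_mix\<close>)
  also have "\<dots> = (\<Sum>L\<in>\<Omega>. marg G A L * 1)"
  proof (intro sum.cong refl)
    fix L assume "L \<in> \<Omega>"
    with pos have "marg G B L > 0" by blast
    then show "marg G B L * t L = marg G A L * 1" by (simp add: t_def)
  qed
  also have "\<dots> = (\<Sum>L\<in>\<Omega>. G L * 1)" by (rule sum_marg) auto
  finally have s: "(\<Sum>L\<in>\<Omega>. G L * t L) = (\<Sum>L\<in>\<Omega>. G L)" by simp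
  have "(\<Sum>L\<in>\<Omega>. G L * ln (t L)) \<le> (\<Sum>L\<in>\<Omega>. G L * (t L - 1))"
    using G tpos by (intro sum_mono mult_left_mono ln_le_minus_one) (auto intro: less_imp_le)
  also have "\<dots> = 0" using s by (simp add: algebra_simps sum_subtractf)
  finally have "(\<Sum>L\<in>\<Omega>. G L * ln (t L)) \<le> 0" .
  moreover have "(\<Sum>L\<in>\<Omega>. G L * ln (t L)) = (\<Sum>L\<in>\<Omega>. G L * ln (marg G A L)) - (\<Sum>L\<in>\<Omega>. G L * ln (marg G B L))"
    unfolding sum_subtractf[symmetric]
  proof (intro sum.cong refl)
    fix L assume L: "L \<in> \<Omega>"
    with pos have "marg G B L > 0" "marg G A L > 0" by blast+
    then show "G L * ln (t L) = G L * ln (marg G A L) - G L * ln (marg G B L)"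
      by (simp add: t_def ln_div algebra_simps)
  qed
  ultimately show ?thesis
    unfolding marg_ent_def using card_space_pos by (simp add: divide_right_mono)
qed

text \<open>Induction over the coordinates. A new coordinate \<open>c\<close> raises the entropy on
  \<open>V - C \<omega>\<close> by at most its increment on all of \<open>V\<close>, by
  supermodularity, and by nothing if \<open>\<omega>\<close> removes \<open>c\<close>, which happens
  with weight at least \<open>q\<close>.\<close>

lemma shearer:
  assumes G: "\<And>L. L \<in> \<Omega> \<Longrightarrow> G L > 0"
    and V: "finite V" and I: "finite I" and w: "\<And>\<omega>. \<omega> \<in> I \<Longrightarrow> w \<omega> \<ge> 0" and w1: "sum w I = 1"
    and q: "\<And>c. c \<in> V \<Longrightarrow> (\<Sum>\<omega>\<in>{\<omega>\<in>I. c \<in> C \<omega>}. w \<omega>) \<ge> q"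
  shows "(\<Sum>\<omega>\<in>I. w \<omega> * (marg_ent G (V - C \<omega>) - marg_ent G {})) \<le> (1 - q) * (marg_ent G V - marg_ent G {})"
  using V q
proof (induction V)
  case empty
  then show ?case by simp
next
  case (insert c V)
  let ?h = "marg_ent G"
  have inc: "?h (insert c V) - ?h V \<ge> 0" using marg_ent_mono[of G V "insert c V"] G by auto
  have step: "?h (insert c V - C \<omega>) \<le> ?h (V - C \<omega>) + (if c \<in> C \<omega> then 0 else ?h (insert c V) - ?h V)" for \<omega>
  proof (cases "c \<in> C \<omega>")
    case True
    then have "insert c V - C \<omega> = V - C \<omega>" by auto
    with True show ?thesis by simp
  next
    case False
    then have "(insert c V - C \<omega>) \<union> V = insert c V" "(insert c V - C \<omega>) \<inter> V = V - C \<omega>"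
      using insert.hyps by auto
    with False marg_ent_supermodular[of G, OF G, of "insert c V - C \<omega>" V] show ?thesis by simp
  qed
  have "(\<Sum>\<omega>\<in>I. w \<omega> * (?h (insert c V - C \<omega>) - ?h {})) \<le>
    (\<Sum>\<omega>\<in>I. w \<omega> * (?h (V - C \<omega>) - ?h {}) + (?h (insert c V) - ?h V) * (if c \<in> C \<omega> then 0 else w \<omega>))"
  proof (rule sum_mono)
    fix \<omega> assume "\<omega> \<in> I"
    then have "w \<omega> * (?h (insert c V - C \<omega>) - ?h {}) \<le>
       w \<omega> * (?h (V - C \<omega>) + (if c \<in> C \<omega> then 0 else ?h (insert c V) - ?h V) - ?h {})"
      using step[of \<omega>] w by (intro mult_left_mono) auto
    then show "w \<omega> * (?h (insert c V - C \<omega>) - ?h {}) \<le>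
       w \<omega> * (?h (V - C \<omega>) - ?h {}) + (?h (insert c V) - ?h V) * (if c \<in> C \<omega> then 0 else w \<omega>)"
      by (simp add: algebra_simps split: if_splits)
  qed
  also have "\<dots> = (\<Sum>\<omega>\<in>I. w \<omega> * (?h (V - C \<omega>) - ?h {})) + (?h (insert c V) - ?h V) * (\<Sum>\<omega>\<in>I. if c \<in> C \<omega> then 0 else w \<omega>)"
    by (simp add: sum.distrib flip: sum_distrib_left)
  also have "(\<Sum>\<omega>\<in>I. if c \<in> C \<omega> then 0 else w \<omega>) = 1 - (\<Sum>\<omega>\<in>{\<omega>\<in>I. c \<in> C \<omega>}. w \<omega>)"
  proof -
    have "(\<Sum>\<omega>\<in>I. if c \<in> C \<omega> then 0 else w \<omega>) + (\<Sum>\<omega>\<in>I. if c \<in> C \<omega> then w \<omega> else 0) = 1"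
      unfolding sum.distrib[symmetric] w1[symmetric] by (intro sum.cong) auto
    then show ?thesis using I by (simp add: sum.inter_filter)
  qed
  also have "(?h (insert c V) - ?h V) * (1 - (\<Sum>\<omega>\<in>{\<omega>\<in>I. c \<in> C \<omega>}. w \<omega>)) \<le> (?h (insert c V) - ?h V) * (1 - q)"
    using insert.prems[of c] inc by (intro mult_left_mono) auto
  also have "(\<Sum>\<omega>\<in>I. w \<omega> * (?h (V - C \<omega>) - ?h {})) \<le> (1 - q) * (?h V - ?h {})"
    using insert by auto
  finally show ?case by (simp add: algebra_simps)
qed

text \<open>Data processing: the entropy of an observation that does not depend on the removed coordinates
  is at most the entropy of the remaining coordinates.\<close>

lemma observation_entropy_le_marg_ent:
  fixes ord :: "('c \<Rightarrow> 'l) \<Rightarrow> 'x" and R :: "'x \<Rightarrow> 'y" and f :: "'x \<Rightarrow> real"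
  assumes f: "\<And>L. L \<in> \<Omega> \<Longrightarrow> f (ord L) > 0"
    and R: "\<And>L L'. L \<in> \<Omega> \<Longrightarrow> L' \<in> \<Omega> \<Longrightarrow> R (ord (mix S L L')) = R (ord L)"
  shows "(\<Sum>y\<in>(R \<circ> ord) ` \<Omega>. ((\<Sum>L\<in>{L\<in>\<Omega>. R (ord L) = y}. f (ord L)) / card \<Omega>) *
            ln ((\<Sum>L\<in>{L\<in>\<Omega>. R (ord L) = y}. f (ord L)) / card {L\<in>\<Omega>. R (ord L) = y}))
         \<le> marg_ent (\<lambda>L. f (ord L)) S"
proof -
  let ?G = "\<lambda>L. f (ord L)"
  let ?c = "real (card \<Omega>)"
  have "marg_ent ?G S = (\<Sum>L\<in>\<Omega>. marg ?G S L * ln (marg ?G S L)) / ?c"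
    unfolding marg_ent_def by (subst sum_marg) (auto simp: marg_mix)
  also have "\<dots> = (\<Sum>L\<in>\<Omega>. (marg ?G S L / ?c) * ln ((marg ?G S L / ?c) / (1 / ?c)))"
    using card_space_pos by (simp add: sum_divide_distrib)
  finally have h: "marg_ent ?G S = \<dots>" .
  have U: "(\<Sum>L\<in>{L\<in>\<Omega>. (R \<circ> ord) L = y}. marg ?G S L / ?c) = (\<Sum>L\<in>{L\<in>\<Omega>. R (ord L) = y}. f (ord L)) / ?c" for y
  proof -
    have "(\<Sum>L\<in>\<Omega>. marg ?G S L * of_bool (R (ord L) = y)) = (\<Sum>L\<in>\<Omega>. ?G L * of_bool (R (ord L) = y))"
      by (rule sum_marg) (auto simp: R)
    then have "(\<Sum>L\<in>{L\<in>\<Omega>. R (ord L) = y}. marg ?G S L) = (\<Sum>L\<in>{L\<in>\<Omega>. R (ord L) = y}. f (ord L))"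
      by (simp add: sum.inter_filter finite_space if_distrib[where f = "\<lambda>x. _ * x"] of_bool_def cong: if_cong)
    then show ?thesis by (simp flip: sum_divide_distrib)
  qed
  have W: "(\<Sum>L\<in>{L\<in>\<Omega>. (R \<circ> ord) L = y}. 1 / ?c) = card {L\<in>\<Omega>. R (ord L) = y} / ?c" for y
    by simp
  have "(\<Sum>y\<in>(R \<circ> ord) ` \<Omega>. ((\<Sum>L\<in>{L\<in>\<Omega>. R (ord L) = y}. f (ord L)) / ?c) *
            ln (((\<Sum>L\<in>{L\<in>\<Omega>. R (ord L) = y}. f (ord L)) / ?c) / (card {L\<in>\<Omega>. R (ord L) = y} / ?c)))
      \<le> marg_ent ?G S"
    unfolding h using log_sum_inequality[of \<Omega> "\<lambda>L. marg ?G S L / ?c" "\<lambda>_. 1 / ?c" "R \<circ> ord"]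
    unfolding U W using finite_space card_space_pos marg_pos[of ?G] f by auto
  then show ?thesis using card_space_pos by simp
qed

end

section \<open>The discrete-time chain\<close>

lemma length_remove_at [simp]: "k < length xs \<Longrightarrow> length (remove_at k xs) = length xs - 1"
  by (simp add: remove_at_def)

lemma length_insert_at [simp]: "k \<le> length xs \<Longrightarrow> length (insert_at k c xs) = Suc (length xs)"
  by (simp add: insert_at_def)

lemma mset_insert_at [simp]: "mset (insert_at k c xs) = add_mset c (mset xs)"
proof -
  have "mset xs = mset (take k xs) + mset (drop k xs)" by (metis append_take_drop_id mset_append)
  then show ?thesis by (simp add: insert_at_def)
qed

lemma mset_remove_at: "k < length xs \<Longrightarrow> add_mset (xs ! k) (mset (remove_at k xs)) = mset xs"
proof -
  assume "k < length xs"
  then have "xs = take k xs @ xs ! k # drop (Suc k) xs" by (simp add: id_take_nth_drop)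
  then have "mset xs = mset (take k xs) + mset (xs ! k # drop (Suc k) xs)" by (metis mset_append)
  then show ?thesis by (simp add: remove_at_def)
qed

lemma insert_at_nth: "k \<le> length xs \<Longrightarrow> insert_at k c xs ! k = c"
  by (simp add: insert_at_def nth_append)

lemma remove_at_insert_at: "k \<le> length xs \<Longrightarrow> remove_at k (insert_at k c xs) = xs"
  by (simp add: insert_at_def remove_at_def min_def)

lemma insert_at_remove_at: "k < length xs \<Longrightarrow> insert_at k (xs ! k) (remove_at k xs) = xs"
  by (simp add: insert_at_def remove_at_def min_def id_take_nth_drop[symmetric])

lemma map_remove_at: "map f (remove_at k xs) = remove_at k (map f xs)"
  by (simp add: remove_at_def take_map drop_map)

lemma map_insert_at: "map f (insert_at k c xs) = insert_at k (f c) (map f xs)"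
  by (simp add: insert_at_def take_map drop_map)

section \<open>Arrangements and relabellings of the cards\<close>

text \<open>A map onto a finite set of the same cardinality is injective, so it is enough that all
  cards occur.\<close>

lemma arrangements_iff:
  fixes x :: "'d::finite \<Rightarrow> nat list"
  shows "x \<in> arrangements n \<longleftrightarrow> (\<forall>i. length (x i) = n) \<and> (\<Union>i. set (x i)) = {..<CARD('d) * n}"
proof (cases "\<forall>i. length (x i) = n")
  case True
  have im: "(\<lambda>(i, k). x i ! k) ` (UNIV \<times> {..<n}) = (\<Union>i. set (x i))"
    using True by (force simp: set_conv_nth)
  show ?thesis
    unfolding arrangements_def bij_betw_def using True im
    by (auto intro!: eq_card_imp_inj_on simp: card_cartesian_product)
qed (auto simp: arrangements_def)

lemma arrangements_length: "x \<in> arrangements n \<Longrightarrow> length (x i) = n"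
  by (simp add: arrangements_iff)

lemma arrangements_nth_eq:
  assumes "x \<in> arrangements n" "k < n" "l < n" "x i ! k = x j ! l"
  shows "i = j \<and> k = l"
proof -
  have "inj_on (\<lambda>(i, k). x i ! k) (UNIV \<times> {..<n})" using assms(1) by (simp add: arrangements_def bij_betw_def)
  from inj_onD[OF this, of "(i, k)" "(j, l)"] assms show ?thesis by auto
qed

lemma arrangements_distinct: "x \<in> arrangements n \<Longrightarrow> distinct (x i)"
  unfolding distinct_conv_nth using arrangements_nth_eq[of x n] by (auto simp: arrangements_length)

lemma arrangements_disjoint: "x \<in> arrangements n \<Longrightarrow> v \<in> set (x i) \<Longrightarrow> v \<in> set (x j) \<Longrightarrow> i = j"
  using arrangements_nth_eq[of x n] by (auto simp: arrangements_length in_set_conv_nth)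

lemma finite_arrangements: "finite (arrangements n :: ('d::finite \<Rightarrow> nat list) set)"
proof (rule finite_subset)
  show "(arrangements n :: ('d \<Rightarrow> nat list) set) \<subseteq> Pi\<^sub>E UNIV (\<lambda>_. {xs. set xs \<subseteq> {..<CARD('d) * n} \<and> length xs = n})"
  proof
    fix x :: "'d \<Rightarrow> nat list" assume "x \<in> arrangements n"
    then have "(\<Union>i. set (x i)) = {..<CARD('d) * n}" "\<And>i. length (x i) = n" by (auto simp: arrangements_iff)
    then show "x \<in> Pi\<^sub>E UNIV (\<lambda>_. {xs. set xs \<subseteq> {..<CARD('d) * n} \<and> length xs = n})" by blast
  qed
  show "finite (Pi\<^sub>E (UNIV::'d set) (\<lambda>_. {xs. set xs \<subseteq> {..<CARD('d) * n} \<and> length xs = n}))"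
    by (intro finite_PiE) (auto intro: finite_lists_length_eq)
qed

lemma arrangements_nonempty: "(arrangements n :: ('d::finite \<Rightarrow> nat list) set) \<noteq> {}"
proof -
  obtain f :: "'d \<Rightarrow> nat" where f: "bij_betw f UNIV {..<CARD('d)}"
    using ex_bij_betw_finite_nat[of "UNIV :: 'd set"] by (auto simp: lessThan_atLeast0)
  define x where "x i = [f i * n..<f i * n + n]" for i
  have "(\<Union>i. set (x i)) = {..<CARD('d) * n}"
  proof (intro equalityI subsetI)
    fix v assume "v \<in> (\<Union>i. set (x i))"
    then obtain i where "f i * n \<le> v" "v < f i * n + n" by (auto simp: x_def)
    moreover have "Suc (f i) * n \<le> CARD('d) * n"
      by (intro mult_le_mono1) (use bij_betwE[OF f] in \<open>simp add: Suc_le_eq\<close>)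
    ultimately show "v \<in> {..<CARD('d) * n}" by simp
  next
    fix v assume v: "v \<in> {..<CARD('d) * n}"
    then have n: "n > 0" by (cases n) auto
    have "v div n < CARD('d)" using v by (simp add: less_mult_imp_div_less)
    then obtain i where "f i = v div n" using f by (metis bij_betw_imp_surj_on imageE lessThan_iff)
    then have "v \<in> set (x i)" using n by (simp add: x_def) (metis div_mult_mod_eq le_add1 add_strict_left_mono mod_less_divisor)
    then show "v \<in> (\<Union>i. set (x i))" by blast
  qed
  then have "x \<in> arrangements n" by (auto simp: arrangements_iff x_def)
  then show ?thesis by blast
qed

lemma arrangements_relabel:
  fixes x :: "'d::finite \<Rightarrow> nat list"
  assumes x: "x \<in> arrangements n" and g: "g permutes {..<CARD('d) * n}"
  shows "(\<lambda>j. map g (x j)) \<in> arrangements n"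
proof -
  have "(\<Union>j. set (map g (x j))) = g ` (\<Union>j. set (x j))" by auto
  also have "\<dots> = {..<CARD('d) * n}" using x g by (simp add: arrangements_iff permutes_image)
  finally show ?thesis using x by (simp add: arrangements_iff)
qed

text \<open>The group of card relabellings acts transitively on the arrangements: \<open>g\<close>
  sends each card of \<open>x\<close> to the card that \<open>y\<close> has in the same
  place.\<close>

lemma relabelling_exists:
  fixes x y :: "'d::finite \<Rightarrow> nat list"
  assumes x: "x \<in> arrangements n" and y: "y \<in> arrangements n"
  shows "\<exists>g. g permutes {..<CARD('d) * n} \<and> (\<forall>j. map g (x j) = y j)"
proof -
  let ?V = "{..<CARD('d) * n}"
  define st where "st v = (THE j. v \<in> set (x j))" for v
  define g where "g v = (if v \<in> ?V then the (map_of (zip (x (st v)) (y (st v))) v) else v)" for v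
  have g: "g (x j ! k) = y j ! k" if "k < n" for j k
  proof -
    have mem: "x j ! k \<in> set (x j)" using that x by (simp add: arrangements_length)
    then have "st (x j ! k) = j" unfolding st_def
      using arrangements_disjoint[OF x] by (intro the_equality) auto
    moreover have "x j ! k \<in> ?V" using mem x by (auto simp: arrangements_iff)
    ultimately show ?thesis
      using that x y arrangements_distinct[OF x, of j] by (simp add: g_def map_of_zip_nth arrangements_length)
  qed
  have mg: "map g (x j) = y j" for j
    by (rule nth_equalityI) (use x y g in \<open>auto simp: arrangements_length\<close>)
  have "g ` ?V = g ` (\<Union>j. set (x j))" using x by (simp add: arrangements_iff)
  also have "\<dots> = (\<Union>j. set (map g (x j)))" by auto
  also have "\<dots> = ?V" using y by (simp add: mg arrangements_iff)
  finally have im: "g ` ?V = ?V" .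
  have "inj_on g ?V" by (rule eq_card_imp_inj_on) (simp_all add: im)
  with im have "g permutes ?V" by (intro bij_imp_permutes) (auto simp: bij_betw_def g_def)
  with mg show ?thesis by blast
qed

section \<open>Uniform positions\<close>

definition rand_pos :: "nat \<Rightarrow> ('d::finite \<Rightarrow> nat) pmf" where
  "rand_pos n = Pi_pmf UNIV 0 (\<lambda>_. pmf_of_set {..<n})"

lemma rand_pos_eq: "n > 0 \<Longrightarrow> rand_pos n = pmf_of_set {p :: 'd::finite \<Rightarrow> nat. \<forall>i. p i < n}"
  unfolding rand_pos_def by (subst Pi_pmf_of_set) (auto simp: PiE_dflt_def intro!: arg_cong[where f = pmf_of_set])

lemma finite_positions: "finite {p :: 'd::finite \<Rightarrow> nat. \<forall>i. p i < n}"
proof -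
  have "{p :: 'd \<Rightarrow> nat. \<forall>i. p i < n} = Pi\<^sub>E UNIV (\<lambda>_. {..<n})" by auto
  then show ?thesis by (simp add: finite_PiE)
qed

lemma card_positions: "card {p :: 'd::finite \<Rightarrow> nat. \<forall>i. p i < n} = n ^ CARD('d)"
proof -
  have "{p :: 'd \<Rightarrow> nat. \<forall>i. p i < n} = Pi\<^sub>E UNIV (\<lambda>_. {..<n})" by auto
  then show ?thesis by (simp add: card_PiE)
qed

lemma positions_nonempty: "n > 0 \<Longrightarrow> {p :: 'd::finite \<Rightarrow> nat. \<forall>i. p i < n} \<noteq> {}"
  by auto

lemma set_rand_pos: "n > 0 \<Longrightarrow> set_pmf (rand_pos n) = {p :: 'd::finite \<Rightarrow> nat. \<forall>i. p i < n}"
  using set_pmf_of_set[OF positions_nonempty finite_positions, of n] by (simp add: rand_pos_eq)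

lemma rand_pos_component: "map_pmf (\<lambda>p. p i) (rand_pos n) = pmf_of_set {..<n}"
  unfolding rand_pos_def by (subst Pi_pmf_component) auto

text \<open>Permuting the positions of every stack separately preserves the uniform draw. The
  couplings and the symmetry arguments all act on the chain through such permutations.\<close>

lemma rand_pos_permute:
  assumes n: "n > 0" and \<theta>: "\<And>i. bij_betw (\<theta> i) {..<n} {..<n}"
  shows "map_pmf (\<lambda>p i. \<theta> i (p i)) (rand_pos n) = (rand_pos n :: ('d::finite \<Rightarrow> nat) pmf)"
proof -
  let ?P = "{p :: 'd \<Rightarrow> nat. \<forall>i. p i < n}"
  let ?f = "\<lambda>(p :: 'd \<Rightarrow> nat) i. \<theta> i (p i)"
  have inj: "inj_on ?f ?P"
  proof (rule inj_onI, rule ext)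
    fix p q i assume a: "p \<in> ?P" "q \<in> ?P" "?f p = ?f q"
    then have "\<theta> i (p i) = \<theta> i (q i)" by meson
    with a \<theta>[of i] show "p i = q i" by (auto simp: bij_betw_def inj_on_def)
  qed
  have "?f ` ?P \<subseteq> ?P" using \<theta> by (auto dest: bij_betwE)
  then have "?f ` ?P = ?P" by (rule endo_inj_surj[OF finite_positions _ inj])
  then show ?thesis
    using map_pmf_of_set_inj[OF inj positions_nonempty[OF n] finite_positions] n by (simp add: rand_pos_eq)
qed

section \<open>Moves and stationarity\<close>

text \<open>One setting for both chains: the full shuffle has \<open>act \<sigma> = UNIV\<close>,
  the restricted one takes the stacks that \<open>\<sigma>\<close> moves. The assumptions on
  \<open>act\<close> say that inactive stacks are fixed by \<open>\<sigma>\<close> and that the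
  active ones are permuted among themselves.\<close>

locale stack_shuffle =
  fixes act :: "('d::finite \<Rightarrow> 'd) \<Rightarrow> 'd set" and \<mu> :: "('d \<Rightarrow> 'd) pmf" and n :: nat
  assumes n_pos: "n > 0"
    and perm: "set_pmf \<mu> \<subseteq> {\<sigma>. \<sigma> permutes UNIV}"
    and act_moved: "\<And>\<sigma> i. \<sigma> i \<noteq> i \<Longrightarrow> i \<in> act \<sigma>"
    and act_inv: "\<And>\<sigma> i. \<sigma> permutes UNIV \<Longrightarrow> \<sigma> i \<in> act \<sigma> \<longleftrightarrow> i \<in> act \<sigma>"
begin

abbreviation X :: "('d \<Rightarrow> nat list) set" where "X \<equiv> arrangements n"

abbreviation K :: "('d \<Rightarrow> nat list) \<Rightarrow> ('d \<Rightarrow> nat list) pmf" where "K \<equiv> shuffle_step act n \<mu>"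

definition mv :: "(('d \<Rightarrow> 'd) \<times> ('d \<Rightarrow> nat) \<times> ('d \<Rightarrow> nat)) pmf" where
  "mv = pair_pmf \<mu> (pair_pmf (rand_pos n) (rand_pos n))"

definition move :: "('d \<Rightarrow> 'd) \<times> ('d \<Rightarrow> nat) \<times> ('d \<Rightarrow> nat) \<Rightarrow> ('d \<Rightarrow> 'a list) \<Rightarrow> ('d \<Rightarrow> 'a list)" where
  "move m x = move_cards (act (fst m)) (fst m) (fst (snd m)) (snd (snd m)) x"

lemma K_eq: "K x = map_pmf (\<lambda>m. move m x) mv"
  by (simp add: shuffle_step_def mv_def pair_pmf_def map_pmf_def bind_assoc_pmf bind_return_pmf move_def rand_pos_def)

lemma set_mv: "set_pmf mv = set_pmf \<mu> \<times> {p. \<forall>i. p i < n} \<times> {p. \<forall>i. p i < n}"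
  by (simp add: mv_def set_rand_pos n_pos)

lemma finite_set_\<mu>: "finite (set_pmf \<mu>)"
proof (rule finite_subset)
  show "set_pmf \<mu> \<subseteq> {\<sigma>. \<sigma> permutes UNIV}" by (rule perm)
  show "finite {\<sigma> :: 'd \<Rightarrow> 'd. \<sigma> permutes UNIV}" by simp
qed

lemma finite_set_mv: "finite (set_pmf mv)"
  by (simp add: set_mv finite_set_\<mu> finite_positions)

lemma finite_set_K: "finite (set_pmf (K x))"
  by (simp add: K_eq finite_set_mv)

lemma move_relabel:
  assumes "\<And>j. length (x j) = n" and "m \<in> set_pmf mv"
  shows "move m (\<lambda>j. map g (x j)) = (\<lambda>j. map g (move m x j))"
proof
  fix j
  obtain \<sigma> p r where m: "m = (\<sigma>, p, r)" by (cases m) auto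
  have "p i < n" for i using assms(2) by (simp add: set_mv m)
  then show "move m (\<lambda>j. map g (x j)) j = map g (move m x j)"
    by (simp add: move_def m move_cards_def Let_def map_insert_at map_remove_at assms)
qed

text \<open>Both ingredients of a target stack can be read off the result: the card that arrived and
  the remainder in its order. Injectivity of moves and the description of preimages rest on
  this.\<close>

lemma move_nth:
  assumes x: "\<And>j. length (x j) = n" and m: "(\<sigma>, p, r) \<in> set_pmf mv" and i: "i \<in> act \<sigma>"
  shows "move (\<sigma>, p, r) x (\<sigma> i) ! r i = x i ! p i"
    and "remove_at (r i) (move (\<sigma>, p, r) x (\<sigma> i)) = remove_at (p (\<sigma> i)) (x (\<sigma> i))"
proof -
  have s: "\<sigma> permutes UNIV" using perm m by (auto simp: set_mv)
  have "inv \<sigma> (\<sigma> i) = i" using s by (simp add: permutes_inverses)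
  moreover have "\<sigma> i \<in> act \<sigma>" using act_inv[OF s] i by simp
  ultimately have e: "move (\<sigma>, p, r) x (\<sigma> i) = insert_at (r i) (x i ! p i) (remove_at (p (\<sigma> i)) (x (\<sigma> i)))"
    by (simp add: move_def move_cards_def Let_def)
  have b: "p (\<sigma> i) < n" "r i < n" using m by (auto simp: set_mv)
  then have "r i \<le> length (remove_at (p (\<sigma> i)) (x (\<sigma> i)))" using x by simp
  then show "move (\<sigma>, p, r) x (\<sigma> i) ! r i = x i ! p i"
    and "remove_at (r i) (move (\<sigma>, p, r) x (\<sigma> i)) = remove_at (p (\<sigma> i)) (x (\<sigma> i))"
    by (simp_all add: e insert_at_nth remove_at_insert_at)
qed

lemma length_move:
  assumes x: "\<And>j. length (x j) = n" and m: "m \<in> set_pmf mv"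
  shows "length (move m x j) = n"
proof -
  obtain \<sigma> p r where me: "m = (\<sigma>, p, r)" by (cases m) auto
  have b: "p i < n" "r i < n" for i using m by (auto simp: set_mv me)
  have "r i \<le> length (remove_at (p j) (x j))" for i using b[of i] b[of j] x by simp
  then show ?thesis using b x n_pos by (simp add: move_def move_cards_def me Let_def)
qed

text \<open>The formula also covers inactive stacks: there \<open>\<sigma> j = j\<close>, so the
  chosen card is taken out and put back. The contents therefore evolve in the same way for every
  admissible \<open>act\<close>.\<close>

lemma mset_move:
  assumes x: "\<And>j. length (x j) = n" and m: "(\<sigma>, p, r) \<in> set_pmf mv"
  shows "mset (move (\<sigma>, p, r) x j) = add_mset (x (inv \<sigma> j) ! p (inv \<sigma> j)) (mset (x j) - {#x j ! p j#})"
proof -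
  have s: "\<sigma> permutes UNIV" using perm m by (auto simp: set_mv)
  have b: "p i < n" for i using m by (auto simp: set_mv)
  have rm: "mset (remove_at (p j) (x j)) = mset (x j) - {#x j ! p j#}"
    using mset_remove_at[of "p j" "x j"] b x by (metis add_mset_remove_trivial)
  show ?thesis
  proof (cases "j \<in> act \<sigma>")
    case True
    then show ?thesis by (simp add: move_def move_cards_def Let_def rm)
  next
    case False
    then have "\<sigma> j = j" using act_moved by blast
    then have "inv \<sigma> j = j" using s by (metis permutes_inverses(2))
    moreover have "x j ! p j \<in># mset (x j)" using b x by simp
    ultimately show ?thesis using False by (simp add: move_def move_cards_def Let_def)
  qed
qed

lemma move_arrangement:
  assumes x: "x \<in> X" and m: "m \<in> set_pmf mv"
  shows "move m x \<in> X"
proof -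
  obtain \<sigma> p r where me: "m = (\<sigma>, p, r)" by (cases m) auto
  have m': "(\<sigma>, p, r) \<in> set_pmf mv" using m me by simp
  have s: "\<sigma> permutes UNIV" using perm m' by (auto simp: set_mv)
  have b: "p i < n" for i using m' by (auto simp: set_mv)
  note lx = arrangements_length[OF x]
  note st = mset_move[of x, OF lx m']
  have set_st: "set (move (\<sigma>, p, r) x j) = insert (x (inv \<sigma> j) ! p (inv \<sigma> j)) (set_mset (mset (x j) - {#x j ! p j#}))" for j
    using arg_cong[where f = set_mset, OF st[of j]] by simp
  have "(\<Union>j. set (move (\<sigma>, p, r) x j)) = (\<Union>j. set (x j))"
  proof (intro equalityI subsetI)
    fix v assume "v \<in> (\<Union>j. set (move (\<sigma>, p, r) x j))"
    then obtain j where "v = x (inv \<sigma> j) ! p (inv \<sigma> j) \<or> v \<in># mset (x j) - {#x j ! p j#}" by (auto simp: set_st)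
    then show "v \<in> (\<Union>j. set (x j))"
    proof
      assume "v = x (inv \<sigma> j) ! p (inv \<sigma> j)"
      then have "v \<in> set (x (inv \<sigma> j))" using b lx by simp
      then show ?thesis by blast
    next
      assume "v \<in># mset (x j) - {#x j ! p j#}"
      then have "v \<in># mset (x j)" by (rule in_diffD)
      then show ?thesis by auto
    qed
  next
    fix v assume "v \<in> (\<Union>j. set (x j))"
    then obtain j where v: "v \<in> set (x j)" by blast
    show "v \<in> (\<Union>j. set (move (\<sigma>, p, r) x j))"
    proof (cases "v = x j ! p j")
      case True
      then have "v \<in> set (move (\<sigma>, p, r) x (\<sigma> j))" using s by (simp add: set_st permutes_inverses)
      then show ?thesis by blast
    next
      case False
      then have "v \<in># mset (x j) - {#x j ! p j#}" using v by (simp add: in_diff_count)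
      then have "v \<in> set (move (\<sigma>, p, r) x j)" by (simp add: set_st)
      then show ?thesis by blast
    qed
  qed
  moreover have "length (move (\<sigma>, p, r) x j) = n" for j using length_move[of x, OF lx m'] .
  ultimately show ?thesis using x by (simp add: arrangements_iff me)
qed

text \<open>With the random choices fixed, a move permutes the finite set of arrangements; this is
  why the uniform distribution is stationary.\<close>

lemma move_inj:
  assumes m: "m \<in> set_pmf mv"
  shows "inj_on (move m) X"
proof (rule inj_onI, rule ext)
  fix x y :: "'d \<Rightarrow> nat list" and j assume x: "x \<in> X" and y: "y \<in> X" and e: "move m x = move m y"
  obtain \<sigma> p r where me: "m = (\<sigma>, p, r)" by (cases m) auto
  have m': "(\<sigma>, p, r) \<in> set_pmf mv" using m me by simp
  have s: "\<sigma> permutes UNIV" using perm m' by (auto simp: set_mv)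
  have b: "p i < n" for i using m' by (auto simp: set_mv)
  note lx = arrangements_length[OF x] and ly = arrangements_length[OF y]
  show "x j = y j"
  proof (cases "j \<in> act \<sigma>")
    case True
    define i where "i = inv \<sigma> j"
    have i: "\<sigma> i = j" using s by (simp add: i_def permutes_inverses)
    have ia: "i \<in> act \<sigma>" using act_inv[OF s, of i] i True by simp
    have "x j ! p j = y j ! p j"
      using move_nth(1)[of x, OF lx m' True] move_nth(1)[of y, OF ly m' True] e by (simp add: me)
    moreover have "remove_at (p j) (x j) = remove_at (p j) (y j)"
      using move_nth(2)[of x, OF lx m' ia] move_nth(2)[of y, OF ly m' ia] e i by (simp add: me)
    ultimately show ?thesis
      using insert_at_remove_at[of "p j" "x j"] insert_at_remove_at[of "p j" "y j"] b lx ly by metis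
  next
    case False
    then show ?thesis using fun_cong[OF e, of j] by (simp add: me move_def move_cards_def)
  qed
qed

definition U0 :: "('d \<Rightarrow> nat list) pmf" where "U0 = pmf_of_set X"

lemma set_U0: "set_pmf U0 = X"
  by (simp add: U0_def finite_arrangements arrangements_nonempty)

lemma map_move_U0: "m \<in> set_pmf mv \<Longrightarrow> map_pmf (move m) U0 = U0"
proof -
  assume m: "m \<in> set_pmf mv"
  have "move m ` X \<subseteq> X" using move_arrangement m by blast
  then have "move m ` X = X" by (simp add: endo_inj_surj finite_arrangements move_inj[OF m])
  then show ?thesis unfolding U0_def
    using map_pmf_of_set_inj[OF move_inj[OF m] arrangements_nonempty finite_arrangements] by simp
qed

lemma bind_U0_K: "bind_pmf U0 K = U0"
proof -
  have "bind_pmf U0 K = bind_pmf mv (\<lambda>m. map_pmf (move m) U0)"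
    unfolding K_eq map_pmf_def by (rule bind_commute_pmf)
  also have "\<dots> = bind_pmf mv (\<lambda>_. U0)" by (intro bind_pmf_cong refl map_move_U0)
  finally show ?thesis by (simp add: bind_pmf_const)
qed

lemma set_K: "x \<in> X \<Longrightarrow> set_pmf (K x) \<subseteq> X"
  by (auto simp: K_eq move_arrangement)

primrec law :: "nat \<Rightarrow> ('d \<Rightarrow> nat list) \<Rightarrow> ('d \<Rightarrow> nat list) pmf" where
  "law 0 x = return_pmf x"
| "law (Suc k) x = bind_pmf (law k x) K"

lemma law_eq: "((\<lambda>p. bind_pmf p K) ^^ k) (return_pmf x) = law k x"
  by (induction k) auto

lemma law_add: "law (k + l) x = bind_pmf (law k x) (law l)"
  by (induction l) (simp_all add: bind_return_pmf' bind_assoc_pmf)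

lemma set_law: "x \<in> X \<Longrightarrow> set_pmf (law k x) \<subseteq> X"
  by (induction k) (use set_K in auto)

lemma finite_set_law: "finite (set_pmf (law k x))"
  by (induction k) (auto simp: finite_set_K)

lemma bind_U0_law: "bind_pmf U0 (law k) = U0"
  by (induction k) (simp_all add: bind_return_pmf' bind_U0_K flip: bind_assoc_pmf)

end

section \<open>Entropy of the order within the stacks\<close>

definition fiber :: "('d \<Rightarrow> nat list) \<Rightarrow> ('d \<Rightarrow> nat list) set" where
  "fiber x0 = {x. \<forall>j. mset (x j) = mset (x0 j)}"

lemma fiber_arrangements: "x0 \<in> arrangements n \<Longrightarrow> x \<in> fiber x0 \<Longrightarrow> x \<in> (arrangements n :: ('d::finite \<Rightarrow> nat list) set)"
proof -
  assume a: "x0 \<in> arrangements n" "x \<in> fiber x0"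
  then have m: "mset (x j) = mset (x0 j)" for j by (simp add: fiber_def)
  have "set (x j) = set (x0 j)" "length (x j) = length (x0 j)" for j
    using mset_eq_setD[OF m] mset_eq_length[OF m] by auto
  with a show ?thesis by (simp add: arrangements_iff)
qed

lemma finite_fiber: "x0 \<in> arrangements n \<Longrightarrow> finite (fiber (x0 :: 'd::finite \<Rightarrow> nat list))"
  using fiber_arrangements finite_arrangements by (metis finite_subset subsetI)

lemma fiber_self: "x0 \<in> fiber x0" by (simp add: fiber_def)

lemma fiber_eq: "x \<in> fiber x0 \<Longrightarrow> fiber x = fiber x0" by (simp add: fiber_def)

lemma card_fiber:
  assumes "x0 \<in> arrangements n"
  shows "card (fiber (x0 :: 'd::finite \<Rightarrow> nat list)) = fact n ^ CARD('d)"
proof -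
  have c: "card {xs. mset xs = mset (x0 j)} = fact n" for j
  proof -
    have "{xs. mset xs = mset (x0 j)} = permutations_of_set (set (x0 j))"
      using assms by (simp add: permutations_of_set_altdef permutations_of_multiset_def mset_set_set arrangements_distinct)
    then show ?thesis
      using assms by (simp add: arrangements_length distinct_card[OF arrangements_distinct[OF assms]])
  qed
  have "fiber x0 = Pi\<^sub>E UNIV (\<lambda>j. {xs. mset xs = mset (x0 j)})" by (auto simp: fiber_def)
  then show ?thesis by (simp add: card_PiE c)
qed

text \<open>The sort is stable, so equal labels leave a trace of the order in \<open>x0\<close>.
  Such ties become rare as the number of labels grows.\<close>

definition ordering :: "('d \<Rightarrow> nat list) \<Rightarrow> (nat \<Rightarrow> nat) \<Rightarrow> 'd \<Rightarrow> nat list" where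
  "ordering x0 L = (\<lambda>j. sort_key L (x0 j))"

definition drop_cards :: "nat set \<Rightarrow> ('d \<Rightarrow> nat list) \<Rightarrow> 'd \<Rightarrow> nat list" where
  "drop_cards C x = (\<lambda>j. filter (\<lambda>v. v \<notin> C) (x j))"

lemma ordering_fiber: "ordering x0 L \<in> fiber x0"
  by (simp add: ordering_def fiber_def)

lemma insort_key_cong: "f a = g a \<Longrightarrow> (\<And>v. v \<in> set xs \<Longrightarrow> f v = g v) \<Longrightarrow> insort_key f a xs = insort_key g a xs"
  by (induction xs) auto

lemma sort_key_cong: "(\<And>v. v \<in> set xs \<Longrightarrow> f v = g v) \<Longrightarrow> sort_key f xs = sort_key g xs"
  by (induction xs) (auto intro!: insort_key_cong)

text \<open>Sorting commutes with filtering, so the order of the remaining cards depends on their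
  own labels only. Removing cards thus corresponds to removing coordinates in Shearer's
  inequality.\<close>

lemma drop_cards_ordering_mix:
  assumes "\<And>j. set (x0 j) \<subseteq> V"
  shows "drop_cards C (ordering x0 (mix (V - C) L L')) = drop_cards C (ordering x0 L)"
proof
  fix j
  have "sort_key (mix (V - C) L L') (filter (\<lambda>v. v \<notin> C) (x0 j)) = sort_key L (filter (\<lambda>v. v \<notin> C) (x0 j))"
    by (rule sort_key_cong) (use assms in \<open>auto simp: mix_def\<close>)
  then show "drop_cards C (ordering x0 (mix (V - C) L L')) j = drop_cards C (ordering x0 L) j"
    by (simp add: drop_cards_def ordering_def filter_sort)
qed

text \<open>A uniform order of each stack is produced by sorting by i.i.d. labels from \<open>{..<N}\<close>, up to an error that
  vanishes as \<open>N\<close> grows. This gives the product structure that Shearer's inequality needs.\<close>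

definition labels :: "nat set \<Rightarrow> nat \<Rightarrow> (nat \<Rightarrow> nat) set" where
  "labels V N = Pi\<^sub>E V (\<lambda>_. {..<N})"

lemma finite_labels: "finite V \<Longrightarrow> finite (labels V N)"
  by (simp add: labels_def finite_PiE)

lemma mix_space_labels: "finite V \<Longrightarrow> N > 0 \<Longrightarrow> mix_space (labels V N)"
  by unfold_locales (auto simp: labels_def finite_PiE PiE_eq_empty_iff mix_def PiE_iff extensional_def)

text \<open>Union bound over pairs of cards. For one pair, a labelling with \<open>L u = L v\<close>
  together with a new label for \<open>u\<close> injects into all labellings, as the old label of
  \<open>u\<close> is still visible at \<open>v\<close>.\<close>

lemma card_noninjective_labels:
  assumes V: "finite V"
  shows "card {L \<in> labels V N. \<not> inj_on L V} * N \<le> (card V)\<^sup>2 * card (labels V N)"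
proof -
  have pair: "card {L \<in> labels V N. L u = L v} * N \<le> card (labels V N)" if "u \<in> V" "v \<in> V" "u \<noteq> v" for u v
  proof -
    have "card {L \<in> labels V N. L u = L v} * N = card ({L \<in> labels V N. L u = L v} \<times> {..<N})"
      by (simp add: card_cartesian_product)
    also have "\<dots> \<le> card (labels V N)"
    proof (rule card_inj_on_le[where f = "\<lambda>(L, l). L(u := l)"])
      show "inj_on (\<lambda>(L, l). L(u := l)) ({L \<in> labels V N. L u = L v} \<times> {..<N})"
      proof (rule inj_onI, clarify)
        fix L l L' l' assume a: "L u = L v" "L' u = L' v" "L(u := l) = L'(u := l')"
        have "L w = L' w" for w
        proof (cases "w = u")
          case True
          moreover have "L v = L' v" using fun_cong[OF a(3), of v] that by simp
          ultimately show ?thesis using a by simp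
        next
          case False
          then show ?thesis using fun_cong[OF a(3), of w] by simp
        qed
        moreover have "l = l'" using fun_cong[OF a(3), of u] by simp
        ultimately show "L = L' \<and> l = l'" by blast
      qed
      show "(\<lambda>(L, l). L(u := l)) ` ({L \<in> labels V N. L u = L v} \<times> {..<N}) \<subseteq> labels V N"
        using that by (auto simp: labels_def PiE_iff extensional_def)
      show "finite (labels V N)" using V by (rule finite_labels)
    qed
    finally show ?thesis .
  qed
  have "{L \<in> labels V N. \<not> inj_on L V} \<subseteq> (\<Union>(u, v)\<in>{(u, v)\<in>V\<times>V. u \<noteq> v}. {L \<in> labels V N. L u = L v})"
    by (auto simp: inj_on_def)
  then have "card {L \<in> labels V N. \<not> inj_on L V} \<le> card (\<Union>(u, v)\<in>{(u, v)\<in>V\<times>V. u \<noteq> v}. {L \<in> labels V N. L u = L v})"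
  proof (rule card_mono[rotated])
    have "(\<Union>(u, v)\<in>{(u, v)\<in>V\<times>V. u \<noteq> v}. {L \<in> labels V N. L u = L v}) \<subseteq> labels V N" by auto
    then show "finite (\<Union>(u, v)\<in>{(u, v)\<in>V\<times>V. u \<noteq> v}. {L \<in> labels V N. L u = L v})"
      using finite_labels[OF V] by (rule finite_subset)
  qed
  also have "\<dots> \<le> (\<Sum>z\<in>{(u, v)\<in>V\<times>V. u \<noteq> v}. card (case z of (u, v) \<Rightarrow> {L \<in> labels V N. L u = L v}))"
    by (rule card_UN_le, rule finite_subset[of _ "V \<times> V"]) (use V in auto)
  finally have "card {L \<in> labels V N. \<not> inj_on L V} * N \<le>
     (\<Sum>z\<in>{(u, v)\<in>V\<times>V. u \<noteq> v}. card (case z of (u, v) \<Rightarrow> {L \<in> labels V N. L u = L v}) * N)"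
    by (simp flip: sum_distrib_right)
  also have "\<dots> \<le> (\<Sum>z\<in>{(u, v)\<in>V\<times>V. u \<noteq> v}. card (labels V N))"
    by (intro sum_mono) (use pair in auto)
  also have "\<dots> = card {(u, v)\<in>V\<times>V. u \<noteq> v} * card (labels V N)" by simp
  also have "\<dots> \<le> (card V)\<^sup>2 * card (labels V N)"
  proof (rule mult_right_mono)
    have "card {(u, v)\<in>V\<times>V. u \<noteq> v} \<le> card (V \<times> V)" using V by (intro card_mono) auto
    then show "card {(u, v)\<in>V\<times>V. u \<noteq> v} \<le> (card V)\<^sup>2" by (simp add: card_cartesian_product power2_eq_square)
  qed simp
  finally show ?thesis .
qed

definition ordering_freq :: "('d \<Rightarrow> nat list) \<Rightarrow> nat set \<Rightarrow> nat \<Rightarrow> ('d \<Rightarrow> nat list) \<Rightarrow> real" where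
  "ordering_freq x0 V N x = card {L \<in> labels V N. ordering x0 L = x} / card (labels V N)"

text \<open>Labels are transported along the relabelling that carries \<open>y\<close> to
  \<open>x\<close>. Since \<open>x\<close> and \<open>y\<close> are arbitrary, the two counts are in
  fact equal.\<close>

lemma increasing_labels_card_eq:
  fixes x y :: "'d::finite \<Rightarrow> nat list" and n :: nat
  defines "V \<equiv> {..<CARD('d) * n}"
  assumes x: "x \<in> arrangements n" and y: "y \<in> arrangements n"
  shows "card {L \<in> labels V N. \<forall>j. sorted_wrt (<) (map L (x j))} \<le> card {L \<in> labels V N. \<forall>j. sorted_wrt (<) (map L (y j))}"
proof -
  obtain g where g: "g permutes V" and gy: "\<And>j. map g (y j) = x j"
    using relabelling_exists[OF y x] by (auto simp: V_def)
  have sub: "set (y j) \<subseteq> V" for j using y by (auto simp: arrangements_iff V_def)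
  have gV: "g v \<in> V \<longleftrightarrow> v \<in> V" for v using g by (simp add: permutes_in_image)
  show ?thesis
  proof (rule card_inj_on_le[where f = "\<lambda>L. restrict (L \<circ> g) V"])
    show "finite {L \<in> labels V N. \<forall>j. sorted_wrt (<) (map L (y j))}"
      by (rule finite_subset[OF _ finite_labels[of V N]]) (auto simp: V_def)
    show "inj_on (\<lambda>L. restrict (L \<circ> g) V) {L \<in> labels V N. \<forall>j. sorted_wrt (<) (map L (x j))}"
    proof (rule inj_onI, rule ext)
      fix L L' v
      assume a: "L \<in> {L \<in> labels V N. \<forall>j. sorted_wrt (<) (map L (x j))}" "L' \<in> {L \<in> labels V N. \<forall>j. sorted_wrt (<) (map L (x j))}"
        and e: "restrict (L \<circ> g) V = restrict (L' \<circ> g) V"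
      show "L v = L' v"
      proof (cases "v \<in> V")
        case True
        then obtain u where "u \<in> V" "v = g u" using g by (metis gV permutes_def)
        then show ?thesis using fun_cong[OF e, of u] by simp
      next
        case False
        then show ?thesis using a by (simp add: labels_def PiE_iff extensional_def)
      qed
    qed
    show "(\<lambda>L. restrict (L \<circ> g) V) ` {L \<in> labels V N. \<forall>j. sorted_wrt (<) (map L (x j))}
       \<subseteq> {L \<in> labels V N. \<forall>j. sorted_wrt (<) (map L (y j))}"
    proof (rule image_subsetI)
      fix L assume a: "L \<in> {L \<in> labels V N. \<forall>j. sorted_wrt (<) (map L (x j))}"
      have "map (restrict (L \<circ> g) V) (y j) = map (L \<circ> g) (y j)" for j
        using sub[of j] by auto
      also have "map (L \<circ> g) (y j) = map L (x j)" for j by (simp flip: gy)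
      finally have "map (restrict (L \<circ> g) V) (y j) = map L (x j)" for j .
      then show "restrict (L \<circ> g) V \<in> {L \<in> labels V N. \<forall>j. sorted_wrt (<) (map L (y j))}"
        using a gV by (auto simp: labels_def PiE_iff)
    qed
  qed
qed

text \<open>Every order receives at least its fair share up to the collision error. As the
  frequencies add up to 1, these lower bounds also bound each frequency from above.\<close>

lemma ordering_freq_tendsto:
  fixes x0 :: "'d::finite \<Rightarrow> nat list" and n :: nat
  defines "V \<equiv> {..<CARD('d) * n}"
  assumes x0: "x0 \<in> arrangements n" and x: "x \<in> fiber x0"
  shows "(\<lambda>N. ordering_freq x0 V (Suc N) x) \<longlonglongrightarrow> 1 / card (fiber x0)"
proof -
  let ?F = "fiber x0"
  have finV: "finite V" by (simp add: V_def)
  have finF: "finite ?F" using finite_fiber[OF x0] .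
  define M where "M = real (card ?F)"
  have M: "M > 0" using finF fiber_self[of x0] by (auto simp: M_def card_gt_0_iff)
  define inc where "inc N y = {L \<in> labels V N. \<forall>j. sorted_wrt (<) (map L (y j))}" for N and y :: "'d \<Rightarrow> nat list"
  have lab_pos: "card (labels V (Suc N)) > 0" for N
    using mix_space_labels[OF finV, of "Suc N"] by (simp add: mix_space_def card_gt_0_iff)
  have inc_sub: "inc N y \<subseteq> {L \<in> labels V N. ordering x0 L = y}" if y: "y \<in> ?F" for N y
  proof
    fix L assume L: "L \<in> inc N y"
    have "sort_key L (x0 j) = y j" for j
    proof (rule sort_key_inj_key_eq)
      show m: "mset (x0 j) = mset (y j)" using y by (simp add: fiber_def)
      have sw: "sorted_wrt (<) (map L (y j))" using L by (simp add: inc_def)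
      then show "sorted (map L (y j))" by (rule strict_sorted_imp_sorted)
      from sw have "distinct (map L (y j))" using strict_sorted_iff by blast
      then have "inj_on L (set (y j))" by (simp add: distinct_map)
      then show "inj_on L (set (x0 j))" using mset_eq_setD[OF m] by simp
    qed
    then show "L \<in> {L \<in> labels V N. ordering x0 L = y}" using L by (auto simp: inc_def ordering_def)
  qed
  have fr_lower: "ordering_freq x0 V (Suc N) y \<ge> (1 - (card V)\<^sup>2 / Suc N) / M" if y: "y \<in> ?F" for y N
  proof -
    \<comment> \<open>An injective labelling is strictly increasing along the order that it
      produces, and by symmetry all orders have equally many such labellings.\<close>
    have inj_sub: "{L \<in> labels V (Suc N). inj_on L V} \<subseteq> (\<Union>z\<in>?F. inc (Suc N) z)"
    proof
      fix L assume L: "L \<in> {L \<in> labels V (Suc N). inj_on L V}"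
      have sub: "set (x0 j) \<subseteq> V" for j using x0 by (auto simp: arrangements_iff V_def)
      have "sorted_wrt (<) (map L (ordering x0 L j))" for j
      proof -
        have "inj_on L (set (ordering x0 L j))"
          using L sub[of j] by (auto simp: ordering_def intro: inj_on_subset)
        then have "distinct (map L (ordering x0 L j))"
          using arrangements_distinct[OF x0, of j] by (simp add: distinct_map ordering_def)
        then show ?thesis by (simp add: strict_sorted_iff ordering_def)
      qed
      then have "L \<in> inc (Suc N) (ordering x0 L)" using L by (simp add: inc_def)
      then show "L \<in> (\<Union>z\<in>?F. inc (Suc N) z)" using ordering_fiber by blast
    qed
    have "card {L \<in> labels V (Suc N). inj_on L V} \<le> card (\<Union>z\<in>?F. inc (Suc N) z)"
      using finF finite_labels[OF finV] by (intro card_mono inj_sub finite_UN_I) (auto simp: inc_def)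
    also have "\<dots> \<le> (\<Sum>z\<in>?F. card (inc (Suc N) z))" using finF by (rule card_UN_le)
    also have "\<dots> \<le> (\<Sum>z\<in>?F. card (inc (Suc N) y))"
      unfolding inc_def V_def by (intro sum_mono increasing_labels_card_eq fiber_arrangements[OF x0] y)
    also have "\<dots> = card ?F * card (inc (Suc N) y)" by simp
    finally have a: "real (card {L \<in> labels V (Suc N). inj_on L V}) \<le> M * card (inc (Suc N) y)"
      by (simp add: M_def flip: of_nat_mult)
    have "card (labels V (Suc N)) = card {L \<in> labels V (Suc N). inj_on L V} + card {L \<in> labels V (Suc N). \<not> inj_on L V}"
      using finV by (subst card_Un_disjoint[symmetric]) (auto intro!: arg_cong[where f = card] finite_labels)
    moreover have "real (card {L \<in> labels V (Suc N). \<not> inj_on L V}) \<le> (card V)\<^sup>2 / Suc N * card (labels V (Suc N))"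
    proof -
      have "real (card {L \<in> labels V (Suc N). \<not> inj_on L V} * Suc N) \<le> real ((card V)\<^sup>2 * card (labels V (Suc N)))"
        using card_noninjective_labels[OF finV, of "Suc N"] of_nat_mono by blast
      then have "real (card {L \<in> labels V (Suc N). \<not> inj_on L V}) * Suc N \<le> (card V)\<^sup>2 * card (labels V (Suc N))"
        by (simp only: of_nat_mult of_nat_power)
      then show ?thesis by (simp add: pos_le_divide_eq del: of_nat_Suc)
    qed
    ultimately have "(1 - (card V)\<^sup>2 / Suc N) * card (labels V (Suc N)) \<le> M * card (inc (Suc N) y)"
      using a by (simp add: algebra_simps)
    moreover have "card (inc (Suc N) y) \<le> card {L \<in> labels V (Suc N). ordering x0 L = y}"
      using finite_labels[OF finV, of "Suc N"] by (intro card_mono inc_sub y) simp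
    ultimately have "(1 - (card V)\<^sup>2 / Suc N) * card (labels V (Suc N)) \<le> M * card {L \<in> labels V (Suc N). ordering x0 L = y}"
      using M by (meson mult_left_mono of_nat_mono less_imp_le order_trans)
    moreover have "t * l \<le> M * c \<Longrightarrow> l > 0 \<Longrightarrow> t / M \<le> c / l" for t l c :: real
      using M by (simp add: field_simps)
    ultimately show ?thesis using lab_pos[of N] unfolding ordering_freq_def by simp
  qed
  have fr_sum: "(\<Sum>y\<in>?F. ordering_freq x0 V (Suc N) y) = 1" for N
  proof -
    have "(\<Sum>y\<in>?F. card {L \<in> labels V (Suc N). ordering x0 L = y}) = card (labels V (Suc N))"
      using sum.group[OF finite_labels[OF finV] finF, of "ordering x0" "Suc N" "\<lambda>_. 1::nat"] ordering_fiber[of x0] by auto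
    then show ?thesis using lab_pos[of N]
      by (simp add: ordering_freq_def flip: sum_divide_distrib of_nat_sum)
  qed
  have upper: "ordering_freq x0 V (Suc N) x \<le> 1 - (M - 1) * ((1 - (card V)\<^sup>2 / Suc N) / M)" for N
  proof -
    have "(M - 1) * ((1 - (card V)\<^sup>2 / Suc N) / M) = (\<Sum>y\<in>?F - {x}. (1 - (card V)\<^sup>2 / Suc N) / M)"
    proof -
      have "card ?F \<ge> 1" using M by (simp add: M_def)
      then have "real (card (?F - {x})) = M - 1" using x finF by (simp add: M_def of_nat_diff)
      then show ?thesis by simp
    qed
    also have "\<dots> \<le> (\<Sum>y\<in>?F - {x}. ordering_freq x0 V (Suc N) y)"
      by (intro sum_mono fr_lower) auto
    also have "\<dots> = 1 - ordering_freq x0 V (Suc N) x"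
      using fr_sum[of N] sum.remove[OF finF x, of "ordering_freq x0 V (Suc N)"] by simp
    finally show ?thesis by simp
  qed
  have z: "(\<lambda>N. (card V)\<^sup>2 / real (Suc N)) \<longlonglongrightarrow> 0"
    using LIMSEQ_Suc[OF lim_const_over_n] by simp
  show ?thesis
  proof (rule tendsto_sandwich)
    show "\<forall>\<^sub>F N in sequentially. (1 - (card V)\<^sup>2 / Suc N) / M \<le> ordering_freq x0 V (Suc N) x"
      using fr_lower[OF x] by simp
    show "\<forall>\<^sub>F N in sequentially. ordering_freq x0 V (Suc N) x \<le> 1 - (M - 1) * ((1 - (card V)\<^sup>2 / Suc N) / M)"
      using upper by simp
    have "(\<lambda>N. (1 - (card V)\<^sup>2 / real (Suc N)) / M) \<longlonglongrightarrow> (1 - 0) / M"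
      by (intro tendsto_intros z) (use M in auto)
    then show "(\<lambda>N. (1 - (card V)\<^sup>2 / real (Suc N)) / M) \<longlonglongrightarrow> 1 / card ?F" by (simp add: M_def)
    have "(\<lambda>N. 1 - (M - 1) * ((1 - (card V)\<^sup>2 / real (Suc N)) / M)) \<longlonglongrightarrow> 1 - (M - 1) * ((1 - 0) / M)"
      by (intro tendsto_intros z) (use M in auto)
    moreover have "1 - (M - 1) * ((1 - 0) / M) = 1 / M" using M by (simp add: field_simps)
    ultimately show "(\<lambda>N. 1 - (M - 1) * ((1 - (card V)\<^sup>2 / real (Suc N)) / M)) \<longlonglongrightarrow> 1 / card ?F"
      by (simp add: M_def)
  qed
qed

text \<open>Shearer's inequality for the labels, with the density \<open>f (ordering x0 L)\<close>
  and with the drawn cards \<open>C \<omega>\<close> as removed coordinates, in the limit of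
  infinitely many labels. There the produced order becomes uniform on the fibre, and the label
  counts turn into cardinalities.\<close>

lemma order_entropy_contraction:
  fixes x0 :: "'d::finite \<Rightarrow> nat list" and f :: "('d \<Rightarrow> nat list) \<Rightarrow> real"
  assumes x0: "x0 \<in> arrangements n" and f: "\<And>x. x \<in> fiber x0 \<Longrightarrow> f x > 0"
    and I: "finite I" and w: "\<And>\<omega>. \<omega> \<in> I \<Longrightarrow> w \<omega> \<ge> 0" and w1: "sum w I = 1"
    and q: "\<And>c. c < CARD('d) * n \<Longrightarrow> (\<Sum>\<omega>\<in>{\<omega>\<in>I. c \<in> C \<omega>}. w \<omega>) \<ge> q"
  defines "S \<equiv> \<Sum>x\<in>fiber x0. f x" and "M \<equiv> real (card (fiber x0))"
  shows "(\<Sum>\<omega>\<in>I. w \<omega> * (\<Sum>y\<in>drop_cards (C \<omega>) ` fiber x0.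
            (\<Sum>x\<in>{x\<in>fiber x0. drop_cards (C \<omega>) x = y}. f x) *
            ln ((\<Sum>x\<in>{x\<in>fiber x0. drop_cards (C \<omega>) x = y}. f x) / card {x\<in>fiber x0. drop_cards (C \<omega>) x = y})))
         - S * ln (S / M) \<le> (1 - q) * ((\<Sum>x\<in>fiber x0. f x * ln (f x)) - S * ln (S / M))"
proof -
  let ?F = "fiber x0"
  define V where "V = {..<CARD('d) * n}"
  have finV: "finite V" by (simp add: V_def)
  have finF: "finite ?F" using finite_fiber[OF x0] .
  have neF: "?F \<noteq> {}" using fiber_self by blast
  have M: "M > 0" using finF neF by (auto simp: M_def card_gt_0_iff)
  have S: "S > 0" unfolding S_def using finF neF f by (intro sum_pos) auto
  define e where "e N x = ordering_freq x0 V (Suc N) x" for N x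
  have e_lim: "(\<lambda>N. e N x) \<longlonglongrightarrow> 1 / M" if "x \<in> ?F" for x
    using ordering_freq_tendsto[OF x0 that] by (simp add: e_def V_def M_def)
  define FY where "FY \<omega> y = {x\<in>?F. drop_cards (C \<omega>) x = y}" for \<omega> y
  define A where "A N \<omega> y = (\<Sum>x\<in>FY \<omega> y. e N x * f x)" for N \<omega> y
  define B where "B N \<omega> y = (\<Sum>x\<in>FY \<omega> y. e N x)" for N \<omega> y
  define m where "m N = (\<Sum>x\<in>?F. e N x * f x)" for N
  have ineq: "(\<Sum>\<omega>\<in>I. w \<omega> * ((\<Sum>y\<in>drop_cards (C \<omega>) ` ?F. A N \<omega> y * ln (A N \<omega> y / B N \<omega> y)) - m N * ln (m N)))
     \<le> (1 - q) * ((\<Sum>x\<in>?F. e N x * (f x * ln (f x))) - m N * ln (m N))" for N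
  proof -
    define \<Omega> where "\<Omega> = labels V (Suc N)"
    interpret mix_space \<Omega> unfolding \<Omega>_def by (rule mix_space_labels) (use finV in auto)
    define G where "G L = f (ordering x0 L)" for L
    have G: "G L > 0" for L unfolding G_def by (rule f) (rule ordering_fiber)
    have grp: "(\<Sum>L\<in>\<Omega>. h (ordering x0 L)) / card \<Omega> = (\<Sum>x\<in>?F. e N x * h x)" for h
    proof -
      have "(\<Sum>L\<in>\<Omega>. h (ordering x0 L)) = (\<Sum>x\<in>?F. \<Sum>L\<in>{L\<in>\<Omega>. ordering x0 L = x}. h (ordering x0 L))"
        by (rule sum.group[OF finite_space finF, symmetric]) (use ordering_fiber[of x0] in auto)
      also have "\<dots> = (\<Sum>x\<in>?F. card {L\<in>\<Omega>. ordering x0 L = x} * h x)"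
      proof (intro sum.cong refl)
        fix x
        have "(\<Sum>L\<in>{L\<in>\<Omega>. ordering x0 L = x}. h (ordering x0 L)) = (\<Sum>L\<in>{L\<in>\<Omega>. ordering x0 L = x}. h x)"
          by (intro sum.cong) auto
        then show "(\<Sum>L\<in>{L\<in>\<Omega>. ordering x0 L = x}. h (ordering x0 L)) = card {L\<in>\<Omega>. ordering x0 L = x} * h x" by simp
      qed
      finally show ?thesis by (simp add: e_def ordering_freq_def \<Omega>_def sum_divide_distrib)
    qed
    have sub: "set (x0 j) \<subseteq> V" for j using x0 by (auto simp: arrangements_iff V_def)
    have hV: "marg_ent G V = (\<Sum>x\<in>?F. e N x * (f x * ln (f x)))"
    proof -
      have "marg G V L = G L" if "L \<in> \<Omega>" for L
      proof -
        have "mix V L L' = L" if "L' \<in> \<Omega>" for L'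
          using \<open>L \<in> \<Omega>\<close> that by (auto simp: mix_def \<Omega>_def labels_def PiE_iff extensional_def)
        then show ?thesis using card_space_pos by (simp add: marg_def)
      qed
      then have "marg_ent G V = (\<Sum>L\<in>\<Omega>. G L * ln (G L)) / card \<Omega>" by (simp add: marg_ent_def)
      then show ?thesis using grp[of "\<lambda>x. f x * ln (f x)"] by (simp add: G_def)
    qed
    have h0: "marg_ent G {} = m N * ln (m N)"
    proof -
      have "marg G {} L = m N" for L using grp[of f] by (simp add: marg_def mix_def G_def m_def)
      then have "marg_ent G {} = (\<Sum>L\<in>\<Omega>. G L) / card \<Omega> * ln (m N)"
        by (simp add: marg_ent_def sum_distrib_right)
      then show ?thesis using grp[of f] by (simp add: G_def m_def)
    qed
    have obs: "(\<Sum>y\<in>drop_cards (C \<omega>) ` ?F. A N \<omega> y * ln (A N \<omega> y / B N \<omega> y)) \<le> marg_ent G (V - C \<omega>)" for \<omega>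
    proof -
      let ?R = "drop_cards (C \<omega>)"
      have AA: "(\<Sum>L\<in>{L\<in>\<Omega>. ?R (ordering x0 L) = y}. f (ordering x0 L)) = card \<Omega> * A N \<omega> y" for y
      proof -
        have "(\<Sum>L\<in>{L\<in>\<Omega>. ?R (ordering x0 L) = y}. f (ordering x0 L)) =
            (\<Sum>L\<in>\<Omega>. if ?R (ordering x0 L) = y then f (ordering x0 L) else 0)"
          using finite_space by (simp add: sum.inter_filter)
        then show ?thesis using grp[of "\<lambda>x. if ?R x = y then f x else 0"] card_space_pos finF
          by (simp add: A_def FY_def sum.inter_filter[symmetric] if_distrib[where f = "\<lambda>x. _ * x"] field_simps cong: if_cong)
      qed
      have BB: "real (card {L\<in>\<Omega>. ?R (ordering x0 L) = y}) = card \<Omega> * B N \<omega> y" for y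
      proof -
        have "real (card {L\<in>\<Omega>. ?R (ordering x0 L) = y}) = (\<Sum>L\<in>\<Omega>. if ?R (ordering x0 L) = y then 1 else 0)"
          using finite_space by (simp add: sum.inter_filter[symmetric])
        then show ?thesis using grp[of "\<lambda>x. if ?R x = y then 1 else 0"] card_space_pos finF
          by (simp add: B_def FY_def sum.inter_filter[symmetric] if_distrib[where f = "\<lambda>x. _ * x"] field_simps cong: if_cong)
      qed
      \<comment> \<open>Values that no labelling reaches for this \<open>N\<close> have
        \<open>A N \<omega> y = 0\<close> and contribute nothing. The index set is thereby
        independent of \<open>N\<close>, as the limit requires.\<close>
      have "(\<Sum>y\<in>?R ` ?F. A N \<omega> y * ln (A N \<omega> y / B N \<omega> y)) =
         (\<Sum>y\<in>(?R \<circ> ordering x0) ` \<Omega>. A N \<omega> y * ln (A N \<omega> y / B N \<omega> y))"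
      proof (rule sum.mono_neutral_right)
        show "finite (?R ` ?F)" using finF by simp
        show "(?R \<circ> ordering x0) ` \<Omega> \<subseteq> ?R ` ?F" using ordering_fiber by fastforce
        show "\<forall>y\<in>?R ` ?F - (?R \<circ> ordering x0) ` \<Omega>. A N \<omega> y * ln (A N \<omega> y / B N \<omega> y) = 0"
        proof
          fix y assume "y \<in> ?R ` ?F - (?R \<circ> ordering x0) ` \<Omega>"
          then have e: "{L\<in>\<Omega>. ?R (ordering x0 L) = y} = {}" by (fastforce simp: image_iff)
          have "A N \<omega> y = 0" using AA[of y] card_space_pos unfolding e by simp
          then show "A N \<omega> y * ln (A N \<omega> y / B N \<omega> y) = 0" by simp
        qed
      qed
      also have "\<dots> \<le> marg_ent G (V - C \<omega>)"
      proof -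
        have p1: "f (ordering x0 L) > 0" for L by (rule f) (rule ordering_fiber)
        have p2: "?R (ordering x0 (mix (V - C \<omega>) L L')) = ?R (ordering x0 L)" for L L'
          by (rule drop_cards_ordering_mix) (rule sub)
        have "(\<Sum>y\<in>(?R \<circ> ordering x0) ` \<Omega>. (card \<Omega> * A N \<omega> y / card \<Omega>) *
            ln ((card \<Omega> * A N \<omega> y) / (card \<Omega> * B N \<omega> y))) \<le> marg_ent G (V - C \<omega>)"
          using observation_entropy_le_marg_ent[of f "ordering x0" ?R "V - C \<omega>"] p1 p2
          unfolding AA BB G_def[abs_def] by blast
        then show ?thesis using card_space_pos by simp
      qed
      finally show ?thesis .
    qed
    have "(\<Sum>\<omega>\<in>I. w \<omega> * ((\<Sum>y\<in>drop_cards (C \<omega>) ` ?F. A N \<omega> y * ln (A N \<omega> y / B N \<omega> y)) - m N * ln (m N)))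
      \<le> (\<Sum>\<omega>\<in>I. w \<omega> * (marg_ent G (V - C \<omega>) - marg_ent G {}))"
      unfolding h0[symmetric] by (intro sum_mono mult_left_mono diff_right_mono obs w)
    also have "\<dots> \<le> (1 - q) * (marg_ent G V - marg_ent G {})"
      by (rule shearer[OF G finV I w w1]) (use q in \<open>auto simp: V_def\<close>)
    finally show ?thesis by (simp add: hV h0)
  qed
  have finFY: "finite (FY \<omega> y)" "FY \<omega> y \<subseteq> ?F" for \<omega> y using finF by (auto simp: FY_def)
  define Al where "Al \<omega> y = (\<Sum>x\<in>FY \<omega> y. f x)" for \<omega> y
  define Bl where "Bl \<omega> y = real (card (FY \<omega> y))" for \<omega> y
  have pos: "Al \<omega> y > 0" "Bl \<omega> y > 0" if "y \<in> drop_cards (C \<omega>) ` ?F" for \<omega> y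
  proof -
    have ne: "FY \<omega> y \<noteq> {}" using that by (auto simp: FY_def)
    have "f x > 0" if "x \<in> FY \<omega> y" for x using that by (intro f) (simp add: FY_def)
    with ne finFY(1) show "Al \<omega> y > 0" unfolding Al_def by (intro sum_pos) auto
    show "Bl \<omega> y > 0" using ne finFY by (simp add: Bl_def card_gt_0_iff)
  qed
  have limA: "(\<lambda>N. A N \<omega> y) \<longlonglongrightarrow> Al \<omega> y / M" for \<omega> y
  proof -
    have "(\<lambda>N. A N \<omega> y) \<longlonglongrightarrow> (\<Sum>x\<in>FY \<omega> y. 1 / M * f x)"
      unfolding A_def by (intro tendsto_intros e_lim) (auto simp: FY_def)
    then show ?thesis by (simp add: Al_def sum_divide_distrib)
  qed
  have limB: "(\<lambda>N. B N \<omega> y) \<longlonglongrightarrow> Bl \<omega> y / M" for \<omega> y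
  proof -
    have "(\<lambda>N. B N \<omega> y) \<longlonglongrightarrow> (\<Sum>x\<in>FY \<omega> y. 1 / M)"
      unfolding B_def by (intro tendsto_intros e_lim) (auto simp: FY_def)
    then show ?thesis by (simp add: Bl_def)
  qed
  have limm: "m \<longlonglongrightarrow> S / M"
  proof -
    have "m \<longlonglongrightarrow> (\<Sum>x\<in>?F. 1 / M * f x)"
      unfolding m_def by (intro tendsto_intros e_lim)
    then show ?thesis by (simp add: S_def sum_divide_distrib)
  qed
  have "(\<Sum>\<omega>\<in>I. w \<omega> * ((\<Sum>y\<in>drop_cards (C \<omega>) ` ?F. Al \<omega> y / M * ln ((Al \<omega> y / M) / (Bl \<omega> y / M))) - S / M * ln (S / M)))
     \<le> (1 - q) * ((\<Sum>x\<in>?F. 1 / M * (f x * ln (f x))) - S / M * ln (S / M))"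
  proof (rule LIMSEQ_le[OF _ _ exI[where x = 0]])
    show "(\<lambda>N. \<Sum>\<omega>\<in>I. w \<omega> * ((\<Sum>y\<in>drop_cards (C \<omega>) ` ?F. A N \<omega> y * ln (A N \<omega> y / B N \<omega> y)) - m N * ln (m N)))
      \<longlonglongrightarrow> (\<Sum>\<omega>\<in>I. w \<omega> * ((\<Sum>y\<in>drop_cards (C \<omega>) ` ?F. Al \<omega> y / M * ln ((Al \<omega> y / M) / (Bl \<omega> y / M))) - S / M * ln (S / M)))"
    proof (intro tendsto_sum tendsto_mult tendsto_diff tendsto_const tendsto_ln tendsto_divide limA limB limm)
      fix \<omega> y assume "y \<in> drop_cards (C \<omega>) ` ?F"
      with pos[OF this] M show "Bl \<omega> y / M \<noteq> 0" "Al \<omega> y / M / (Bl \<omega> y / M) \<noteq> 0"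
        by (simp_all add: less_imp_neq[symmetric])
    qed (use S M in auto)
    show "(\<lambda>N. (1 - q) * ((\<Sum>x\<in>?F. e N x * (f x * ln (f x))) - m N * ln (m N)))
      \<longlonglongrightarrow> (1 - q) * ((\<Sum>x\<in>?F. 1 / M * (f x * ln (f x))) - S / M * ln (S / M))"
      by (intro tendsto_intros e_lim limm) (use S M in auto)
    show "\<forall>N\<ge>0. (\<Sum>\<omega>\<in>I. w \<omega> * ((\<Sum>y\<in>drop_cards (C \<omega>) ` ?F. A N \<omega> y * ln (A N \<omega> y / B N \<omega> y)) - m N * ln (m N)))
      \<le> (1 - q) * ((\<Sum>x\<in>?F. e N x * (f x * ln (f x))) - m N * ln (m N))"
      using ineq by blast
  qed
  then have "M * (\<Sum>\<omega>\<in>I. w \<omega> * ((\<Sum>y\<in>drop_cards (C \<omega>) ` ?F. Al \<omega> y / M * ln ((Al \<omega> y / M) / (Bl \<omega> y / M))) - S / M * ln (S / M)))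
     \<le> M * ((1 - q) * ((\<Sum>x\<in>?F. 1 / M * (f x * ln (f x))) - S / M * ln (S / M)))"
    using M by (intro mult_left_mono) auto
  also have "M * (\<Sum>\<omega>\<in>I. w \<omega> * ((\<Sum>y\<in>drop_cards (C \<omega>) ` ?F. Al \<omega> y / M * ln ((Al \<omega> y / M) / (Bl \<omega> y / M))) - S / M * ln (S / M)))
    = (\<Sum>\<omega>\<in>I. w \<omega> * (\<Sum>y\<in>drop_cards (C \<omega>) ` ?F. Al \<omega> y * ln (Al \<omega> y / Bl \<omega> y))) - sum w I * (S * ln (S / M))"
    using M by (simp add: sum_distrib_left sum_distrib_right right_diff_distrib sum_subtractf mult.assoc mult.left_commute[of M])
  also have "M * ((1 - q) * ((\<Sum>x\<in>?F. 1 / M * (f x * ln (f x))) - S / M * ln (S / M)))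
    = (1 - q) * ((\<Sum>x\<in>?F. f x * ln (f x)) - S * ln (S / M))"
    using M by (simp add: sum_divide_distrib[symmetric] field_simps)
  finally show ?thesis by (simp add: w1 Al_def Bl_def FY_def)
qed

section \<open>Matching by colour and lumping to the contents\<close>

text \<open>Both colour lists are rearranged so that they begin with the common part
  \<open>A \<inter># B\<close>. Positions paired within this part agree in colour, and what remains
  has the size of \<open>A - B\<close>.\<close>

lemma colour_matching_exists:
  fixes \<kappa> :: "nat \<Rightarrow> 'c"
  assumes xs: "length xs = n" and ys: "length ys = n"
  shows "\<exists>\<theta>. bij_betw \<theta> {..<n} {..<n} \<and>
    card {p. p < n \<and> \<kappa> (xs ! p) \<noteq> \<kappa> (ys ! \<theta> p)} \<le> size (mset (map \<kappa> xs) - mset (map \<kappa> ys))"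
proof -
  define A where "A = mset (map \<kappa> xs)"
  define B where "B = mset (map \<kappa> ys)"
  obtain cs where cs: "mset cs = A \<inter># B" using ex_mset by blast
  obtain as where as: "mset as = A - B" using ex_mset by blast
  obtain bs where bs: "mset bs = B - A" using ex_mset by blast
  have "A \<inter># B + (A - B) = A" "A \<inter># B + (B - A) = B" by (simp_all add: multiset_eq_iff min_def)
  then have ma: "mset (cs @ as) = A" and mb: "mset (cs @ bs) = B" by (simp_all add: cs as bs)
  have "mset (cs @ as) = mset (map \<kappa> xs)" unfolding ma A_def ..
  then obtain \<pi>1 where p1: "\<pi>1 permutes {..<length (map \<kappa> xs)}" "permute_list \<pi>1 (map \<kappa> xs) = cs @ as"
    by (rule mset_eq_permutation)
  have "mset (cs @ bs) = mset (map \<kappa> ys)" unfolding mb B_def ..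
  then obtain \<pi>2 where p2: "\<pi>2 permutes {..<length (map \<kappa> ys)}" "permute_list \<pi>2 (map \<kappa> ys) = cs @ bs"
    by (rule mset_eq_permutation)
  have p1n: "\<pi>1 permutes {..<n}" and p2n: "\<pi>2 permutes {..<n}" using p1 p2 xs ys by simp_all
  have len: "length cs + length as = n" using arg_cong[OF p1(2), of length] xs by simp
  have at1: "\<kappa> (xs ! \<pi>1 i) = (cs @ as) ! i" if "i < n" for i
  proof -
    have "\<pi>1 i < n" using that p1n by (metis lessThan_iff permutes_in_image)
    then show ?thesis using that xs unfolding p1(2)[symmetric] by (simp add: permute_list_def)
  qed
  have at2: "\<kappa> (ys ! \<pi>2 i) = (cs @ bs) ! i" if "i < n" for i
  proof -
    have "\<pi>2 i < n" using that p2n by (metis lessThan_iff permutes_in_image)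
    then show ?thesis using that ys unfolding p2(2)[symmetric] by (simp add: permute_list_def)
  qed
  define \<theta> where "\<theta> = \<pi>2 \<circ> inv \<pi>1"
  have "\<theta> permutes {..<n}" unfolding \<theta>_def by (rule permutes_compose[OF permutes_inv[OF p1n] p2n])
  then have bij: "bij_betw \<theta> {..<n} {..<n}" by (rule permutes_imp_bij)
  have "{p. p < n \<and> \<kappa> (xs ! p) \<noteq> \<kappa> (ys ! \<theta> p)} \<subseteq> \<pi>1 ` {length cs..<n}"
  proof
    fix p assume p: "p \<in> {p. p < n \<and> \<kappa> (xs ! p) \<noteq> \<kappa> (ys ! \<theta> p)}"
    define i where "i = inv \<pi>1 p"
    have pi: "p = \<pi>1 i" using p1n by (simp add: i_def permutes_inverses)
    have i: "i < n" using p p1n by (metis (mono_tags) i_def lessThan_iff mem_Collect_eq permutes_in_image permutes_inv)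
    have "\<not> i < length cs"
    proof
      assume "i < length cs"
      then have "\<kappa> (xs ! \<pi>1 i) = \<kappa> (ys ! \<pi>2 i)" using at1[OF i] at2[OF i] by (simp add: nth_append)
      then show False using p pi permutes_inverses(2)[OF p1n, of i] by (simp add: \<theta>_def)
    qed
    then show "p \<in> \<pi>1 ` {length cs..<n}" using i pi by auto
  qed
  then have "card {p. p < n \<and> \<kappa> (xs ! p) \<noteq> \<kappa> (ys ! \<theta> p)} \<le> card {length cs..<n}"
    by (meson card_image_le card_mono finite_atLeastLessThan finite_imageI le_trans)
  also have "\<dots> = size (mset as)" using len by simp
  finally show ?thesis using bij by (auto simp: as A_def B_def)
qed

context stack_shuffle
begin

lemma mv_permute_draws:
  assumes \<theta>: "\<And>i. bij_betw (\<theta> i) {..<n} {..<n}"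
  shows "map_pmf (\<lambda>m. (fst m, (\<lambda>i. \<theta> i (fst (snd m) i)), snd (snd m))) mv = mv"
proof -
  have "map_pmf (\<lambda>m. (fst m, (\<lambda>i. \<theta> i (fst (snd m) i)), snd (snd m))) mv =
     pair_pmf \<mu> (pair_pmf (map_pmf (\<lambda>p i. \<theta> i (p i)) (rand_pos n)) (rand_pos n))"
    unfolding mv_def pair_map_pmf1 pair_map_pmf2 map_pmf_comp
    by (intro map_pmf_cong refl) (auto simp: apfst_def apsnd_def map_prod_def split: prod.splits)
  then show ?thesis by (simp add: rand_pos_permute[OF n_pos \<theta>] mv_def)
qed

text \<open>The entry \<open>r i\<close> is a position in the stack \<open>\<sigma> i\<close>, hence
  the permutation applied to it is the one of the target stack.\<close>

lemma mv_permute_insertions: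
  assumes \<theta>: "\<And>i. bij_betw (\<theta> i) {..<n} {..<n}"
  shows "map_pmf (\<lambda>m. (fst m, fst (snd m), (\<lambda>i. \<theta> (fst m i) (snd (snd m) i)))) mv = mv"
proof -
  have "map_pmf (\<lambda>m. (fst m, fst (snd m), (\<lambda>i. \<theta> (fst m i) (snd (snd m) i)))) mv =
     bind_pmf \<mu> (\<lambda>\<sigma>. bind_pmf (rand_pos n) (\<lambda>p. bind_pmf (map_pmf (\<lambda>r i. \<theta> (\<sigma> i) (r i)) (rand_pos n)) (\<lambda>r. return_pmf (\<sigma>, p, r))))"
    by (simp add: mv_def pair_pmf_def map_pmf_def bind_assoc_pmf bind_return_pmf)
  also have "\<dots> = bind_pmf \<mu> (\<lambda>\<sigma>. bind_pmf (rand_pos n) (\<lambda>p. bind_pmf (rand_pos n) (\<lambda>r. return_pmf (\<sigma>, p, r))))"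
  proof -
    have "map_pmf (\<lambda>r i. \<theta> (\<sigma> i) (r i)) (rand_pos n) = rand_pos n" for \<sigma> :: "'d \<Rightarrow> 'd"
      by (rule rand_pos_permute[OF n_pos, of "\<lambda>i. \<theta> (\<sigma> i)"]) (rule \<theta>)
    then show ?thesis by simp
  qed
  also have "bind_pmf \<mu> (\<lambda>\<sigma>. bind_pmf (rand_pos n) (\<lambda>p. bind_pmf (rand_pos n) (\<lambda>r. return_pmf (\<sigma>, p, r)))) = mv"
    by (simp add: mv_def pair_pmf_def bind_assoc_pmf bind_return_pmf)
  finally show ?thesis .
qed

text \<open>With \<open>\<kappa> = id\<close> this records which cards are in which stack; coarser
  colourings record only how many of each colour.\<close>

definition contents :: "(nat \<Rightarrow> 'c) \<Rightarrow> ('d \<Rightarrow> nat list) \<Rightarrow> 'd \<Rightarrow> 'c multiset" where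
  "contents \<kappa> x = (\<lambda>j. image_mset \<kappa> (mset (x j)))"

lemma contents_move:
  assumes x: "\<And>j. length (x j) = n" and m: "(\<sigma>, p, r) \<in> set_pmf mv"
  shows "contents \<kappa> (move (\<sigma>, p, r) x) j =
    add_mset (\<kappa> (x (inv \<sigma> j) ! p (inv \<sigma> j))) (contents \<kappa> x j - {#\<kappa> (x j ! p j)#})"
proof -
  have "p j < n" using m by (simp add: set_mv)
  then have "x j ! p j \<in># mset (x j)" using x by simp
  then show ?thesis by (simp add: contents_def mset_move[of x, OF x m] image_mset_Diff)
qed

text \<open>Lumpability: equal contents admit a perfect matching of colours, and permuting the draws
  along it turns a step from \<open>y\<close> into a step from \<open>x\<close> with the same
  coloured result.\<close>

lemma contents_law_step:
  assumes x: "x \<in> X" and y: "y \<in> X" and e: "contents \<kappa> x = contents \<kappa> y"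
  shows "map_pmf (contents \<kappa>) (K x) = map_pmf (contents \<kappa>) (K y)"
proof -
  note lx = arrangements_length[OF x] and ly = arrangements_length[OF y]
  have "\<exists>\<theta>. bij_betw \<theta> {..<n} {..<n} \<and> (\<forall>p<n. \<kappa> (x j ! p) = \<kappa> (y j ! \<theta> p))" for j
  proof -
    obtain \<theta> where th: "bij_betw \<theta> {..<n} {..<n}"
      "card {p. p < n \<and> \<kappa> (x j ! p) \<noteq> \<kappa> (y j ! \<theta> p)} \<le> size (mset (map \<kappa> (x j)) - mset (map \<kappa> (y j)))"
      using colour_matching_exists[of "x j" n "y j" \<kappa>] lx ly by blast
    have "mset (map \<kappa> (x j)) = mset (map \<kappa> (y j))" using fun_cong[OF e, of j] by (simp add: contents_def)
    with th have "{p. p < n \<and> \<kappa> (x j ! p) \<noteq> \<kappa> (y j ! \<theta> p)} = {}" by simp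
    with th show ?thesis by blast
  qed
  then obtain \<theta> where \<theta>: "\<And>j. bij_betw (\<theta> j) {..<n} {..<n}" and match: "\<And>j p. p < n \<Longrightarrow> \<kappa> (x j ! p) = \<kappa> (y j ! \<theta> j p)"
    by metis
  have "map_pmf (contents \<kappa>) (K y) = map_pmf (\<lambda>m. contents \<kappa> (move m y)) mv"
    by (simp add: K_eq map_pmf_comp)
  also have "\<dots> = map_pmf (\<lambda>m. contents \<kappa> (move (fst m, (\<lambda>i. \<theta> i (fst (snd m) i)), snd (snd m)) y)) mv"
    by (subst mv_permute_draws[of \<theta>, OF \<theta>, symmetric]) (simp add: map_pmf_comp)
  also have "\<dots> = map_pmf (\<lambda>m. contents \<kappa> (move m x)) mv"
  proof (intro map_pmf_cong refl ext)
    fix m j assume m: "m \<in> set_pmf mv"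
    obtain \<sigma> p r where me: "m = (\<sigma>, p, r)" by (cases m) auto
    have pn: "p i < n" for i using m by (simp add: me set_mv)
    have m2: "(\<sigma>, (\<lambda>i. \<theta> i (p i)), r) \<in> set_pmf mv"
      using m \<theta> by (auto simp: me set_mv dest: bij_betwE)
    show "contents \<kappa> (move (fst m, (\<lambda>i. \<theta> i (fst (snd m) i)), snd (snd m)) y) j = contents \<kappa> (move m x) j"
      using contents_move[of y, OF ly m2, of \<kappa> j] contents_move[of x, OF lx m[unfolded me], of \<kappa> j]
      by (simp add: me e match[OF pn])
  qed
  also have "\<dots> = map_pmf (contents \<kappa>) (K x)" by (simp add: K_eq map_pmf_comp)
  finally show ?thesis by simp
qed

lemma contents_law:
  assumes "x \<in> X" "y \<in> X" "contents \<kappa> x = contents \<kappa> y"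
  shows "map_pmf (contents \<kappa>) (law k x) = map_pmf (contents \<kappa>) (law k y)"
  using assms
proof (induction k)
  case (Suc k)
  \<comment> \<open>The transition kernel of the lumped chain, evaluated at a chosen representative
    of the contents.\<close>
  define T where "T c = map_pmf (contents \<kappa>) (K (SOME z. z \<in> X \<and> contents \<kappa> z = c))" for c
  have T: "map_pmf (contents \<kappa>) (K z) = T (contents \<kappa> z)" if "z \<in> X" for z
  proof -
    define w where "w = (SOME z'. z' \<in> X \<and> contents \<kappa> z' = contents \<kappa> z)"
    have "w \<in> X \<and> contents \<kappa> w = contents \<kappa> z"
      unfolding w_def by (rule someI[of _ z]) (use that in auto)
    then have w: "w \<in> X" "contents \<kappa> z = contents \<kappa> w" by simp_all
    show ?thesis unfolding T_def w_def[symmetric] by (rule contents_law_step[OF that w])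
  qed
  have step: "map_pmf (contents \<kappa>) (law (Suc k) z) = bind_pmf (map_pmf (contents \<kappa>) (law k z)) T" if "z \<in> X" for z
  proof -
    have "map_pmf (contents \<kappa>) (law (Suc k) z) = bind_pmf (law k z) (\<lambda>z. map_pmf (contents \<kappa>) (K z))"
      by (simp add: map_bind_pmf)
    also have "\<dots> = bind_pmf (law k z) (\<lambda>z. T (contents \<kappa> z))"
      using set_law[OF that] by (intro bind_pmf_cong refl T) auto
    finally show ?thesis by (simp add: bind_map_pmf)
  qed
  then show ?case using step[OF Suc.prems(1)] step[OF Suc.prems(2)] Suc.IH[OF Suc.prems] by simp
qed simp

lemma fiber_iff_contents: "y \<in> fiber x \<longleftrightarrow> contents id y = contents id x"
  by (simp add: fiber_def contents_def fun_eq_iff)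

lemma prob_fiber_eq:
  assumes "x \<in> X" "y \<in> fiber x"
  shows "measure_pmf.prob (K y) (fiber z) = measure_pmf.prob (K x) (fiber z)"
proof -
  have y: "y \<in> X" using fiber_arrangements assms by blast
  have e: "contents id y = contents id x" using assms by (simp add: fiber_iff_contents)
  have pf: "measure_pmf.prob (K w) (fiber z) = measure_pmf.prob (map_pmf (contents id) (K w)) {contents id z}" for w
  proof -
    have "fiber z = contents id -` {contents id z}" by (auto simp: fiber_iff_contents)
    then show ?thesis by (simp only: measure_map_pmf)
  qed
  show ?thesis unfolding pf contents_law_step[OF y assms(1) e] ..
qed

text \<open>The preimage of an arrangement under a move has contents that depend only on the cards at
  the insertion positions, so permuting these positions along with the target changes nothing.\<close>

lemma pull_back_fiber_eq:
  assumes x: "x \<in> X" and z: "z \<in> X" and z': "z' \<in> fiber z"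
  shows "measure_pmf.prob mv {m. \<exists>y\<in>fiber x. move m y = z'} = measure_pmf.prob mv {m. \<exists>y\<in>fiber x. move m y = z}"
proof -
  have z'X: "z' \<in> X" using fiber_arrangements[OF z z'] .
  note lz = arrangements_length[OF z] and lz' = arrangements_length[OF z'X]
  have "\<exists>\<theta>. bij_betw \<theta> {..<n} {..<n} \<and> (\<forall>p<n. z j ! p = z' j ! \<theta> p)" for j
  proof -
    obtain \<theta> where th: "bij_betw \<theta> {..<n} {..<n}"
      "card {p. p < n \<and> id (z j ! p) \<noteq> id (z' j ! \<theta> p)} \<le> size (mset (map id (z j)) - mset (map id (z' j)))"
      using colour_matching_exists[of "z j" n "z' j" id] lz lz' by blast
    have "mset (map id (z j)) = mset (map id (z' j))" using z' by (simp add: fiber_def)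
    with th have "{p. p < n \<and> id (z j ! p) \<noteq> id (z' j ! \<theta> p)} = {}" by simp
    with th show ?thesis by auto
  qed
  then obtain \<theta> where \<theta>: "\<And>j. bij_betw (\<theta> j) {..<n} {..<n}" and match: "\<And>j p. p < n \<Longrightarrow> z j ! p = z' j ! \<theta> j p"
    by metis
  let ?f = "\<lambda>m. (fst m, fst (snd m), (\<lambda>i. \<theta> (fst m i) (snd (snd m) i)))"
  have surj: "\<exists>y\<in>X. move m y = w" if "m \<in> set_pmf mv" "w \<in> X" for m w
  proof -
    have "move m ` X \<subseteq> X" using move_arrangement that by blast
    then have "move m ` X = X" by (simp add: endo_inj_surj finite_arrangements move_inj[OF that(1)])
    with that(2) show ?thesis by (metis imageE)
  qed
  have iff: "(\<exists>y\<in>fiber x. move m y = z) \<longleftrightarrow> (\<exists>y\<in>fiber x. move (?f m) y = z')" if m: "m \<in> set_pmf mv" for m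
  proof -
    obtain \<sigma> p r where me: "m = (\<sigma>, p, r)" by (cases m) auto
    have s: "\<sigma> permutes UNIV" using perm m by (auto simp: set_mv me)
    have rn: "r i < n" "p i < n" for i using m by (simp_all add: me set_mv)
    define r' where "r' = (\<lambda>i. \<theta> (\<sigma> i) (r i))"
    have fm: "?f m = (\<sigma>, p, r')" by (simp add: me r'_def)
    have "\<theta> (\<sigma> i) (r i) < n" for i using bij_betwE[OF \<theta>, of "\<sigma> i"] rn(1)[of i] by blast
    then have m2: "(\<sigma>, p, r') \<in> set_pmf mv" using m by (simp add: me set_mv r'_def)
    \<comment> \<open>The two preimages have the same contents, because the cards leaving and
      entering each stack can be read off \<open>z\<close> and \<open>z'\<close> and agree by the
      choice of \<open>\<theta>\<close>.\<close>
    have key: "fiber y = fiber y'" if y: "y \<in> X" "move m y = z" and y': "y' \<in> X" "move (?f m) y' = z'" for y y'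
    proof -
      note ly = arrangements_length[OF y(1)] and ly' = arrangements_length[OF y'(1)]
      have mz: "move (\<sigma>, p, r) y = z" "move (\<sigma>, p, r') y' = z'" using y(2) y'(2) by (simp_all add: me r'_def)
      have mzz: "mset (z' j) = mset (z j)" for j using z' by (simp add: fiber_def)
      have "mset (y j) = mset (y' j)" for j
      proof (cases "j \<in> act \<sigma>")
        case True
        define i where "i = inv \<sigma> j"
        have si: "\<sigma> i = j" using s by (simp add: i_def permutes_inverses)
        have ia: "i \<in> act \<sigma>" using act_inv[OF s, of i] si True by simp
        have out: "y j ! p j = y' j ! p j"
          using move_nth(1)[of y, OF ly m[unfolded me] True] move_nth(1)[of y', OF ly' m2 True] match[OF rn(1)[of j], of "\<sigma> j"]
          unfolding mz by (simp add: r'_def)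
        have inc: "y i ! p i = y' i ! p i"
          using move_nth(1)[of y, OF ly m[unfolded me] ia] move_nth(1)[of y', OF ly' m2 ia] match[OF rn(1)[of i], of "\<sigma> i"]
          unfolding mz by (simp add: r'_def)
        have "add_mset (y i ! p i) (mset (y j) - {#y j ! p j#}) = add_mset (y' i ! p i) (mset (y' j) - {#y' j ! p j#})"
          using mset_move[of y, OF ly m[unfolded me], of j] mset_move[of y', OF ly' m2, of j] mzz[of j]
          unfolding mz i_def by simp
        then have d: "mset (y j) - {#y j ! p j#} = mset (y' j) - {#y j ! p j#}" using inc out by simp
        have "y j ! p j \<in># mset (y j)" using ly rn(2)[of j] by simp
        then have "mset (y j) = add_mset (y j ! p j) (mset (y j) - {#y j ! p j#})" by (rule insert_DiffM[symmetric])
        also have "\<dots> = add_mset (y' j ! p j) (mset (y' j) - {#y' j ! p j#})" using d by (simp add: out)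
        also have "\<dots> = mset (y' j)" by (rule insert_DiffM) (use ly' rn(2)[of j] in simp)
        finally show ?thesis .
      next
        case False
        then have "z j = y j" "z' j = y' j" using fun_cong[OF mz(1), of j] fun_cong[OF mz(2), of j] by (simp_all add: move_def move_cards_def)
        then show ?thesis using mzz[of j] by simp
      qed
      then show ?thesis by (simp add: fiber_def)
    qed
    show ?thesis
    proof
      assume "\<exists>y\<in>fiber x. move m y = z"
      then obtain y where y: "y \<in> fiber x" "move m y = z" by blast
      obtain y' where y': "y' \<in> X" "move (?f m) y' = z'" using surj[OF m2 z'X] unfolding fm by blast
      have "y \<in> X" using fiber_arrangements[OF x] y by blast
      with key y y' have "fiber y = fiber y'" by blast
      then have "y' \<in> fiber x" using y(1) fiber_self by (auto simp: fiber_def)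
      with y' show "\<exists>y\<in>fiber x. move (?f m) y = z'" by blast
    next
      assume "\<exists>y\<in>fiber x. move (?f m) y = z'"
      then obtain y' where y': "y' \<in> fiber x" "move (?f m) y' = z'" by blast
      obtain y where y: "y \<in> X" "move m y = z" using surj[OF m z] by blast
      have "y' \<in> X" using fiber_arrangements[OF x] y' by blast
      with key y y' have "fiber y = fiber y'" by blast
      then have "y \<in> fiber x" using y'(1) fiber_self[of y] by (auto simp: fiber_def)
      with y show "\<exists>y\<in>fiber x. move m y = z" by blast
    qed
  qed
  have "measure_pmf.prob mv {m. \<exists>y\<in>fiber x. move m y = z'} =
     measure_pmf.prob (map_pmf ?f mv) {m. \<exists>y\<in>fiber x. move m y = z'}"
    by (simp only: mv_permute_insertions[of \<theta>, OF \<theta>])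
  also have "\<dots> = measure_pmf.prob mv (?f -` {m. \<exists>y\<in>fiber x. move m y = z'})" by simp
  also have "\<dots> = measure_pmf.prob mv {m. \<exists>y\<in>fiber x. move m y = z}"
  proof -
    have "?f -` {m. \<exists>y\<in>fiber x. move m y = z'} \<inter> set_pmf mv = {m. \<exists>y\<in>fiber x. move m y = z} \<inter> set_pmf mv"
      using iff by blast
    then show ?thesis by (metis (no_types, lifting) measure_Int_set_pmf)
  qed
  finally show ?thesis .
qed

section \<open>Uniform order given the contents\<close>

text \<open>Re-randomises the order within every stack and keeps the contents.\<close>

definition sym :: "('d \<Rightarrow> nat list) pmf \<Rightarrow> ('d \<Rightarrow> nat list) pmf" where
  "sym P = bind_pmf P (\<lambda>x. pmf_of_set (fiber x))"

lemma pmf_fiber: "x \<in> X \<Longrightarrow> pmf (pmf_of_set (fiber x)) y = (if y \<in> fiber x then 1 / fact n ^ CARD('d) else 0)"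
  using card_fiber[of x n] finite_fiber[of x n] fiber_self[of x] by (subst pmf_of_set) (auto simp: indicator_def)

lemma fiber_sym: "y \<in> fiber x \<longleftrightarrow> x \<in> fiber y"
  by (auto simp: fiber_def)

lemma pmf_K: "pmf (K y) z = measure_pmf.prob mv {m. move m y = z}"
  by (simp add: K_eq pmf_map vimage_def)

text \<open>The chain intertwines with re-randomising the order. From a uniform order, the mass sent
  to \<open>w\<close> is constant while \<open>w\<close> varies over the fibre of \<open>z\<close>,
  since permuting insertion positions identifies the preimages; the total mass sent to that fibre
  depends only on the contents, by lumpability.\<close>

lemma bind_fiber_K:
  assumes x: "x \<in> X"
  shows "bind_pmf (pmf_of_set (fiber x)) K = bind_pmf (K x) (\<lambda>y. pmf_of_set (fiber y))"
proof (rule pmf_eqI)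
  fix z
  let ?M = "fact n ^ CARD('d) :: real"
  have neF: "fiber x \<noteq> {}" and finF: "finite (fiber x)" using fiber_self finite_fiber[OF x] by blast+
  have lhs: "pmf (bind_pmf (pmf_of_set (fiber x)) K) w = (\<Sum>y\<in>fiber x. pmf (K y) w) / ?M" for w
    using card_fiber[OF x] by (simp add: pmf_bind integral_pmf_of_set[OF neF finF])
  show "pmf (bind_pmf (pmf_of_set (fiber x)) K) z = pmf (bind_pmf (K x) (\<lambda>y. pmf_of_set (fiber y))) z"
  proof (cases "z \<in> X")
    case True
    define G where "G w = (\<Sum>y\<in>fiber x. pmf (K y) w)" for w
    have finZ: "finite (fiber z)" using finite_fiber[OF True] .
    have G: "G w = measure_pmf.prob mv {m. \<exists>y\<in>fiber x. move m y = w}" for w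
    proof -
      have "G w = (\<Sum>y\<in>fiber x. measure_pmf.prob mv ({m. move m y = w} \<inter> set_pmf mv))"
        by (simp add: G_def pmf_K measure_Int_set_pmf)
      also have "\<dots> = measure_pmf.prob mv (\<Union>y\<in>fiber x. {m. move m y = w} \<inter> set_pmf mv)"
      proof (rule measure_pmf.finite_measure_finite_Union[symmetric])
        show "disjoint_family_on (\<lambda>y. {m. move m y = w} \<inter> set_pmf mv) (fiber x)"
          unfolding disjoint_family_on_def
          using move_inj fiber_arrangements[OF x] by (auto simp: inj_on_def)
      qed (use finF in auto)
      also have "(\<Union>y\<in>fiber x. {m. move m y = w} \<inter> set_pmf mv) = {m. \<exists>y\<in>fiber x. move m y = w} \<inter> set_pmf mv" by auto
      finally show ?thesis by (simp add: measure_Int_set_pmf)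
    qed
    have Gc: "G w = G z" if "w \<in> fiber z" for w
      unfolding G by (rule pull_back_fiber_eq[OF x True that])
    \<comment> \<open>Double counting of the mass that the fibre of \<open>x\<close> sends to the
      fibre of \<open>z\<close>.\<close>
    have "?M * G z = (\<Sum>w\<in>fiber z. G w)" using card_fiber[OF True] by (simp add: Gc)
    also have "\<dots> = (\<Sum>y\<in>fiber x. \<Sum>w\<in>fiber z. pmf (K y) w)" unfolding G_def by (rule sum.swap)
    also have "\<dots> = (\<Sum>y\<in>fiber x. measure_pmf.prob (K y) (fiber z))"
      by (simp add: measure_measure_pmf_finite[OF finZ])
    also have "\<dots> = ?M * measure_pmf.prob (K x) (fiber z)"
      using card_fiber[OF x] by (simp add: prob_fiber_eq[OF x])
    finally have Gz: "G z = measure_pmf.prob (K x) (fiber z)" by simp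
    have "pmf (bind_pmf (K x) (\<lambda>y. pmf_of_set (fiber y))) z = measure_pmf.expectation (K x) (\<lambda>y. indicator (fiber z) y / ?M)"
      unfolding pmf_bind
    proof (intro integral_cong_AE AE_pmfI)
      fix y assume "y \<in> set_pmf (K x)"
      then have "y \<in> X" using set_K[OF x] by blast
      then show "pmf (pmf_of_set (fiber y)) z = indicator (fiber z) y / ?M"
        using pmf_fiber[of y z] fiber_sym[of z y] by (simp add: indicator_def)
    qed auto
    also have "\<dots> = measure_pmf.prob (K x) (fiber z) / ?M" by simp
    finally show ?thesis using Gz lhs[of z] by (simp add: G_def)
  next
    case False
    have a: "z \<notin> set_pmf (bind_pmf (pmf_of_set (fiber x)) K)"
      using False fiber_arrangements[OF x] set_K by (auto simp: set_pmf_of_set[OF neF finF])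
    have b: "z \<notin> set_pmf (bind_pmf (K x) (\<lambda>y. pmf_of_set (fiber y)))"
    proof
      assume "z \<in> set_pmf (bind_pmf (K x) (\<lambda>y. pmf_of_set (fiber y)))"
      then obtain y where y: "y \<in> set_pmf (K x)" "z \<in> set_pmf (pmf_of_set (fiber y))" by auto
      then have yX: "y \<in> X" using set_K[OF x] by blast
      have "fiber y \<noteq> {}" using fiber_self by blast
      then have "z \<in> fiber y" using y(2) set_pmf_of_set[OF _ finite_fiber[OF yX]] by blast
      then show False using False fiber_arrangements[OF yX] by blast
    qed
    show ?thesis using a b unfolding set_pmf_iff by simp
  qed
qed

lemma sym_bind_K: "set_pmf P \<subseteq> X \<Longrightarrow> bind_pmf (sym P) K = sym (bind_pmf P K)"
  by (simp add: sym_def bind_assoc_pmf) (intro bind_pmf_cong refl bind_fiber_K, auto)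

end

lemma expectation_bind_finite:
  fixes h :: "'b \<Rightarrow> 'c :: {banach, second_countable_topology}"
  assumes "finite (set_pmf p)" "\<And>x. x \<in> set_pmf p \<Longrightarrow> finite (set_pmf (f x))"
  shows "measure_pmf.expectation (bind_pmf p f) h = measure_pmf.expectation p (\<lambda>x. measure_pmf.expectation (f x) h)"
proof -
  have "measure_pmf.expectation p (\<lambda>x. measure_pmf.expectation (f x) h) =
      (\<Sum>x\<in>set_pmf p. pmf p x *\<^sub>R measure_pmf.expectation (f x) h)"
    by (rule integral_measure_pmf) (use assms in auto)
  then show ?thesis using pmf_expectation_bind[of "set_pmf p" f p h] assms by simp
qed

lemma sum_SIGMA:
  assumes "finite A" "\<And>x. x \<in> A \<Longrightarrow> finite (B x)"
  shows "(\<Sum>z\<in>Sigma A B. h z) = (\<Sum>x\<in>A. \<Sum>y\<in>B x. h (x, y))"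
  using sum.Sigma[of A B "\<lambda>x y. h (x, y)"] assms by (simp add: case_prod_unfold)

context stack_shuffle
begin

section \<open>Entropy decay in one step\<close>

definition positions :: "('d \<Rightarrow> nat) set" where "positions = {p. \<forall>i. p i < n}"

text \<open>The insertion half of a move: \<open>c\<close> gives the drawn cards by source stack,
  and \<open>y\<close> the stacks from which they have been removed.\<close>

definition insert_cards :: "('d \<Rightarrow> 'd) \<Rightarrow> ('d \<Rightarrow> nat) \<Rightarrow> ('d \<Rightarrow> nat list) \<Rightarrow> ('d \<Rightarrow> nat) \<Rightarrow> 'd \<Rightarrow> nat list" where
  "insert_cards \<sigma> c y r = (\<lambda>j. if j \<in> act \<sigma> then insert_at (r (inv \<sigma> j)) (c (inv \<sigma> j)) (y j) else y j)"

text \<open>Draws are described by cards rather than positions. The set of choices is then the same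
  for all orders in a fibre, so the random set of removed coordinates does not depend on the
  order.\<close>

definition card_choices :: "('d \<Rightarrow> nat list) \<Rightarrow> ('d \<Rightarrow> nat) set" where
  "card_choices x0 = {c. \<forall>j. c j \<in> set (x0 j)}"

lemma card_choices_PiE: "card_choices x0 = Pi\<^sub>E UNIV (\<lambda>j. set (x0 j))"
  by (auto simp: card_choices_def)

lemma finite_card_choices: "finite (card_choices x0)"
  by (simp add: card_choices_PiE finite_PiE)

lemma card_card_choices: "x0 \<in> X \<Longrightarrow> card (card_choices x0) = n ^ CARD('d)"
  by (simp add: card_choices_PiE card_PiE distinct_card arrangements_distinct arrangements_length)

lemma card_card_choices_fixed:
  assumes x0: "x0 \<in> X" and v: "v \<in> set (x0 i)"
  shows "real (card {c \<in> card_choices x0. c i = v}) = n ^ CARD('d) / n"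
proof -
  have "{c \<in> card_choices x0. c i = v} = Pi\<^sub>E UNIV (\<lambda>j. if j = i then {v} else set (x0 j))"
    using v by (fastforce simp: card_choices_def PiE_iff split: if_splits)
  then have "card {c \<in> card_choices x0. c i = v} = (\<Prod>j\<in>UNIV. if j = i then 1 else n)"
    by (simp add: card_PiE distinct_card[OF arrangements_distinct[OF x0]] arrangements_length[OF x0] if_distrib cong: if_cong)
  also have "\<dots> = n ^ (CARD('d) - 1)"
    by (subst prod.If_cases) (auto simp: Compl_eq_Diff_UNIV card_Diff_subset)
  finally have "real (card {c \<in> card_choices x0. c i = v}) = real n ^ (CARD('d) - 1)" by simp
  moreover have "real n ^ CARD('d) = real n * real n ^ (CARD('d) - 1)"
    by (simp add: power_Suc[symmetric] del: power_Suc)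
  ultimately show ?thesis using n_pos by simp
qed

lemma remove_at_filter:
  assumes "distinct xs" "k < length xs"
  shows "remove_at k xs = filter (\<lambda>v. v \<noteq> xs ! k) xs"
proof -
  have xs: "xs = take k xs @ xs ! k # drop (Suc k) xs" using assms by (simp add: id_take_nth_drop)
  have "distinct (take k xs @ xs ! k # drop (Suc k) xs)" using assms xs by simp
  then have a: "xs ! k \<notin> set (take k xs)" "xs ! k \<notin> set (drop (Suc k) xs)" by auto
  have "filter (\<lambda>v. v \<noteq> xs ! k) (take k xs @ xs ! k # drop (Suc k) xs) = take k xs @ drop (Suc k) xs"
  proof -
    have "filter (\<lambda>v. v \<noteq> xs ! k) (take k xs) = take k xs" by (rule filter_True) (use a in auto)
    moreover have "filter (\<lambda>v. v \<noteq> xs ! k) (drop (Suc k) xs) = drop (Suc k) xs" by (rule filter_True) (use a in auto)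
    ultimately show ?thesis by simp
  qed
  then show ?thesis using xs by (simp add: remove_at_def)
qed

text \<open>Once the drawn cards are known, the result depends on the old arrangement only through
  the order of the other cards. This bottleneck is what reduces the entropy.\<close>

lemma insert_cards_drop_cards:
  assumes x: "x \<in> X" and m: "(\<sigma>, p, r) \<in> set_pmf mv"
  shows "insert_cards \<sigma> (\<lambda>j. x j ! p j) (drop_cards ((\<lambda>j. x j ! p j) ` act \<sigma>) x) r = move (\<sigma>, p, r) x"
proof
  fix j
  have pn: "p i < n" for i using m by (simp add: set_mv)
  note lx = arrangements_length[OF x]
  let ?C = "(\<lambda>j. x j ! p j) ` act \<sigma>"
  have C: "v \<in> ?C \<longleftrightarrow> j \<in> act \<sigma> \<and> v = x j ! p j" if v: "v \<in> set (x j)" for v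
  proof
    assume "v \<in> ?C"
    then obtain i where i: "i \<in> act \<sigma>" "v = x i ! p i" by blast
    then have "v \<in> set (x i)" using pn lx by simp
    then show "j \<in> act \<sigma> \<and> v = x j ! p j" using arrangements_disjoint[OF x v] i by blast
  qed auto
  have "drop_cards ?C x j = (if j \<in> act \<sigma> then remove_at (p j) (x j) else x j)"
  proof -
    have "drop_cards ?C x j = filter (\<lambda>v. \<not> (j \<in> act \<sigma> \<and> v = x j ! p j)) (x j)"
      unfolding drop_cards_def using C by (intro filter_cong) auto
    then show ?thesis using remove_at_filter[OF arrangements_distinct[OF x], of "p j"] pn lx by simp
  qed
  then show "insert_cards \<sigma> (\<lambda>j. x j ! p j) (drop_cards ?C x) r j = move (\<sigma>, p, r) x j"
    by (simp add: insert_cards_def move_def move_cards_def Let_def)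
qed

lemma pmf_K_sum:
  "pmf (K x) x' = (\<Sum>\<sigma>\<in>set_pmf \<mu>. \<Sum>p\<in>positions. \<Sum>r\<in>positions.
      pmf \<mu> \<sigma> / (real n ^ CARD('d))\<^sup>2 * of_bool (move (\<sigma>, p, r) x = x'))"
proof -
  note P = positions_nonempty[OF n_pos] finite_positions[of n]
  have "pmf (K x) x' = measure_pmf.expectation \<mu> (\<lambda>\<sigma>. (\<Sum>p\<in>positions. (\<Sum>r\<in>positions. of_bool (move (\<sigma>, p, r) x = x')) / real n ^ CARD('d)) / real n ^ CARD('d))"
    unfolding shuffle_step_def rand_pos_def[symmetric] rand_pos_eq[OF n_pos]
    by (subst pmf_bind)
      (simp add: pmf_bind_pmf_of_set[OF P] card_positions positions_def pmf_return indicator_def of_bool_def move_def cong: if_cong)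
  also have "\<dots> = (\<Sum>\<sigma>\<in>set_pmf \<mu>. (\<Sum>p\<in>positions. (\<Sum>r\<in>positions. of_bool (move (\<sigma>, p, r) x = x')) / real n ^ CARD('d)) / real n ^ CARD('d) * pmf \<mu> \<sigma>)"
    by (subst integral_measure_pmf_real[OF finite_set_\<mu>]) auto
  also have "\<dots> = (\<Sum>\<sigma>\<in>set_pmf \<mu>. \<Sum>p\<in>positions. \<Sum>r\<in>positions.
      pmf \<mu> \<sigma> / (real n ^ CARD('d))\<^sup>2 * of_bool (move (\<sigma>, p, r) x = x'))"
    by (intro sum.cong refl) (simp add: sum_divide_distrib sum_distrib_left sum_distrib_right power2_eq_square mult_ac)
  finally show ?thesis .
qed

text \<open>Relative entropy of \<open>P\<close> with respect to \<open>sym P\<close>; equivalently,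
  the mean entropy deficit of the order given the contents.\<close>

definition fiber_entropy :: "('d \<Rightarrow> nat list) pmf \<Rightarrow> real" where
  "fiber_entropy P = (\<Sum>x\<in>X. pmf P x * ln (pmf P x / pmf (sym P) x))"

lemma pmf_sym:
  assumes P: "set_pmf P \<subseteq> X" and y: "y \<in> X"
  shows "pmf (sym P) y = (\<Sum>x\<in>fiber y. pmf P x) / fact n ^ CARD('d)"
proof -
  have "pmf (sym P) y = measure_pmf.expectation P (\<lambda>x. pmf (pmf_of_set (fiber x)) y)"
    by (simp add: sym_def pmf_bind)
  also have "\<dots> = (\<Sum>x\<in>X. pmf (pmf_of_set (fiber x)) y * pmf P x)"
    by (rule integral_measure_pmf_real[OF finite_arrangements]) (use P in auto)
  also have "\<dots> = (\<Sum>x\<in>X. if x \<in> fiber y then pmf P x / fact n ^ CARD('d) else 0)"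
    by (intro sum.cong refl) (simp add: pmf_fiber fiber_sym[of y])
  also have "\<dots> = (\<Sum>x\<in>fiber y. pmf P x / fact n ^ CARD('d))"
    using fiber_arrangements[OF y]
    by (subst sum.inter_filter[symmetric]) (auto intro!: sum.cong simp: finite_arrangements)
  finally show ?thesis by (simp add: sum_divide_distrib)
qed

text \<open>A step is split into a draw and an insertion. By data processing, passing from the
  intermediate data to the result cannot raise the entropy, and the intermediate data carry only the
  entropy of the undrawn cards, to which Shearer's inequality applies. Full support keeps all
  logarithms meaningful.\<close>

lemma fiber_entropy_contraction:
  assumes P: "set_pmf P = X" and q: "\<And>i. q \<le> measure_pmf.prob \<mu> {\<sigma>. i \<in> act \<sigma>}"
  shows "fiber_entropy (bind_pmf P K) \<le> (1 - q / n) * fiber_entropy P"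
proof -
  define N where "N = real n ^ CARD('d)"
  have N: "N > 0" using n_pos by (simp add: N_def)
  define M where "M = (fact n ^ CARD('d) :: real)"
  have M: "M > 0" by (simp add: M_def)
  \<comment> \<open>The choice depends only on the set \<open>fiber x\<close>, so it selects one
    representative for each class of contents.\<close>
  define rep where "rep x = (SOME y. y \<in> fiber x)" for x :: "'d \<Rightarrow> nat list"
  have rep: "rep x \<in> fiber x" for x unfolding rep_def by (rule someI[of _ x]) (rule fiber_self)
  have rep_eq: "rep x = rep y \<longleftrightarrow> x \<in> fiber y" for x y
  proof
    assume "rep x = rep y"
    then show "x \<in> fiber y" using rep[of x] rep[of y] by (simp add: fiber_def)
  next
    assume "x \<in> fiber y"
    then show "rep x = rep y" unfolding rep_def by (simp add: fiber_eq)
  qed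
  define Rp where "Rp = rep ` X"
  have finRp: "finite Rp" by (simp add: Rp_def finite_arrangements)
  have RpX: "x0 \<in> X" if "x0 \<in> Rp" for x0 using that rep fiber_arrangements by (auto simp: Rp_def)
  have sum_X: "(\<Sum>x\<in>X. h x) = (\<Sum>x0\<in>Rp. \<Sum>x\<in>fiber x0. h x)" for h :: "('d \<Rightarrow> nat list) \<Rightarrow> real"
  proof -
    have gen: "(\<Sum>x\<in>X. h x) = (\<Sum>x0\<in>Rp. \<Sum>x\<in>{x\<in>X. rep x = x0}. h x)"
      unfolding Rp_def by (rule sum.image_gen[OF finite_arrangements])
    have "{x\<in>X. rep x = x0} = fiber x0" if x0: "x0 \<in> Rp" for x0
    proof -
      obtain z where z: "z \<in> X" "x0 = rep z" using x0 by (auto simp: Rp_def)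
      have "rep x = x0 \<longleftrightarrow> x \<in> fiber x0" for x
        using rep_eq[of x z] rep[of z] z by (simp add: fiber_def)
      then show ?thesis using fiber_arrangements[OF RpX[OF x0]] by auto
    qed
    then have "(\<Sum>x0\<in>Rp. \<Sum>x\<in>{x\<in>X. rep x = x0}. h x) = (\<Sum>x0\<in>Rp. \<Sum>x\<in>fiber x0. h x)"
      by (intro sum.cong) auto
    with gen show ?thesis by simp
  qed
  have finF: "finite (fiber x0)" if "x0 \<in> Rp" for x0 using finite_fiber RpX that by blast
  have finPos: "finite positions" using finite_positions by (simp add: positions_def)
  have cardPos: "real (card positions) = N" by (simp add: positions_def card_positions N_def)
  define D :: "('d \<Rightarrow> 'd) \<Rightarrow> ('d \<Rightarrow> nat) \<Rightarrow> ('d \<Rightarrow> nat list) \<Rightarrow> 'd \<Rightarrow> nat list"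
    where "D \<sigma> c = drop_cards (c ` act \<sigma>)" for \<sigma> c
  \<comment> \<open>The intermediate data: class of the contents, permutation, drawn cards,
    remaining stacks and insertion positions. Below, \<open>g\<close> maps them to the new
    arrangement, and \<open>u Q\<close> is their joint mass when the old law is
    \<open>Q\<close>.\<close>
  define Z where "Z = (SIGMA x0:Rp. SIGMA \<sigma>:set_pmf \<mu>. SIGMA c:card_choices x0. (D \<sigma> c ` fiber x0) \<times> positions)"
  define g where "g = (\<lambda>(x0 :: 'd \<Rightarrow> nat list, \<sigma>, c, y, r). insert_cards \<sigma> c y r)"
  define A where "A Q x0 \<sigma> c y = (\<Sum>x\<in>{x\<in>fiber x0. D \<sigma> c x = y}. pmf Q x)" for Q x0 \<sigma> c y
  define u where "u Q = (\<lambda>(x0, \<sigma>, c, y, r :: 'd \<Rightarrow> nat). pmf \<mu> \<sigma> * A Q x0 \<sigma> c y / N\<^sup>2)" for Q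
  have sumZ: "(\<Sum>z\<in>Z. h z) = (\<Sum>x0\<in>Rp. \<Sum>\<sigma>\<in>set_pmf \<mu>. \<Sum>c\<in>card_choices x0. \<Sum>y\<in>D \<sigma> c ` fiber x0. \<Sum>r\<in>positions. h (x0, \<sigma>, c, y, r))"
    for h :: "_ \<Rightarrow> real"
  proof -
    note fin = finite_SigmaI finite_cartesian_product finite_imageI finRp finite_set_\<mu> finite_card_choices finF finPos
    have "(\<Sum>z\<in>Z. h z) = (\<Sum>x0\<in>Rp. \<Sum>z\<in>(SIGMA \<sigma>:set_pmf \<mu>. SIGMA c:card_choices x0. (D \<sigma> c ` fiber x0) \<times> positions). h (x0, z))"
      unfolding Z_def by (rule sum_SIGMA) (intro fin, assumption?)+
    also have "\<dots> = (\<Sum>x0\<in>Rp. \<Sum>\<sigma>\<in>set_pmf \<mu>. \<Sum>z\<in>(SIGMA c:card_choices x0. (D \<sigma> c ` fiber x0) \<times> positions). h (x0, \<sigma>, z))"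
      by (intro sum.cong refl, rule sum_SIGMA) (intro fin, assumption?)+
    also have "\<dots> = (\<Sum>x0\<in>Rp. \<Sum>\<sigma>\<in>set_pmf \<mu>. \<Sum>c\<in>card_choices x0. \<Sum>z\<in>(D \<sigma> c ` fiber x0) \<times> positions. h (x0, \<sigma>, c, z))"
      by (intro sum.cong refl, rule sum_SIGMA) (intro fin, assumption?)+
    also have "\<dots> = (\<Sum>x0\<in>Rp. \<Sum>\<sigma>\<in>set_pmf \<mu>. \<Sum>c\<in>card_choices x0. \<Sum>y\<in>D \<sigma> c ` fiber x0. \<Sum>r\<in>positions. h (x0, \<sigma>, c, y, r))"
      by (intro sum.cong refl, rule sum_SIGMA) (intro fin, assumption?)+
    finally show ?thesis .
  qed
  have finZ: "finite Z"
    unfolding Z_def using finRp finite_set_\<mu> finite_card_choices finF finPos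
    by (blast intro: finite_SigmaI finite_cartesian_product finite_imageI)
  \<comment> \<open>One step of the chain is the image of \<open>u Q\<close> under \<open>g\<close>.
    Drawn cards are exchanged for drawn positions through a bijection that depends on the
    arrangement \<open>x\<close>.\<close>
  have push: "(\<Sum>z\<in>{z\<in>Z. g z = x'}. u Q z) = pmf (bind_pmf Q K) x'" if Q: "set_pmf Q \<subseteq> X" for Q x'
  proof -
    have "(\<Sum>z\<in>{z\<in>Z. g z = x'}. u Q z) = (\<Sum>z\<in>Z. u Q z * of_bool (g z = x'))"
      using finZ by (simp add: sum.inter_filter of_bool_def if_distrib[where f = "\<lambda>x. _ * x"] cong: if_cong)
    also have "\<dots> = (\<Sum>x0\<in>Rp. \<Sum>\<sigma>\<in>set_pmf \<mu>. \<Sum>c\<in>card_choices x0. \<Sum>y\<in>D \<sigma> c ` fiber x0. \<Sum>r\<in>positions.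
        pmf \<mu> \<sigma> * A Q x0 \<sigma> c y / N\<^sup>2 * of_bool (insert_cards \<sigma> c y r = x'))"
      by (simp add: sumZ u_def g_def)
    also have "\<dots> = (\<Sum>x0\<in>Rp. \<Sum>\<sigma>\<in>set_pmf \<mu>. \<Sum>x\<in>fiber x0. \<Sum>p\<in>positions. \<Sum>r\<in>positions.
        pmf Q x * (pmf \<mu> \<sigma> / N\<^sup>2 * of_bool (move (\<sigma>, p, r) x = x')))"
    proof (rule sum.cong[OF refl], rule sum.cong[OF refl])
      fix x0 \<sigma> assume x0: "x0 \<in> Rp" and \<sigma>: "\<sigma> \<in> set_pmf \<mu>"
      have "(\<Sum>c\<in>card_choices x0. \<Sum>y\<in>D \<sigma> c ` fiber x0. \<Sum>r\<in>positions.
          pmf \<mu> \<sigma> * A Q x0 \<sigma> c y / N\<^sup>2 * of_bool (insert_cards \<sigma> c y r = x'))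
        = (\<Sum>c\<in>card_choices x0. \<Sum>x\<in>fiber x0. \<Sum>r\<in>positions.
          pmf Q x * (pmf \<mu> \<sigma> / N\<^sup>2 * of_bool (insert_cards \<sigma> c (D \<sigma> c x) r = x')))"
      proof (rule sum.cong[OF refl])
        fix c
        have "(\<Sum>x\<in>fiber x0. \<Sum>r\<in>positions. pmf Q x * (pmf \<mu> \<sigma> / N\<^sup>2 * of_bool (insert_cards \<sigma> c (D \<sigma> c x) r = x')))
          = (\<Sum>y\<in>D \<sigma> c ` fiber x0. \<Sum>x\<in>{x\<in>fiber x0. D \<sigma> c x = y}. \<Sum>r\<in>positions.
              pmf Q x * (pmf \<mu> \<sigma> / N\<^sup>2 * of_bool (insert_cards \<sigma> c (D \<sigma> c x) r = x')))"
          by (rule sum.image_gen[OF finF[OF x0]])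
        also have "\<dots> = (\<Sum>y\<in>D \<sigma> c ` fiber x0. \<Sum>r\<in>positions. \<Sum>x\<in>{x\<in>fiber x0. D \<sigma> c x = y}.
              pmf Q x * (pmf \<mu> \<sigma> / N\<^sup>2 * of_bool (insert_cards \<sigma> c (D \<sigma> c x) r = x')))"
          by (rule sum.cong[OF refl], rule sum.swap)
        also have "\<dots> = (\<Sum>y\<in>D \<sigma> c ` fiber x0. \<Sum>r\<in>positions.
          pmf \<mu> \<sigma> * A Q x0 \<sigma> c y / N\<^sup>2 * of_bool (insert_cards \<sigma> c y r = x'))"
          by (intro sum.cong refl) (simp add: A_def sum_distrib_left sum_distrib_right sum_divide_distrib mult_ac)
        finally show "(\<Sum>y\<in>D \<sigma> c ` fiber x0. \<Sum>r\<in>positions. pmf \<mu> \<sigma> * A Q x0 \<sigma> c y / N\<^sup>2 * of_bool (insert_cards \<sigma> c y r = x'))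
          = (\<Sum>x\<in>fiber x0. \<Sum>r\<in>positions. pmf Q x * (pmf \<mu> \<sigma> / N\<^sup>2 * of_bool (insert_cards \<sigma> c (D \<sigma> c x) r = x')))"
          by simp
      qed
      also have "\<dots> = (\<Sum>x\<in>fiber x0. \<Sum>c\<in>card_choices x0. \<Sum>r\<in>positions.
          pmf Q x * (pmf \<mu> \<sigma> / N\<^sup>2 * of_bool (insert_cards \<sigma> c (D \<sigma> c x) r = x')))"
        by (rule sum.swap)
      also have "\<dots> = (\<Sum>x\<in>fiber x0. \<Sum>p\<in>positions. \<Sum>r\<in>positions.
          pmf Q x * (pmf \<mu> \<sigma> / N\<^sup>2 * of_bool (move (\<sigma>, p, r) x = x')))"
      proof (rule sum.cong[OF refl])
        fix x assume x: "x \<in> fiber x0"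
        have xX: "x \<in> X" using fiber_arrangements[OF RpX[OF x0] x] .
        note lx = arrangements_length[OF xX]
        have setx: "set (x0 j) = set (x j)" for j using x mset_eq_setD[of "x0 j" "x j"] by (simp add: fiber_def)
        have bij: "bij_betw (\<lambda>p j. x j ! p j) positions (card_choices x0)"
        proof (rule bij_betwI')
          fix p p' assume "p \<in> positions" "p' \<in> positions"
          then have b: "p j < n" "p' j < n" for j by (simp_all add: positions_def)
          show "((\<lambda>j. x j ! p j) = (\<lambda>j. x j ! p' j)) = (p = p')"
          proof
            assume e: "(\<lambda>j. x j ! p j) = (\<lambda>j. x j ! p' j)"
            show "p = p'"
            proof
              fix j
              show "p j = p' j" using arrangements_nth_eq[OF xX b(1)[of j] b(2)[of j]] fun_cong[OF e, of j] by blast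
            qed
          qed simp
        next
          fix p assume "p \<in> positions"
          then show "(\<lambda>j. x j ! p j) \<in> card_choices x0" by (simp add: card_choices_def setx positions_def lx)
        next
          fix c assume "c \<in> card_choices x0"
          then have "\<forall>j. \<exists>k<n. x j ! k = c j" by (simp add: card_choices_def setx in_set_conv_nth lx)
          then obtain p where "\<And>j. p j < n" "\<And>j. c j = x j ! p j" by metis
          then show "\<exists>p\<in>positions. c = (\<lambda>j. x j ! p j)" by (intro bexI[of _ p]) (auto simp: positions_def fun_eq_iff)
        qed
        have "(\<Sum>c\<in>card_choices x0. \<Sum>r\<in>positions.
            pmf Q x * (pmf \<mu> \<sigma> / N\<^sup>2 * of_bool (insert_cards \<sigma> c (D \<sigma> c x) r = x')))
          = (\<Sum>p\<in>positions. \<Sum>r\<in>positions.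
            pmf Q x * (pmf \<mu> \<sigma> / N\<^sup>2 * of_bool (insert_cards \<sigma> (\<lambda>j. x j ! p j) (D \<sigma> (\<lambda>j. x j ! p j) x) r = x')))"
          by (rule sum.reindex_bij_betw[OF bij, symmetric])
        also have "\<dots> = (\<Sum>p\<in>positions. \<Sum>r\<in>positions.
          pmf Q x * (pmf \<mu> \<sigma> / N\<^sup>2 * of_bool (move (\<sigma>, p, r) x = x')))"
        proof (intro sum.cong refl)
          fix p r assume "p \<in> positions" "r \<in> positions"
          then have "(\<sigma>, p, r) \<in> set_pmf mv" using \<sigma> by (simp add: set_mv positions_def)
          then show "pmf Q x * (pmf \<mu> \<sigma> / N\<^sup>2 * of_bool (insert_cards \<sigma> (\<lambda>j. x j ! p j) (D \<sigma> (\<lambda>j. x j ! p j) x) r = x'))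
            = pmf Q x * (pmf \<mu> \<sigma> / N\<^sup>2 * of_bool (move (\<sigma>, p, r) x = x'))"
            using insert_cards_drop_cards[OF xX] by (simp add: D_def)
        qed
        finally show "(\<Sum>c\<in>card_choices x0. \<Sum>r\<in>positions.
            pmf Q x * (pmf \<mu> \<sigma> / N\<^sup>2 * of_bool (insert_cards \<sigma> c (D \<sigma> c x) r = x')))
          = (\<Sum>p\<in>positions. \<Sum>r\<in>positions. pmf Q x * (pmf \<mu> \<sigma> / N\<^sup>2 * of_bool (move (\<sigma>, p, r) x = x')))" .
      qed
      finally show "(\<Sum>c\<in>card_choices x0. \<Sum>y\<in>D \<sigma> c ` fiber x0. \<Sum>r\<in>positions.
          pmf \<mu> \<sigma> * A Q x0 \<sigma> c y / N\<^sup>2 * of_bool (insert_cards \<sigma> c y r = x'))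
        = (\<Sum>x\<in>fiber x0. \<Sum>p\<in>positions. \<Sum>r\<in>positions.
          pmf Q x * (pmf \<mu> \<sigma> / N\<^sup>2 * of_bool (move (\<sigma>, p, r) x = x')))" .
    qed
    also have "\<dots> = (\<Sum>x0\<in>Rp. \<Sum>x\<in>fiber x0. \<Sum>\<sigma>\<in>set_pmf \<mu>. \<Sum>p\<in>positions. \<Sum>r\<in>positions.
        pmf Q x * (pmf \<mu> \<sigma> / N\<^sup>2 * of_bool (move (\<sigma>, p, r) x = x')))"
      by (rule sum.cong[OF refl], rule sum.swap)
    also have "\<dots> = (\<Sum>x0\<in>Rp. \<Sum>x\<in>fiber x0. pmf (K x) x' * pmf Q x)"
      by (simp add: pmf_K_sum N_def sum_distrib_left mult_ac)
    also have "\<dots> = (\<Sum>x\<in>X. pmf (K x) x' * pmf Q x)" by (simp add: sum_X)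
    also have "\<dots> = pmf (bind_pmf Q K) x'"
      unfolding pmf_bind by (rule integral_measure_pmf_real[OF finite_arrangements, symmetric]) (use Q in auto)
    finally show ?thesis .
  qed
  have symX: "set_pmf (sym P) \<subseteq> X"
  proof
    fix y assume "y \<in> set_pmf (sym P)"
    then obtain x where x: "x \<in> X" "y \<in> set_pmf (pmf_of_set (fiber x))" by (auto simp: sym_def P)
    have "fiber x \<noteq> {}" using fiber_self by blast
    then have "y \<in> fiber x" using x set_pmf_of_set[OF _ finite_fiber[OF x(1)]] by blast
    then show "y \<in> X" using fiber_arrangements x by blast
  qed
  define S where "S x0 = (\<Sum>x\<in>fiber x0. pmf P x)" for x0
  have Ppos: "pmf P x > 0" if "x \<in> X" for x using that P by (simp add: pmf_positive)
  have Ppos': "pmf P x > 0" if "x0 \<in> Rp" "x \<in> fiber x0" for x x0 using Ppos fiber_arrangements RpX that by blast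
  have Spos: "S x0 > 0" if "x0 \<in> Rp" for x0
    unfolding S_def using finF[OF that] fiber_self[of x0] Ppos'[OF that] by (intro sum_pos) auto
  have symP: "pmf (sym P) x = S x0 / M" if "x0 \<in> Rp" "x \<in> fiber x0" for x x0
    using pmf_sym[of P x] P fiber_arrangements[OF RpX[OF that(1)] that(2)] fiber_eq[OF that(2)]
    by (simp add: S_def M_def)
  define B where "B x0 \<sigma> c y = real (card {x\<in>fiber x0. D \<sigma> c x = y})" for x0 \<sigma> c y
  have Asym: "A (sym P) x0 \<sigma> c y = B x0 \<sigma> c y * (S x0 / M)" if "x0 \<in> Rp" for x0 \<sigma> c y
    using symP[OF that] by (simp add: A_def B_def)
  have ApBp: "A P x0 \<sigma> c y > 0" "B x0 \<sigma> c y > 0" if "x0 \<in> Rp" "y \<in> D \<sigma> c ` fiber x0" for x0 \<sigma> c y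
  proof -
    have ne: "{x\<in>fiber x0. D \<sigma> c x = y} \<noteq> {}" "finite {x\<in>fiber x0. D \<sigma> c x = y}" using that finF by auto
    then show "A P x0 \<sigma> c y > 0" unfolding A_def using Ppos'[OF that(1)] by (intro sum_pos) auto
    show "B x0 \<sigma> c y > 0" using ne by (simp add: B_def card_gt_0_iff)
  qed
  have upos: "u P z > 0" "u (sym P) z > 0" if z: "z \<in> Z" for z
  proof -
    obtain x0 \<sigma> c y r where ze: "z = (x0, \<sigma>, c, y, r)" "x0 \<in> Rp" "\<sigma> \<in> set_pmf \<mu>" "y \<in> D \<sigma> c ` fiber x0"
      using z by (auto simp: Z_def)
    then show "u P z > 0" "u (sym P) z > 0"
      using N M Spos[OF ze(2)] ApBp[OF ze(2,4)] by (simp_all add: u_def Asym pmf_positive)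
  qed
  have PK: "set_pmf (bind_pmf P K) \<subseteq> X" using P set_K by auto
  have "fiber_entropy (bind_pmf P K) = (\<Sum>x'\<in>g ` Z. pmf (bind_pmf P K) x' * ln (pmf (bind_pmf P K) x' / pmf (bind_pmf (sym P) K) x'))"
    unfolding fiber_entropy_def sym_bind_K[of P, unfolded P, OF order_refl]
  proof (rule sum.mono_neutral_right)
    show "g ` Z \<subseteq> X"
    proof
      fix x' assume x': "x' \<in> g ` Z"
      then have "{z\<in>Z. g z = x'} \<noteq> {}" by blast
      then have "(\<Sum>z\<in>{z\<in>Z. g z = x'}. u P z) > 0" using finZ by (intro sum_pos upos(1)) simp_all
      then have "x' \<in> set_pmf (bind_pmf P K)" unfolding push[of P, unfolded P, OF order_refl] by (simp add: set_pmf_iff del: set_bind_pmf)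
      then show "x' \<in> X" using PK by blast
    qed
    show "\<forall>x'\<in>X - g ` Z. pmf (bind_pmf P K) x' * ln (pmf (bind_pmf P K) x' / pmf (sym (bind_pmf P K)) x') = 0"
    proof
      fix x' assume "x' \<in> X - g ` Z"
      then have e: "{z\<in>Z. g z = x'} = {}" by blast
      have "pmf (bind_pmf P K) x' = 0" using push[of P x', unfolded P, OF order_refl] unfolding e by simp
      then show "pmf (bind_pmf P K) x' * ln (pmf (bind_pmf P K) x' / pmf (sym (bind_pmf P K)) x') = 0" by simp
    qed
  qed (rule finite_arrangements)
  \<comment> \<open>Data processing along \<open>g\<close>. The reference law is
    \<open>sym P\<close>, whose next step is \<open>sym\<close> of the next law by the
    intertwining.\<close>
  also have "\<dots> \<le> (\<Sum>z\<in>Z. u P z * ln (u P z / u (sym P) z))"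
    using log_sum_inequality[where Z = Z and u = "u P" and v = "u (sym P)" and g = g, OF finZ upos] unfolding push[of P, unfolded P, OF order_refl] push[OF symX] by blast
  also have "\<dots> = (\<Sum>x0\<in>Rp. \<Sum>\<sigma>\<in>set_pmf \<mu>. \<Sum>c\<in>card_choices x0. \<Sum>y\<in>D \<sigma> c ` fiber x0.
      pmf \<mu> \<sigma> / N * (A P x0 \<sigma> c y * ln (A P x0 \<sigma> c y / B x0 \<sigma> c y) - A P x0 \<sigma> c y * ln (S x0 / M)))"
    unfolding sumZ
  proof (intro sum.cong refl)
    fix x0 \<sigma> c y assume a: "x0 \<in> Rp" "\<sigma> \<in> set_pmf \<mu>" "c \<in> card_choices x0" "y \<in> D \<sigma> c ` fiber x0"
    let ?a = "A P x0 \<sigma> c y" and ?b = "B x0 \<sigma> c y" and ?s = "S x0 / M"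
    have p: "?a > 0" "?b > 0" "?s > 0" "pmf \<mu> \<sigma> > 0" using ApBp a Spos M by (simp_all add: pmf_positive)
    have "u P (x0, \<sigma>, c, y, r) * ln (u P (x0, \<sigma>, c, y, r) / u (sym P) (x0, \<sigma>, c, y, r)) =
      pmf \<mu> \<sigma> / N\<^sup>2 * (?a * ln (?a / ?b) - ?a * ln ?s)" for r
    proof -
      have "u P (x0, \<sigma>, c, y, r) / u (sym P) (x0, \<sigma>, c, y, r) = ?a / (?b * ?s)"
        using p N a(1) by (simp add: u_def Asym)
      moreover have "ln (?a / (?b * ?s)) = ln (?a / ?b) - ln ?s"
      proof -
        have "ln (a / (b * s)) = ln (a / b) - ln s" if "a > 0" "b > 0" "s > 0" for a b s :: real
          using that by (simp add: ln_div ln_mult)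
        then show ?thesis using p by blast
      qed
      ultimately have e: "ln (u P (x0, \<sigma>, c, y, r) / u (sym P) (x0, \<sigma>, c, y, r)) = ln (?a / ?b) - ln ?s" by simp
      show ?thesis unfolding e by (simp add: u_def right_diff_distrib)
    qed
    then show "(\<Sum>r\<in>positions. u P (x0, \<sigma>, c, y, r) * ln (u P (x0, \<sigma>, c, y, r) / u (sym P) (x0, \<sigma>, c, y, r))) =
       pmf \<mu> \<sigma> / N * (?a * ln (?a / ?b) - ?a * ln ?s)"
      using N by (simp add: cardPos power2_eq_square)
  qed
  also have "\<dots> = (\<Sum>x0\<in>Rp. (\<Sum>\<omega>\<in>set_pmf \<mu> \<times> card_choices x0. pmf \<mu> (fst \<omega>) / N *
       (\<Sum>y\<in>D (fst \<omega>) (snd \<omega>) ` fiber x0. A P x0 (fst \<omega>) (snd \<omega>) y * ln (A P x0 (fst \<omega>) (snd \<omega>) y / B x0 (fst \<omega>) (snd \<omega>) y)))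
       - S x0 * ln (S x0 / M))"
  proof (intro sum.cong refl)
    fix x0 assume x0: "x0 \<in> Rp"
    have SA: "(\<Sum>y\<in>D \<sigma> c ` fiber x0. A P x0 \<sigma> c y) = S x0" for \<sigma> c
      unfolding A_def S_def by (rule sum.image_gen[OF finF[OF x0], symmetric])
    have "(\<Sum>\<sigma>\<in>set_pmf \<mu>. \<Sum>c\<in>card_choices x0. \<Sum>y\<in>D \<sigma> c ` fiber x0.
      pmf \<mu> \<sigma> / N * (A P x0 \<sigma> c y * ln (A P x0 \<sigma> c y / B x0 \<sigma> c y) - A P x0 \<sigma> c y * ln (S x0 / M)))
     = (\<Sum>\<sigma>\<in>set_pmf \<mu>. \<Sum>c\<in>card_choices x0. pmf \<mu> \<sigma> / N * (\<Sum>y\<in>D \<sigma> c ` fiber x0. A P x0 \<sigma> c y * ln (A P x0 \<sigma> c y / B x0 \<sigma> c y)))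
      - (\<Sum>\<sigma>\<in>set_pmf \<mu>. \<Sum>c\<in>card_choices x0. pmf \<mu> \<sigma> / N * (S x0 * ln (S x0 / M)))"
      unfolding sum_distrib_left[symmetric] sum_subtractf sum_distrib_right[symmetric] SA
      by (simp only: right_diff_distrib sum_subtractf sum_distrib_right)
    also have "(\<Sum>\<sigma>\<in>set_pmf \<mu>. \<Sum>c\<in>card_choices x0. pmf \<mu> \<sigma> / N * (S x0 * ln (S x0 / M))) = S x0 * ln (S x0 / M)"
    proof -
      have "(\<Sum>\<sigma>\<in>set_pmf \<mu>. pmf \<mu> \<sigma> * (S x0 * ln (S x0 / M))) = S x0 * ln (S x0 / M)"
        using sum_pmf_eq_1[OF finite_set_\<mu> order_refl] by (simp flip: sum_distrib_right)
      then show ?thesis using N card_card_choices[OF RpX[OF x0]] by (simp add: N_def)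
    qed
    finally show "(\<Sum>\<sigma>\<in>set_pmf \<mu>. \<Sum>c\<in>card_choices x0. \<Sum>y\<in>D \<sigma> c ` fiber x0.
      pmf \<mu> \<sigma> / N * (A P x0 \<sigma> c y * ln (A P x0 \<sigma> c y / B x0 \<sigma> c y) - A P x0 \<sigma> c y * ln (S x0 / M)))
     = (\<Sum>\<omega>\<in>set_pmf \<mu> \<times> card_choices x0. pmf \<mu> (fst \<omega>) / N *
       (\<Sum>y\<in>D (fst \<omega>) (snd \<omega>) ` fiber x0. A P x0 (fst \<omega>) (snd \<omega>) y * ln (A P x0 (fst \<omega>) (snd \<omega>) y / B x0 (fst \<omega>) (snd \<omega>) y)))
       - S x0 * ln (S x0 / M)"
      by (simp add: sum.cartesian_product case_prod_unfold)
  qed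
  \<comment> \<open>Shearer's inequality on each class; the random set consists of the chosen cards
    of the active stacks.\<close>
  also have "\<dots> \<le> (\<Sum>x0\<in>Rp. (1 - q / n) * ((\<Sum>x\<in>fiber x0. pmf P x * ln (pmf P x)) - S x0 * ln (S x0 / M)))"
  proof (rule sum_mono)
    fix x0 assume x0: "x0 \<in> Rp"
    let ?I = "set_pmf \<mu> \<times> card_choices x0"
    let ?w = "\<lambda>\<omega>. pmf \<mu> (fst \<omega>) / N"
    have Mc: "M = real (card (fiber x0))" using card_fiber[OF RpX[OF x0]] by (simp add: M_def)
    have w1: "sum ?w ?I = 1"
    proof -
      have "sum ?w ?I = (\<Sum>\<sigma>\<in>set_pmf \<mu>. \<Sum>c\<in>card_choices x0. pmf \<mu> \<sigma> / N)"
        by (subst sum_SIGMA) (simp_all add: finite_set_\<mu> finite_card_choices)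
      then show ?thesis using N card_card_choices[OF RpX[OF x0]] sum_pmf_eq_1[OF finite_set_\<mu> order_refl]
        by (simp add: N_def)
    qed
    \<comment> \<open>A card of stack \<open>i\<close> is chosen with probability
      \<open>1 / n\<close>, independently of whether stack \<open>i\<close> is active.\<close>
    have qq: "(\<Sum>\<omega>\<in>{\<omega>\<in>?I. v \<in> snd \<omega> ` act (fst \<omega>)}. ?w \<omega>) \<ge> q / n" if v: "v < CARD('d) * n" for v
    proof -
      obtain i where i: "v \<in> set (x0 i)" using v RpX[OF x0] by (auto simp: arrangements_iff)
      have "q / n \<le> measure_pmf.prob \<mu> {\<sigma>. i \<in> act \<sigma>} / n" using q by (simp add: divide_right_mono)
      also have "measure_pmf.prob \<mu> {\<sigma>. i \<in> act \<sigma>} = (\<Sum>\<sigma>\<in>{\<sigma>\<in>set_pmf \<mu>. i \<in> act \<sigma>}. pmf \<mu> \<sigma>)"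
      proof -
        have "measure_pmf.prob \<mu> {\<sigma>. i \<in> act \<sigma>} = measure_pmf.prob \<mu> ({\<sigma>. i \<in> act \<sigma>} \<inter> set_pmf \<mu>)"
          by (simp add: measure_Int_set_pmf)
        also have "\<dots> = (\<Sum>\<sigma>\<in>{\<sigma>. i \<in> act \<sigma>} \<inter> set_pmf \<mu>. pmf \<mu> \<sigma>)"
          using finite_set_\<mu> by (intro measure_measure_pmf_finite) auto
        finally show ?thesis by (simp add: Int_def conj_commute)
      qed
      also have "\<dots> / n = (\<Sum>\<sigma>\<in>{\<sigma>\<in>set_pmf \<mu>. i \<in> act \<sigma>}. \<Sum>c\<in>{c\<in>card_choices x0. c i = v}. pmf \<mu> \<sigma> / N)"
        using N card_card_choices_fixed[OF RpX[OF x0] i] by (simp add: N_def sum_divide_distrib)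
      also have "\<dots> = (\<Sum>\<omega>\<in>{\<sigma>\<in>set_pmf \<mu>. i \<in> act \<sigma>} \<times> {c\<in>card_choices x0. c i = v}. ?w \<omega>)"
        by (subst sum_SIGMA) (simp_all add: finite_set_\<mu> finite_card_choices)
      also have "\<dots> \<le> (\<Sum>\<omega>\<in>{\<omega>\<in>?I. v \<in> snd \<omega> ` act (fst \<omega>)}. ?w \<omega>)"
        using N finite_set_\<mu> finite_card_choices by (intro sum_mono2) auto
      finally show ?thesis .
    qed
    show "(\<Sum>\<omega>\<in>?I. ?w \<omega> * (\<Sum>y\<in>D (fst \<omega>) (snd \<omega>) ` fiber x0. A P x0 (fst \<omega>) (snd \<omega>) y * ln (A P x0 (fst \<omega>) (snd \<omega>) y / B x0 (fst \<omega>) (snd \<omega>) y)))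
       - S x0 * ln (S x0 / M) \<le> (1 - q / n) * ((\<Sum>x\<in>fiber x0. pmf P x * ln (pmf P x)) - S x0 * ln (S x0 / M))"
      unfolding A_def B_def S_def D_def Mc
      by (rule order_entropy_contraction[where n = n and w = ?w and C = "\<lambda>\<omega>. snd \<omega> ` act (fst \<omega>)" and f = "pmf P"])
        (use RpX[OF x0] Ppos'[OF x0] w1 qq N finite_set_\<mu> finite_card_choices in auto)
  qed
  also have "\<dots> = (1 - q / n) * (\<Sum>x0\<in>Rp. (\<Sum>x\<in>fiber x0. pmf P x * ln (pmf P x)) - S x0 * ln (S x0 / M))"
    by (simp add: sum_distrib_left)
  also have "(\<Sum>x0\<in>Rp. (\<Sum>x\<in>fiber x0. pmf P x * ln (pmf P x)) - S x0 * ln (S x0 / M)) = fiber_entropy P"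
    unfolding fiber_entropy_def sum_X
  proof (intro sum.cong refl)
    fix x0 assume x0: "x0 \<in> Rp"
    have "(\<Sum>x\<in>fiber x0. pmf P x * ln (pmf P x / pmf (sym P) x)) = (\<Sum>x\<in>fiber x0. pmf P x * ln (pmf P x) - pmf P x * ln (S x0 / M))"
    proof (intro sum.cong refl)
      fix x assume x: "x \<in> fiber x0"
      have "S x0 / M > 0" using Spos[OF x0] M by simp
      moreover have "ln (a / b) = ln a - ln b" if "a > 0" "b > 0" for a b :: real using that by (simp add: ln_div)
      ultimately have "ln (pmf P x / (S x0 / M)) = ln (pmf P x) - ln (S x0 / M)" using Ppos'[OF x0 x] by blast
      then show "pmf P x * ln (pmf P x / pmf (sym P) x) = pmf P x * ln (pmf P x) - pmf P x * ln (S x0 / M)"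
        unfolding symP[OF x0 x] by (simp only: right_diff_distrib)
    qed
    then show "(\<Sum>x\<in>fiber x0. pmf P x * ln (pmf P x)) - S x0 * ln (S x0 / M) = (\<Sum>x\<in>fiber x0. pmf P x * ln (pmf P x / pmf (sym P) x))"
      by (simp only: sum_subtractf S_def sum_distrib_right)
  qed
  finally show ?thesis .
qed

section \<open>From entropy to distance of laws\<close>

text \<open>The density relative to \<open>sym P\<close> is at most the size of a fibre,
  \<open>n!\<close> to the power \<open>d\<close>, and \<open>n!\<close> is at most
  \<open>n ^ n\<close>.\<close>

lemma fiber_entropy_le:
  assumes P: "set_pmf P = X"
  shows "fiber_entropy P \<le> CARD('d) * (n * ln n)"
proof -
  have "fiber_entropy P \<le> (\<Sum>x\<in>X. pmf P x * (CARD('d) * (n * ln n)))"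
    unfolding fiber_entropy_def
  proof (rule sum_mono)
    fix x assume x: "x \<in> X"
    have p: "pmf P x > 0" using x P by (simp add: pmf_positive)
    have le: "pmf P x \<le> (\<Sum>y\<in>fiber x. pmf P y)"
      using finite_fiber[OF x] fiber_self by (intro member_le_sum) auto
    define s where "s = (\<Sum>y\<in>fiber x. pmf P y)"
    have s: "s > 0" "pmf P x \<le> s" using le p by (simp_all add: s_def)
    have "pmf P x / pmf (sym P) x = pmf P x / s * fact n ^ CARD('d)"
      using pmf_sym[of P x] P x by (simp add: s_def)
    also have "\<dots> \<le> 1 * fact n ^ CARD('d)" using s by (intro mult_right_mono) auto
    also have "\<dots> \<le> (real n ^ n) ^ CARD('d)"
    proof -
      have "fact n \<le> real n ^ n" using fact_le_power[where 'a = real, of n] n_pos by simp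
      then show ?thesis by (simp add: power_mono)
    qed
    finally have a: "pmf P x / pmf (sym P) x \<le> (real n ^ n) ^ CARD('d)" .
    have "pmf P x / pmf (sym P) x > 0"
      using p s pmf_sym[of P x] P x by (simp add: s_def)
    then have "ln (pmf P x / pmf (sym P) x) \<le> ln ((real n ^ n) ^ CARD('d))"
      using a by (subst ln_le_cancel_iff) auto
    also have "\<dots> = CARD('d) * (n * ln n)" using n_pos by (simp add: ln_realpow)
    finally show "pmf P x * ln (pmf P x / pmf (sym P) x) \<le> pmf P x * (CARD('d) * (n * ln n))"
      using p by (intro mult_left_mono) auto
  qed
  also have "\<dots> = CARD('d) * (n * ln n)"
    unfolding sum_distrib_right[symmetric] using sum_pmf_eq_1[OF finite_arrangements, of P] P by simp
  finally show ?thesis .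
qed

lemma sym_U0: "sym U0 = U0"
proof (rule pmf_eqI)
  fix y
  show "pmf (sym U0) y = pmf U0 y"
  proof (cases "y \<in> X")
    case True
    have "pmf U0 x = pmf U0 y" if "x \<in> fiber y" for x
      using fiber_arrangements[OF True that] True
      by (simp add: U0_def finite_arrangements arrangements_nonempty)
    then show ?thesis using pmf_sym[of U0 y] True card_fiber[OF True] by (simp add: set_U0)
  next
    case False
    have "y \<notin> set_pmf (sym U0)"
    proof
      assume "y \<in> set_pmf (sym U0)"
      then obtain x where x: "x \<in> X" "y \<in> set_pmf (pmf_of_set (fiber x))" by (auto simp: sym_def set_U0)
      have "fiber x \<noteq> {}" using fiber_self by blast
      then have "y \<in> fiber x" using x set_pmf_of_set[OF _ finite_fiber[OF x(1)]] by blast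
      then show False using fiber_arrangements x False by blast
    qed
    moreover have "y \<notin> set_pmf U0" using False by (simp add: set_U0)
    ultimately show ?thesis by (simp add: set_pmf_iff)
  qed
qed

lemma sum_law_sym_diff:
  assumes x: "x \<in> X" and q: "\<And>i. q \<le> measure_pmf.prob \<mu> {\<sigma>. i \<in> act \<sigma>}" and q1: "q \<le> 1"
  shows "(\<Sum>y\<in>X. \<bar>pmf (law k x) y - pmf (sym (law k x)) y\<bar>) \<le> 4 * sqrt ((1 - q / n) ^ k * (CARD('d) * (n * ln n)))"
proof -
  let ?B = "bernoulli_pmf (1 / 2)"
  \<comment> \<open>Averaging with the stationary law provides the full support that the contraction
    demands. It halves the difference from the re-randomised law, which explains the constant 4 in
    place of 2.\<close>
  define P where "P k = bind_pmf ?B (\<lambda>b. if b then law k x else U0)" for k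
  have setP: "set_pmf (P k) = X" for k
    using set_law[OF x, of k] by (auto simp: P_def set_U0 set_pmf_bernoulli UNIV_bool split: if_splits)
  have PSuc: "P (Suc k) = bind_pmf (P k) K" for k
    unfolding P_def bind_assoc_pmf by (intro bind_pmf_cong refl) (simp add: bind_U0_K)
  have PE: "pmf (P k) y = pmf (law k x) y / 2 + pmf U0 y / 2" for k y
    by (simp add: P_def pmf_bind)
  have symP: "pmf (sym (P k)) y = pmf (sym (law k x)) y / 2 + pmf U0 y / 2" for k y
  proof -
    have "sym (P k) = bind_pmf ?B (\<lambda>b. if b then sym (law k x) else sym U0)"
      unfolding P_def sym_def bind_assoc_pmf by (intro bind_pmf_cong refl) simp
    then show ?thesis by (simp add: pmf_bind sym_U0)
  qed
  have qn: "1 - q / n \<ge> 0" using q1 n_pos by (simp add: divide_le_eq)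
  have ent: "fiber_entropy (P k) \<le> (1 - q / n) ^ k * (CARD('d) * (n * ln n))"
  proof (induction k)
    case 0
    then show ?case using fiber_entropy_le[OF setP[of 0]] by simp
  next
    case (Suc k)
    have "fiber_entropy (P (Suc k)) \<le> (1 - q / n) * fiber_entropy (P k)"
      unfolding PSuc by (rule fiber_entropy_contraction[OF setP q])
    also have "\<dots> \<le> (1 - q / n) * ((1 - q / n) ^ k * (CARD('d) * (n * ln n)))"
      using Suc qn by (rule mult_left_mono)
    finally show ?case by simp
  qed
  have setS: "set_pmf (sym (P k)) = X"
  proof
    show "set_pmf (sym (P k)) \<subseteq> X"
    proof
      fix y assume "y \<in> set_pmf (sym (P k))"
      then obtain z where z: "z \<in> X" "y \<in> set_pmf (pmf_of_set (fiber z))" by (auto simp: sym_def setP)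
      have "fiber z \<noteq> {}" using fiber_self by blast
      then have "y \<in> fiber z" using z set_pmf_of_set[OF _ finite_fiber[OF z(1)]] by blast
      then show "y \<in> X" using fiber_arrangements z by blast
    qed
    show "X \<subseteq> set_pmf (sym (P k))"
    proof
      fix y assume y: "y \<in> X"
      have "fiber y \<noteq> {}" using fiber_self by blast
      then have "y \<in> set_pmf (pmf_of_set (fiber y))" using set_pmf_of_set[OF _ finite_fiber[OF y]] fiber_self by blast
      then show "y \<in> set_pmf (sym (P k))" using y by (auto simp: sym_def setP)
    qed
  qed
  have "(\<Sum>y\<in>X. \<bar>pmf (P k) y - pmf (sym (P k)) y\<bar>) \<le> 2 * sqrt (fiber_entropy (P k))"
    unfolding fiber_entropy_def
    by (rule sum_abs_diff_le_relative_entropy[OF finite_arrangements])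
       (simp_all add: pmf_positive setP setS sum_pmf_eq_1 finite_arrangements)
  also have "\<dots> \<le> 2 * sqrt ((1 - q / n) ^ k * (CARD('d) * (n * ln n)))" using ent by simp
  finally have "(\<Sum>y\<in>X. \<bar>pmf (law k x) y - pmf (sym (law k x)) y\<bar> / 2) \<le> 2 * sqrt ((1 - q / n) ^ k * (CARD('d) * (n * ln n)))"
    by (simp add: PE symP diff_divide_distrib[symmetric])
  then show ?thesis by (simp flip: sum_divide_distrib)
qed

text \<open>Splits the distance from uniformity in two: the first summand pays for re-randomising
  the order, and the second compares expectations of a function of the contents alone.\<close>

lemma prob_diff_le_contents:
  assumes x: "x \<in> X" and q: "\<And>i. q \<le> measure_pmf.prob \<mu> {\<sigma>. i \<in> act \<sigma>}" and q1: "q \<le> 1"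
  shows "\<bar>measure_pmf.prob (law k x) A - measure_pmf.prob U0 A\<bar> \<le>
     4 * sqrt ((1 - q / n) ^ k * (CARD('d) * (n * ln n)))
     + \<bar>measure_pmf.expectation (law k x) (\<lambda>y. measure_pmf.prob (pmf_of_set (fiber y)) A)
        - measure_pmf.expectation U0 (\<lambda>y. measure_pmf.prob (pmf_of_set (fiber y)) A)\<bar>"
proof -
  have symA: "measure_pmf.prob (sym Q) A = measure_pmf.expectation Q (\<lambda>y. measure_pmf.prob (pmf_of_set (fiber y)) A)"
    if Q: "set_pmf Q \<subseteq> X" for Q
  proof -
    have finQ: "finite (set_pmf Q)" using Q finite_arrangements by (rule finite_subset)
    have fin: "finite (set_pmf (pmf_of_set (fiber y)))" if "y \<in> set_pmf Q" for y
    proof -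
      have "y \<in> X" "fiber y \<noteq> {}" using Q that fiber_self by blast+
      then show ?thesis using finite_fiber[of y n] by simp
    qed
    have "measure_pmf.prob (sym Q) A = measure_pmf.expectation (sym Q) (indicator A)" by simp
    also have "\<dots> = measure_pmf.expectation Q (\<lambda>y. measure_pmf.expectation (pmf_of_set (fiber y)) (indicator A))"
      unfolding sym_def by (rule expectation_bind_finite[OF finQ fin])
    finally show ?thesis by simp
  qed
  have symX: "set_pmf (sym (law k x)) \<subseteq> X"
  proof
    fix y assume "y \<in> set_pmf (sym (law k x))"
    then obtain z where z: "z \<in> X" "y \<in> set_pmf (pmf_of_set (fiber z))" using set_law[OF x] by (auto simp: sym_def)
    have "fiber z \<noteq> {}" using fiber_self by blast
    then have "y \<in> fiber z" using z set_pmf_of_set[OF _ finite_fiber[OF z(1)]] by blast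
    then show "y \<in> X" using fiber_arrangements z by blast
  qed
  have pr: "measure_pmf.prob Q A = (\<Sum>y\<in>X \<inter> A. pmf Q y)" if "set_pmf Q \<subseteq> X" for Q
  proof -
    have "measure_pmf.prob Q A = measure_pmf.prob Q (X \<inter> A)"
      using that by (intro measure_pmf.finite_measure_eq_AE) (auto simp: AE_measure_pmf_iff)
    also have "\<dots> = (\<Sum>y\<in>X \<inter> A. pmf Q y)"
      by (rule measure_measure_pmf_finite) (simp add: finite_arrangements)
    finally show ?thesis .
  qed
  have "\<bar>measure_pmf.prob (law k x) A - measure_pmf.prob (sym (law k x)) A\<bar> = \<bar>\<Sum>y\<in>X \<inter> A. pmf (law k x) y - pmf (sym (law k x)) y\<bar>"
    by (simp add: pr set_law[OF x] symX sum_subtractf)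
  also have "\<dots> \<le> (\<Sum>y\<in>X \<inter> A. \<bar>pmf (law k x) y - pmf (sym (law k x)) y\<bar>)" by (rule sum_abs)
  also have "\<dots> \<le> (\<Sum>y\<in>X. \<bar>pmf (law k x) y - pmf (sym (law k x)) y\<bar>)"
    by (intro sum_mono2) (auto simp: finite_arrangements)
  also have "\<dots> \<le> 4 * sqrt ((1 - q / n) ^ k * (CARD('d) * (n * ln n)))"
    by (rule sum_law_sym_diff[OF x q q1])
  finally have "\<bar>measure_pmf.prob (law k x) A - measure_pmf.prob (sym (law k x)) A\<bar> \<le> 4 * sqrt ((1 - q / n) ^ k * (CARD('d) * (n * ln n)))" .
  moreover have "measure_pmf.prob U0 A = measure_pmf.prob (sym U0) A" by (simp add: sym_U0)
  ultimately show ?thesis using symA[OF set_law[OF x]] symA[of U0] set_U0 by simp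
qed

end

section \<open>Spectral theory of the single ball matrix\<close>

type_synonym 'd cvec = "'d \<Rightarrow> complex"

definition linear_op :: "('d cvec \<Rightarrow> 'd cvec) \<Rightarrow> bool" where
  "linear_op A \<longleftrightarrow> (\<forall>v w a b. A (\<lambda>j. a * v j + b * w j) = (\<lambda>j. a * A v j + b * A w j))"

definition factor_op :: "('d cvec \<Rightarrow> 'd cvec) \<Rightarrow> complex \<Rightarrow> 'd cvec \<Rightarrow> 'd cvec" where
  "factor_op A l w = (\<lambda>j. A w j - l * w j)"

text \<open>The product of the operators \<open>A - l\<close>. A list rather than a polynomial,
  because the adapted norm is built from its prefixes.\<close>

fun factors_op :: "('d cvec \<Rightarrow> 'd cvec) \<Rightarrow> complex list \<Rightarrow> 'd cvec \<Rightarrow> 'd cvec" where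
  "factors_op A [] w = w"
| "factors_op A (l # ls) w = factors_op A ls (factor_op A l w)"

lemma linear_opD: "linear_op A \<Longrightarrow> A (\<lambda>j. a * v j + b * w j) = (\<lambda>j. a * A v j + b * A w j)"
  by (simp add: linear_op_def)

lemma linear_op_diff: "linear_op A \<Longrightarrow> A (\<lambda>j. v j - l * w j) = (\<lambda>j. A v j - l * A w j)"
  using linear_opD[of A 1 v "-l" w] by simp

lemma linear_op_zero: "linear_op A \<Longrightarrow> A (\<lambda>_. 0) = (\<lambda>_. 0)"
  using linear_opD[of A 0 "\<lambda>_. 0" 0 "\<lambda>_. 0"] by simp

lemma linear_factor_op: "linear_op A \<Longrightarrow> linear_op (factor_op A l)"
  unfolding linear_op_def factor_op_def by (simp add: algebra_simps)

lemma linear_factors_op: "linear_op A \<Longrightarrow> linear_op (factors_op A ls)"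
proof (induction ls)
  case Nil
  then show ?case by (simp add: linear_op_def)
next
  case (Cons l ls)
  note f = linear_factor_op[OF Cons.prems, of l]
  show ?case
    unfolding linear_op_def factors_op.simps linear_opD[OF f] linear_opD[OF Cons.IH[OF Cons.prems]] by simp
qed

lemma factors_op_append: "factors_op A (xs @ ys) w = factors_op A ys (factors_op A xs w)"
  by (induction xs arbitrary: w) auto

lemma factor_op_commute: "linear_op A \<Longrightarrow> factor_op A l (factor_op A l' w) = factor_op A l' (factor_op A l w)"
  unfolding factor_op_def by (simp add: linear_op_diff algebra_simps)

lemma factors_op_factor_op:
  "linear_op A \<Longrightarrow> factors_op A ls (factor_op A l w) = factor_op A l (factors_op A ls w)"
  by (induction ls arbitrary: w) (simp_all add: factor_op_commute[of A _ l])

lemma factors_op_commute: "linear_op A \<Longrightarrow> factors_op A ls (A w) = A (factors_op A ls w)"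
proof -
  assume "linear_op A"
  moreover have "factor_op A 0 v = A v" for v by (simp add: factor_op_def)
  ultimately show ?thesis using factors_op_factor_op[of A ls 0 w] by simp
qed

definition poly_op :: "('d cvec \<Rightarrow> 'd cvec) \<Rightarrow> complex poly \<Rightarrow> 'd cvec \<Rightarrow> 'd cvec" where
  "poly_op A p w = (\<lambda>j. \<Sum>i\<le>degree p. coeff p i * (A ^^ i) w j)"

lemma poly_op_bound: "degree p \<le> N \<Longrightarrow> poly_op A p w = (\<lambda>j. \<Sum>i\<le>N. coeff p i * (A ^^ i) w j)"
  unfolding poly_op_def by (intro ext sum.mono_neutral_left) (auto simp: coeff_eq_0)

lemma funpow_linear_op: "linear_op A \<Longrightarrow> linear_op (A ^^ i)"
  by (induction i) (auto simp: linear_op_def)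

lemma poly_op_mult_linear:
  assumes A: "linear_op A"
  shows "poly_op A ([:-l, 1:] * p) w = poly_op A p (factor_op A l w)"
proof
  fix j
  let ?N = "degree p"
  have "degree ([:-l, 1:] * p) \<le> Suc ?N"
    using degree_mult_le[of "[:-l, 1:]" p] by simp
  then have "poly_op A ([:-l, 1:] * p) w j = (\<Sum>i\<le>Suc ?N. coeff ([:-l, 1:] * p) i * (A ^^ i) w j)"
    by (simp add: poly_op_bound)
  also have "\<dots> = (\<Sum>i\<le>Suc ?N. coeff (pCons 0 p) i * (A ^^ i) w j) - l * (\<Sum>i\<le>Suc ?N. coeff p i * (A ^^ i) w j)"
    by (simp add: algebra_simps sum.distrib sum_subtractf sum_distrib_left del: sum.atMost_Suc)
  also have "(\<Sum>i\<le>Suc ?N. coeff (pCons 0 p) i * (A ^^ i) w j) = (\<Sum>i\<le>?N. coeff p i * (A ^^ i) (A w) j)"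
    by (subst sum.atMost_Suc_shift) (simp add: funpow_swap1)
  also have "(\<Sum>i\<le>Suc ?N. coeff p i * (A ^^ i) w j) = (\<Sum>i\<le>?N. coeff p i * (A ^^ i) w j)"
    by (simp add: coeff_eq_0)
  also have "(\<Sum>i\<le>?N. coeff p i * (A ^^ i) (A w) j) - l * (\<Sum>i\<le>?N. coeff p i * (A ^^ i) w j)
      = (\<Sum>i\<le>?N. coeff p i * (A ^^ i) (factor_op A l w) j)"
    unfolding factor_op_def linear_op_diff[OF funpow_linear_op[OF A]]
    by (simp add: algebra_simps sum_subtractf sum_distrib_left)
  finally show "poly_op A ([:-l, 1:] * p) w j = poly_op A p (factor_op A l w) j"
    by (simp add: poly_op_def)
qed

lemma poly_op_factors:
  assumes A: "linear_op A"
  shows "poly_op A (smult c (\<Prod>l\<leftarrow>ls. [:-l, 1:])) w = (\<lambda>j. c * factors_op A ls w j)"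
proof (induction ls arbitrary: w)
  case Nil
  then show ?case by (simp add: poly_op_def)
next
  case (Cons l ls)
  have "smult c (\<Prod>l\<leftarrow>l # ls. [:-l, 1:]) = [:-l, 1:] * smult c (\<Prod>l\<leftarrow>ls. [:-l, 1:])" by simp
  then show ?case unfolding poly_op_mult_linear[OF A] Cons.IH by (simp only: poly_op_mult_linear[OF A] Cons.IH factors_op.simps)
qed

section \<open>Operators of a doubly stochastic matrix\<close>

locale doubly_stochastic =
  fixes U :: "real ^ 'd ^ ('d::finite)"
  assumes nonneg: "\<And>i j. U $ i $ j \<ge> 0"
    and row_sum: "\<And>i. (\<Sum>j\<in>UNIV. U $ i $ j) = 1"
    and col_sum: "\<And>j. (\<Sum>i\<in>UNIV. U $ i $ j) = 1"
begin

text \<open>\<open>cop\<close> acts on functions of the stack, that is, on column vectors;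
  \<open>rop\<close> acts on row vectors such as card counts by stack. The two are adjoint.\<close>

definition cop :: "'d cvec \<Rightarrow> 'd cvec" where "cop w = (\<lambda>i. \<Sum>j\<in>UNIV. complex_of_real (U $ i $ j) * w j)"

definition rop :: "'d cvec \<Rightarrow> 'd cvec" where "rop w = (\<lambda>j. \<Sum>i\<in>UNIV. w i * complex_of_real (U $ i $ j))"

lemma linear_cop: "linear_op cop"
  unfolding linear_op_def cop_def by (simp add: algebra_simps sum.distrib sum_distrib_left)

lemma linear_rop: "linear_op rop"
  unfolding linear_op_def rop_def by (simp add: algebra_simps sum.distrib sum_distrib_left)

definition pw :: "nat \<Rightarrow> real ^ 'd ^ 'd" where "pw k = (((**) U) ^^ k) (mat 1)"

lemma pw_Suc: "pw (Suc k) = U ** pw k" by (simp add: pw_def)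

lemma cop_funpow: "(cop ^^ k) w i = (\<Sum>j\<in>UNIV. complex_of_real (pw k $ i $ j) * w j)"
proof (induction k arbitrary: i)
  case 0
  have "(\<Sum>j\<in>UNIV. complex_of_real (if i = j then 1 else 0) * w j) = (\<Sum>j\<in>UNIV. if i = j then w j else 0)"
    by (intro sum.cong) auto
  then show ?case by (simp add: pw_def mat_def)
next
  case (Suc k)
  have "(cop ^^ Suc k) w i = (\<Sum>j\<in>UNIV. complex_of_real (U $ i $ j) * (\<Sum>l\<in>UNIV. complex_of_real (pw k $ j $ l) * w l))"
    by (simp add: cop_def Suc.IH)
  also have "\<dots> = (\<Sum>j\<in>UNIV. \<Sum>l\<in>UNIV. complex_of_real (U $ i $ j) * complex_of_real (pw k $ j $ l) * w l)"
    by (simp add: sum_distrib_left mult.assoc)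
  also have "\<dots> = (\<Sum>l\<in>UNIV. \<Sum>j\<in>UNIV. complex_of_real (U $ i $ j) * complex_of_real (pw k $ j $ l) * w l)" by (rule sum.swap)
  also have "\<dots> = (\<Sum>l\<in>UNIV. complex_of_real (pw (Suc k) $ i $ l) * w l)"
    by (simp add: pw_Suc matrix_matrix_mult_def sum_distrib_right)
  finally show ?case .
qed

text \<open>There are more powers than dimensions. A repetition among the powers is a separate case
  because linear dependence is a property of the set of powers.\<close>

lemma annihilating_coefficients:
  "\<exists>N (c :: nat \<Rightarrow> real). (\<exists>k\<le>N. c k \<noteq> 0) \<and> (\<Sum>k\<le>N. c k *\<^sub>R pw k) = 0"
proof -
  let ?N = "DIM(real ^ 'd ^ 'd)"
  show ?thesis
  proof (cases "inj_on pw {..?N}")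
    case False
    then obtain a b where ab: "a \<le> ?N" "b \<le> ?N" "a \<noteq> b" "pw a = pw b" by (auto simp: inj_on_def)
    define c where "c k = (if k = a then 1 else if k = b then -1 else 0 :: real)" for k
    have "(\<Sum>k\<le>?N. c k *\<^sub>R pw k) = (\<Sum>k\<in>{a, b}. c k *\<^sub>R pw k)"
      using ab by (intro sum.mono_neutral_right) (auto simp: c_def)
    also have "\<dots> = 0" using ab by (simp add: c_def)
    finally show ?thesis using ab by (intro exI[of _ ?N] exI[of _ c]) (auto simp: c_def)
  next
    case True
    then have "card (pw ` {..?N}) = Suc ?N" by (simp add: card_image)
    then have "dependent (pw ` {..?N})" using independent_bound[of "pw ` {..?N}"] by fastforce
    then obtain u where u: "\<exists>v\<in>pw ` {..?N}. u v \<noteq> 0" "(\<Sum>v\<in>pw ` {..?N}. u v *\<^sub>R v) = 0"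
      using dependent_finite[of "pw ` {..?N}"] by auto
    have "(\<Sum>k\<le>?N. u (pw k) *\<^sub>R pw k) = 0" using u(2) True by (simp add: sum.reindex)
    then show ?thesis using u(1) by (intro exI[of _ ?N] exI[of _ "\<lambda>k. u (pw k)"]) auto
  qed
qed

text \<open>An annihilating polynomial splits into linear factors over the complex numbers, and its
  leading coefficient can be divided out.\<close>

lemma annihilating_list: "\<exists>ls. \<forall>w. factors_op cop ls w = (\<lambda>_. 0)"
proof -
  obtain N and c :: "nat \<Rightarrow> real" where c: "\<exists>k\<le>N. c k \<noteq> 0" "(\<Sum>k\<le>N. c k *\<^sub>R pw k) = 0"
    using annihilating_coefficients by blast
  define p where "p = (\<Sum>k\<le>N. monom (complex_of_real (c k)) k)"
  have cp: "coeff p i = (if i \<le> N then c i else 0)" for i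
    by (simp add: p_def coeff_sum if_distrib cong: if_cong)
  have "p \<noteq> 0" using c(1) cp by (metis coeff_0 of_real_eq_0_iff)
  have deg: "degree p \<le> N" by (rule degree_le) (simp add: cp)
  have ann: "poly_op cop p w = (\<lambda>_. 0)" for w
  proof
    fix i
    have z: "(\<Sum>k\<le>N. c k * pw k $ i $ j) = 0" for j
      using arg_cong[where f = "\<lambda>M. M $ i $ j", OF c(2)] by (simp add: sum_component)
    have "poly_op cop p w i = (\<Sum>k\<le>N. complex_of_real (c k) * (\<Sum>j\<in>UNIV. complex_of_real (pw k $ i $ j) * w j))"
      by (simp add: poly_op_bound[OF deg] cp cop_funpow)
    also have "\<dots> = (\<Sum>j\<in>UNIV. complex_of_real (\<Sum>k\<le>N. c k * pw k $ i $ j) * w j)"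
      by (simp add: sum_distrib_left sum_distrib_right mult.assoc, rule sum.swap)
    finally show "poly_op cop p w i = 0" by (simp add: z)
  qed
  obtain R where R: "p = smult (lead_coeff p) (\<Prod>x\<in>#R. [:-x, 1:])"
    using complex_poly_decompose_multiset[of p] by metis
  obtain ls where ls: "mset ls = R" using ex_mset by blast
  have "(\<Prod>x\<in>#R. [:-x, 1:]) = (\<Prod>l\<leftarrow>ls. [:-l, 1:])"
    by (simp flip: ls add: prod_mset_prod_list mset_map[symmetric] del: mset_map)
  with R have p: "p = smult (lead_coeff p) (\<Prod>l\<leftarrow>ls. [:-l, 1:])" by simp
  have "factors_op cop ls w = (\<lambda>_. 0)" for w
  proof
    fix j
    have "lead_coeff p * factors_op cop ls w j = 0"
      using ann[of w] poly_op_factors[OF linear_cop, of "lead_coeff p" ls w] p by (metis (mono_tags))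
    then show "factors_op cop ls w j = 0" using \<open>p \<noteq> 0\<close> by simp
  qed
  then show ?thesis by blast
qed

lemma sum_cop: "(\<Sum>i\<in>UNIV. cop w i) = (\<Sum>j\<in>UNIV. w j)"
proof -
  have "(\<Sum>i\<in>UNIV. cop w i) = (\<Sum>j\<in>UNIV. \<Sum>i\<in>UNIV. complex_of_real (U $ i $ j) * w j)"
    unfolding cop_def by (rule sum.swap)
  also have "\<dots> = (\<Sum>j\<in>UNIV. complex_of_real (\<Sum>i\<in>UNIV. U $ i $ j) * w j)"
    by (simp add: sum_distrib_right)
  finally show ?thesis by (simp add: col_sum)
qed

lemma sum_rop: "(\<Sum>j\<in>UNIV. rop w j) = (\<Sum>i\<in>UNIV. w i)"
proof -
  have "(\<Sum>j\<in>UNIV. rop w j) = (\<Sum>i\<in>UNIV. \<Sum>j\<in>UNIV. w i * complex_of_real (U $ i $ j))"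
    unfolding rop_def by (rule sum.swap)
  also have "\<dots> = (\<Sum>i\<in>UNIV. w i * complex_of_real (\<Sum>j\<in>UNIV. U $ i $ j))"
    by (simp add: sum_distrib_left)
  finally show ?thesis by (simp add: row_sum)
qed

lemma sum_factor_op_cop: "(\<Sum>i\<in>UNIV. w i) = 0 \<Longrightarrow> (\<Sum>i\<in>UNIV. factor_op cop l w i) = 0"
  by (simp add: factor_op_def sum_subtractf sum_cop sum_distrib_left[symmetric])

lemma sum_factors_op_cop: "(\<Sum>i\<in>UNIV. w i) = 0 \<Longrightarrow> (\<Sum>i\<in>UNIV. factors_op cop ls w i) = 0"
  by (induction ls arbitrary: w) (simp_all add: sum_factor_op_cop)

lemma factors_op_eigenvector:
  "cop v = (\<lambda>i. l * v i) \<Longrightarrow> factors_op cop ls v = (\<lambda>i. (\<Prod>l'\<leftarrow>ls. (l - l')) * v i)"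
proof (induction ls)
  case Nil
  then show ?case by simp
next
  case (Cons l' ls)
  have "factor_op cop l' v = (\<lambda>i. (l - l') * v i + 0 * v i)" using Cons.prems by (auto simp: factor_op_def algebra_simps)
  then have "factors_op cop (l' # ls) v = (\<lambda>i. (l - l') * factors_op cop ls v i + 0 * factors_op cop ls v i)"
    by (simp only: factors_op.simps linear_opD[OF linear_factors_op[OF linear_cop]])
  then show ?case using Cons.IH[OF Cons.prems] by (simp add: mult.assoc)
qed

section \<open>Eigenvalues with non-constant eigenvectors\<close>

definition nonconst_eigenvalues :: "complex set" where
  "nonconst_eigenvalues = {l. \<exists>v. cop v = (\<lambda>i. l * v i) \<and> (\<exists>i j. v i \<noteq> v j)}"

text \<open>Stands in for the roots of the minimal polynomial of \<open>U\<close> on mean-zero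
  vectors. It records that the product annihilates these vectors and that the roots are exactly the
  eigenvalues in question; the multiplicities are free as long as the product annihilates.\<close>

definition mean_zero_minimal :: "complex list \<Rightarrow> bool" where
  "mean_zero_minimal ls \<longleftrightarrow> (\<forall>w. (\<Sum>i\<in>UNIV. w i) = 0 \<longrightarrow> factors_op cop ls w = (\<lambda>_. 0)) \<and> set ls = nonconst_eigenvalues"

text \<open>A shortest annihilating list works. Without a given entry some mean-zero vector
  survives, and what survives is an eigenvector for that entry; conversely an eigenvector is scaled
  by the product of all \<open>l - l'\<close>, so its eigenvalue occurs.\<close>

lemma mean_zero_minimal_exists: "\<exists>ls. mean_zero_minimal ls"
proof -
  define Q where "Q ls \<longleftrightarrow> (\<forall>w. (\<Sum>i\<in>UNIV. w i) = 0 \<longrightarrow> factors_op cop ls w = (\<lambda>_. 0))" for ls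
  have "\<exists>ls. Q ls" using annihilating_list by (auto simp: Q_def)
  then obtain ls where ls: "Q ls" and least: "\<And>ls'. Q ls' \<Longrightarrow> length ls \<le> length ls'"
    using ex_has_least_nat[of Q _ length] by metis
  have "l \<in> nonconst_eigenvalues" if lm: "l \<in> set ls" for l
  proof -
    obtain xs ys where e: "ls = xs @ l # ys" using split_list[OF lm] by blast
    have "\<not> Q (xs @ ys)" using least[of "xs @ ys"] by (auto simp: e)
    then obtain w where w: "(\<Sum>i\<in>UNIV. w i) = 0" "factors_op cop (xs @ ys) w \<noteq> (\<lambda>_. 0)" by (auto simp: Q_def)
    define v where "v = factors_op cop (xs @ ys) w"
    have "factor_op cop l v = factors_op cop ls w"
      by (simp add: v_def e factors_op_append factors_op_factor_op[OF linear_cop])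
    also have "\<dots> = (\<lambda>_. 0)" using ls w by (simp add: Q_def)
    finally have eig: "cop v = (\<lambda>i. l * v i)" by (auto simp: factor_op_def fun_eq_iff)
    have s: "(\<Sum>i\<in>UNIV. v i) = 0" unfolding v_def by (rule sum_factors_op_cop[OF w(1)])
    obtain i where i: "v i \<noteq> 0" using w(2) by (auto simp: v_def)
    have "\<exists>i j. v i \<noteq> v j"
    proof (rule ccontr)
      assume "\<nexists>i j. v i \<noteq> v j"
      then have "(\<Sum>j\<in>UNIV. v j) = (\<Sum>j\<in>(UNIV :: 'd set). v i)" by (intro sum.cong) auto
      then have "(\<Sum>j\<in>UNIV. v j) = of_nat CARD('d) * v i" by simp
      then show False using s i by simp
    qed
    then show ?thesis using eig by (auto simp: nonconst_eigenvalues_def)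
  qed
  moreover have "l \<in> set ls" if l: "l \<in> nonconst_eigenvalues" for l
  proof -
    obtain v i j where v: "cop v = (\<lambda>i. l * v i)" "v i \<noteq> v j" using l by (auto simp: nonconst_eigenvalues_def)
    define m where "m = (\<Sum>i\<in>UNIV. v i) / of_nat CARD('d)"
    define u where "u i = v i - m" for i
    have su: "(\<Sum>i\<in>UNIV. u i) = 0" by (simp add: u_def m_def sum_subtractf)
    have cc: "cop (\<lambda>_. 1) = (\<lambda>_. 1)" by (auto simp: cop_def row_sum simp flip: of_real_sum)
    \<comment> \<open>By the column sums, either \<open>l = 1\<close> or the mean \<open>m\<close>
      vanishes. In both cases subtracting the mean leaves an eigenvector for
      \<open>l\<close>.\<close>
    have lm: "l * m = m"
    proof -
      have "(\<Sum>i\<in>UNIV. v i) = l * (\<Sum>i\<in>UNIV. v i)" using sum_cop[of v] by (simp add: v(1) sum_distrib_left)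
      then show ?thesis by (simp add: m_def)
    qed
    have "cop u = (\<lambda>i. cop v i - m * cop (\<lambda>_. 1) i)"
      using linear_op_diff[OF linear_cop, of v m "\<lambda>_. 1"] by (simp add: u_def[abs_def])
    then have "cop u = (\<lambda>i. l * u i)" by (simp add: v(1) cc u_def algebra_simps lm)
    from factors_op_eigenvector[OF this, of ls] have "(\<lambda>i. (\<Prod>l'\<leftarrow>ls. (l - l')) * u i) = (\<lambda>_. 0)"
      using ls su by (simp add: Q_def)
    then have "(\<Prod>l'\<leftarrow>ls. (l - l')) * u k = 0" for k by metis
    moreover have "u i \<noteq> 0 \<or> u j \<noteq> 0" using v(2) by (auto simp: u_def)
    ultimately have "(\<Prod>l'\<leftarrow>ls. (l - l')) = 0" by auto
    then show ?thesis by (auto simp: prod_list_zero_iff)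
  qed
  ultimately show ?thesis using ls by (auto simp: mean_zero_minimal_def Q_def)
qed

lemma finite_nonconst_eigenvalues: "finite nonconst_eigenvalues"
  using mean_zero_minimal_exists by (metis List.finite_set mean_zero_minimal_def)

lemma mean_zero_minimal_nonempty:
  assumes ls: "mean_zero_minimal ls" and d: "CARD('d) \<ge> 2"
  shows "ls \<noteq> []"
proof
  assume e: "ls = []"
  obtain a b :: 'd where ab: "a \<noteq> b"
    using d card_le_Suc0_iff_eq[of "UNIV :: 'd set"] by auto
  define w where "w = (\<lambda>i. if i = a then 1 else if i = b then -1 else (0::complex))"
  have "(\<Sum>i\<in>UNIV. w i) = (\<Sum>i\<in>{a, b}. w i)" by (intro sum.mono_neutral_right) (auto simp: w_def)
  also have "\<dots> = 0" using ab by (simp add: w_def)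
  finally have "w = (\<lambda>_. 0)" using ls e by (auto simp: mean_zero_minimal_def)
  then show False by (auto simp: w_def fun_eq_iff split: if_splits)
qed

lemma eigenvalue_norm_le_1:
  assumes l: "l \<in> nonconst_eigenvalues" shows "norm l \<le> 1"
proof -
  obtain v i j where v: "cop v = (\<lambda>i. l * v i)" "v i \<noteq> v j" using l by (auto simp: nonconst_eigenvalues_def)
  define m where "m = Max (range (\<lambda>i. norm (v i)))"
  have le: "norm (v i) \<le> m" for i by (simp add: m_def)
  have "m \<in> range (\<lambda>i. norm (v i))" unfolding m_def by (rule Max_in) auto
  then obtain a where a: "norm (v a) = m" by auto
  have "m > 0"
  proof (rule ccontr)
    assume "\<not> m > 0"
    then have "v k = 0" for k using le[of k] by (metis dual_order.trans norm_le_zero_iff not_le)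
    then show False using v by simp
  qed
  have "norm l * m = norm (cop v a)" by (simp add: v(1) norm_mult a)
  also have "\<dots> \<le> (\<Sum>j\<in>UNIV. norm (complex_of_real (U $ a $ j) * v j))" unfolding cop_def by (rule norm_sum)
  also have "\<dots> \<le> (\<Sum>j\<in>UNIV. U $ a $ j * m)"
    using nonneg le by (intro sum_mono) (simp add: norm_mult mult_left_mono)
  also have "\<dots> = 1 * m" by (simp add: row_sum flip: sum_distrib_right)
  finally show ?thesis using \<open>m > 0\<close> by (simp del: mult_1)
qed

lemma pw_nonneg: "pw k $ i $ j \<ge> 0"
proof (induction k arbitrary: i j)
  case 0
  then show ?case by (simp add: pw_def mat_def)
next
  case (Suc k)
  then show ?case using nonneg by (simp add: pw_Suc matrix_matrix_mult_def sum_nonneg)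
qed

lemma pw_row_sum: "(\<Sum>j\<in>UNIV. pw k $ i $ j) = 1"
proof -
  have "(cop ^^ k) (\<lambda>_. 1) = (\<lambda>_. 1)"
  proof (induction k)
    case (Suc k)
    then show ?case by (auto simp: cop_def row_sum simp flip: of_real_sum)
  qed simp
  then have "complex_of_real (\<Sum>j\<in>UNIV. pw k $ i $ j) = 1" using cop_funpow[of k "\<lambda>_. 1" i] by simp
  then show ?thesis by (simp only: of_real_eq_1_iff)
qed

text \<open>Maximum principle for the powers of \<open>U\<close>: the value at a maximum is an
  average, so it is attained wherever some power has positive weight.\<close>

lemma harmonic_constant:
  fixes h :: "'d \<Rightarrow> real"
  assumes irr: "irreducible_matrix U" and h: "\<And>i. (\<Sum>j\<in>UNIV. U $ i $ j * h j) = h i"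
  shows "h i = h j"
proof -
  have hk: "(\<Sum>j\<in>UNIV. pw k $ i $ j * h j) = h i" for k i
  proof -
    have "(cop ^^ k) (\<lambda>j. of_real (h j)) = (\<lambda>j. of_real (h j))"
    proof (induction k)
      case (Suc k)
      then show ?case using h by (auto simp: cop_def simp flip: of_real_mult of_real_sum)
    qed simp
    then have "complex_of_real (\<Sum>j\<in>UNIV. pw k $ i $ j * h j) = of_real (h i)"
      using cop_funpow[of k "\<lambda>j. of_real (h j)" i] by simp
    then show ?thesis by (simp only: of_real_eq_iff)
  qed
  have "Max (range h) \<in> range h" by (rule Max_in) auto
  then obtain a where am: "Max (range h) = h a" by (rule rangeE)
  have a: "h b \<le> h a" for b unfolding am[symmetric] by simp
  have "h b = h a" for b
  proof -
    obtain k where k: "pw k $ a $ b > 0" using irr by (auto simp: irreducible_matrix_def pw_def)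
    have "(\<Sum>j\<in>UNIV. pw k $ a $ j * (h a - h j)) = 0"
      by (simp add: right_diff_distrib sum_subtractf hk pw_row_sum flip: sum_distrib_right)
    then have "pw k $ a $ b * (h a - h b) = 0"
      using a pw_nonneg by (subst (asm) sum_nonneg_eq_0_iff) auto
    then show ?thesis using k by simp
  qed
  then show ?thesis by metis
qed

text \<open>Within the unit disc, \<open>Re l \<ge> 1\<close> leaves only \<open>l = 1\<close>, and
  real and imaginary parts of its eigenvectors are harmonic, hence constant.\<close>

lemma eigenvalue_Re_less_1:
  assumes l: "l \<in> nonconst_eigenvalues" and irr: "irreducible_matrix U" shows "Re l < 1"
proof (rule ccontr)
  assume "\<not> Re l < 1"
  then have "Re l \<ge> 1" by simp
  have n1: "(Re l)\<^sup>2 + (Im l)\<^sup>2 \<le> 1"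
    using eigenvalue_norm_le_1[OF l] by (metis cmod_power2 norm_ge_zero power_le_one)
  have "(Re l)\<^sup>2 \<ge> 1" using \<open>Re l \<ge> 1\<close> by simp
  then have "(Im l)\<^sup>2 \<le> 0" "(Re l)\<^sup>2 \<le> 1" using n1 by (smt (verit) zero_le_power2)+
  then have "Im l = 0" "Re l = 1" using \<open>Re l \<ge> 1\<close> by (auto simp: power2_le_iff_abs_le abs_square_le_1)
  then have l1: "l = 1" by (simp add: complex_eq_iff)
  obtain v i j where v: "cop v = (\<lambda>i. l * v i)" "v i \<noteq> v j" using l by (auto simp: nonconst_eigenvalues_def)
  have e: "(\<Sum>j\<in>UNIV. complex_of_real (U $ i $ j) * v j) = v i" for i using fun_cong[OF v(1), of i] by (simp add: cop_def l1)
  have "(\<Sum>j\<in>UNIV. U $ i $ j * Re (v j)) = Re (v i)" "(\<Sum>j\<in>UNIV. U $ i $ j * Im (v j)) = Im (v i)" for i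
    using arg_cong[OF e[of i], of Re] arg_cong[OF e[of i], of Im] by simp_all
  then have "Re (v i) = Re (v j)" "Im (v i) = Im (v j)"
    using harmonic_constant[OF irr, of "\<lambda>j. Re (v j)"] harmonic_constant[OF irr, of "\<lambda>j. Im (v j)"] by blast+
  then show False using v(2) by (simp add: complex_eq_iff)
qed

lemma spectral_gap_eq: "spectral_gap U = Min ((\<lambda>l. 1 - Re l) ` nonconst_eigenvalues)"
proof -
  have "(\<exists>v :: complex ^ 'd. map_matrix complex_of_real U *v v = l *s v \<and> (\<exists>i j. v $ i \<noteq> v $ j)) \<longleftrightarrow> l \<in> nonconst_eigenvalues" for l
  proof
    assume "\<exists>v :: complex ^ 'd. map_matrix complex_of_real U *v v = l *s v \<and> (\<exists>i j. v $ i \<noteq> v $ j)"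
    then obtain v :: "complex ^ 'd" where v: "map_matrix complex_of_real U *v v = l *s v" "\<exists>i j. v $ i \<noteq> v $ j" by blast
    have "cop (($) v) = (\<lambda>i. l * v $ i)"
      using v(1) by (auto simp: cop_def vec_eq_iff matrix_vector_mult_def map_matrix_def)
    then show "l \<in> nonconst_eigenvalues" using v(2) by (auto simp: nonconst_eigenvalues_def)
  next
    assume "l \<in> nonconst_eigenvalues"
    then obtain v where v: "cop v = (\<lambda>i. l * v i)" "\<exists>i j. v i \<noteq> v j" by (auto simp: nonconst_eigenvalues_def)
    have "map_matrix complex_of_real U *v (\<chi> i. v i) = l *s (\<chi> i. v i)"
      using fun_cong[OF v(1)] by (auto simp: cop_def vec_eq_iff matrix_vector_mult_def map_matrix_def)
    then show "\<exists>v :: complex ^ 'd. map_matrix complex_of_real U *v v = l *s v \<and> (\<exists>i j. v $ i \<noteq> v $ j)"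
      using v(2) by (intro exI[of _ "\<chi> i. v i"]) auto
  qed
  then have "{1 - Re l | l. \<exists>v :: complex ^ 'd. map_matrix complex_of_real U *v v = l *s v \<and> (\<exists>i j. v $ i \<noteq> v $ j)}
     = (\<lambda>l. 1 - Re l) ` nonconst_eigenvalues" by auto
  then show ?thesis by (simp add: spectral_gap_def)
qed

lemma nonconst_eigenvalues_nonempty: "CARD('d) \<ge> 2 \<Longrightarrow> nonconst_eigenvalues \<noteq> {}"
  using mean_zero_minimal_exists mean_zero_minimal_nonempty by (metis mean_zero_minimal_def set_empty2)

lemma spectral_gap_attained:
  assumes "CARD('d) \<ge> 2"
  shows "\<exists>l\<in>nonconst_eigenvalues. 1 - Re l = spectral_gap U"
proof -
  have "spectral_gap U \<in> (\<lambda>l. 1 - Re l) ` nonconst_eigenvalues"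
    unfolding spectral_gap_eq
    by (rule Min_in) (use finite_nonconst_eigenvalues nonconst_eigenvalues_nonempty[OF assms] in auto)
  then show ?thesis by auto
qed

lemma spectral_gap_le: "l \<in> nonconst_eigenvalues \<Longrightarrow> spectral_gap U \<le> 1 - Re l"
  unfolding spectral_gap_eq by (intro Min_le) (use finite_nonconst_eigenvalues in auto)

lemma spectral_gap_pos:
  assumes "CARD('d) \<ge> 2" "irreducible_matrix U"
  shows "spectral_gap U > 0"
  using spectral_gap_attained[OF assms(1)] eigenvalue_Re_less_1[OF _ assms(2)] by force

section \<open>Duality and the adapted norm\<close>

lemma adjoint_factor_op:
  "(\<Sum>j\<in>UNIV. factor_op rop l w j * f j) = (\<Sum>j\<in>UNIV. w j * factor_op cop l f j)"
proof -
  have "(\<Sum>j\<in>UNIV. rop w j * f j) = (\<Sum>j\<in>UNIV. \<Sum>i\<in>UNIV. w i * complex_of_real (U $ i $ j) * f j)"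
    by (simp add: rop_def sum_distrib_right)
  also have "\<dots> = (\<Sum>i\<in>UNIV. \<Sum>j\<in>UNIV. w i * complex_of_real (U $ i $ j) * f j)" by (rule sum.swap)
  also have "\<dots> = (\<Sum>i\<in>UNIV. w i * cop f i)" by (simp add: cop_def sum_distrib_left mult.assoc)
  finally show ?thesis by (simp add: factor_op_def algebra_simps sum_subtractf)
qed

lemma adjoint_factors_op:
  "(\<Sum>j\<in>UNIV. factors_op rop ls w j * f j) = (\<Sum>j\<in>UNIV. w j * factors_op cop ls f j)"
proof (induction ls arbitrary: w f)
  case (Cons l ls)
  then show ?case by (simp add: adjoint_factor_op factors_op_factor_op[OF linear_cop])
qed simp

text \<open>By duality: a unit vector is a mean-zero vector plus a constant. The product annihilates
  the first part and maps the second to a constant, which pairs to zero with the mean-zero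
  \<open>w\<close>.\<close>

lemma factors_op_rop:
  assumes ls: "mean_zero_minimal ls" and w: "(\<Sum>j\<in>UNIV. w j) = 0"
  shows "factors_op rop ls w = (\<lambda>_. 0)"
proof
  fix a :: 'd
  define f where "f = (\<lambda>j. if j = a then 1 else (0::complex))"
  define f0 where "f0 = (\<lambda>j. f j - (1 / of_nat CARD('d)) * (1::complex))"
  have s0: "(\<Sum>j\<in>UNIV. f0 j) = 0" by (simp add: f0_def f_def sum_subtractf)
  have cc: "cop (\<lambda>_. 1) = (\<lambda>_. 1 * 1)" by (auto simp: cop_def row_sum simp flip: of_real_sum)
  obtain c where c: "factors_op cop ls (\<lambda>_. 1) = (\<lambda>_. c)" using factors_op_eigenvector[OF cc] by auto
  have "factors_op cop ls f0 = (\<lambda>j. factors_op cop ls f j - (1 / of_nat CARD('d)) * factors_op cop ls (\<lambda>_. 1) j)"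
    unfolding f0_def by (rule linear_op_diff[OF linear_factors_op[OF linear_cop]])
  moreover have "factors_op cop ls f0 = (\<lambda>_. 0)" using ls s0 by (simp add: mean_zero_minimal_def)
  ultimately have f: "factors_op cop ls f j = (1 / of_nat CARD('d)) * c" for j by (simp add: c fun_eq_iff)
  have "(\<Sum>j\<in>UNIV. factors_op rop ls w j * f j) = (\<Sum>j\<in>UNIV. w j) * ((1 / of_nat CARD('d)) * c)"
    unfolding adjoint_factors_op f by (simp only: sum_distrib_right)
  moreover have "(\<Sum>j\<in>UNIV. factors_op rop ls w j * f j) = factors_op rop ls w a"
    by (simp add: f_def if_distrib cong: if_cong)
  ultimately show "factors_op rop ls w a = 0" using w by simp
qed

lemma norm_sum_rop: "(\<Sum>j\<in>UNIV. norm (rop w j)) \<le> (\<Sum>j\<in>UNIV. norm (w j))"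
proof -
  have "(\<Sum>j\<in>UNIV. norm (rop w j)) \<le> (\<Sum>j\<in>UNIV. \<Sum>i\<in>UNIV. norm (w i) * (U $ i $ j))"
    unfolding rop_def using nonneg by (intro sum_mono order_trans[OF norm_sum]) (simp add: norm_mult)
  also have "\<dots> = (\<Sum>i\<in>UNIV. \<Sum>j\<in>UNIV. norm (w i) * (U $ i $ j))" by (rule sum.swap)
  also have "\<dots> = (\<Sum>i\<in>UNIV. norm (w i))" by (simp add: row_sum flip: sum_distrib_left)
  finally show ?thesis .
qed

text \<open>Each factor at most doubles the sum of the moduli, as \<open>rop\<close> does not
  increase it and \<open>norm l \<le> 1\<close>.\<close>

lemma norm_sum_factors_op:
  assumes "\<And>l. l \<in> set ls \<Longrightarrow> norm l \<le> 1"
  shows "(\<Sum>j\<in>UNIV. norm (factors_op rop ls w j)) \<le> 2 ^ length ls * (\<Sum>j\<in>UNIV. norm (w j))"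
  using assms
proof (induction ls arbitrary: w)
  case (Cons l ls)
  have "(\<Sum>j\<in>UNIV. norm (factor_op rop l w j)) \<le> (\<Sum>j\<in>UNIV. norm (rop w j) + norm l * norm (w j))"
    unfolding factor_op_def by (intro sum_mono order_trans[OF norm_triangle_ineq4]) (simp add: norm_mult)
  also have "\<dots> \<le> (\<Sum>j\<in>UNIV. norm (w j)) + norm l * (\<Sum>j\<in>UNIV. norm (w j))"
    using norm_sum_rop[of w] by (simp add: sum.distrib sum_distrib_left)
  also have "\<dots> \<le> (\<Sum>j\<in>UNIV. norm (w j)) + 1 * (\<Sum>j\<in>UNIV. norm (w j))"
    using Cons.prems by (intro add_left_mono mult_right_mono) (auto intro: sum_nonneg)
  finally have a: "(\<Sum>j\<in>UNIV. norm (factor_op rop l w j)) \<le> 2 * (\<Sum>j\<in>UNIV. norm (w j))" by simp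
  have "(\<Sum>j\<in>UNIV. norm (factors_op rop (l # ls) w j)) \<le> 2 ^ length ls * (\<Sum>j\<in>UNIV. norm (factor_op rop l w j))"
    using Cons by simp
  also have "\<dots> \<le> 2 ^ length ls * (2 * (\<Sum>j\<in>UNIV. norm (w j)))" using a by simp
  finally show ?case by simp
qed simp

text \<open>A Hilbert norm adapted to the Jordan structure: weighting the iterated factors by powers of a
  large \<open>L\<close> makes the nilpotent part contribute only \<open>1 / L\<close>.\<close>

definition jnorm2 :: "complex list \<Rightarrow> real \<Rightarrow> 'd cvec \<Rightarrow> real" where
  "jnorm2 ls L w = (\<Sum>k<length ls. L ^ (2 * k) * (\<Sum>j\<in>UNIV. (norm (factors_op rop (take k ls) w j))\<^sup>2))"

lemma jnorm2_nonneg: "L \<ge> 0 \<Longrightarrow> jnorm2 ls L w \<ge> 0"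
  unfolding jnorm2_def by (intro sum_nonneg mult_nonneg_nonneg) auto

lemma jnorm2_ge:
  assumes "ls \<noteq> []" "L \<ge> 0"
  shows "(\<Sum>j\<in>UNIV. (norm (w j))\<^sup>2) \<le> jnorm2 ls L w"
proof -
  have "(\<Sum>k\<in>{0}. L ^ (2 * k) * (\<Sum>j\<in>UNIV. (norm (factors_op rop (take k ls) w j))\<^sup>2)) \<le> jnorm2 ls L w"
    unfolding jnorm2_def using assms by (intro sum_mono2) (auto intro!: mult_nonneg_nonneg sum_nonneg)
  then show ?thesis by simp
qed

text \<open>The distortion of the adapted norm is a power of \<open>L\<close>. For
  \<open>L = ln n\<close> it is paid for by a multiple of \<open>n ln ln n\<close> steps.\<close>

lemma jnorm2_le:
  fixes L :: real
  assumes L: "L \<ge> 1" and ls: "\<And>l. l \<in> set ls \<Longrightarrow> norm l \<le> 1"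
  shows "jnorm2 ls L w \<le> length ls * 4 ^ length ls * L ^ (2 * length ls) * (\<Sum>j\<in>UNIV. norm (w j))\<^sup>2"
proof -
  have "jnorm2 ls L w \<le> (\<Sum>k<length ls. L ^ (2 * length ls) * (4 ^ length ls * (\<Sum>j\<in>UNIV. norm (w j))\<^sup>2))"
    unfolding jnorm2_def
  proof (rule sum_mono)
    fix k assume k: "k \<in> {..<length ls}"
    have Lk: "L ^ (2 * k) \<le> L ^ (2 * length ls)" using L k by (intro power_increasing) auto
    let ?s = "\<Sum>j\<in>UNIV. norm (w j)"
    have "(\<Sum>j\<in>UNIV. (norm (factors_op rop (take k ls) w j))\<^sup>2) \<le> (\<Sum>j\<in>UNIV. norm (factors_op rop (take k ls) w j))\<^sup>2"
      using power_mono[OF L2_set_le_sum[of UNIV "\<lambda>j. norm (factors_op rop (take k ls) w j)"], of 2]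
      by (simp add: L2_set_def sum_nonneg)
    also have "\<dots> \<le> (2 ^ length (take k ls) * ?s)\<^sup>2"
      using ls by (intro power_mono norm_sum_factors_op) (auto dest: in_set_takeD intro: sum_nonneg)
    also have "\<dots> = 4 ^ k * ?s\<^sup>2"
      using k by (simp add: power_mult_distrib power2_eq_square flip: power_mult_distrib)
    also have "\<dots> \<le> 4 ^ length ls * ?s\<^sup>2" using k by (intro mult_right_mono power_increasing) auto
    finally show "L ^ (2 * k) * (\<Sum>j\<in>UNIV. (norm (factors_op rop (take k ls) w j))\<^sup>2)
        \<le> L ^ (2 * length ls) * (4 ^ length ls * ?s\<^sup>2)"
      using Lk L by (intro mult_mono) (auto intro: sum_nonneg)
  qed
  then show ?thesis by (simp add: mult_ac)
qed

text \<open>Along the vectors \<open>y k\<close> the averaging operator is bidiagonal, with diagonal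
  entry \<open>1 + (l - 1) / n\<close> and coefficient \<open>1 / n\<close> towards
  \<open>y (Suc k)\<close>. The weights reduce that coefficient to \<open>1 / (n L)\<close>, and the
  last link is zero by annihilation.\<close>

lemma jnorm2_contraction:
  fixes n L \<rho> :: real
  assumes ann: "factors_op rop ls w = (\<lambda>_. 0)" and L: "L > 0" and n: "n > 0"
    and \<rho>: "\<And>l. l \<in> set ls \<Longrightarrow> norm (1 + (l - 1) / of_real n) \<le> \<rho>" and r0: "\<rho> \<ge> 0"
  shows "jnorm2 ls L (\<lambda>j. w j + (rop w j - w j) / of_real n) \<le> (\<rho> + 1 / (n * L))\<^sup>2 * jnorm2 ls L w"
proof -
  define y where "y k = factors_op rop (take k ls) w" for k
  define e where "e = 1 / (n * L)"
  have e: "e > 0" using L n by (simp add: e_def)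
  let ?m = "length ls"
  have yS: "y (Suc k) = (\<lambda>j. rop (y k) j - ls ! k * y k j)" if "k < ?m" for k
    using that by (simp add: y_def take_Suc_conv_app_nth factors_op_append factor_op_def)
  have ym: "y ?m = (\<lambda>_. 0)" by (simp add: y_def ann)
  have yM: "factors_op rop (take k ls) (\<lambda>j. w j + (rop w j - w j) / of_real n) j
      = (1 + (ls ! k - 1) / of_real n) * y k j + y (Suc k) j / of_real n" if k: "k < ?m" for k j
  proof -
    have "(\<lambda>j. w j + (rop w j - w j) / of_real n) = (\<lambda>j. (1 - 1 / of_real n) * w j + (1 / of_real n) * rop w j)"
      by (auto simp: algebra_simps diff_divide_distrib)
    then have "factors_op rop (take k ls) (\<lambda>j. w j + (rop w j - w j) / of_real n) j =
       (1 - 1 / of_real n) * y k j + (1 / of_real n) * rop (y k) j"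
      by (simp only: y_def linear_opD[OF linear_factors_op[OF linear_rop]] factors_op_commute[OF linear_rop])
    then show ?thesis by (simp add: yS[OF k] algebra_simps diff_divide_distrib)
  qed
  define a where "a k = L ^ (2 * k) * (\<Sum>j\<in>UNIV. (norm (y k j))\<^sup>2)" for k
  have a0: "a k \<ge> 0" for k using L by (simp add: a_def sum_nonneg)
  have step: "L ^ (2 * k) * (\<Sum>j\<in>UNIV. (norm (factors_op rop (take k ls) (\<lambda>j. w j + (rop w j - w j) / of_real n) j))\<^sup>2)
      \<le> (\<rho> + e) * (\<rho> * a k + e * a (Suc k))" if k: "k < ?m" for k
  proof -
    have "(norm (factors_op rop (take k ls) (\<lambda>j. w j + (rop w j - w j) / of_real n) j))\<^sup>2
       \<le> (\<rho> + e) * (\<rho> * (norm (y k j))\<^sup>2 + e * (L\<^sup>2 * (norm (y (Suc k) j))\<^sup>2))" for j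
    proof -
      have "norm (factors_op rop (take k ls) (\<lambda>j. w j + (rop w j - w j) / of_real n) j)
         \<le> norm (1 + (ls ! k - 1) / of_real n) * norm (y k j) + norm (y (Suc k) j) / n"
        unfolding yM[OF k] using n by (intro order_trans[OF norm_triangle_ineq]) (simp add: norm_mult norm_divide)
      also have "\<dots> \<le> \<rho> * norm (y k j) + norm (y (Suc k) j) / n"
        using \<rho> k by (intro add_right_mono mult_right_mono) auto
      also have "norm (y (Suc k) j) / n = e * (L * norm (y (Suc k) j))" using L n by (simp add: e_def)
      finally have le: "norm (factors_op rop (take k ls) (\<lambda>j. w j + (rop w j - w j) / of_real n) j)
         \<le> \<rho> * norm (y k j) + e * (L * norm (y (Suc k) j))" .
      \<comment> \<open>Weighted Cauchy-Schwarz; it makes the square of the sum of both rates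
        appear.\<close>
      have cs: "(p * s + q * t)\<^sup>2 \<le> (p + q) * (p * s\<^sup>2 + q * t\<^sup>2)" if "p \<ge> 0" "q \<ge> 0" for p q s t :: real
      proof -
        have "(p + q) * (p * s\<^sup>2 + q * t\<^sup>2) - (p * s + q * t)\<^sup>2 = p * q * (s - t)\<^sup>2"
          by (simp add: power2_eq_square algebra_simps)
        moreover have "p * q * (s - t)\<^sup>2 \<ge> 0" using that by simp
        ultimately show ?thesis by simp
      qed
      have "(norm (factors_op rop (take k ls) (\<lambda>j. w j + (rop w j - w j) / of_real n) j))\<^sup>2
        \<le> (\<rho> * norm (y k j) + e * (L * norm (y (Suc k) j)))\<^sup>2"
        using le by (intro power_mono) auto
      also have "\<dots> \<le> (\<rho> + e) * (\<rho> * (norm (y k j))\<^sup>2 + e * (L * norm (y (Suc k) j))\<^sup>2)"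
        using r0 e by (intro cs) auto
      finally show ?thesis by (simp add: power_mult_distrib)
    qed
    then have "(\<Sum>j\<in>UNIV. (norm (factors_op rop (take k ls) (\<lambda>j. w j + (rop w j - w j) / of_real n) j))\<^sup>2)
       \<le> (\<Sum>j\<in>UNIV. (\<rho> + e) * (\<rho> * (norm (y k j))\<^sup>2 + e * (L\<^sup>2 * (norm (y (Suc k) j))\<^sup>2)))"
      by (intro sum_mono)
    then have "L ^ (2 * k) * (\<Sum>j\<in>UNIV. (norm (factors_op rop (take k ls) (\<lambda>j. w j + (rop w j - w j) / of_real n) j))\<^sup>2)
       \<le> L ^ (2 * k) * (\<Sum>j\<in>UNIV. (\<rho> + e) * (\<rho> * (norm (y k j))\<^sup>2 + e * (L\<^sup>2 * (norm (y (Suc k) j))\<^sup>2)))"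
      using L by (intro mult_left_mono) auto
    also have "\<dots> = (\<rho> + e) * (\<rho> * a k + e * a (Suc k))"
      by (simp add: a_def sum.distrib sum_distrib_left algebra_simps power2_eq_square)
    finally show ?thesis .
  qed
  have "jnorm2 ls L (\<lambda>j. w j + (rop w j - w j) / of_real n) \<le> (\<Sum>k<?m. (\<rho> + e) * (\<rho> * a k + e * a (Suc k)))"
    unfolding jnorm2_def by (intro sum_mono step) simp
  also have "\<dots> = (\<rho> + e) * (\<rho> * (\<Sum>k<?m. a k) + e * (\<Sum>k<?m. a (Suc k)))"
    by (simp add: sum_distrib_left sum.distrib distrib_left mult.assoc)
  also have "\<dots> \<le> (\<rho> + e) * (\<rho> * (\<Sum>k<?m. a k) + e * (\<Sum>k<?m. a k))"
  proof -
    have "a 0 + (\<Sum>k<?m. a (Suc k)) = (\<Sum>k<?m. a k) + a ?m"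
      by (simp flip: sum.lessThan_Suc_shift)
    moreover have "a ?m = 0" by (simp add: a_def ym)
    ultimately have "(\<Sum>k<?m. a (Suc k)) \<le> (\<Sum>k<?m. a k)" using a0[of 0] by simp
    then show ?thesis using r0 e by (intro mult_left_mono add_left_mono) auto
  qed
  also have "\<dots> = (\<rho> + e)\<^sup>2 * (\<Sum>k<?m. a k)" by (simp add: power2_eq_square algebra_simps)
  also have "(\<Sum>k<?m. a k) = jnorm2 ls L w" by (simp add: jnorm2_def a_def y_def)
  finally show ?thesis by (simp only: e_def)
qed

end

context doubly_stochastic
begin

section \<open>The averaging operator of one step\<close>

text \<open>The mean effect of one step on a single card, which is drawn with probability
  \<open>1 / n\<close> and then moves according to \<open>U\<close>.\<close>

definition lazy :: "real \<Rightarrow> 'd cvec \<Rightarrow> 'd cvec" where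
  "lazy n f = (\<lambda>i. f i + (cop f i - f i) / of_real n)"

definition rlazy :: "real \<Rightarrow> 'd cvec \<Rightarrow> 'd cvec" where
  "rlazy n w = (\<lambda>j. w j + (rop w j - w j) / of_real n)"

lemma cop_le:
  assumes "\<And>j. norm (f j) \<le> F" shows "norm (cop f i) \<le> F"
proof -
  have "norm (cop f i) \<le> (\<Sum>j\<in>UNIV. norm (complex_of_real (U $ i $ j) * f j))" unfolding cop_def by (rule norm_sum)
  also have "\<dots> \<le> (\<Sum>j\<in>UNIV. U $ i $ j * F)"
    using nonneg assms by (intro sum_mono) (simp add: norm_mult mult_left_mono)
  also have "\<dots> = F" by (simp add: row_sum flip: sum_distrib_right)
  finally show ?thesis .
qed

lemma lazy_le:
  assumes n: "n \<ge> 1" and f: "\<And>j. norm (f j) \<le> F" shows "norm (lazy n f i) \<le> F"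
proof -
  have "lazy n f i = of_real (1 - 1 / n) * f i + of_real (1 / n) * cop f i"
    by (simp add: lazy_def algebra_simps diff_divide_distrib)
  also have "norm \<dots> \<le> (1 - 1 / n) * norm (f i) + (1 / n) * norm (cop f i)"
  proof -
    have "\<bar>1 - 1 / n\<bar> = 1 - 1 / n" "\<bar>1 / n\<bar> = 1 / n" using n by simp_all
    then show ?thesis
      using norm_triangle_ineq[of "of_real (1 - 1 / n) * f i" "of_real (1 / n) * cop f i"]
      unfolding norm_mult norm_of_real by simp
  qed
  also have "\<dots> \<le> (1 - 1 / n) * F + (1 / n) * F"
    using n f[of i] cop_le[of f F i] f by (intro add_mono mult_left_mono) auto
  finally show ?thesis by (simp add: algebra_simps)
qed

lemma lazy_funpow_le:
  "n \<ge> 1 \<Longrightarrow> (\<And>j. norm (f j) \<le> F) \<Longrightarrow> norm ((lazy n ^^ k) f i) \<le> F"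
  by (induction k arbitrary: i) (simp_all add: lazy_le)

lemma adjoint_rop: "(\<Sum>j\<in>UNIV. rop w j * f j) = (\<Sum>j\<in>UNIV. w j * cop f j)"
  using adjoint_factor_op[of 0 w f] by (simp add: factor_op_def)

lemma adjoint_rlazy: "(\<Sum>j\<in>UNIV. rlazy n w j * f j) = (\<Sum>j\<in>UNIV. w j * lazy n f j)"
proof -
  have "(\<Sum>j\<in>UNIV. rlazy n w j * f j) = (\<Sum>j\<in>UNIV. w j * f j) + ((\<Sum>j\<in>UNIV. rop w j * f j) - (\<Sum>j\<in>UNIV. w j * f j)) / of_real n"
    by (simp add: rlazy_def distrib_right left_diff_distrib sum.distrib sum_subtractf flip: sum_divide_distrib)
  also have "\<dots> = (\<Sum>j\<in>UNIV. w j * lazy n f j)"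
    unfolding adjoint_rop by (simp add: lazy_def distrib_left right_diff_distrib sum.distrib sum_subtractf flip: sum_divide_distrib)
  finally show ?thesis .
qed

lemma adjoint_rlazy_funpow:
  "(\<Sum>j\<in>UNIV. (rlazy n ^^ k) w j * f j) = (\<Sum>j\<in>UNIV. w j * (lazy n ^^ k) f j)"
proof (induction k arbitrary: f)
  case (Suc k)
  have "(\<Sum>j\<in>UNIV. (rlazy n ^^ Suc k) w j * f j) = (\<Sum>j\<in>UNIV. (rlazy n ^^ k) w j * lazy n f j)"
    by (simp add: adjoint_rlazy)
  also have "\<dots> = (\<Sum>j\<in>UNIV. w j * (lazy n ^^ k) (lazy n f) j)" by (rule Suc)
  finally show ?case by (simp add: funpow_swap1)
qed simp

lemma sum_rlazy: "(\<Sum>j\<in>UNIV. rlazy n w j) = (\<Sum>j\<in>UNIV. w j)"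
  by (simp add: rlazy_def sum.distrib sum_subtractf sum_rop flip: sum_divide_distrib)

lemma eigenvalue_shift_norm2:
  assumes l: "l \<in> nonconst_eigenvalues" and n: "n > 0"
  shows "(norm (1 + (l - 1) / of_real n))\<^sup>2 \<le> 1 - 2 * (1 - Re l) / n + 4 / n\<^sup>2"
proof -
  have "norm (l - 1) \<le> 2" using eigenvalue_norm_le_1[OF l] norm_triangle_ineq4[of l 1] by simp
  then have "(norm (l - 1))\<^sup>2 \<le> 2\<^sup>2" by (intro power_mono) auto
  then have b: "(Re l - 1)\<^sup>2 + (Im l)\<^sup>2 \<le> 4" by (simp add: cmod_power2)
  have "(norm (1 + (l - 1) / of_real n))\<^sup>2 = (1 + (Re l - 1) / n)\<^sup>2 + (Im l / n)\<^sup>2"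
    by (simp add: cmod_power2)
  also have "\<dots> = 1 - 2 * (1 - Re l) / n + ((Re l - 1)\<^sup>2 + (Im l)\<^sup>2) / n\<^sup>2"
    using n by (simp add: power2_eq_square field_simps)
  also have "\<dots> \<le> 1 - 2 * (1 - Re l) / n + 4 / n\<^sup>2"
    using b by (intro add_left_mono divide_right_mono) auto
  finally show ?thesis .
qed

lemma eigenvalue_shift_norm:
  assumes l: "l \<in> nonconst_eigenvalues" and n: "n > 0"
  shows "norm (1 + (l - 1) / of_real n) \<le> 1 - spectral_gap U / n + 2 / n\<^sup>2"
proof (rule power2_le_imp_le)
  let ?g = "spectral_gap U"
  have g2: "?g \<le> 2"
    using spectral_gap_le[OF l] eigenvalue_norm_le_1[OF l] abs_Re_le_cmod[of l] by linarith
  \<comment> \<open>Chosen so that the bound on the squared modulus is \<open>1 - 2 * u\<close>,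
    which is at most the square of \<open>1 - u\<close>.\<close>
  define u where "u = ?g / n - 2 / n\<^sup>2"
  have "(norm (1 + (l - 1) / of_real n))\<^sup>2 \<le> 1 - 2 * (1 - Re l) / n + 4 / n\<^sup>2"
    by (rule eigenvalue_shift_norm2[OF l n])
  also have "\<dots> \<le> 1 - 2 * ?g / n + 4 / n\<^sup>2"
    using spectral_gap_le[OF l] n by (simp add: divide_right_mono)
  also have "\<dots> = 1 - 2 * u" by (simp add: u_def)
  also have "\<dots> \<le> (1 - u)\<^sup>2"
    using zero_le_power2[of u] by (simp add: power2_diff)
  also have "1 - u = 1 - ?g / n + 2 / n\<^sup>2" by (simp add: u_def)
  finally show "(norm (1 + (l - 1) / of_real n))\<^sup>2 \<le> (1 - ?g / n + 2 / n\<^sup>2)\<^sup>2" .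
  have "n\<^sup>2 - ?g * n + 2 \<ge> 0"
  proof -
    have "?g * n \<le> 2 * n" using g2 n by simp
    moreover have "(n - 1)\<^sup>2 \<ge> 0" by simp
    ultimately show ?thesis by (simp add: power2_diff)
  qed
  then have "(n\<^sup>2 - ?g * n + 2) / n\<^sup>2 \<ge> 0" by simp
  moreover have "(n\<^sup>2 - ?g * n + 2) / n\<^sup>2 = 1 - ?g / n + 2 / n\<^sup>2"
    using n by (simp add: power2_eq_square field_simps)
  ultimately show "1 - ?g / n + 2 / n\<^sup>2 \<ge> 0" by simp
qed

lemma jnorm2_rlazy:
  assumes ls: "mean_zero_minimal ls" and w: "(\<Sum>j\<in>UNIV. w j) = 0" and L: "L > 0" and n: "n > 0" and ne: "ls \<noteq> []"
  shows "jnorm2 ls L (rlazy n w) \<le> (1 - spectral_gap U / n + 2 / n\<^sup>2 + 1 / (n * L))\<^sup>2 * jnorm2 ls L w"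
  unfolding rlazy_def
proof (rule jnorm2_contraction[OF factors_op_rop[OF ls w] L n])
  show "norm (1 + (l - 1) / of_real n) \<le> 1 - spectral_gap U / n + 2 / n\<^sup>2" if "l \<in> set ls" for l
    using eigenvalue_shift_norm[of l n] that ls n by (auto simp: mean_zero_minimal_def)
  then show "1 - spectral_gap U / n + 2 / n\<^sup>2 \<ge> 0"
    using ne by (metis list.set_intros(1) neq_Nil_conv norm_ge_zero order_trans)
qed

text \<open>A single card is equidistributed up to a fixed accuracy after order \<open>n\<close>
  steps, uniformly in \<open>n\<close>. Here \<open>L\<close> can be a constant because no sharp
  rate is at stake.\<close>

lemma lazy_equidistribution:
  assumes d: "CARD('d) \<ge> 2" and irr: "irreducible_matrix U"
  shows "\<exists>C0>0. \<exists>N0>0. \<forall>n\<ge>N0. \<forall>k. real k \<ge> C0 * n \<longrightarrow>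
     (\<forall>a J. norm ((lazy n ^^ k) (\<lambda>j. of_bool (j = J)) a - 1 / of_nat CARD('d)) \<le> 1 / (4 * CARD('d)))"
proof -
  let ?g = "spectral_gap U"
  obtain ls where ls: "mean_zero_minimal ls" using mean_zero_minimal_exists by blast
  have ne: "ls \<noteq> []" by (rule mean_zero_minimal_nonempty[OF ls d])
  have g: "?g > 0" by (rule spectral_gap_pos[OF d irr])
  \<comment> \<open>With this \<open>L\<close> the nilpotent part costs at most a quarter of the
    gap; for \<open>8 \<le> ?g * n\<close> the quadratic error costs at most another quarter, and
    the rate \<open>?g / (2 * n)\<close> remains.\<close>
  define L where "L = max 1 (4 / ?g)"
  have L: "L \<ge> 1" "L > 0" "1 / L \<le> ?g / 4"
    using g by (auto simp: L_def max_def field_simps)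
  define m where "m = length ls"
  define C where "C = m * 4 ^ m * L ^ (2 * m) * 4 + 1"
  have C: "C > 0" using L by (simp add: C_def add_nonneg_pos)
  \<comment> \<open>After \<open>C0 * n\<close> steps the squared norm, initially at most
    \<open>C\<close>, is below the square of \<open>1 / (4 d)\<close>.\<close>
  define C0 where "C0 = max 1 (ln (16 * (real CARD('d))\<^sup>2 * C) / ?g)"
  have C0: "C0 > 0" "ln (16 * (real CARD('d))\<^sup>2 * C) \<le> ?g * C0"
    using g by (auto simp: C0_def max_def field_simps)
  have "norm ((lazy n ^^ k) (\<lambda>j. of_bool (j = J)) a - 1 / of_nat CARD('d)) \<le> 1 / (4 * CARD('d))"
    if n: "n \<ge> 8 / ?g + 1" and k: "real k \<ge> C0 * n" for n :: real and k a J
  proof -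
    have n0: "n > 0" using n g by (smt (verit) divide_pos_pos)
    have n8: "8 \<le> ?g * n" using n g by (simp add: field_simps)
    \<comment> \<open>A point mass at \<open>a\<close> minus the uniform distribution. By duality
      its evolved value at \<open>J\<close> is the deviation to be bounded.\<close>
    define w where "w = (\<lambda>j. of_bool (j = a) - 1 / (of_nat CARD('d) :: complex))"
    have w: "(\<Sum>j\<in>UNIV. w j) = 0" by (simp add: w_def sum_subtractf)
    have wk: "(\<Sum>j\<in>UNIV. (rlazy n ^^ i) w j) = 0" for i
      by (induction i) (simp_all add: w sum_rlazy)
    define r where "r = 1 - ?g / (2 * n)"
    have rb: "1 - ?g / n + 2 / n\<^sup>2 + 1 / (n * L) \<le> r"
    proof -
      have "1 / (n * L) = (1 / L) / n" by simp
      also have "\<dots> \<le> (?g / 4) / n" using L n0 by (intro divide_right_mono) auto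
      finally have "1 / (n * L) \<le> (?g / 4) / n" .
      moreover have "2 / n\<^sup>2 \<le> (?g / 4) / n" using n8 n0 by (simp add: power2_eq_square field_simps)
      ultimately show ?thesis by (simp add: r_def field_simps)
    qed
    have step: "jnorm2 ls L (rlazy n v) \<le> r\<^sup>2 * jnorm2 ls L v" if "(\<Sum>j\<in>UNIV. v j) = 0" for v
    proof -
      have "0 \<le> 1 - ?g / n + 2 / n\<^sup>2"
        using eigenvalue_shift_norm[of "hd ls" n] ls ne n0 norm_ge_zero order_trans
        unfolding mean_zero_minimal_def by (metis hd_in_set)
      then have "0 \<le> 1 - ?g / n + 2 / n\<^sup>2 + 1 / (n * L)" using n0 L by simp
      then have "(1 - ?g / n + 2 / n\<^sup>2 + 1 / (n * L))\<^sup>2 \<le> r\<^sup>2" using rb by (intro power_mono)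
      then show ?thesis using jnorm2_rlazy[OF ls that L(2) n0 ne] jnorm2_nonneg[of L ls v] L
        by (meson less_imp_le mult_right_mono order_trans)
    qed
    have "jnorm2 ls L ((rlazy n ^^ i) w) \<le> (r\<^sup>2) ^ i * jnorm2 ls L w" for i
    proof (induction i)
      case (Suc i)
      have "jnorm2 ls L ((rlazy n ^^ Suc i) w) \<le> r\<^sup>2 * jnorm2 ls L ((rlazy n ^^ i) w)"
        using step[OF wk[of i]] by simp
      also have "\<dots> \<le> r\<^sup>2 * ((r\<^sup>2) ^ i * jnorm2 ls L w)" using Suc by (intro mult_left_mono) auto
      finally show ?case by simp
    qed simp
    moreover have "jnorm2 ls L w \<le> C"
    proof -
      have "(\<Sum>j\<in>UNIV. norm (w j)) \<le> (\<Sum>j\<in>UNIV. of_bool (j = a) + 1 / real CARD('d))"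
        unfolding w_def by (intro sum_mono order_trans[OF norm_triangle_ineq4]) (simp add: norm_divide of_bool_def)
      also have "\<dots> = 2" by (simp add: sum.distrib)
      finally have "(\<Sum>j\<in>UNIV. norm (w j))\<^sup>2 \<le> 2\<^sup>2" by (intro power_mono) (auto intro: sum_nonneg)
      then have "m * 4 ^ m * L ^ (2 * m) * (\<Sum>j\<in>UNIV. norm (w j))\<^sup>2 \<le> m * 4 ^ m * L ^ (2 * m) * 4"
        using L by (intro mult_left_mono) auto
      moreover have "jnorm2 ls L w \<le> m * 4 ^ m * L ^ (2 * m) * (\<Sum>j\<in>UNIV. norm (w j))\<^sup>2"
        unfolding m_def by (rule jnorm2_le[OF L(1)]) (use ls eigenvalue_norm_le_1 in \<open>auto simp: mean_zero_minimal_def\<close>)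
      ultimately show ?thesis by (simp add: C_def)
    qed
    ultimately have jn: "jnorm2 ls L ((rlazy n ^^ k) w) \<le> (r\<^sup>2) ^ k * C"
      by (meson mult_left_mono order_trans zero_le_power zero_le_power2)
    have "(r\<^sup>2) ^ k \<le> exp (- ?g * C0)"
    proof -
      have "r \<ge> 0"
      proof -
        have "0 \<le> 1 - ?g / n + 2 / n\<^sup>2"
          using eigenvalue_shift_norm[of "hd ls" n] ls ne n0 norm_ge_zero order_trans
          unfolding mean_zero_minimal_def by (metis hd_in_set)
        moreover have "1 / (n * L) \<ge> 0" using n0 L by simp
        ultimately show ?thesis using rb by linarith
      qed
      moreover have "r \<le> exp (- (?g / (2 * n)))" using exp_ge_add_one_self[of "- (?g / (2 * n))"] by (simp add: r_def)
      ultimately have "r ^ (2 * k) \<le> exp (- (?g / (2 * n))) ^ (2 * k)" by (rule power_mono[rotated])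
      also have "\<dots> = exp (- (?g * k / n))" by (simp flip: exp_of_nat_mult)
      also have "\<dots> \<le> exp (- ?g * C0)"
        using k g n0 by (simp add: pos_le_divide_eq mult.assoc)
      finally show ?thesis by (simp add: power_mult)
    qed
    also have "exp (- ?g * C0) \<le> exp (- ln (16 * (real CARD('d))\<^sup>2 * C))" using C0 by simp
    also have "\<dots> = 1 / (16 * (real CARD('d))\<^sup>2 * C)" using C by (simp add: exp_minus inverse_eq_divide)
    finally have "(r\<^sup>2) ^ k * C \<le> 1 / (16 * (real CARD('d))\<^sup>2 * C) * C" using C by (intro mult_right_mono) auto
    also have "\<dots> = (1 / (4 * real CARD('d)))\<^sup>2" using C by (simp add: power2_eq_square)
    finally have "jnorm2 ls L ((rlazy n ^^ k) w) \<le> (1 / (4 * real CARD('d)))\<^sup>2" using jn by simp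
    moreover have "(norm ((rlazy n ^^ k) w J))\<^sup>2 \<le> (\<Sum>j\<in>UNIV. (norm ((rlazy n ^^ k) w j))\<^sup>2)"
      by (rule member_le_sum[of J UNIV "\<lambda>j. (norm ((rlazy n ^^ k) w j))\<^sup>2"]) auto
    moreover have "(\<Sum>j\<in>UNIV. (norm ((rlazy n ^^ k) w j))\<^sup>2) \<le> jnorm2 ls L ((rlazy n ^^ k) w)"
      using L by (intro jnorm2_ge[OF ne]) auto
    ultimately have "(norm ((rlazy n ^^ k) w J))\<^sup>2 \<le> (1 / (4 * real CARD('d)))\<^sup>2" by linarith
    then have nb: "norm ((rlazy n ^^ k) w J) \<le> 1 / (4 * real CARD('d))"
      by (rule power2_le_imp_le) simp
    have "(rlazy n ^^ k) w J = (\<Sum>j\<in>UNIV. (rlazy n ^^ k) w j * of_bool (j = J))"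
      by (simp add: of_bool_def if_distrib cong: if_cong)
    also have "\<dots> = (\<Sum>j\<in>UNIV. w j * (lazy n ^^ k) (\<lambda>j. of_bool (j = J)) j)" by (rule adjoint_rlazy_funpow)
    also have "\<dots> = (lazy n ^^ k) (\<lambda>j. of_bool (j = J)) a - (\<Sum>j\<in>UNIV. (lazy n ^^ k) (\<lambda>j. of_bool (j = J)) j) / of_nat CARD('d)"
      by (simp add: w_def left_diff_distrib sum_subtractf of_bool_def if_distrib[where f = "\<lambda>x. x * _"] flip: sum_divide_distrib cong: if_cong)
    also have "(\<Sum>j\<in>UNIV. (lazy n ^^ k) f j) = (\<Sum>j\<in>UNIV. f j)" for f
      by (induction k) (simp_all add: lazy_def sum.distrib sum_subtractf sum_cop flip: sum_divide_distrib)
    finally show ?thesis using nb by simp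
  qed
  then show ?thesis using C0(1) g by (intro exI[of _ C0] conjI exI[of _ "8 / ?g + 1"] allI impI) (auto intro: add_pos_pos)
qed

end

section \<open>Linear statistics of the chain\<close>

text \<open>The second moment about \<open>a\<close> is the squared bias plus the variance, and the
  variance is at most the second moment about any other point \<open>c\<close>.\<close>

lemma expectation_norm2_shift:
  fixes Z :: "'a \<Rightarrow> complex"
  assumes p: "finite (set_pmf p)"
  shows "measure_pmf.expectation p (\<lambda>x. (norm (Z x - a))\<^sup>2) \<le>
     (norm (measure_pmf.expectation p Z - a))\<^sup>2 + measure_pmf.expectation p (\<lambda>x. (norm (Z x - c))\<^sup>2)"
proof -
  note int = integrable_measure_pmf_finite[OF p]
  have real: "measure_pmf.expectation p (\<lambda>x. (Y x - s)\<^sup>2) =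
     measure_pmf.expectation p (\<lambda>x. (Y x)\<^sup>2) - 2 * s * measure_pmf.expectation p Y + s\<^sup>2" for Y :: "'a \<Rightarrow> real" and s
  proof -
    have "measure_pmf.expectation p (\<lambda>x. (Y x - s)\<^sup>2) = measure_pmf.expectation p (\<lambda>x. (Y x)\<^sup>2 - 2 * s * Y x + s\<^sup>2)"
      by (simp add: power2_diff algebra_simps)
    also have "\<dots> = measure_pmf.expectation p (\<lambda>x. (Y x)\<^sup>2) - 2 * s * measure_pmf.expectation p Y + s\<^sup>2"
      by (simp add: int)
    finally show ?thesis .
  qed
  have cplx: "measure_pmf.expectation p (\<lambda>x. (norm (Z x - s))\<^sup>2) =
     measure_pmf.expectation p (\<lambda>x. (Re (Z x))\<^sup>2) + measure_pmf.expectation p (\<lambda>x. (Im (Z x))\<^sup>2)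
     - (Re (measure_pmf.expectation p Z))\<^sup>2 - (Im (measure_pmf.expectation p Z))\<^sup>2 + (norm (measure_pmf.expectation p Z - s))\<^sup>2" for s
  proof -
    have "measure_pmf.expectation p (\<lambda>x. (norm (Z x - s))\<^sup>2) =
      measure_pmf.expectation p (\<lambda>x. (Re (Z x) - Re s)\<^sup>2) + measure_pmf.expectation p (\<lambda>x. (Im (Z x) - Im s)\<^sup>2)"
      by (simp add: cmod_power2 int)
    also have "measure_pmf.expectation p (\<lambda>x. Re (Z x)) = Re (measure_pmf.expectation p Z)"
      "measure_pmf.expectation p (\<lambda>x. Im (Z x)) = Im (measure_pmf.expectation p Z)"
      by (simp_all add: int)
    note e = this
    have "measure_pmf.expectation p (\<lambda>x. (Re (Z x) - Re s)\<^sup>2) + measure_pmf.expectation p (\<lambda>x. (Im (Z x) - Im s)\<^sup>2) =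
      measure_pmf.expectation p (\<lambda>x. (Re (Z x))\<^sup>2) + measure_pmf.expectation p (\<lambda>x. (Im (Z x))\<^sup>2)
     - (Re (measure_pmf.expectation p Z))\<^sup>2 - (Im (measure_pmf.expectation p Z))\<^sup>2 + (norm (measure_pmf.expectation p Z - s))\<^sup>2"
      unfolding real e by (simp add: cmod_power2 power2_diff)
    with calculation show ?thesis by simp
  qed
  show ?thesis unfolding cplx[of a] cplx[of c] using zero_le_power2[of "norm (measure_pmf.expectation p Z - c)"] by linarith
qed

lemma markov_norm2:
  fixes Z :: "'a \<Rightarrow> complex"
  assumes p: "finite (set_pmf p)" and R: "R > 0"
  shows "measure_pmf.prob p {x. norm (Z x) \<ge> R} \<le> measure_pmf.expectation p (\<lambda>x. (norm (Z x))\<^sup>2) / R\<^sup>2"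
proof -
  note int = integrable_measure_pmf_finite[OF p]
  have "measure_pmf.prob p {x. norm (Z x) \<ge> R} = measure_pmf.expectation p (indicator {x. norm (Z x) \<ge> R})" by simp
  also have "\<dots> \<le> measure_pmf.expectation p (\<lambda>x. (norm (Z x))\<^sup>2 / R\<^sup>2)"
  proof (rule integral_mono[OF int int])
    fix x
    show "indicator {x. norm (Z x) \<ge> R} x \<le> (norm (Z x))\<^sup>2 / R\<^sup>2"
      using R power_mono[of R "norm (Z x)" 2] by (auto simp: indicator_def field_simps)
  qed
  finally show ?thesis by simp
qed

context stack_shuffle
begin

lemma U_sum: "single_ball_matrix \<mu> $ i $ j = (\<Sum>\<sigma>\<in>set_pmf \<mu>. pmf \<mu> \<sigma> * of_bool (\<sigma> i = j))"
proof -
  have "single_ball_matrix \<mu> $ i $ j = measure_pmf.expectation \<mu> (indicator {\<sigma>. \<sigma> i = j})" by (simp add: single_ball_matrix_def)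
  also have "\<dots> = (\<Sum>\<sigma>\<in>set_pmf \<mu>. indicator {\<sigma>. \<sigma> i = j} \<sigma> * pmf \<mu> \<sigma>)"
    by (rule integral_measure_pmf_real[OF finite_set_\<mu>]) auto
  finally show ?thesis by (simp add: indicator_def of_bool_def mult.commute)
qed

sublocale doubly_stochastic "single_ball_matrix \<mu>"
proof
  show "single_ball_matrix \<mu> $ i $ j \<ge> 0" for i j by (simp add: single_ball_matrix_def)
  show "(\<Sum>j\<in>UNIV. single_ball_matrix \<mu> $ i $ j) = 1" for i
  proof -
    have "(\<Sum>j\<in>UNIV. single_ball_matrix \<mu> $ i $ j) = (\<Sum>\<sigma>\<in>set_pmf \<mu>. \<Sum>j\<in>UNIV. pmf \<mu> \<sigma> * of_bool (\<sigma> i = j))"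
      unfolding U_sum by (rule sum.swap)
    also have "\<dots> = (\<Sum>\<sigma>\<in>set_pmf \<mu>. pmf \<mu> \<sigma>)"
      by (simp add: of_bool_def if_distrib cong: if_cong)
    finally show ?thesis using sum_pmf_eq_1[OF finite_set_\<mu> order_refl] by simp
  qed
  show "(\<Sum>i\<in>UNIV. single_ball_matrix \<mu> $ i $ j) = 1" for j
  proof -
    have "(\<Sum>i\<in>UNIV. single_ball_matrix \<mu> $ i $ j) = (\<Sum>\<sigma>\<in>set_pmf \<mu>. \<Sum>i\<in>UNIV. pmf \<mu> \<sigma> * of_bool (\<sigma> i = j))"
      unfolding U_sum by (rule sum.swap)
    also have "\<dots> = (\<Sum>\<sigma>\<in>set_pmf \<mu>. pmf \<mu> \<sigma>)"
    proof (intro sum.cong refl)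
      fix \<sigma> assume "\<sigma> \<in> set_pmf \<mu>"
      then have s: "\<sigma> permutes UNIV" using perm by auto
      have "(\<sigma> i = j) = (i = inv \<sigma> j)" for i using s by (metis permutes_inverses)
      then show "(\<Sum>i\<in>UNIV. pmf \<mu> \<sigma> * of_bool (\<sigma> i = j)) = pmf \<mu> \<sigma>"
        by (simp add: of_bool_def if_distrib cong: if_cong)
    qed
    finally show ?thesis using sum_pmf_eq_1[OF finite_set_\<mu> order_refl] by simp
  qed
qed

section \<open>Card counts by stack\<close>

definition cnt :: "nat set \<Rightarrow> ('d \<Rightarrow> nat list) \<Rightarrow> 'd \<Rightarrow> nat" where
  "cnt B x j = size {#v \<in># mset (x j). v \<in> B#}"

lemma cnt_eq_card:
  assumes "length (x j) = n"
  shows "cnt B x j = card {k. k < n \<and> x j ! k \<in> B}"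
  using assms by (simp add: cnt_def length_filter_conv_card flip: mset_filter)

lemma cnt_move:
  assumes x: "\<And>j. length (x j) = n" and m: "(\<sigma>, p, r) \<in> set_pmf mv"
  shows "complex_of_nat (cnt B (move (\<sigma>, p, r) x) j) =
     of_nat (cnt B x j) - of_bool (x j ! p j \<in> B) + of_bool (x (inv \<sigma> j) ! p (inv \<sigma> j) \<in> B)"
proof -
  have "p j < n" using m by (simp add: set_mv)
  then have "x j ! p j \<in># mset (x j)" using x by simp
  then have mx: "mset (x j) = add_mset (x j ! p j) (mset (x j) - {#x j ! p j#})" by (rule insert_DiffM[symmetric])
  define R where "R = mset (x j) - {#x j ! p j#}"
  have "mset (x j) = add_mset (x j ! p j) R" using mx by (simp only: R_def)
  then have e1: "cnt B x j = size {#v \<in># add_mset (x j ! p j) R. v \<in> B#}" by (simp only: cnt_def)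
  have e2: "cnt B (move (\<sigma>, p, r) x) j = size {#v \<in># add_mset (x (inv \<sigma> j) ! p (inv \<sigma> j)) R. v \<in> B#}"
    unfolding cnt_def mset_move[of x, OF x m] R_def ..
  show ?thesis unfolding e1 e2 by simp
qed

definition stat :: "'d cvec \<Rightarrow> nat set \<Rightarrow> ('d \<Rightarrow> nat list) \<Rightarrow> complex" where
  "stat f B x = (\<Sum>j\<in>UNIV. f j * of_nat (cnt B x j))"

lemma stat_move:
  assumes x: "\<And>j. length (x j) = n" and m: "(\<sigma>, p, r) \<in> set_pmf mv"
  shows "stat f B (move (\<sigma>, p, r) x) = stat f B x + (\<Sum>i\<in>UNIV. (f (\<sigma> i) - f i) * of_bool (x i ! p i \<in> B))"
proof -
  have s: "\<sigma> permutes UNIV" using perm m by (auto simp: set_mv)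
  have "(\<Sum>j\<in>UNIV. f j * of_bool (x (inv \<sigma> j) ! p (inv \<sigma> j) \<in> B)) =
      (\<Sum>i\<in>UNIV. f (\<sigma> i) * of_bool (x i ! p i \<in> B))"
    using sum.permute[OF s, of "\<lambda>j. f j * of_bool (x (inv \<sigma> j) ! p (inv \<sigma> j) \<in> B)"] s
    by (simp add: o_def permutes_inverses)
  then show ?thesis
    by (simp add: stat_def cnt_move[of x, OF x m] algebra_simps sum.distrib sum_subtractf)
qed

lemma expectation_mv:
  fixes F :: "_ \<Rightarrow> 'b :: {banach, second_countable_topology}"
  shows "measure_pmf.expectation mv F = measure_pmf.expectation \<mu> (\<lambda>\<sigma>. measure_pmf.expectation (rand_pos n) (\<lambda>p.
      measure_pmf.expectation (rand_pos n) (\<lambda>r. F (\<sigma>, p, r))))"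
proof -
  have fin: "finite (set_pmf (rand_pos n :: ('d \<Rightarrow> nat) pmf))" by (simp add: set_rand_pos n_pos finite_positions)
  show ?thesis
    unfolding mv_def pair_pmf_def using fin finite_set_\<mu>
    by (simp add: expectation_bind_finite)
qed

lemma expectation_rand_pos:
  fixes b :: "nat \<Rightarrow> 'b :: {banach, second_countable_topology}"
  shows "measure_pmf.expectation (rand_pos n) (\<lambda>p. b (p (i :: 'd))) = (\<Sum>k<n. b k) /\<^sub>R n"
proof -
  have "measure_pmf.expectation (rand_pos n) (\<lambda>p. b (p i)) = measure_pmf.expectation (map_pmf (\<lambda>p. p i) (rand_pos n)) b"
    by simp
  also have "\<dots> = measure_pmf.expectation (pmf_of_set {..<n}) b" by (simp only: rand_pos_component)
  also have "\<dots> = (\<Sum>k<n. pmf (pmf_of_set {..<n}) k *\<^sub>R b k)"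
    using n_pos by (intro integral_measure_pmf) (auto simp: set_pmf_of_set lessThan_empty_iff)
  also have "\<dots> = (\<Sum>k<n. b k) /\<^sub>R n"
    using n_pos by (simp add: pmf_of_set lessThan_empty_iff scaleR_sum_right inverse_eq_divide)
  finally show ?thesis .
qed

lemma expectation_draw:
  fixes a :: "('d \<Rightarrow> 'd) \<Rightarrow> complex"
  shows "measure_pmf.expectation mv (\<lambda>m. a (fst m) * b (fst (snd m) i)) = measure_pmf.expectation \<mu> a * (\<Sum>k<n. b k) / of_nat n"
proof -
  have "measure_pmf.expectation mv (\<lambda>m. a (fst m) * b (fst (snd m) i)) =
    measure_pmf.expectation \<mu> (\<lambda>\<sigma>. a \<sigma> * measure_pmf.expectation (rand_pos n) (\<lambda>p. b (p i)))"
    by (simp add: expectation_mv)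
  also have "\<dots> = measure_pmf.expectation \<mu> a * ((\<Sum>k<n. b k) / of_nat n)"
    by (simp add: expectation_rand_pos scaleR_conv_of_real divide_inverse mult.commute)
  finally show ?thesis by simp
qed

lemma expectation_jump: "measure_pmf.expectation \<mu> (\<lambda>\<sigma>. f (\<sigma> i)) = cop f i"
proof -
  have "measure_pmf.expectation \<mu> (\<lambda>\<sigma>. f (\<sigma> i)) = (\<Sum>\<sigma>\<in>set_pmf \<mu>. pmf \<mu> \<sigma> *\<^sub>R f (\<sigma> i))"
    by (rule integral_measure_pmf[OF finite_set_\<mu>]) auto
  also have "\<dots> = (\<Sum>\<sigma>\<in>set_pmf \<mu>. \<Sum>j\<in>UNIV. of_real (pmf \<mu> \<sigma> * of_bool (\<sigma> i = j)) * f j)"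
  proof (intro sum.cong refl)
    fix \<sigma>
    have "(\<Sum>j\<in>UNIV. of_real (pmf \<mu> \<sigma> * of_bool (\<sigma> i = j)) * f j) = (\<Sum>j\<in>UNIV. if \<sigma> i = j then of_real (pmf \<mu> \<sigma>) * f j else 0)"
      by (intro sum.cong) auto
    then show "pmf \<mu> \<sigma> *\<^sub>R f (\<sigma> i) = (\<Sum>j\<in>UNIV. of_real (pmf \<mu> \<sigma> * of_bool (\<sigma> i = j)) * f j)"
      by (simp add: scaleR_conv_of_real)
  qed
  also have "\<dots> = (\<Sum>j\<in>UNIV. \<Sum>\<sigma>\<in>set_pmf \<mu>. of_real (pmf \<mu> \<sigma> * of_bool (\<sigma> i = j)) * f j)" by (rule sum.swap)
  also have "\<dots> = cop f i" by (simp only: cop_def U_sum of_real_sum sum_distrib_right)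
  finally show ?thesis .
qed

text \<open>The conditional mean of a linear statistic is again one, with \<open>f\<close> replaced
  by \<open>lazy n f\<close>. This closure lets moments be iterated over time.\<close>

lemma stat_step_mean:
  assumes x: "x \<in> X"
  shows "measure_pmf.expectation (K x) (stat f B) = stat (lazy n f) B x"
proof -
  note lx = arrangements_length[OF x]
  note int = integrable_measure_pmf_finite[OF finite_set_mv]
  have "measure_pmf.expectation (K x) (stat f B) = measure_pmf.expectation mv (\<lambda>m. stat f B (move m x))"
    by (simp add: K_eq)
  also have "\<dots> = measure_pmf.expectation mv (\<lambda>m. stat f B x + (\<Sum>i\<in>UNIV. (f (fst m i) - f i) * of_bool (x i ! (fst (snd m) i) \<in> B)))"
  proof (intro integral_cong_AE AE_pmfI)
    fix m assume "m \<in> set_pmf mv"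
    then show "stat f B (move m x) = stat f B x + (\<Sum>i\<in>UNIV. (f (fst m i) - f i) * of_bool (x i ! (fst (snd m) i) \<in> B))"
      using stat_move[of x, OF lx] by (cases m) auto
  qed auto
  also have "\<dots> = stat f B x + (\<Sum>i\<in>UNIV. measure_pmf.expectation mv (\<lambda>m. (f (fst m i) - f i) * of_bool (x i ! (fst (snd m) i) \<in> B)))"
    by (subst Bochner_Integration.integral_add[OF int int], subst Bochner_Integration.integral_sum[OF int]) simp
  also have "\<dots> = stat f B x + (\<Sum>i\<in>UNIV. (cop f i - f i) * of_nat (cnt B x i) / of_nat n)"
  proof -
    have "measure_pmf.expectation mv (\<lambda>m. (f (fst m i) - f i) * of_bool (x i ! (fst (snd m) i) \<in> B)) =
        (cop f i - f i) * of_nat (cnt B x i) / of_nat n" for i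
    proof -
      have "(\<Sum>k<n. of_bool (x i ! k \<in> B) :: complex) = of_nat (cnt B x i)"
      proof -
        have "(\<Sum>k<n. of_bool (x i ! k \<in> B) :: complex) = of_nat (card ({..<n} \<inter> {k. x i ! k \<in> B}))"
          by (simp add: of_bool_def sum.If_cases)
        also have "{..<n} \<inter> {k. x i ! k \<in> B} = {k. k < n \<and> x i ! k \<in> B}" by auto
        finally show ?thesis using cnt_eq_card[of x i B, OF lx] by simp
      qed
      moreover have "measure_pmf.expectation \<mu> (\<lambda>\<sigma>. f (\<sigma> i) - f i) = cop f i - f i"
        by (subst Bochner_Integration.integral_diff[OF integrable_measure_pmf_finite integrable_measure_pmf_finite])
           (simp_all add: finite_set_\<mu> expectation_jump)
      ultimately show ?thesis
        using expectation_draw[of "\<lambda>\<sigma>. f (\<sigma> i) - f i" "\<lambda>k. of_bool (x i ! k \<in> B)" i] by simp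
    qed
    then show ?thesis by simp
  qed
  also have "\<dots> = stat (lazy n f) B x"
    by (simp add: stat_def lazy_def distrib_right sum.distrib)
  finally show ?thesis .
qed

lemma stat_increment:
  fixes F :: real
  assumes x: "x \<in> X" and f: "\<And>j. norm (f j) \<le> F" and m: "m \<in> set_pmf mv"
  shows "norm (stat f B (move m x) - stat f B x) \<le> 2 * CARD('d) * F"
proof -
  note lx = arrangements_length[OF x]
  obtain \<sigma> p r where me: "m = (\<sigma>, p, r)" by (cases m) auto
  have "norm (stat f B (move m x) - stat f B x) = norm (\<Sum>i\<in>UNIV. (f (\<sigma> i) - f i) * of_bool (x i ! p i \<in> B))"
    using stat_move[of x, OF lx m[unfolded me], of f B] by (simp add: me)
  also have "\<dots> \<le> (\<Sum>i\<in>UNIV. norm ((f (\<sigma> i) - f i) * of_bool (x i ! p i \<in> B)))" by (rule norm_sum)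
  also have "\<dots> \<le> (\<Sum>i\<in>(UNIV :: 'd set). 2 * F)"
  proof (rule sum_mono)
    fix i
    have "norm (f (\<sigma> i) - f i) \<le> 2 * F" using norm_triangle_ineq4[of "f (\<sigma> i)" "f i"] f[of "\<sigma> i"] f[of i] by linarith
    moreover have "F \<ge> 0" using f[of i] norm_ge_zero order_trans by blast
    ultimately show "norm ((f (\<sigma> i) - f i) * of_bool (x i ! p i \<in> B)) \<le> 2 * F" by (simp add: norm_mult of_bool_def)
  qed
  finally show ?thesis by simp
qed

lemma stat_step_deviation:
  fixes F :: real
  assumes x: "x \<in> X" and f: "\<And>j. norm (f j) \<le> F"
  shows "measure_pmf.expectation (K x) (\<lambda>y. (norm (stat f B y - a))\<^sup>2) \<le>
     (norm (stat (lazy n f) B x - a))\<^sup>2 + (2 * CARD('d) * F)\<^sup>2"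
proof -
  have "measure_pmf.expectation (K x) (\<lambda>y. (norm (stat f B y - a))\<^sup>2) \<le>
     (norm (measure_pmf.expectation (K x) (stat f B) - a))\<^sup>2 + measure_pmf.expectation (K x) (\<lambda>y. (norm (stat f B y - stat f B x))\<^sup>2)"
    by (rule expectation_norm2_shift[OF finite_set_K])
  also have "measure_pmf.expectation (K x) (\<lambda>y. (norm (stat f B y - stat f B x))\<^sup>2) \<le> measure_pmf.expectation (K x) (\<lambda>_. (2 * CARD('d) * F)\<^sup>2)"
  proof (intro integral_mono_AE integrable_measure_pmf_finite finite_set_K AE_pmfI)
    fix y assume "y \<in> set_pmf (K x)"
    then obtain m where m: "m \<in> set_pmf mv" "y = move m x" by (auto simp: K_eq)
    show "(norm (stat f B y - stat f B x))\<^sup>2 \<le> (2 * CARD('d) * F)\<^sup>2"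
      unfolding m(2) by (intro power_mono stat_increment[OF x f m(1)]) auto
  qed
  finally show ?thesis by (simp add: stat_step_mean[OF x])
qed

text \<open>Induction that peels off the last step. The step with \<open>s\<close> steps still to
  follow adds the variance of the statistic whose coefficients are evolved \<open>s\<close> times,
  so a decay of \<open>F\<close> bounds the sum uniformly in \<open>k\<close>.\<close>

lemma stat_law_deviation:
  fixes F :: "nat \<Rightarrow> real"
  assumes x: "x \<in> X" and f: "\<And>s j. norm ((lazy n ^^ s) f j) \<le> F s"
  shows "measure_pmf.expectation (law k x) (\<lambda>y. (norm (stat f B y - stat ((lazy n ^^ k) f) B x))\<^sup>2) \<le>
     (\<Sum>s<k. (2 * CARD('d) * F s)\<^sup>2)"
  using f
proof (induction k arbitrary: f F)
  case (Suc k)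
  let ?a = "stat ((lazy n ^^ Suc k) f) B x"
  have "measure_pmf.expectation (law (Suc k) x) (\<lambda>y. (norm (stat f B y - ?a))\<^sup>2) =
    measure_pmf.expectation (law k x) (\<lambda>y. measure_pmf.expectation (K y) (\<lambda>z. (norm (stat f B z - ?a))\<^sup>2))"
    by (simp add: expectation_bind_finite[OF finite_set_law finite_set_K])
  also have "\<dots> \<le> measure_pmf.expectation (law k x) (\<lambda>y. (norm (stat (lazy n f) B y - ?a))\<^sup>2 + (2 * CARD('d) * F 0)\<^sup>2)"
  proof (intro integral_mono_AE integrable_measure_pmf_finite finite_set_law AE_pmfI)
    fix y assume "y \<in> set_pmf (law k x)"
    then have "y \<in> X" using set_law[OF x] by blast
    then show "measure_pmf.expectation (K y) (\<lambda>z. (norm (stat f B z - ?a))\<^sup>2) \<le> (norm (stat (lazy n f) B y - ?a))\<^sup>2 + (2 * CARD('d) * F 0)\<^sup>2"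
      by (rule stat_step_deviation) (use Suc.prems[of 0] in simp)
  qed
  also have "\<dots> = measure_pmf.expectation (law k x) (\<lambda>y. (norm (stat (lazy n f) B y - stat ((lazy n ^^ k) (lazy n f)) B x))\<^sup>2) + (2 * CARD('d) * F 0)\<^sup>2"
    by (simp add: integrable_measure_pmf_finite finite_set_law funpow_swap1)
  also have "\<dots> \<le> (\<Sum>s<k. (2 * CARD('d) * F (Suc s))\<^sup>2) + (2 * CARD('d) * F 0)\<^sup>2"
  proof (intro add_right_mono Suc.IH)
    show "norm ((lazy n ^^ s) (lazy n f) j) \<le> F (Suc s)" for s j
      using Suc.prems[of "Suc s" j] by (simp add: funpow_swap1)
  qed
  also have "\<dots> = (\<Sum>s<Suc k. (2 * CARD('d) * F s)\<^sup>2)"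
    by (subst sum.lessThan_Suc_shift) simp
  finally show ?case .
qed simp

end

section \<open>Coupling of the colour counts\<close>

lemma linear_op_representation:
  fixes A :: "('d::finite) cvec \<Rightarrow> 'd cvec"
  assumes A: "linear_op A"
  shows "A w j = (\<Sum>a\<in>UNIV. w a * A (\<lambda>i. of_bool (i = a)) j)"
proof -
  have "A (\<lambda>j. \<Sum>a\<in>S. w a * of_bool (j = a)) j = (\<Sum>a\<in>S. w a * A (\<lambda>i. of_bool (i = a)) j)" if "finite S" for S
    using that
  proof (induction S)
    case empty
    then show ?case by (simp add: linear_op_zero[OF A])
  next
    case (insert a S)
    have "(\<lambda>j. \<Sum>b\<in>insert a S. w b * of_bool (j = b)) = (\<lambda>j. w a * of_bool (j = a) + 1 * (\<Sum>b\<in>S. w b * of_bool (j = b)))"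
      by (simp only: sum.insert[OF insert.hyps] mult_1)
    then show ?case using insert by (simp only: linear_opD[OF A]) simp
  qed
  from this[of UNIV] show ?thesis by (simp add: of_bool_def if_distrib cong: if_cong)
qed

lemma expectation_linear_op:
  fixes A :: "('d::finite) cvec \<Rightarrow> 'd cvec"
  assumes A: "linear_op A" and p: "finite (set_pmf p)"
  shows "measure_pmf.expectation p (\<lambda>m. A (w m) j) = A (\<lambda>i. measure_pmf.expectation p (\<lambda>m. w m i)) j"
proof -
  note int = integrable_measure_pmf_finite[OF p]
  have "measure_pmf.expectation p (\<lambda>m. A (w m) j) = measure_pmf.expectation p (\<lambda>m. \<Sum>a\<in>UNIV. w m a * A (\<lambda>i. of_bool (i = a)) j)"
    by (subst linear_op_representation[OF A]) simp
  also have "\<dots> = (\<Sum>a\<in>UNIV. measure_pmf.expectation p (\<lambda>m. w m a) * A (\<lambda>i. of_bool (i = a)) j)"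
    by (subst Bochner_Integration.integral_sum[OF int]) (simp add: int)
  also have "\<dots> = A (\<lambda>i. measure_pmf.expectation p (\<lambda>m. w m i)) j"
    by (rule linear_op_representation[OF A, symmetric])
  finally show ?thesis .
qed

lemma expectation_sqrt_le:
  assumes p: "finite (set_pmf p)" and N: "\<And>x. N x \<ge> (0::real)"
  shows "measure_pmf.expectation p (\<lambda>x. sqrt (N x)) \<le> sqrt (measure_pmf.expectation p N)"
proof (rule real_le_rsqrt)
  note int = integrable_measure_pmf_finite[OF p]
  define e where "e = measure_pmf.expectation p (\<lambda>x. sqrt (N x))"
  have "0 \<le> measure_pmf.expectation p (\<lambda>x. (sqrt (N x) - e)\<^sup>2)" by (rule integral_nonneg_AE) auto
  also have "\<dots> = measure_pmf.expectation p (\<lambda>x. N x - 2 * e * sqrt (N x) + e\<^sup>2)"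
    using N by (intro Bochner_Integration.integral_cong refl) (simp add: power2_diff)
  also have "\<dots> = measure_pmf.expectation p N - 2 * e * e + e\<^sup>2"
    by (simp add: int e_def)
  finally show "e\<^sup>2 \<le> measure_pmf.expectation p N" by (simp add: power2_eq_square)
qed

context stack_shuffle
begin

text \<open>Both copies use the same permutation and the same insertion positions; \<open>match\<close> pairs the positions of
  stack \<open>j\<close> so that as few pairs as possible carry different colours.\<close>

definition match :: "(nat \<Rightarrow> 'd) \<Rightarrow> ('d \<Rightarrow> nat list) \<Rightarrow> ('d \<Rightarrow> nat list) \<Rightarrow> 'd \<Rightarrow> nat \<Rightarrow> nat" where
  "match \<kappa> x y j = (SOME \<theta>. bij_betw \<theta> {..<n} {..<n} \<and>
    card {p. p < n \<and> \<kappa> (x j ! p) \<noteq> \<kappa> (y j ! \<theta> p)} \<le> size (mset (map \<kappa> (x j)) - mset (map \<kappa> (y j))))"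

definition rematch :: "(nat \<Rightarrow> 'd) \<Rightarrow> ('d \<Rightarrow> nat list) \<Rightarrow> ('d \<Rightarrow> nat list) \<Rightarrow>
    ('d \<Rightarrow> 'd) \<times> ('d \<Rightarrow> nat) \<times> ('d \<Rightarrow> nat) \<Rightarrow> ('d \<Rightarrow> 'd) \<times> ('d \<Rightarrow> nat) \<times> ('d \<Rightarrow> nat)" where
  "rematch \<kappa> x y m = (fst m, (\<lambda>i. match \<kappa> x y i (fst (snd m) i)), snd (snd m))"

definition pair_step :: "(nat \<Rightarrow> 'd) \<Rightarrow> ('d \<Rightarrow> nat list) \<times> ('d \<Rightarrow> nat list) \<Rightarrow> (('d \<Rightarrow> nat list) \<times> ('d \<Rightarrow> nat list)) pmf" where
  "pair_step \<kappa> z = map_pmf (\<lambda>m. (move m (fst z), move (rematch \<kappa> (fst z) (snd z) m) (snd z))) mv"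

primrec pair_law :: "(nat \<Rightarrow> 'd) \<Rightarrow> nat \<Rightarrow> ('d \<Rightarrow> nat list) \<times> ('d \<Rightarrow> nat list) \<Rightarrow> (('d \<Rightarrow> nat list) \<times> ('d \<Rightarrow> nat list)) pmf" where
  "pair_law \<kappa> 0 z = return_pmf z"
| "pair_law \<kappa> (Suc k) z = bind_pmf (pair_law \<kappa> k z) (pair_step \<kappa>)"

lemma match_props:
  assumes "x \<in> X" "y \<in> X"
  shows "bij_betw (match \<kappa> x y j) {..<n} {..<n}"
    and "card {p. p < n \<and> \<kappa> (x j ! p) \<noteq> \<kappa> (y j ! match \<kappa> x y j p)} \<le> size (mset (map \<kappa> (x j)) - mset (map \<kappa> (y j)))"
  using someI_ex[OF colour_matching_exists[of "x j" n "y j" \<kappa>]] assms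
  unfolding match_def by (simp_all add: arrangements_length)

lemma map_rematch: "x \<in> X \<Longrightarrow> y \<in> X \<Longrightarrow> map_pmf (rematch \<kappa> x y) mv = mv"
  using mv_permute_draws[of "match \<kappa> x y"] match_props(1) by (simp add: rematch_def[abs_def])

lemma rematch_mv: "x \<in> X \<Longrightarrow> y \<in> X \<Longrightarrow> m \<in> set_pmf mv \<Longrightarrow> rematch \<kappa> x y m \<in> set_pmf mv"
  using map_rematch[of x y \<kappa>] by (metis imageI set_map_pmf)

lemma pair_step_marginals:
  assumes "fst z \<in> X" "snd z \<in> X"
  shows "map_pmf fst (pair_step \<kappa> z) = K (fst z)" "map_pmf snd (pair_step \<kappa> z) = K (snd z)"
proof -
  show "map_pmf fst (pair_step \<kappa> z) = K (fst z)" by (simp add: pair_step_def map_pmf_comp K_eq)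
  have "map_pmf snd (pair_step \<kappa> z) = map_pmf (\<lambda>m. move m (snd z)) (map_pmf (rematch \<kappa> (fst z) (snd z)) mv)"
    by (simp add: pair_step_def map_pmf_comp)
  then show "map_pmf snd (pair_step \<kappa> z) = K (snd z)" using map_rematch[OF assms] by (simp add: K_eq)
qed

lemma set_pair_step: "fst z \<in> X \<Longrightarrow> snd z \<in> X \<Longrightarrow> set_pmf (pair_step \<kappa> z) \<subseteq> X \<times> X"
  by (auto simp: pair_step_def intro!: move_arrangement rematch_mv)

lemma set_pair_law: "fst z \<in> X \<Longrightarrow> snd z \<in> X \<Longrightarrow> set_pmf (pair_law \<kappa> k z) \<subseteq> X \<times> X"
proof (induction k)
  case 0
  then show ?case by (cases z) auto
next
  case (Suc k)
  show ?case
  proof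
    fix w assume "w \<in> set_pmf (pair_law \<kappa> (Suc k) z)"
    then obtain v where v: "v \<in> set_pmf (pair_law \<kappa> k z)" "w \<in> set_pmf (pair_step \<kappa> v)" by auto
    then have "fst v \<in> X" "snd v \<in> X" using Suc by auto
    then show "w \<in> X \<times> X" using set_pair_step v(2) by blast
  qed
qed

lemma finite_pair_step: "finite (set_pmf (pair_step \<kappa> z))"
  by (simp add: pair_step_def finite_set_mv)

lemma finite_pair_law: "finite (set_pmf (pair_law \<kappa> k z))"
  by (induction k) (auto simp: finite_pair_step)

lemma pair_law_marginals:
  assumes z: "fst z \<in> X" "snd z \<in> X"
  shows "map_pmf fst (pair_law \<kappa> k z) = law k (fst z) \<and> map_pmf snd (pair_law \<kappa> k z) = law k (snd z)"
proof (induction k)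
  case (Suc k)
  have in_X: "fst v \<in> X" "snd v \<in> X" if "v \<in> set_pmf (pair_law \<kappa> k z)" for v
    using subsetD[OF set_pair_law[OF z] that] by (simp_all add: mem_Times_iff)
  have "map_pmf fst (pair_law \<kappa> (Suc k) z) = bind_pmf (pair_law \<kappa> k z) (\<lambda>v. K (fst v))"
    unfolding pair_law.simps map_bind_pmf by (intro bind_pmf_cong refl pair_step_marginals in_X)
  also have "\<dots> = law (Suc k) (fst z)" using Suc by (simp add: bind_map_pmf flip: conjunct1[OF Suc])
  finally have 1: "map_pmf fst (pair_law \<kappa> (Suc k) z) = law (Suc k) (fst z)" .
  have "map_pmf snd (pair_law \<kappa> (Suc k) z) = bind_pmf (pair_law \<kappa> k z) (\<lambda>v. K (snd v))"
    unfolding pair_law.simps map_bind_pmf by (intro bind_pmf_cong refl pair_step_marginals in_X)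
  also have "\<dots> = law (Suc k) (snd z)" by (simp add: bind_map_pmf flip: conjunct2[OF Suc])
  finally show ?case using 1 by simp
qed simp

section \<open>Colour counts of two copies\<close>

definition colour_cnt :: "(nat \<Rightarrow> 'd) \<Rightarrow> 'd \<Rightarrow> ('d \<Rightarrow> nat list) \<Rightarrow> 'd \<Rightarrow> nat" where
  "colour_cnt \<kappa> i x j = cnt {v. \<kappa> v = i} x j"

lemma colour_cnt_contents: "colour_cnt \<kappa> i x j = count (contents \<kappa> x j) i"
proof -
  have "size {#v \<in># A. \<kappa> v = i#} = count (image_mset \<kappa> A) i" for A :: "nat multiset"
    by (induction A) auto
  then show ?thesis by (simp add: colour_cnt_def cnt_def contents_def)
qed

lemma sum_colour_cnt: "x \<in> X \<Longrightarrow> (\<Sum>i\<in>UNIV. colour_cnt \<kappa> i x j) = n"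
proof -
  assume x: "x \<in> X"
  have "size A = (\<Sum>i\<in>UNIV. count A i)" for A :: "'d multiset"
    by (simp add: size_multiset_overloaded_eq) (rule sum.mono_neutral_left, auto simp: not_in_iff)
  from this[of "contents \<kappa> x j"] show ?thesis using x by (simp add: colour_cnt_contents contents_def arrangements_length)
qed

lemma colour_cnt_le: "x \<in> X \<Longrightarrow> colour_cnt \<kappa> i x j \<le> n"
  using member_le_sum[of i UNIV "\<lambda>i. colour_cnt \<kappa> i x j"] sum_colour_cnt[of x \<kappa> j] by simp

definition delta :: "(nat \<Rightarrow> 'd) \<Rightarrow> 'd \<Rightarrow> ('d \<Rightarrow> nat list) \<times> ('d \<Rightarrow> nat list) \<Rightarrow> 'd \<Rightarrow> complex" where
  "delta \<kappa> i z j = of_nat (colour_cnt \<kappa> i (fst z) j) - of_nat (colour_cnt \<kappa> i (snd z) j)"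

definition discrepancy :: "(nat \<Rightarrow> 'd) \<Rightarrow> ('d \<Rightarrow> nat list) \<times> ('d \<Rightarrow> nat list) \<Rightarrow> real" where
  "discrepancy \<kappa> z = (\<Sum>i\<in>UNIV. \<Sum>j\<in>UNIV. norm (delta \<kappa> i z j))"

lemma norm_delta: "norm (delta \<kappa> i z j) = \<bar>real (colour_cnt \<kappa> i (fst z) j) - real (colour_cnt \<kappa> i (snd z) j)\<bar>"
proof -
  have "delta \<kappa> i z j = of_real (real (colour_cnt \<kappa> i (fst z) j) - real (colour_cnt \<kappa> i (snd z) j))"
    by (simp add: delta_def)
  then show ?thesis by (simp only: norm_of_real)
qed

lemma mismatch_card_le:
  assumes x: "x \<in> X" and y: "y \<in> X"
  shows "real (card {p. p < n \<and> \<kappa> (x j ! p) \<noteq> \<kappa> (y j ! match \<kappa> x y j p)}) \<le> (\<Sum>i\<in>UNIV. norm (delta \<kappa> i (x, y) j))"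
proof -
  let ?A = "mset (map \<kappa> (x j))" and ?B = "mset (map \<kappa> (y j))"
  have "size (?A - ?B) = (\<Sum>i\<in>UNIV. count (?A - ?B) i)"
    by (simp add: size_multiset_overloaded_eq) (rule sum.mono_neutral_left, auto simp: not_in_iff)
  then have "real (size (?A - ?B)) = (\<Sum>i\<in>UNIV. real (count ?A i - count ?B i))" by simp
  also have "\<dots> \<le> (\<Sum>i\<in>UNIV. norm (delta \<kappa> i (x, y) j))"
  proof (rule sum_mono)
    fix i
    have "count ?A i = colour_cnt \<kappa> i x j" "count ?B i = colour_cnt \<kappa> i y j"
      by (simp_all add: colour_cnt_contents contents_def)
    then show "real (count ?A i - count ?B i) \<le> norm (delta \<kappa> i (x, y) j)" by (simp add: norm_delta)
  qed
  finally show ?thesis using match_props(2)[OF x y, of \<kappa> j] by linarith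
qed

definition mismatch :: "(nat \<Rightarrow> 'd) \<Rightarrow> ('d \<Rightarrow> nat list) \<Rightarrow> ('d \<Rightarrow> nat list) \<Rightarrow>
    ('d \<Rightarrow> 'd) \<times> ('d \<Rightarrow> nat) \<times> ('d \<Rightarrow> nat) \<Rightarrow> 'd \<Rightarrow> real" where
  "mismatch \<kappa> x y m s = of_bool (\<kappa> (x s ! fst (snd m) s) \<noteq> \<kappa> (y s ! match \<kappa> x y s (fst (snd m) s)))"

text \<open>Matched draws differ in colour with a probability proportional to the present difference
  of the counts. The noise of the coupling therefore fades together with the difference.\<close>

lemma expectation_mismatch:
  assumes x: "x \<in> X" and y: "y \<in> X"
  shows "measure_pmf.expectation mv (\<lambda>m. mismatch \<kappa> x y m s) \<le> (\<Sum>i\<in>UNIV. norm (delta \<kappa> i (x, y) s)) / n"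
proof -
  have "measure_pmf.expectation mv (\<lambda>m. mismatch \<kappa> x y m s) =
    (\<Sum>k<n. of_bool (\<kappa> (x s ! k) \<noteq> \<kappa> (y s ! match \<kappa> x y s k))) /\<^sub>R n"
    unfolding mismatch_def expectation_mv
    using expectation_rand_pos[of "\<lambda>k. of_bool (\<kappa> (x s ! k) \<noteq> \<kappa> (y s ! match \<kappa> x y s k)) :: real" s] by simp
  also have "(\<Sum>k<n. of_bool (\<kappa> (x s ! k) \<noteq> \<kappa> (y s ! match \<kappa> x y s k)) :: real) =
      card {p. p < n \<and> \<kappa> (x s ! p) \<noteq> \<kappa> (y s ! match \<kappa> x y s p)}"
  proof -
    have "(\<Sum>k<n. of_bool (\<kappa> (x s ! k) \<noteq> \<kappa> (y s ! match \<kappa> x y s k)) :: real) =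
      card ({..<n} \<inter> {k. \<kappa> (x s ! k) \<noteq> \<kappa> (y s ! match \<kappa> x y s k)})"
      by (simp add: of_bool_def sum.If_cases)
    also have "{..<n} \<inter> {k. \<kappa> (x s ! k) \<noteq> \<kappa> (y s ! match \<kappa> x y s k)} = {p. p < n \<and> \<kappa> (x s ! p) \<noteq> \<kappa> (y s ! match \<kappa> x y s p)}"
      by auto
    finally show ?thesis .
  qed
  finally show ?thesis using mismatch_card_le[OF x y, of \<kappa> s] n_pos by (simp add: divide_inverse_commute mult_left_mono)
qed

text \<open>Rematching preserves the law of the choices, so each copy alone moves like the chain and
  the mean difference follows the linear evolution.\<close>

lemma delta_step_mean:
  assumes x: "x \<in> X" and y: "y \<in> X"
  shows "measure_pmf.expectation mv (\<lambda>m. delta \<kappa> i (move m x, move (rematch \<kappa> x y m) y) J) = rlazy n (delta \<kappa> i (x, y)) J"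
proof -
  note int = integrable_measure_pmf_finite[OF finite_set_mv]
  let ?C = "{v. \<kappa> v = i}"
  have st: "of_nat (colour_cnt \<kappa> i v J) = stat (\<lambda>j. of_bool (j = J)) ?C v" for v
    by (simp add: stat_def colour_cnt_def of_bool_def if_distrib[where f = "\<lambda>x. x * _"] cong: if_cong)
  have mean: "measure_pmf.expectation (K v) (\<lambda>v. of_nat (colour_cnt \<kappa> i v J)) = (rlazy n (\<lambda>j. of_nat (colour_cnt \<kappa> i v j)) J :: complex)" if v: "v \<in> X" for v
  proof -
    have "measure_pmf.expectation (K v) (\<lambda>v. of_nat (colour_cnt \<kappa> i v J)) = stat (lazy n (\<lambda>j. of_bool (j = J))) ?C v"
      unfolding st by (rule stat_step_mean[OF v])
    also have "\<dots> = (\<Sum>j\<in>UNIV. of_nat (colour_cnt \<kappa> i v j) * lazy n (\<lambda>j. of_bool (j = J)) j)"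
      by (simp add: stat_def colour_cnt_def mult.commute)
    also have "\<dots> = (\<Sum>j\<in>UNIV. rlazy n (\<lambda>j. of_nat (colour_cnt \<kappa> i v j)) j * of_bool (j = J))"
      by (rule adjoint_rlazy[symmetric])
    finally show ?thesis by (simp add: of_bool_def if_distrib cong: if_cong)
  qed
  have "measure_pmf.expectation mv (\<lambda>m. delta \<kappa> i (move m x, move (rematch \<kappa> x y m) y) J) =
     measure_pmf.expectation mv (\<lambda>m. of_nat (colour_cnt \<kappa> i (move m x) J)) - measure_pmf.expectation mv (\<lambda>m. of_nat (colour_cnt \<kappa> i (move (rematch \<kappa> x y m) y) J))"
    unfolding delta_def fst_conv snd_conv by (rule Bochner_Integration.integral_diff[OF int int])
  also have "measure_pmf.expectation mv (\<lambda>m. of_nat (colour_cnt \<kappa> i (move (rematch \<kappa> x y m) y) J)) =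
     measure_pmf.expectation (map_pmf (rematch \<kappa> x y) mv) (\<lambda>m. complex_of_nat (colour_cnt \<kappa> i (move m y) J))"
    by simp
  also have "\<dots> = measure_pmf.expectation mv (\<lambda>m. of_nat (colour_cnt \<kappa> i (move m y) J))"
    by (simp only: map_rematch[OF x y])
  also have "\<dots> = measure_pmf.expectation (K y) (\<lambda>v. of_nat (colour_cnt \<kappa> i v J))" by (simp add: K_eq)
  also have "measure_pmf.expectation mv (\<lambda>m. complex_of_nat (colour_cnt \<kappa> i (move m x) J)) = measure_pmf.expectation (K x) (\<lambda>v. of_nat (colour_cnt \<kappa> i v J))"
    by (simp add: K_eq)
  finally have E: "measure_pmf.expectation mv (\<lambda>m. delta \<kappa> i (move m x, move (rematch \<kappa> x y m) y) J) =
      rlazy n (\<lambda>j. of_nat (colour_cnt \<kappa> i x j)) J - rlazy n (\<lambda>j. of_nat (colour_cnt \<kappa> i y j)) J"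
    unfolding mean[OF x] mean[OF y] .
  have "rop (delta \<kappa> i (x, y)) = (\<lambda>j. rop (\<lambda>j. of_nat (colour_cnt \<kappa> i x j)) j - rop (\<lambda>j. of_nat (colour_cnt \<kappa> i y j)) j)"
    using linear_op_diff[OF linear_rop, of "\<lambda>j. of_nat (colour_cnt \<kappa> i x j)" 1 "\<lambda>j. of_nat (colour_cnt \<kappa> i y j)"]
    by (simp add: delta_def[abs_def])
  then show ?thesis unfolding E rlazy_def by (simp add: delta_def add_divide_distrib diff_divide_distrib)
qed

text \<open>Only mismatched draws change the difference; each of them counts once at its source and
  once at its target.\<close>

lemma delta_increment:
  assumes x: "x \<in> X" and y: "y \<in> X" and m: "m \<in> set_pmf mv"
  shows "(\<Sum>j\<in>UNIV. norm (delta \<kappa> i (move m x, move (rematch \<kappa> x y m) y) j - delta \<kappa> i (x, y) j))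
     \<le> 2 * (\<Sum>s\<in>UNIV. mismatch \<kappa> x y m s)"
proof -
  note lx = arrangements_length[OF x] and ly = arrangements_length[OF y]
  obtain \<sigma> p r where me: "m = (\<sigma>, p, r)" by (cases m) auto
  have s: "\<sigma> permutes UNIV" using perm m by (auto simp: set_mv me)
  define p' where "p' = (\<lambda>i. match \<kappa> x y i (p i))"
  have rm: "rematch \<kappa> x y m = (\<sigma>, p', r)" by (simp add: rematch_def me p'_def)
  have m2: "(\<sigma>, p', r) \<in> set_pmf mv" using rematch_mv[OF x y m, of \<kappa>] by (simp add: rm)
  define D where "D s = (of_bool (\<kappa> (x s ! p s) = i) - of_bool (\<kappa> (y s ! p' s) = i) :: complex)" for s
  have D: "norm (D s) \<le> mismatch \<kappa> x y m s" for s
    by (auto simp: D_def mismatch_def me p'_def)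
  have e: "delta \<kappa> i (move m x, move (rematch \<kappa> x y m) y) j - delta \<kappa> i (x, y) j = D (inv \<sigma> j) - D j" for j
    using cnt_move[of x, OF lx m[unfolded me], of "{v. \<kappa> v = i}" j] cnt_move[of y, OF ly m2, of "{v. \<kappa> v = i}" j]
    unfolding rm unfolding me by (simp add: delta_def colour_cnt_def D_def)
  have "(\<Sum>j\<in>UNIV. norm (delta \<kappa> i (move m x, move (rematch \<kappa> x y m) y) j - delta \<kappa> i (x, y) j))
     \<le> (\<Sum>j\<in>UNIV. norm (D (inv \<sigma> j)) + norm (D j))"
    unfolding e by (intro sum_mono norm_triangle_ineq4)
  also have "\<dots> = 2 * (\<Sum>j\<in>UNIV. norm (D j))"
    using sum.permute[OF permutes_inv[OF s], of "\<lambda>j. norm (D j)"] by (simp add: sum.distrib o_def)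
  also have "\<dots> \<le> 2 * (\<Sum>s\<in>UNIV. mismatch \<kappa> x y m s)"
    using D by (intro mult_left_mono sum_mono) auto
  finally show ?thesis .
qed

lemma cnt_eq_card_set: "v \<in> X \<Longrightarrow> cnt B v j = card (B \<inter> set (v j))"
proof -
  assume v: "v \<in> X"
  have "cnt B v j = card {c \<in> set (v j). c \<in> B}"
    using arrangements_distinct[OF v, of j] by (simp add: cnt_def flip: mset_filter distinct_card set_filter)
  also have "{c \<in> set (v j). c \<in> B} = B \<inter> set (v j)" by auto
  finally show ?thesis .
qed

lemma sum_colour_cnt_stacks:
  assumes v: "v \<in> X"
  shows "(\<Sum>j\<in>UNIV. colour_cnt \<kappa> i v j) = card {c. c < CARD('d) * n \<and> \<kappa> c = i}"
proof -
  have "(\<Sum>j\<in>UNIV. colour_cnt \<kappa> i v j) = (\<Sum>j\<in>UNIV. card ({c. \<kappa> c = i} \<inter> set (v j)))"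
    by (simp add: colour_cnt_def cnt_eq_card_set[OF v])
  also have "\<dots> = card (\<Union>j. {c. \<kappa> c = i} \<inter> set (v j))"
    by (rule card_UN_disjoint[symmetric]) (auto dest: arrangements_disjoint[OF v])
  also have "(\<Union>j. {c. \<kappa> c = i} \<inter> set (v j)) = {c. c < CARD('d) * n \<and> \<kappa> c = i}"
  proof -
    have e1: "(\<Union>j. {c. \<kappa> c = i} \<inter> set (v j)) = {c \<in> (\<Union>j. set (v j)). \<kappa> c = i}" by blast
    have e2: "(\<Union>j. set (v j)) = {..<CARD('d) * n}" using v unfolding arrangements_iff by blast
    show ?thesis unfolding e1 e2 by simp
  qed
  finally show ?thesis .
qed

section \<open>Contraction of the coupled difference\<close>

definition pair_norm2 :: "(nat \<Rightarrow> 'd) \<Rightarrow> complex list \<Rightarrow> real \<Rightarrow> ('d \<Rightarrow> nat list) \<times> ('d \<Rightarrow> nat list) \<Rightarrow> real" where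
  "pair_norm2 \<kappa> ls L z = (\<Sum>i\<in>UNIV. jnorm2 ls L (delta \<kappa> i z))"

lemma expectation_jnorm2:
  assumes p: "finite (set_pmf p)" and L: "L \<ge> 0"
  shows "measure_pmf.expectation p (\<lambda>m. jnorm2 ls L (w m)) \<le>
    jnorm2 ls L (\<lambda>j. measure_pmf.expectation p (\<lambda>m. w m j)) + measure_pmf.expectation p (\<lambda>m. jnorm2 ls L (\<lambda>j. w m j - v j))"
proof -
  note int = integrable_measure_pmf_finite[OF p]
  let ?E = "measure_pmf.expectation p"
  let ?A = "\<lambda>k. factors_op rop (take k ls)"
  have lin: "linear_op (?A k)" for k by (rule linear_factors_op[OF linear_rop])
  have pt: "?E (\<lambda>m. (norm (?A k (w m) j))\<^sup>2) \<le> (norm (?A k (\<lambda>j. ?E (\<lambda>m. w m j)) j))\<^sup>2 + ?E (\<lambda>m. (norm (?A k (\<lambda>j. w m j - v j) j))\<^sup>2)" for k j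
  proof -
    have "?A k (\<lambda>j. w m j - v j) j = ?A k (w m) j - ?A k v j" for m
      using linear_op_diff[OF lin, of k "w m" 1 v] by simp
    then show ?thesis
      using expectation_norm2_shift[OF p, of "\<lambda>m. ?A k (w m) j" 0 "?A k v j"]
      by (simp add: expectation_linear_op[OF lin p])
  qed
  have "?E (\<lambda>m. jnorm2 ls L (w m)) = (\<Sum>k<length ls. L ^ (2 * k) * (\<Sum>j\<in>UNIV. ?E (\<lambda>m. (norm (?A k (w m) j))\<^sup>2)))"
    unfolding jnorm2_def by (simp add: int)
  also have "\<dots> \<le> (\<Sum>k<length ls. L ^ (2 * k) * (\<Sum>j\<in>UNIV. (norm (?A k (\<lambda>j. ?E (\<lambda>m. w m j)) j))\<^sup>2 + ?E (\<lambda>m. (norm (?A k (\<lambda>j. w m j - v j) j))\<^sup>2)))"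
    using L by (intro sum_mono mult_left_mono pt) auto
  also have "\<dots> = jnorm2 ls L (\<lambda>j. ?E (\<lambda>m. w m j)) + ?E (\<lambda>m. jnorm2 ls L (\<lambda>j. w m j - v j))"
    unfolding jnorm2_def by (simp add: int sum.distrib distrib_left)
  finally show ?thesis .
qed

text \<open>Mean plus noise. The mean contracts in the adapted norm, and the noise is controlled by
  the expected number of mismatches, at most \<open>discrepancy / n\<close>.\<close>

lemma pair_norm2_step:
  fixes L :: real
  assumes x: "x \<in> X" and y: "y \<in> X" and ls: "mean_zero_minimal ls" and ne: "ls \<noteq> []" and L: "L \<ge> 1"
  defines "m \<equiv> length ls"
  shows "measure_pmf.expectation (pair_step \<kappa> (x, y)) (pair_norm2 \<kappa> ls L) \<le>
    (1 - spectral_gap (single_ball_matrix \<mu>) / n + 2 / (real n)\<^sup>2 + 1 / (n * L))\<^sup>2 * pair_norm2 \<kappa> ls L (x, y)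
    + 4 * (real CARD('d))\<^sup>2 * (m * 4 ^ m * L ^ (2 * m)) / n * discrepancy \<kappa> (x, y)"
proof -
  note int = integrable_measure_pmf_finite[OF finite_set_mv]
  let ?E = "measure_pmf.expectation mv"
  let ?r = "1 - spectral_gap (single_ball_matrix \<mu>) / n + 2 / (real n)\<^sup>2 + 1 / (n * L)"
  define w where "w i v = delta \<kappa> i (move v x, move (rematch \<kappa> x y v) y)" for i v
  define d where "d i = delta \<kappa> i (x, y)" for i
  define B where "B = m * 4 ^ m * L ^ (2 * m)"
  have B: "B \<ge> 0" using L by (simp add: B_def)
  have sd: "(\<Sum>j\<in>UNIV. d i j) = 0" for i
  proof -
    have "(\<Sum>j\<in>UNIV. colour_cnt \<kappa> i x j) = (\<Sum>j\<in>UNIV. colour_cnt \<kappa> i y j)"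
      using x y by (simp add: sum_colour_cnt_stacks)
    then have "(\<Sum>j\<in>UNIV. complex_of_nat (colour_cnt \<kappa> i x j)) = (\<Sum>j\<in>UNIV. of_nat (colour_cnt \<kappa> i y j))"
      by (simp flip: of_nat_sum)
    then show ?thesis by (simp add: d_def delta_def sum_subtractf)
  qed
  have mean: "(\<lambda>j. ?E (\<lambda>v. w i v j)) = rlazy n (d i)" for i
    unfolding w_def d_def using delta_step_mean[OF x y] by blast
  have contr: "jnorm2 ls L (rlazy n (d i)) \<le> ?r\<^sup>2 * jnorm2 ls L (d i)" for i
    by (rule jnorm2_rlazy[OF ls sd]) (use L n_pos ne in auto)
  have noise: "jnorm2 ls L (\<lambda>j. w i v j - d i j) \<le> B * (4 * real CARD('d) * (\<Sum>s\<in>UNIV. mismatch \<kappa> x y v s))"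
    if v: "v \<in> set_pmf mv" for i v
  proof -
    let ?M = "\<Sum>s\<in>UNIV. mismatch \<kappa> x y v s"
    have M: "0 \<le> ?M" "?M \<le> CARD('d)"
      using sum_mono[of UNIV "mismatch \<kappa> x y v" "\<lambda>_. 1"] by (auto simp: mismatch_def intro: sum_nonneg)
    have "jnorm2 ls L (\<lambda>j. w i v j - d i j) \<le> B * (\<Sum>j\<in>UNIV. norm (w i v j - d i j))\<^sup>2"
      unfolding B_def m_def by (rule jnorm2_le[OF L]) (use ls eigenvalue_norm_le_1 in \<open>auto simp: mean_zero_minimal_def\<close>)
    also have "\<dots> \<le> B * (2 * ?M)\<^sup>2"
      using delta_increment[OF x y v, of \<kappa> i] B unfolding w_def d_def
      by (intro mult_left_mono power_mono) (auto intro: sum_nonneg)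
    \<comment> \<open>There is at most one mismatch per stack, so one factor is bounded by
      \<open>d\<close> and the noise becomes linear in the mismatches.\<close>
    also have "(2 * ?M)\<^sup>2 = 4 * ?M * ?M" by (simp add: power2_eq_square)
    also have "B * \<dots> \<le> B * (4 * real CARD('d) * ?M)"
      using M B by (intro mult_left_mono mult_right_mono) auto
    finally show ?thesis .
  qed
  have EM: "?E (\<lambda>v. \<Sum>s\<in>UNIV. mismatch \<kappa> x y v s) \<le> discrepancy \<kappa> (x, y) / n"
  proof -
    have "?E (\<lambda>v. \<Sum>s\<in>UNIV. mismatch \<kappa> x y v s) = (\<Sum>s\<in>UNIV. ?E (\<lambda>v. mismatch \<kappa> x y v s))"
      by (rule Bochner_Integration.integral_sum[OF int])
    also have "\<dots> \<le> (\<Sum>s\<in>UNIV. (\<Sum>i\<in>UNIV. norm (delta \<kappa> i (x, y) s)) / n)"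
      by (intro sum_mono expectation_mismatch[OF x y])
    also have "\<dots> = discrepancy \<kappa> (x, y) / n"
      unfolding discrepancy_def sum_divide_distrib[symmetric] by (subst sum.swap) simp
    finally show ?thesis .
  qed
  have "measure_pmf.expectation (pair_step \<kappa> (x, y)) (pair_norm2 \<kappa> ls L) = (\<Sum>i\<in>UNIV. ?E (\<lambda>v. jnorm2 ls L (w i v)))"
    unfolding pair_step_def pair_norm2_def by (simp add: int w_def)
  also have "\<dots> \<le> (\<Sum>i\<in>UNIV. ?r\<^sup>2 * jnorm2 ls L (d i) + B * (4 * real CARD('d) * (discrepancy \<kappa> (x, y) / n)))"
  proof (rule sum_mono)
    fix i
    have "?E (\<lambda>v. jnorm2 ls L (w i v)) \<le> jnorm2 ls L (rlazy n (d i)) + ?E (\<lambda>v. jnorm2 ls L (\<lambda>j. w i v j - d i j))"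
      using expectation_jnorm2[OF finite_set_mv, of L ls "w i" "d i"] L by (simp add: mean)
    also have "?E (\<lambda>v. jnorm2 ls L (\<lambda>j. w i v j - d i j)) \<le> ?E (\<lambda>v. B * (4 * real CARD('d) * (\<Sum>s\<in>UNIV. mismatch \<kappa> x y v s)))"
      by (intro integral_mono_AE int AE_pmfI noise)
    also have "\<dots> = B * (4 * real CARD('d) * ?E (\<lambda>v. \<Sum>s\<in>UNIV. mismatch \<kappa> x y v s))" by simp
    also have "\<dots> \<le> B * (4 * real CARD('d) * (discrepancy \<kappa> (x, y) / n))"
      using EM B by (intro mult_left_mono) auto
    finally show "?E (\<lambda>v. jnorm2 ls L (w i v)) \<le> ?r\<^sup>2 * jnorm2 ls L (d i) + B * (4 * real CARD('d) * (discrepancy \<kappa> (x, y) / n))"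
      using contr[of i] by simp
  qed
  also have "\<dots> = ?r\<^sup>2 * pair_norm2 \<kappa> ls L (x, y) + 4 * (real CARD('d))\<^sup>2 * B / n * discrepancy \<kappa> (x, y)"
    by (simp add: pair_norm2_def d_def sum.distrib sum_distrib_left power2_eq_square)
  finally show ?thesis by (simp add: B_def)
qed

lemma discrepancy_le:
  assumes "ls \<noteq> []" "L \<ge> 0"
  shows "discrepancy \<kappa> z \<le> CARD('d) * sqrt (pair_norm2 \<kappa> ls L z)"
proof -
  have "discrepancy \<kappa> z = (\<Sum>ij\<in>UNIV \<times> UNIV. 1 * norm (delta \<kappa> (fst ij) z (snd ij)))"
    by (simp add: discrepancy_def sum.cartesian_product case_prod_unfold)
  also have "\<dots> \<le> (\<Sum>ij\<in>UNIV \<times> UNIV. \<bar>1\<bar> * \<bar>norm (delta \<kappa> (fst ij) z (snd ij))\<bar>)" by simp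
  also have "\<dots> \<le> L2_set (\<lambda>_. 1) (UNIV \<times> UNIV :: ('d \<times> 'd) set) * L2_set (\<lambda>ij. norm (delta \<kappa> (fst ij) z (snd ij))) (UNIV \<times> UNIV)"
    by (rule L2_set_mult_ineq)
  also have "L2_set (\<lambda>_. 1) (UNIV \<times> UNIV :: ('d \<times> 'd) set) = CARD('d)"
    by (simp add: L2_set_def card_cartesian_product)
  also have "L2_set (\<lambda>ij. norm (delta \<kappa> (fst ij) z (snd ij))) (UNIV \<times> UNIV) = sqrt (\<Sum>i\<in>UNIV. \<Sum>j\<in>UNIV. (norm (delta \<kappa> i z j))\<^sup>2)"
    by (simp add: L2_set_def sum.cartesian_product case_prod_unfold)
  also have "\<dots> \<le> sqrt (pair_norm2 \<kappa> ls L z)"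
    unfolding pair_norm2_def using assms by (intro real_sqrt_le_mono sum_mono jnorm2_ge)
  finally show ?thesis by simp
qed

lemma pair_norm2_nonneg: "L \<ge> 0 \<Longrightarrow> pair_norm2 \<kappa> ls L z \<ge> 0"
  unfolding pair_norm2_def by (intro sum_nonneg jnorm2_nonneg)

text \<open>In terms of the square root of the norm, the bound for one step is affine with slope
  \<open>r\<close> and offset \<open>b\<close>. Its iterates are at most the contracted initial
  value, which is of order \<open>n\<close>, plus the fixed point \<open>b / (1 - r)\<close>. If
  \<open>1 - r\<close> is of order \<open>1 / n\<close>, the fixed point depends on \<open>n\<close>
  only through \<open>B\<close>.\<close>

lemma coupling_bound:
  fixes L r B :: real and m :: nat
  assumes x: "x \<in> X" and y: "y \<in> X" and ls: "mean_zero_minimal ls" and ne: "ls \<noteq> []" and L: "L \<ge> 1"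
  defines "m \<equiv> length ls"
  defines "r \<equiv> 1 - spectral_gap (single_ball_matrix \<mu>) / n + 2 / (real n)\<^sup>2 + 1 / (n * L)"
  defines "B \<equiv> m * 4 ^ m * L ^ (2 * m)"
  assumes r: "r \<ge> 1/2" "r < 1"
  shows "measure_pmf.expectation (pair_law \<kappa> k (x, y)) (discrepancy \<kappa>) \<le>
     CARD('d) * (r ^ k * (n * sqrt ((real CARD('d)) ^ 3 * B)) + 4 * (real CARD('d)) ^ 3 * B / (n * (1 - r)))"
proof -
  let ?N = "\<lambda>z. sqrt (pair_norm2 \<kappa> ls L z)"
  define b where "b = 4 * (real CARD('d)) ^ 3 * B / n"
  have B: "B \<ge> 0" using L by (simp add: B_def)
  have b: "b \<ge> 0" using B by (simp add: b_def)
  have step: "measure_pmf.expectation (pair_step \<kappa> z) ?N \<le> r * ?N z + b" if z: "fst z \<in> X" "snd z \<in> X" for z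
  proof -
    have N0: "pair_norm2 \<kappa> ls L z \<ge> 0" using L by (intro pair_norm2_nonneg) auto
    have "measure_pmf.expectation (pair_step \<kappa> z) ?N \<le> sqrt (measure_pmf.expectation (pair_step \<kappa> z) (pair_norm2 \<kappa> ls L))"
      using L by (intro expectation_sqrt_le finite_pair_step pair_norm2_nonneg) auto
    also have "\<dots> \<le> sqrt ((r * ?N z + b)\<^sup>2)"
    proof (rule real_sqrt_le_mono)
      have "measure_pmf.expectation (pair_step \<kappa> z) (pair_norm2 \<kappa> ls L) \<le>
         r\<^sup>2 * pair_norm2 \<kappa> ls L z + 4 * (real CARD('d))\<^sup>2 * B / n * discrepancy \<kappa> z"
        using pair_norm2_step[OF z ls ne L, of \<kappa>] by (simp add: r_def B_def m_def)
      also have "\<dots> \<le> r\<^sup>2 * pair_norm2 \<kappa> ls L z + 4 * (real CARD('d))\<^sup>2 * B / n * (CARD('d) * ?N z)"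
        using B L by (intro add_left_mono mult_left_mono discrepancy_le[OF ne]) auto
      also have "\<dots> = (r * ?N z)\<^sup>2 + b * ?N z"
        using N0 by (simp add: b_def power_mult_distrib power3_eq_cube power2_eq_square[of "real CARD('d)"])
      \<comment> \<open>Completing the square: as \<open>r \<ge> 1/2\<close>, the noise
        \<open>b * ?N z\<close> is at most the mixed term.\<close>
      also have "\<dots> \<le> (r * ?N z)\<^sup>2 + 2 * (r * ?N z) * b + b\<^sup>2"
      proof -
        have "1 * (b * ?N z) \<le> (2 * r) * (b * ?N z)" using r b N0 by (intro mult_right_mono) auto
        then have "b * ?N z \<le> 2 * (r * ?N z) * b" by (simp add: mult_ac)
        then show ?thesis using zero_le_power2[of b] by linarith
      qed
      finally show "measure_pmf.expectation (pair_step \<kappa> z) (pair_norm2 \<kappa> ls L) \<le> (r * ?N z + b)\<^sup>2"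
        by (simp add: power2_sum)
    qed
    also have "\<dots> = r * ?N z + b" using r b N0 by simp
    finally show ?thesis .
  qed
  have it: "measure_pmf.expectation (pair_law \<kappa> k (x, y)) ?N \<le> r ^ k * ?N (x, y) + b / (1 - r)" for k
  proof (induction k)
    case 0
    then show ?case using b r by simp
  next
    case (Suc k)
    note int = integrable_measure_pmf_finite[OF finite_pair_law]
    have "measure_pmf.expectation (pair_law \<kappa> (Suc k) (x, y)) ?N =
      measure_pmf.expectation (pair_law \<kappa> k (x, y)) (\<lambda>z. measure_pmf.expectation (pair_step \<kappa> z) ?N)"
      by (simp add: expectation_bind_finite[OF finite_pair_law finite_pair_step])
    also have "\<dots> \<le> measure_pmf.expectation (pair_law \<kappa> k (x, y)) (\<lambda>z. r * ?N z + b)"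
    proof (intro integral_mono_AE int AE_pmfI step)
      fix z assume "z \<in> set_pmf (pair_law \<kappa> k (x, y))"
      then have "z \<in> X \<times> X" using set_pair_law[of "(x, y)"] x y by auto
      then show "fst z \<in> X" "snd z \<in> X" by auto
    qed
    also have "\<dots> = r * measure_pmf.expectation (pair_law \<kappa> k (x, y)) ?N + b" by (simp add: int)
    also have "\<dots> \<le> r * (r ^ k * ?N (x, y) + b / (1 - r)) + b" using Suc r by simp
    also have "\<dots> = r ^ Suc k * ?N (x, y) + b / (1 - r)"
    proof -
      have "r * (b / (1 - r)) + b = b / (1 - r)" using r by (simp add: field_simps)
      then show ?thesis by (simp add: distrib_left mult.assoc)
    qed
    finally show ?case .
  qed
  have N0: "?N (x, y) \<le> n * sqrt ((real CARD('d)) ^ 3 * B)"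
  proof (rule real_le_lsqrt[THEN order_trans])
    show "pair_norm2 \<kappa> ls L (x, y) \<le> (n * sqrt ((real CARD('d)) ^ 3 * B))\<^sup>2"
    proof -
      have "pair_norm2 \<kappa> ls L (x, y) \<le> (\<Sum>i\<in>(UNIV :: 'd set). B * (CARD('d) * n)\<^sup>2)"
        unfolding pair_norm2_def
      proof (rule sum_mono)
        fix i
        have "jnorm2 ls L (delta \<kappa> i (x, y)) \<le> B * (\<Sum>j\<in>UNIV. norm (delta \<kappa> i (x, y) j))\<^sup>2"
          unfolding B_def m_def by (rule jnorm2_le[OF L]) (use ls eigenvalue_norm_le_1 in \<open>auto simp: mean_zero_minimal_def\<close>)
        also have "\<dots> \<le> B * (\<Sum>j\<in>(UNIV :: 'd set). real n)\<^sup>2"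
        proof (intro mult_left_mono power_mono sum_mono B)
          fix j
          show "norm (delta \<kappa> i (x, y) j) \<le> real n"
            using colour_cnt_le[OF x, of \<kappa> i j] colour_cnt_le[OF y, of \<kappa> i j] by (simp add: norm_delta)
        qed (auto intro: sum_nonneg)
        finally show "jnorm2 ls L (delta \<kappa> i (x, y)) \<le> B * (CARD('d) * n)\<^sup>2" by simp
      qed
      also have "\<dots> = (n * sqrt ((real CARD('d)) ^ 3 * B))\<^sup>2"
        using B by (simp add: power_mult_distrib power2_eq_square power3_eq_cube)
      finally show ?thesis .
    qed
  qed (use B in auto)
  have "measure_pmf.expectation (pair_law \<kappa> k (x, y)) (discrepancy \<kappa>) \<le> measure_pmf.expectation (pair_law \<kappa> k (x, y)) (\<lambda>z. CARD('d) * ?N z)"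
    using L by (intro integral_mono integrable_measure_pmf_finite finite_pair_law discrepancy_le[OF ne]) auto
  also have "\<dots> = CARD('d) * measure_pmf.expectation (pair_law \<kappa> k (x, y)) ?N" by simp
  also have "\<dots> \<le> CARD('d) * (r ^ k * (n * sqrt ((real CARD('d)) ^ 3 * B)) + b / (1 - r))"
  proof (rule mult_left_mono)
    have "r ^ k * ?N (x, y) \<le> r ^ k * (n * sqrt ((real CARD('d)) ^ 3 * B))"
      using r by (intro mult_left_mono N0) auto
    then show "measure_pmf.expectation (pair_law \<kappa> k (x, y)) ?N \<le> r ^ k * (n * sqrt ((real CARD('d)) ^ 3 * B)) + b / (1 - r)"
      using it[of k] by simp
  qed simp
  finally show ?thesis by (simp add: b_def)
qed

end

section \<open>Mixing of the contents\<close>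

context stack_shuffle
begin

section \<open>Symmetry under relabelling\<close>

definition relabel :: "(nat \<Rightarrow> nat) \<Rightarrow> ('d \<Rightarrow> nat list) \<Rightarrow> 'd \<Rightarrow> nat list" where
  "relabel g x = (\<lambda>j. map g (x j))"

text \<open>Functions on arrangements that factor through the coloured contents.\<close>

definition contents_fun :: "(nat \<Rightarrow> 'c) \<Rightarrow> (('d \<Rightarrow> nat list) \<Rightarrow> real) \<Rightarrow> bool" where
  "contents_fun \<kappa> \<Phi> \<longleftrightarrow> (\<forall>y\<in>X. \<forall>z\<in>X. contents \<kappa> y = contents \<kappa> z \<longrightarrow> \<Phi> y = \<Phi> z)"

lemma relabel_X: "x \<in> X \<Longrightarrow> g permutes {..<CARD('d) * n} \<Longrightarrow> relabel g x \<in> X"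
  unfolding relabel_def by (rule arrangements_relabel)

lemma relabel_K: "x \<in> X \<Longrightarrow> K (relabel g x) = map_pmf (relabel g) (K x)"
  unfolding K_eq map_pmf_comp relabel_def
  by (intro map_pmf_cong refl move_relabel) (simp add: arrangements_length)

text \<open>The dynamics never looks at the names of the cards and so commutes with
  relabelling.\<close>

lemma relabel_law: "x \<in> X \<Longrightarrow> law k (relabel g x) = map_pmf (relabel g) (law k x)"
proof (induction k)
  case (Suc k)
  have "law (Suc k) (relabel g x) = bind_pmf (law k x) (\<lambda>y. K (relabel g y))"
    using Suc by (simp add: bind_map_pmf)
  also have "\<dots> = bind_pmf (law k x) (\<lambda>y. map_pmf (relabel g) (K y))"
    using set_law[OF Suc.prems] by (intro bind_pmf_cong refl relabel_K) auto
  finally show ?case by (simp add: map_bind_pmf)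
qed simp

lemma expectation_contents:
  assumes x: "x \<in> X" and y: "y \<in> X" and e: "contents \<kappa> x = contents \<kappa> y" and \<Phi>: "contents_fun \<kappa> \<Phi>"
  shows "measure_pmf.expectation (law k x) \<Phi> = measure_pmf.expectation (law k y) \<Phi>"
proof -
  define \<Psi> where "\<Psi> c = \<Phi> (SOME z. z \<in> X \<and> contents \<kappa> z = c)" for c
  have \<Psi>: "\<Phi> z = \<Psi> (contents \<kappa> z)" if z: "z \<in> X" for z
  proof -
    have "(SOME z'. z' \<in> X \<and> contents \<kappa> z' = contents \<kappa> z) \<in> X \<and> contents \<kappa> (SOME z'. z' \<in> X \<and> contents \<kappa> z' = contents \<kappa> z) = contents \<kappa> z"
      by (rule someI[of _ z]) (use z in auto)
    then show ?thesis using \<Phi> z unfolding \<Psi>_def contents_fun_def by metis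
  qed
  have E: "measure_pmf.expectation (law k z) \<Phi> = measure_pmf.expectation (map_pmf (contents \<kappa>) (law k z)) \<Psi>" if z: "z \<in> X" for z
  proof -
    have "measure_pmf.expectation (law k z) \<Phi> = measure_pmf.expectation (law k z) (\<lambda>z. \<Psi> (contents \<kappa> z))"
      using set_law[OF z] by (intro integral_cong_AE AE_pmfI) (auto intro: \<Psi>)
    then show ?thesis by simp
  qed
  show ?thesis unfolding E[OF x] E[OF y] contents_law[OF x y e] ..
qed

text \<open>A relabelling that only permutes cards within the stacks of \<open>x\<close> does not
  change the initial contents, hence is invisible to observables of the later contents.\<close>

lemma expectation_relabel:
  assumes x: "x \<in> X" and g: "g permutes {..<CARD('d) * n}" and e: "contents id (relabel g x) = contents id x"
    and \<Phi>: "contents_fun id \<Phi>"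
  shows "measure_pmf.expectation (law k x) \<Phi> = measure_pmf.expectation (law k x) (\<lambda>y. \<Phi> (relabel g y))"
proof -
  have "measure_pmf.expectation (law k x) \<Phi> = measure_pmf.expectation (law k (relabel g x)) \<Phi>"
    by (rule expectation_contents[OF x relabel_X[OF x g] e[symmetric] \<Phi>])
  then show ?thesis by (simp add: relabel_law[OF x])
qed

lemma contents_id: "contents \<kappa> y = (\<lambda>j. image_mset \<kappa> (contents id y j))"
  by (simp add: contents_def)

lemma set_contents_id: "v \<in> set (y j) \<longleftrightarrow> v \<in># contents id y j"
  by (simp add: contents_def)

lemma in_relabel_transpose: "v \<in> set (relabel (Transposition.transpose a b) y j) \<longleftrightarrow> Transposition.transpose a b v \<in> set (y j)"
proof
  assume "v \<in> set (relabel (Transposition.transpose a b) y j)"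
  then obtain u where "u \<in> set (y j)" "v = Transposition.transpose a b u" by (auto simp: relabel_def)
  then show "Transposition.transpose a b v \<in> set (y j)" by simp
next
  assume "Transposition.transpose a b v \<in> set (y j)"
  then have "Transposition.transpose a b (Transposition.transpose a b v) \<in> Transposition.transpose a b ` set (y j)" by (rule imageI)
  then show "v \<in> set (relabel (Transposition.transpose a b) y j)" by (simp add: relabel_def)
qed

lemma image_transpose_avoid: "a \<notin># A \<Longrightarrow> b \<notin># A \<Longrightarrow> image_mset (Transposition.transpose a b) A = A"
proof -
  assume "a \<notin># A" "b \<notin># A"
  then have "image_mset (Transposition.transpose a b) A = image_mset id A"
    by (intro image_mset_cong) (metis id_apply transpose_apply_other)
  then show ?thesis by simp
qed

lemma contents_swap_same:
  assumes y: "y \<in> X" and a: "a \<in> set (y J)" and b: "b \<in> set (y J)"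
  shows "contents id (relabel (Transposition.transpose a b) y) = contents id y"
proof
  fix j
  show "contents id (relabel (Transposition.transpose a b) y) j = contents id y j"
  proof (cases "j = J")
    case True
    have "Transposition.transpose a b ` set (y J) = set (y J)" using a b by (simp add: transpose_image_eq)
    moreover have "distinct (map (Transposition.transpose a b) (y J))" using arrangements_distinct[OF y] by (simp add: distinct_map)
    ultimately have "mset (map (Transposition.transpose a b) (y J)) = mset (y J)"
      using arrangements_distinct[OF y] by (metis list.set_map set_eq_iff_mset_eq_distinct)
    then show ?thesis using True by (simp add: contents_def relabel_def)
  next
    case False
    then have "a \<notin># mset (y j)" "b \<notin># mset (y j)" using arrangements_disjoint[OF y] a b by auto
    then show ?thesis by (simp add: contents_def relabel_def image_transpose_avoid)
  qed
qed

lemma contents_swap: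
  assumes y: "y \<in> X" and a: "a \<in> set (y J)" and b: "b \<in> set (y J')" and ne: "J \<noteq> J'"
  shows "contents \<kappa> (relabel (Transposition.transpose a b) y) = (contents \<kappa> y)
    (J := add_mset (\<kappa> b) (contents \<kappa> y J - {#\<kappa> a#}), J' := add_mset (\<kappa> a) (contents \<kappa> y J' - {#\<kappa> b#}))"
proof
  fix j
  have swap: "image_mset (\<kappa> \<circ> Transposition.transpose c d) (mset (y l)) = add_mset (\<kappa> d) (image_mset \<kappa> (mset (y l)) - {#\<kappa> c#})"
    if c: "c \<in> set (y l)" and d: "d \<notin> set (y l)" for c d l
  proof -
    define R where "R = mset (y l) - {#c#}"
    have ml: "mset (y l) = add_mset c R" using c by (simp add: R_def)
    have "count (mset (y l)) c = 1" using c arrangements_distinct[OF y, of l] by (simp add: distinct_count_atmost_1)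
    then have "c \<notin># R" by (simp add: R_def not_in_iff)
    moreover have "d \<notin># R" using d ml by (metis in_multiset_in_set insertCI set_mset_add_mset_insert)
    ultimately have "image_mset (Transposition.transpose c d) R = R" by (rule image_transpose_avoid)
    then have "image_mset \<kappa> (image_mset (Transposition.transpose c d) (add_mset c R)) = add_mset (\<kappa> d) (image_mset \<kappa> R)" by simp
    then show ?thesis unfolding ml by (simp add: multiset.map_comp)
  qed
  have ab: "a \<notin> set (y J')" "b \<notin> set (y J)" using arrangements_disjoint[OF y] a b ne by auto
  consider "j = J" | "j = J'" | "j \<noteq> J" "j \<noteq> J'" by blast
  then show "contents \<kappa> (relabel (Transposition.transpose a b) y) j = ((contents \<kappa> y)
    (J := add_mset (\<kappa> b) (contents \<kappa> y J - {#\<kappa> a#}), J' := add_mset (\<kappa> a) (contents \<kappa> y J' - {#\<kappa> b#}))) j"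
  proof cases
    case 1
    then show ?thesis using swap[OF a ab(2)] ne by (simp add: contents_def relabel_def multiset.map_comp)
  next
    case 2
    then show ?thesis using swap[OF b ab(1)] ne by (simp add: contents_def relabel_def multiset.map_comp transpose_commute[of b a])
  next
    case 3
    then have "a \<notin># mset (y j)" "b \<notin># mset (y j)" using arrangements_disjoint[OF y] a b by auto
    then show ?thesis using 3 by (simp add: contents_def relabel_def image_transpose_avoid)
  qed
qed

section \<open>Smoothing of a single swap\<close>

text \<open>Cards that start in a common stack have the same chance to be in \<open>J\<close> at
  time \<open>T\<close>. The variance bound with coefficients at most 1 gives an error of order
  \<open>sqrt T\<close>, whatever the size of \<open>I\<close>.\<close>

lemma card_in_stack_deviation:
  assumes x: "x \<in> X" and I: "I \<subseteq> set (x k0)"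
  shows "measure_pmf.expectation (law T x) (\<lambda>y. \<bar>real (cnt I y J) - card I * Re ((lazy n ^^ T) (\<lambda>j. of_bool (j = J)) k0)\<bar>)
    \<le> 2 * CARD('d) * sqrt T"
proof -
  note int = integrable_measure_pmf_finite[OF finite_set_law]
  let ?f = "\<lambda>j. of_bool (j = J) :: complex"
  let ?p = "(lazy n ^^ T) ?f k0"
  have st: "stat ?f I y = of_nat (cnt I y J)" for y
    by (simp add: stat_def of_bool_def if_distrib[where f = "\<lambda>x. x * _"] cong: if_cong)
  have fin: "finite I" using I finite_subset by blast
  have "cnt I x j = (if j = k0 then card I else 0)" for j
  proof (cases "j = k0")
    case True
    then show ?thesis using I by (simp add: cnt_eq_card_set[OF x] Int_absorb2)
  next
    case False
    then have "I \<inter> set (x j) = {}" using I arrangements_disjoint[OF x] by blast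
    then show ?thesis using False by (simp add: cnt_eq_card_set[OF x])
  qed
  then have stx: "stat ((lazy n ^^ T) ?f) I x = ?p * of_nat (card I)"
    by (simp add: stat_def if_distrib[where f = of_nat] if_distrib[where f = "\<lambda>x. _ * x"] cong: if_cong)
  have n1: "real n \<ge> 1" using n_pos by simp
  have "measure_pmf.expectation (law T x) (\<lambda>y. (norm (stat ?f I y - stat ((lazy n ^^ T) ?f) I x))\<^sup>2) \<le> (\<Sum>s<T. (2 * real CARD('d) * 1)\<^sup>2)"
  proof -
    have "norm ((lazy n ^^ s) ?f j) \<le> 1" for s j by (rule lazy_funpow_le[OF n1]) simp
    from stat_law_deviation[OF x this, of T I] show ?thesis by simp
  qed
  also have "\<dots> = (2 * CARD('d) * sqrt T)\<^sup>2" by (simp add: power_mult_distrib)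
  finally have v: "measure_pmf.expectation (law T x) (\<lambda>y. (norm (stat ?f I y - stat ((lazy n ^^ T) ?f) I x))\<^sup>2) \<le> (2 * CARD('d) * sqrt T)\<^sup>2" .
  have "measure_pmf.expectation (law T x) (\<lambda>y. \<bar>real (cnt I y J) - card I * Re ?p\<bar>) \<le>
     measure_pmf.expectation (law T x) (\<lambda>y. sqrt ((norm (stat ?f I y - stat ((lazy n ^^ T) ?f) I x))\<^sup>2))"
  proof (rule integral_mono[OF int int])
    fix y
    have "\<bar>Re (stat ?f I y - stat ((lazy n ^^ T) ?f) I x)\<bar> \<le> norm (stat ?f I y - stat ((lazy n ^^ T) ?f) I x)"
      by (rule abs_Re_le_cmod)
    then show "\<bar>real (cnt I y J) - card I * Re ?p\<bar> \<le> sqrt ((norm (stat ?f I y - stat ((lazy n ^^ T) ?f) I x))\<^sup>2)"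
      by (simp add: st stx mult.commute)
  qed
  also have "\<dots> \<le> sqrt (measure_pmf.expectation (law T x) (\<lambda>y. (norm (stat ?f I y - stat ((lazy n ^^ T) ?f) I x))\<^sup>2))"
    by (rule expectation_sqrt_le[OF finite_set_law]) simp
  also have "\<dots> \<le> sqrt ((2 * CARD('d) * sqrt T)\<^sup>2)" using v by (rule real_sqrt_le_mono)
  finally show ?thesis by simp
qed

text \<open>The relative error of a product of two counts is of order \<open>sqrt T / l\<close>,
  hence \<open>1 / sqrt n\<close> when \<open>T\<close> and \<open>l\<close> are of order
  \<open>n\<close>.\<close>

lemma product_deviation:
  fixes p :: "'d \<Rightarrow> real" and c :: real and l :: nat
  assumes x: "x \<in> X" and I: "I \<subseteq> set (x k0)" and I': "I' \<subseteq> set (x k0)" and l: "l > 0" "card I \<ge> l" "card I' \<ge> l"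
    and c: "c > 0" and p: "\<And>J. p J = Re ((lazy n ^^ T) (\<lambda>j. of_bool (j = J)) k0)" and pc: "\<And>J. p J \<ge> c" and p1: "\<And>J. p J \<le> 1"
  shows "measure_pmf.expectation (law T x) (\<lambda>y. \<bar>1 - real (cnt I y J) * real (cnt I' y J') / (card I * card I' * (p J * p J'))\<bar>)
    \<le> 4 * CARD('d) * sqrt T / (l * c\<^sup>2)"
proof -
  note int = integrable_measure_pmf_finite[OF finite_set_law]
  let ?E = "measure_pmf.expectation (law T x)"
  define m where "m = card I * card I' * (p J * p J')"
  have fin: "finite I" "finite I'" using I I' finite_subset by blast+
  have cp: "real (card I) > 0" "real (card I') > 0" using l by simp_all
  have m: "m \<ge> card I * card I' * c\<^sup>2"
    unfolding m_def power2_eq_square using pc c by (intro mult_left_mono mult_mono) (auto intro: less_imp_le order_trans[of 0 c])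
  have m0: "m > 0" using m cp c by (smt (verit) mult_pos_pos zero_less_power of_nat_mult)
  have pt: "\<bar>1 - real (cnt I y J) * real (cnt I' y J') / m\<bar> \<le>
     (card I' * \<bar>real (cnt I y J) - card I * p J\<bar> + card I * \<bar>real (cnt I' y J') - card I' * p J'\<bar>) / m" if y: "y \<in> X" for y
  proof -
    let ?a = "real (cnt I y J)" and ?b = "real (cnt I' y J')"
    have b: "?b \<le> card I'" using cnt_eq_card_set[OF y, of I' J'] fin by (simp add: card_mono)
    have "\<bar>m - ?a * ?b\<bar> = \<bar>(card I * p J - ?a) * ?b + card I * p J * (card I' * p J' - ?b)\<bar>"
      by (simp add: m_def algebra_simps)
    also have "\<dots> \<le> \<bar>card I * p J - ?a\<bar> * ?b + card I * p J * \<bar>card I' * p J' - ?b\<bar>"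
      using pc[of J] c by (intro order_trans[OF abs_triangle_ineq]) (simp add: abs_mult)
    also have "\<dots> \<le> \<bar>card I * p J - ?a\<bar> * card I' + card I * 1 * \<bar>card I' * p J' - ?b\<bar>"
      using b mult_left_mono[OF p1[of J], of "card I"] by (intro add_mono mult_left_mono mult_right_mono) auto
    finally have "\<bar>m - ?a * ?b\<bar> \<le> card I' * \<bar>?a - card I * p J\<bar> + card I * \<bar>?b - card I' * p J'\<bar>"
      by (simp add: abs_minus_commute mult.commute)
    moreover have "\<bar>1 - ?a * ?b / m\<bar> = \<bar>m - ?a * ?b\<bar> / m"
    proof -
      have "1 - ?a * ?b / m = (m - ?a * ?b) / m" using m0 by (simp add: diff_divide_distrib)
      then show ?thesis using m0 by simp
    qed
    ultimately show ?thesis using m0 by (simp add: divide_right_mono)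
  qed
  have "?E (\<lambda>y. \<bar>1 - real (cnt I y J) * real (cnt I' y J') / m\<bar>) \<le>
     ?E (\<lambda>y. (card I' * \<bar>real (cnt I y J) - card I * p J\<bar> + card I * \<bar>real (cnt I' y J') - card I' * p J'\<bar>) / m)"
    using set_law[OF x] by (intro integral_mono_AE int AE_pmfI pt) auto
  also have "\<dots> = (card I' * ?E (\<lambda>y. \<bar>real (cnt I y J) - card I * p J\<bar>) + card I * ?E (\<lambda>y. \<bar>real (cnt I' y J') - card I' * p J'\<bar>)) / m"
    by (simp add: int)
  also have "\<dots> \<le> (card I' * (2 * CARD('d) * sqrt T) + card I * (2 * CARD('d) * sqrt T)) / m"
    using m0 card_in_stack_deviation[OF x I, of T J] card_in_stack_deviation[OF x I', of T J']
    unfolding p by (intro divide_right_mono add_mono mult_left_mono) auto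
  also have "\<dots> \<le> (card I' * (2 * CARD('d) * sqrt T) + card I * (2 * CARD('d) * sqrt T)) / (card I * card I' * c\<^sup>2)"
    using m cp c m0 by (intro divide_left_mono) (auto intro!: mult_pos_pos)
  also have "\<dots> = 2 * CARD('d) * sqrt T / c\<^sup>2 * (1 / card I + 1 / card I')"
    using cp c by (simp add: field_simps)
  also have "\<dots> \<le> 2 * CARD('d) * sqrt T / c\<^sup>2 * (1 / l + 1 / l)"
    using l c by (intro mult_left_mono add_mono divide_left_mono) auto
  also have "\<dots> = 4 * CARD('d) * sqrt T / (l * c\<^sup>2)" by (simp add: mult_ac)
  finally show ?thesis by (simp add: m_def)
qed

text \<open>Exchanging two cards of the same stack does not change the law of the contents. Applied to many
  pairs of cards with the colours of \<open>a\<close> and \<open>b\<close>, this turns a swap of \<open>a\<close> and \<open>b\<close> into a reweighting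
  by a factor close to 1.\<close>

lemma swap_smoothing:
  fixes p :: "'d \<Rightarrow> real" and c :: real and l :: nat
  assumes x: "x \<in> X" and a: "a < CARD('d) * n" and b: "b < CARD('d) * n"
    and \<phi>: "contents_fun \<kappa> \<phi>" and \<phi>1: "\<And>y. \<bar>\<phi> y\<bar> \<le> 1"
    and I: "I \<subseteq> set (x k0)" and I': "I' \<subseteq> set (x k0)" and \<kappa>I: "\<And>v. v \<in> I \<Longrightarrow> \<kappa> v = \<kappa> a" and \<kappa>I': "\<And>v. v \<in> I' \<Longrightarrow> \<kappa> v = \<kappa> b"
    and ab: "\<kappa> a \<noteq> \<kappa> b" and notin: "a \<notin> I" "b \<notin> I'"
    and l: "l > 0" "card I \<ge> l" "card I' \<ge> l"
    and c: "c > 0" and p: "\<And>J. p J = Re ((lazy n ^^ T) (\<lambda>j. of_bool (j = J)) k0)" and pc: "\<And>J. p J \<ge> c" and p1: "\<And>J. p J \<le> 1"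
  shows "\<bar>measure_pmf.expectation (law T x) \<phi> - measure_pmf.expectation (law T (relabel (Transposition.transpose a b) x)) \<phi>\<bar>
     \<le> 8 * (real CARD('d)) ^ 3 * sqrt T / (l * c\<^sup>2)"
proof -
  note int = integrable_measure_pmf_finite[OF finite_set_law]
  let ?E = "measure_pmf.expectation (law T x)"
  let ?\<tau> = "Transposition.transpose a b"
  have fin: "finite I" "finite I'" using I I' finite_subset by blast+
  have "a \<notin> I'" using \<kappa>I'[of a] ab by blast
  moreover have "b \<notin> I" using \<kappa>I[of b] ab by force
  moreover have "v \<notin> I'" if "v \<in> I" for v using \<kappa>I[OF that] \<kappa>I'[of v] ab by force
  ultimately have aI: "a \<notin> I" "a \<notin> I'" "b \<notin> I" "b \<notin> I'" "I \<inter> I' = {}" using notin by blast+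
  have perm\<tau>: "Transposition.transpose u v permutes {..<CARD('d) * n}" if "u < CARD('d) * n" "v < CARD('d) * n" for u v
    using that by (intro permutes_swap_id) auto
  \<comment> \<open>The stacks of \<open>a\<close> and \<open>b\<close> at time \<open>T\<close> are
    fixed through this indicator, and each pair of stacks is treated separately.\<close>
  define Y where "Y J J' y = (of_bool (a \<in> set (y J)) * of_bool (b \<in> set (y J')) :: real)" for J J' and y :: "'d \<Rightarrow> nat list"
  have split: "\<phi> y - \<phi> (relabel ?\<tau> y) = (\<Sum>J\<in>UNIV. \<Sum>J'\<in>UNIV. Y J J' y * (\<phi> y - \<phi> (relabel ?\<tau> y)))" if y: "y \<in> X" for y
  proof -
    have "\<exists>J. v \<in> set (y J)" if "v < CARD('d) * n" for v using y that unfolding arrangements_iff by blast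
    then obtain Ja Jb where J: "a \<in> set (y Ja)" "b \<in> set (y Jb)" using a b by blast
    have "a \<in> set (y J) \<longleftrightarrow> J = Ja" "b \<in> set (y J) \<longleftrightarrow> J = Jb" for J using J arrangements_disjoint[OF y] by blast+
    then have "Y J J' y = of_bool (J = Ja) * of_bool (J' = Jb)" for J J' by (simp add: Y_def)
    then have "(\<Sum>J\<in>UNIV. \<Sum>J'\<in>UNIV. Y J J' y) = (\<Sum>J\<in>UNIV. of_bool (J = Ja)) * (\<Sum>J'\<in>UNIV. of_bool (J' = Jb))"
      by (simp only: sum_product)
    then have "(\<Sum>J\<in>UNIV. \<Sum>J'\<in>UNIV. Y J J' y) = 1" by (simp add: of_bool_def)
    then show ?thesis by (simp flip: sum_distrib_right)
  qed
  have pair: "\<bar>?E (\<lambda>y. Y J J' y * (\<phi> y - \<phi> (relabel ?\<tau> y)))\<bar> \<le> 8 * CARD('d) * sqrt T / (l * c\<^sup>2)" for J J'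
  proof (cases "J = J'")
    case True
    have "Y J J' y * (\<phi> y - \<phi> (relabel ?\<tau> y)) = 0" if y: "y \<in> X" for y
    proof (cases "a \<in> set (y J) \<and> b \<in> set (y J)")
      case True
      then have "contents id (relabel ?\<tau> y) = contents id y" using contents_swap_same[OF y] by blast
      then have "contents \<kappa> (relabel ?\<tau> y) = contents \<kappa> y" by (simp add: contents_id[of \<kappa>])
      then have "\<phi> (relabel ?\<tau> y) = \<phi> y" using \<phi> y relabel_X[OF y perm\<tau>[OF a b]] unfolding contents_fun_def by blast
      then show ?thesis by simp
    next
      case False
      then show ?thesis using \<open>J = J'\<close> by (auto simp: Y_def)
    qed
    then have "?E (\<lambda>y. Y J J' y * (\<phi> y - \<phi> (relabel ?\<tau> y))) = ?E (\<lambda>_. 0)"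
      using set_law[OF x] by (intro integral_cong_AE AE_pmfI) auto
    then show ?thesis using l c by simp
  next
    case False
    \<comment> \<open>The predicted product of the two counts; dividing by it turns the sum over all
      pairs \<open>u\<close>, \<open>w\<close> into a weight close to 1.\<close>
    define m where "m = card I * card I' * (p J * p J')"
    have "p J > 0" "p J' > 0" using pc c less_le_trans by blast+
    then have m0: "m > 0" using l by (simp add: m_def)
    \<comment> \<open>The cards \<open>u\<close> and \<open>w\<close> start in the same stack, so
      exchanging them preserves expectations of functions of the contents. When \<open>a\<close> and
      \<open>u\<close> are in \<open>J\<close> while \<open>b\<close> and \<open>w\<close> are in
      \<open>J'\<close>, exchanging \<open>u\<close> with \<open>w\<close> has the same effect on
      the colours as exchanging \<open>a\<close> with \<open>b\<close>.\<close>
    have ex: "?E (\<lambda>y. Y J J' y * (of_bool (u \<in> set (y J')) * of_bool (w \<in> set (y J))) * \<phi> y) =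
       ?E (\<lambda>y. Y J J' y * (of_bool (u \<in> set (y J)) * of_bool (w \<in> set (y J'))) * \<phi> (relabel ?\<tau> y))" if u: "u \<in> I" and w: "w \<in> I'" for u w
    proof -
      let ?\<rho> = "Transposition.transpose u w"
      have uw: "u < CARD('d) * n" "w < CARD('d) * n" using u w I I' x unfolding arrangements_iff by blast+
      have uwne: "a \<noteq> u" "a \<noteq> w" "b \<noteq> u" "b \<noteq> w" "u \<noteq> w" using u w aI by auto
      let ?\<Phi> = "\<lambda>y. Y J J' y * (of_bool (u \<in> set (y J')) * of_bool (w \<in> set (y J))) * \<phi> y"
      have dep: "contents_fun id ?\<Phi>"
        unfolding contents_fun_def
      proof (intro ballI impI)
        fix y z assume yz: "y \<in> X" "z \<in> X" "contents id y = contents id z"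
        then have "\<phi> y = \<phi> z" using \<phi> contents_id[of \<kappa> y] contents_id[of \<kappa> z] unfolding contents_fun_def by metis
        then show "?\<Phi> y = ?\<Phi> z" using yz(3) by (simp add: Y_def set_contents_id)
      qed
      have same: "contents id (relabel ?\<rho> x) = contents id x"
        using contents_swap_same[OF x] u w I I' by blast
      have "?E ?\<Phi> = ?E (\<lambda>y. ?\<Phi> (relabel ?\<rho> y))"
        by (rule expectation_relabel[OF x perm\<tau>[OF uw] same dep])
      also have "\<dots> = ?E (\<lambda>y. Y J J' y * (of_bool (u \<in> set (y J)) * of_bool (w \<in> set (y J'))) * \<phi> (relabel ?\<tau> y))"
      proof (intro integral_cong_AE AE_pmfI)
        fix y assume "y \<in> set_pmf (law T x)"
        then have y: "y \<in> X" using set_law[OF x] by blast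
        have Yr: "Y J J' (relabel ?\<rho> y) = Y J J' y" using uwne by (simp add: Y_def in_relabel_transpose)
        have ur: "u \<in> set (relabel ?\<rho> y J') \<longleftrightarrow> w \<in> set (y J')" "w \<in> set (relabel ?\<rho> y J) \<longleftrightarrow> u \<in> set (y J)"
          by (simp_all add: in_relabel_transpose)
        have "\<phi> (relabel ?\<rho> y) = \<phi> (relabel ?\<tau> y)"
          if "a \<in> set (y J)" "b \<in> set (y J')" "u \<in> set (y J)" "w \<in> set (y J')"
        proof -
          have "contents \<kappa> (relabel ?\<rho> y) = contents \<kappa> (relabel ?\<tau> y)"
            unfolding contents_swap[OF y that(3,4) False] contents_swap[OF y that(1,2) False]
            by (simp add: \<kappa>I[OF u] \<kappa>I'[OF w])
          then show ?thesis using \<phi> relabel_X[OF y perm\<tau>[OF uw]] relabel_X[OF y perm\<tau>[OF a b]] unfolding contents_fun_def by blast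
        qed
        then show "?\<Phi> (relabel ?\<rho> y) = Y J J' y * (of_bool (u \<in> set (y J)) * of_bool (w \<in> set (y J'))) * \<phi> (relabel ?\<tau> y)"
          unfolding Yr ur by (auto simp: Y_def)
      qed auto
      finally show ?thesis .
    qed
    have cs: "real (cnt B y K) = (\<Sum>v\<in>B. of_bool (v \<in> set (y K)))" if "y \<in> X" "finite B" for B y K
      using that by (simp add: cnt_eq_card_set of_bool_def sum.If_cases Int_def)
    have sumex: "?E (\<lambda>y. Y J J' y * (real (cnt I y J') * real (cnt I' y J)) * \<phi> y) =
       ?E (\<lambda>y. Y J J' y * (real (cnt I y J) * real (cnt I' y J')) * \<phi> (relabel ?\<tau> y))"
    proof -
      have "?E (\<lambda>y. Y J J' y * (real (cnt I y J') * real (cnt I' y J)) * \<phi> y) =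
         ?E (\<lambda>y. \<Sum>u\<in>I. \<Sum>w\<in>I'. Y J J' y * (of_bool (u \<in> set (y J')) * of_bool (w \<in> set (y J))) * \<phi> y)"
      proof (intro integral_cong_AE AE_pmfI)
        fix y assume "y \<in> set_pmf (law T x)"
        then have y: "y \<in> X" using set_law[OF x] by blast
        show "Y J J' y * (real (cnt I y J') * real (cnt I' y J)) * \<phi> y = (\<Sum>u\<in>I. \<Sum>w\<in>I'. Y J J' y * (of_bool (u \<in> set (y J')) * of_bool (w \<in> set (y J))) * \<phi> y)"
          unfolding cs[OF y fin(1)] cs[OF y fin(2)] sum_product by (simp only: sum_distrib_left sum_distrib_right)
      qed auto
      also have "\<dots> = (\<Sum>u\<in>I. \<Sum>w\<in>I'. ?E (\<lambda>y. Y J J' y * (of_bool (u \<in> set (y J')) * of_bool (w \<in> set (y J))) * \<phi> y))"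
        by (subst Bochner_Integration.integral_sum[OF int], subst Bochner_Integration.integral_sum[OF int]) simp
      also have "\<dots> = (\<Sum>u\<in>I. \<Sum>w\<in>I'. ?E (\<lambda>y. Y J J' y * (of_bool (u \<in> set (y J)) * of_bool (w \<in> set (y J'))) * \<phi> (relabel ?\<tau> y)))"
        by (intro sum.cong refl ex)
      also have "\<dots> = ?E (\<lambda>y. \<Sum>u\<in>I. \<Sum>w\<in>I'. Y J J' y * (of_bool (u \<in> set (y J)) * of_bool (w \<in> set (y J'))) * \<phi> (relabel ?\<tau> y))"
        by (subst Bochner_Integration.integral_sum[OF int], subst Bochner_Integration.integral_sum[OF int]) simp
      also have "\<dots> = ?E (\<lambda>y. Y J J' y * (real (cnt I y J) * real (cnt I' y J')) * \<phi> (relabel ?\<tau> y))"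
      proof (intro integral_cong_AE AE_pmfI)
        fix y assume "y \<in> set_pmf (law T x)"
        then have y: "y \<in> X" using set_law[OF x] by blast
        show "(\<Sum>u\<in>I. \<Sum>w\<in>I'. Y J J' y * (of_bool (u \<in> set (y J)) * of_bool (w \<in> set (y J'))) * \<phi> (relabel ?\<tau> y)) = Y J J' y * (real (cnt I y J) * real (cnt I' y J')) * \<phi> (relabel ?\<tau> y)"
          unfolding cs[OF y fin(1)] cs[OF y fin(2)] sum_product by (simp only: sum_distrib_left sum_distrib_right)
      qed auto
      finally show ?thesis .
    qed
    define A where "A y = 1 - real (cnt I y J') * real (cnt I' y J) / m" for y
    define B where "B y = 1 - real (cnt I y J) * real (cnt I' y J') / m" for y
    \<comment> \<open>The deviations of the two weights from 1 are split off; the expectations of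
      the weighted parts cancel by \<open>sumex\<close>.\<close>
    have id: "Y J J' y * (\<phi> y - \<phi> (relabel ?\<tau> y)) = Y J J' y * A y * \<phi> y - Y J J' y * B y * \<phi> (relabel ?\<tau> y)
      + (Y J J' y * (real (cnt I y J') * real (cnt I' y J)) * \<phi> y - Y J J' y * (real (cnt I y J) * real (cnt I' y J')) * \<phi> (relabel ?\<tau> y)) / m" for y
      using m0 by (simp add: A_def B_def field_simps)
    have "?E (\<lambda>y. Y J J' y * (\<phi> y - \<phi> (relabel ?\<tau> y))) = ?E (\<lambda>y. Y J J' y * A y * \<phi> y - Y J J' y * B y * \<phi> (relabel ?\<tau> y))
      + ?E (\<lambda>y. (Y J J' y * (real (cnt I y J') * real (cnt I' y J)) * \<phi> y - Y J J' y * (real (cnt I y J) * real (cnt I' y J')) * \<phi> (relabel ?\<tau> y)) / m)"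
      unfolding id by (rule Bochner_Integration.integral_add[OF int int])
    also have "?E (\<lambda>y. (Y J J' y * (real (cnt I y J') * real (cnt I' y J)) * \<phi> y - Y J J' y * (real (cnt I y J) * real (cnt I' y J')) * \<phi> (relabel ?\<tau> y)) / m) = 0"
      using sumex by (simp add: int)
    finally have "\<bar>?E (\<lambda>y. Y J J' y * (\<phi> y - \<phi> (relabel ?\<tau> y)))\<bar> = \<bar>?E (\<lambda>y. Y J J' y * A y * \<phi> y - Y J J' y * B y * \<phi> (relabel ?\<tau> y))\<bar>" by simp
    also have "\<dots> \<le> ?E (\<lambda>y. \<bar>Y J J' y * A y * \<phi> y - Y J J' y * B y * \<phi> (relabel ?\<tau> y)\<bar>)"
      by (rule integral_abs_bound)
    also have "\<dots> \<le> ?E (\<lambda>y. \<bar>A y\<bar> + \<bar>B y\<bar>)"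
    proof (rule integral_mono[OF int int])
      fix y
      have Y01: "\<bar>Y J J' y\<bar> \<le> 1" by (simp add: Y_def)
      have t: "\<bar>Y J J' y * s * f\<bar> \<le> \<bar>s\<bar>" if "\<bar>f\<bar> \<le> 1" for s f
      proof -
        have "\<bar>Y J J' y * s * f\<bar> = \<bar>Y J J' y\<bar> * \<bar>s\<bar> * \<bar>f\<bar>" by (simp add: abs_mult)
        also have "\<dots> \<le> 1 * \<bar>s\<bar> * 1" using Y01 that by (intro mult_mono) auto
        finally show ?thesis by simp
      qed
      show "\<bar>Y J J' y * A y * \<phi> y - Y J J' y * B y * \<phi> (relabel ?\<tau> y)\<bar> \<le> \<bar>A y\<bar> + \<bar>B y\<bar>"
        using t[OF \<phi>1, of "A y" y] t[OF \<phi>1, of "B y" "relabel ?\<tau> y"] by linarith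
    qed
    also have "\<dots> = ?E (\<lambda>y. \<bar>A y\<bar>) + ?E (\<lambda>y. \<bar>B y\<bar>)" by (rule Bochner_Integration.integral_add[OF int int])
    also have "\<dots> \<le> 4 * CARD('d) * sqrt T / (l * c\<^sup>2) + 4 * CARD('d) * sqrt T / (l * c\<^sup>2)"
    proof (rule add_mono)
      show "?E (\<lambda>y. \<bar>A y\<bar>) \<le> 4 * CARD('d) * sqrt T / (l * c\<^sup>2)"
        using product_deviation[OF x I I' l c p pc p1, of J' J] by (simp add: A_def m_def mult.commute)
      show "?E (\<lambda>y. \<bar>B y\<bar>) \<le> 4 * CARD('d) * sqrt T / (l * c\<^sup>2)"
        using product_deviation[OF x I I' l c p pc p1, of J J'] by (simp add: B_def m_def)
    qed
    finally show ?thesis by simp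
  qed
  have "measure_pmf.expectation (law T x) \<phi> - measure_pmf.expectation (law T (relabel ?\<tau> x)) \<phi> = ?E (\<lambda>y. \<phi> y - \<phi> (relabel ?\<tau> y))"
    by (simp add: relabel_law[OF x] int)
  also have "\<dots> = ?E (\<lambda>y. \<Sum>J\<in>UNIV. \<Sum>J'\<in>UNIV. Y J J' y * (\<phi> y - \<phi> (relabel ?\<tau> y)))"
    using set_law[OF x] by (intro integral_cong_AE AE_pmfI split) auto
  also have "\<dots> = (\<Sum>J\<in>UNIV. \<Sum>J'\<in>UNIV. ?E (\<lambda>y. Y J J' y * (\<phi> y - \<phi> (relabel ?\<tau> y))))"
    by (subst Bochner_Integration.integral_sum[OF int], subst Bochner_Integration.integral_sum[OF int]) simp
  also have "\<bar>\<dots>\<bar> \<le> (\<Sum>J\<in>UNIV. \<Sum>J'\<in>UNIV. \<bar>?E (\<lambda>y. Y J J' y * (\<phi> y - \<phi> (relabel ?\<tau> y)))\<bar>)"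
    by (intro order_trans[OF sum_abs] sum_mono sum_abs)
  also have "\<dots> \<le> (\<Sum>J\<in>(UNIV::'d set). \<Sum>J'\<in>(UNIV::'d set). 8 * CARD('d) * sqrt T / (l * c\<^sup>2))"
    by (intro sum_mono pair)
  also have "\<dots> = 8 * (real CARD('d)) ^ 3 * sqrt T / (l * c\<^sup>2)" by (simp add: power3_eq_cube)
  finally show ?thesis .
qed

end

lemma exists_less_if_sum_eq:
  fixes f g :: "'a::finite \<Rightarrow> nat"
  assumes "(\<Sum>a\<in>UNIV. f a) = (\<Sum>a\<in>UNIV. g a)" "f a < g a"
  shows "\<exists>b. g b < f b"
proof (rule ccontr)
  assume "\<nexists>b. g b < f b"
  then have "f b \<le> g b" for b by (simp add: not_less)
  then have "(\<Sum>a\<in>UNIV. f a) < (\<Sum>a\<in>UNIV. g a)"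
    using assms(2) by (intro sum_strict_mono_ex1) auto
  with assms(1) show False by simp
qed

lemma sum_sum_of_bool: "(\<Sum>a\<in>UNIV. \<Sum>b\<in>UNIV. of_bool (a = u \<and> b = v)) = (1 :: real)"
  for u :: "'a::finite" and v :: "'b::finite"
proof -
  have "(\<Sum>a\<in>UNIV. \<Sum>b\<in>UNIV. of_bool (a = u \<and> b = v)) = (\<Sum>a\<in>UNIV. of_bool (a = u)) * (\<Sum>b\<in>UNIV. of_bool (b = v) :: real)"
    by (simp only: sum_product of_bool_conj)
  then show ?thesis by (simp add: of_bool_def)
qed

context stack_shuffle
begin

section \<open>Paths of swaps\<close>

lemma discrepancy_eq:
  "discrepancy \<kappa> (x, y) = (\<Sum>i\<in>UNIV. \<Sum>j\<in>UNIV. \<bar>real (colour_cnt \<kappa> i x j) - real (colour_cnt \<kappa> i y j)\<bar>)"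
  by (simp add: discrepancy_def norm_delta)

text \<open>The tables of colour counts of \<open>x\<close> and \<open>y\<close> have equal row and
  column sums, so there are a surplus at \<open>(i, s)\<close>, a deficit at \<open>(i', s)\<close>
  and a surplus at \<open>(i', s')\<close>. Exchanging two cards improves these three entries by 1
  and worsens \<open>(i, s')\<close> by at most 1. Only entries above those of \<open>y\<close>
  decrease, so the lower bound \<open>l\<close> survives.\<close>

lemma discrepancy_swap:
  assumes x: "x \<in> X" and y: "y \<in> X" and ne: "contents \<kappa> x \<noteq> contents \<kappa> y"
    and lx: "\<And>i j. colour_cnt \<kappa> i x j \<ge> l" and ly: "\<And>i j. colour_cnt \<kappa> i y j \<ge> l"
  shows "\<exists>a b. a < CARD('d) * n \<and> b < CARD('d) * n \<and> \<kappa> a \<noteq> \<kappa> b \<and>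
    discrepancy \<kappa> (relabel (Transposition.transpose a b) x, y) \<le> discrepancy \<kappa> (x, y) - 2 \<and>
    (\<forall>i j. colour_cnt \<kappa> i (relabel (Transposition.transpose a b) x) j \<ge> l)"
proof -
  let ?cx = "\<lambda>i j. colour_cnt \<kappa> i x j" and ?cy = "\<lambda>i j. colour_cnt \<kappa> i y j"
  have "\<exists>i j. ?cx i j \<noteq> ?cy i j"
  proof (rule ccontr)
    assume "\<nexists>i j. ?cx i j \<noteq> ?cy i j"
    then have "contents \<kappa> x j = contents \<kappa> y j" for j
      by (intro multiset_eqI) (simp add: colour_cnt_contents)
    then show False using ne by blast
  qed
  then obtain i0 s where i0: "?cx i0 s \<noteq> ?cy i0 s" by blast
  have col: "(\<Sum>i\<in>UNIV. ?cx i s) = (\<Sum>i\<in>UNIV. ?cy i s)" for s by (simp add: sum_colour_cnt x y)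
  have row: "(\<Sum>s\<in>UNIV. ?cx i s) = (\<Sum>s\<in>UNIV. ?cy i s)" for i by (simp add: sum_colour_cnt_stacks x y)
  have "\<exists>i i'. ?cy i s < ?cx i s \<and> ?cx i' s < ?cy i' s"
  proof (cases "?cx i0 s < ?cy i0 s")
    case True
    then show ?thesis using exists_less_if_sum_eq[OF col[of s] True] by blast
  next
    case False
    then have "?cy i0 s < ?cx i0 s" using i0 by simp
    then show ?thesis using exists_less_if_sum_eq[OF col[of s, symmetric]] by blast
  qed
  then obtain i i' where i: "?cy i s < ?cx i s" and i': "?cx i' s < ?cy i' s" by blast
  obtain s' where s': "?cy i' s' < ?cx i' s'" using exists_less_if_sum_eq[OF row[of i'] i'] by blast
  have ii: "i \<noteq> i'" "s \<noteq> s'" using i i' s' by auto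
  have "?cx i s > 0" "?cx i' s' > 0" using i s' by auto
  then have "{c. \<kappa> c = i} \<inter> set (x s) \<noteq> {}" "{c. \<kappa> c = i'} \<inter> set (x s') \<noteq> {}"
    by (auto simp: colour_cnt_def cnt_eq_card_set[OF x] card_gt_0_iff)
  then obtain a b where a: "\<kappa> a = i" "a \<in> set (x s)" and b: "\<kappa> b = i'" "b \<in> set (x s')" by blast
  have ab: "a < CARD('d) * n" "b < CARD('d) * n" using a b x unfolding arrangements_iff by blast+
  define z where "z = relabel (Transposition.transpose a b) x"
  have cz: "contents \<kappa> z = (contents \<kappa> x)(s := add_mset i' (contents \<kappa> x s - {#i#}), s' := add_mset i (contents \<kappa> x s' - {#i'#}))"
    unfolding z_def using contents_swap[OF x a(2) b(2) ii(2), of \<kappa>] by (simp add: a b)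
  have pos: "count (contents \<kappa> x s) i > 0" "count (contents \<kappa> x s') i' > 0"
    using i s' unfolding colour_cnt_contents by linarith+
  have zc: "real (colour_cnt \<kappa> I z J) = real (?cx I J) - of_bool (I = i \<and> J = s) - of_bool (I = i' \<and> J = s')
     + of_bool (I = i' \<and> J = s) + of_bool (I = i \<and> J = s')" for I J
    using pos ii by (auto simp: colour_cnt_contents cz of_bool_def of_nat_diff)
  have "\<bar>real (colour_cnt \<kappa> I z J) - real (?cy I J)\<bar> \<le> \<bar>real (?cx I J) - real (?cy I J)\<bar>
      - of_bool (I = i \<and> J = s) - of_bool (I = i' \<and> J = s') - of_bool (I = i' \<and> J = s) + of_bool (I = i \<and> J = s')" for I J
    unfolding zc using i i' s' ii by (auto simp: of_bool_def)
  then have "discrepancy \<kappa> (z, y) \<le> (\<Sum>I\<in>UNIV. \<Sum>J\<in>UNIV. \<bar>real (?cx I J) - real (?cy I J)\<bar>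
      - of_bool (I = i \<and> J = s) - of_bool (I = i' \<and> J = s') - of_bool (I = i' \<and> J = s) + of_bool (I = i \<and> J = s'))"
    unfolding discrepancy_eq by (intro sum_mono)
  also have "\<dots> = discrepancy \<kappa> (x, y) - 2"
    unfolding discrepancy_eq sum.distrib sum_subtractf sum_sum_of_bool by simp
  finally have d: "discrepancy \<kappa> (z, y) \<le> discrepancy \<kappa> (x, y) - 2" .
  have "colour_cnt \<kappa> I z J \<ge> l" for I J
  proof -
    have "real (colour_cnt \<kappa> I z J) \<ge> real l"
    proof (cases "(I = i \<and> J = s) \<or> (I = i' \<and> J = s')")
      case True
      then have "real (?cx I J) \<ge> real (?cy I J) + 1" using i s' by auto
      then show ?thesis unfolding zc using True ii ly[of I J] by (auto simp: of_bool_def)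
    next
      case False
      then show ?thesis unfolding zc using lx[of I J] by (auto simp: of_bool_def)
    qed
    then show ?thesis by simp
  qed
  then show ?thesis using d ab a b ii unfolding z_def by blast
qed

text \<open>Interpolates between \<open>x\<close> and \<open>y\<close> by swaps; each costs at most
  \<open>\<epsilon>\<close> and lowers the discrepancy by at least 2, which limits their
  number.\<close>

lemma swap_path:
  fixes p :: "'d \<Rightarrow> real" and c :: real and l :: nat
  assumes y: "y \<in> X"
    and \<phi>: "contents_fun \<kappa> \<phi>" and \<phi>1: "\<And>y. \<bar>\<phi> y\<bar> \<le> 1" and l: "l > 0"
    and ly: "\<And>i j. colour_cnt \<kappa> i y j \<ge> l + 1"
    and c: "c > 0" and p: "\<And>J. p J = Re ((lazy n ^^ T) (\<lambda>j. of_bool (j = J)) k0)" and pc: "\<And>J. p J \<ge> c" and p1: "\<And>J. p J \<le> 1"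
  defines "\<epsilon> \<equiv> 8 * (real CARD('d)) ^ 3 * sqrt T / (l * c\<^sup>2)"
  assumes x: "x \<in> X" and lx: "\<And>i j. colour_cnt \<kappa> i x j \<ge> l + 1"
  shows "\<bar>measure_pmf.expectation (law T x) \<phi> - measure_pmf.expectation (law T y) \<phi>\<bar> \<le> discrepancy \<kappa> (x, y) * \<epsilon>"
proof -
  have \<epsilon>: "\<epsilon> \<ge> 0" by (simp add: \<epsilon>_def)
  have d0: "discrepancy \<kappa> z \<ge> 0" for z by (simp add: discrepancy_def sum_nonneg)
  have "\<bar>measure_pmf.expectation (law T x) \<phi> - measure_pmf.expectation (law T y) \<phi>\<bar> \<le> discrepancy \<kappa> (x, y) * \<epsilon>"
    if "discrepancy \<kappa> (x, y) \<le> real k" for k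
    using that x lx
  proof (induction k arbitrary: x)
    case 0
    have "contents \<kappa> x = contents \<kappa> y"
    proof (rule ccontr)
      assume "contents \<kappa> x \<noteq> contents \<kappa> y"
      then obtain a b where "discrepancy \<kappa> (relabel (Transposition.transpose a b) x, y) \<le> discrepancy \<kappa> (x, y) - 2"
        using discrepancy_swap[OF "0.prems"(2) y _ "0.prems"(3) ly] by blast
      then show False using "0.prems"(1) d0[of "(relabel (Transposition.transpose a b) x, y)"] by simp
    qed
    then have "measure_pmf.expectation (law T x) \<phi> = measure_pmf.expectation (law T y) \<phi>"
      by (rule expectation_contents[OF "0.prems"(2) y _ \<phi>])
    then show ?case using d0 \<epsilon> by simp
  next
    case (Suc k)
    show ?case
    proof (cases "contents \<kappa> x = contents \<kappa> y")
      case True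
      then have "measure_pmf.expectation (law T x) \<phi> = measure_pmf.expectation (law T y) \<phi>"
        by (rule expectation_contents[OF Suc.prems(2) y _ \<phi>])
      then show ?thesis using d0 \<epsilon> by simp
    next
      case False
      then obtain a b where ab: "a < CARD('d) * n" "b < CARD('d) * n" "\<kappa> a \<noteq> \<kappa> b"
        and d: "discrepancy \<kappa> (relabel (Transposition.transpose a b) x, y) \<le> discrepancy \<kappa> (x, y) - 2"
        and lz: "\<And>i j. colour_cnt \<kappa> i (relabel (Transposition.transpose a b) x) j \<ge> l + 1"
        using discrepancy_swap[OF Suc.prems(2) y False Suc.prems(3) ly] by blast
      let ?z = "relabel (Transposition.transpose a b) x"
      have z: "?z \<in> X" by (rule relabel_X[OF Suc.prems(2)]) (use ab in \<open>auto intro: permutes_swap_id\<close>)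
      \<comment> \<open>The swapped card itself must be left out, hence the requirement of
        \<open>l + 1\<close> cards per colour and stack.\<close>
      define I where "I v = ({w. \<kappa> w = \<kappa> v} \<inter> set (x k0)) - {v}" for v
      have cI: "card (I v) \<ge> l" for v
      proof -
        have "card (I v) \<ge> card ({w. \<kappa> w = \<kappa> v} \<inter> set (x k0)) - 1" unfolding I_def by (simp add: card_Diff1_le card_Diff_singleton_if)
        then show ?thesis using Suc.prems(3)[of "\<kappa> v" k0] by (simp add: colour_cnt_def cnt_eq_card_set[OF Suc.prems(2)])
      qed
      have "\<bar>measure_pmf.expectation (law T x) \<phi> - measure_pmf.expectation (law T ?z) \<phi>\<bar> \<le> \<epsilon>"
        unfolding \<epsilon>_def
        by (rule swap_smoothing[OF Suc.prems(2) ab(1,2) \<phi> \<phi>1 _ _ _ _ ab(3) _ _ l cI[of a] cI[of b] c p pc p1])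
          (auto simp: I_def)
      moreover have "\<bar>measure_pmf.expectation (law T ?z) \<phi> - measure_pmf.expectation (law T y) \<phi>\<bar> \<le> discrepancy \<kappa> (?z, y) * \<epsilon>"
        by (rule Suc.IH[OF _ z lz]) (use d Suc.prems(1) in simp)
      moreover have "discrepancy \<kappa> (?z, y) * \<epsilon> \<le> (discrepancy \<kappa> (x, y) - 2) * \<epsilon>" using d \<epsilon> by (rule mult_right_mono)
      ultimately show ?thesis using \<epsilon> by (simp add: algebra_simps)
    qed
  qed
  moreover obtain k where "discrepancy \<kappa> (x, y) \<le> real k" using real_arch_simple by blast
  ultimately show ?thesis by blast
qed

section \<open>Typical colour counts and the reduction to colours\<close>

text \<open>Chebyshev's inequality over the last \<open>T\<close> steps, from an arbitrary state at
  time \<open>k - T\<close>. A colour has \<open>n\<close> cards, each in stack \<open>J\<close>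
  with probability at least \<open>3 / (4 d)\<close>, so the mean count exceeds the threshold by at
  least \<open>n / (4 d)\<close>.\<close>

lemma bulk_probability:
  assumes x: "x \<in> X" and cls: "\<And>i. card {c. c < CARD('d) * n \<and> \<kappa> c = i} = n"
    and eq: "\<And>a J. norm ((lazy n ^^ T) (\<lambda>j. of_bool (j = J)) a - 1 / of_nat CARD('d)) \<le> 1 / (4 * CARD('d))"
    and k: "T \<le> k"
  shows "measure_pmf.prob (law k x) {y. \<exists>i j. real (colour_cnt \<kappa> i y j) < n / (2 * CARD('d))} \<le> 64 * (real CARD('d)) ^ 6 * T / (real n)\<^sup>2"
proof -
  let ?d = "real CARD('d)"
  let ?Bad = "{y. \<exists>i j. real (colour_cnt \<kappa> i y j) < n / (2 * CARD('d))}"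
  have base: "measure_pmf.prob (law T x) ?Bad \<le> 64 * ?d ^ 6 * T / (real n)\<^sup>2" if x: "x \<in> X" for x
  proof -
    let ?P = "measure_pmf.prob (law T x)"
    define f where "f J = (\<lambda>j. of_bool (j = J) :: complex)" for J :: 'd
    have st: "stat (f J) B y = of_nat (cnt B y J)" for J B y
      by (simp add: stat_def f_def of_bool_def if_distrib[where f = "\<lambda>x. x * _"] cong: if_cong)
    have q: "Re ((lazy n ^^ T) (f J) a) \<ge> 3 / (4 * ?d)" for J a
    proof -
      have "\<bar>Re ((lazy n ^^ T) (f J) a - 1 / of_nat CARD('d))\<bar> \<le> 1 / (4 * ?d)"
        using order_trans[OF abs_Re_le_cmod eq[of J a]] by (simp add: f_def)
      moreover have "Re ((lazy n ^^ T) (f J) a - 1 / of_nat CARD('d)) = Re ((lazy n ^^ T) (f J) a) - 1 / ?d" by simp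
      moreover have "1 / ?d = 4 * (1 / (4 * ?d))" "3 / (4 * ?d) = 3 * (1 / (4 * ?d))" by simp_all
      moreover have "z \<ge> 3 * e" if "\<bar>z - 4 * e\<bar> \<le> e" for z e :: real using that by linarith
      ultimately show ?thesis by metis
    qed
    have one: "?P {y. real (colour_cnt \<kappa> i y J) < n / (2 * ?d)} \<le> 64 * ?d ^ 4 * T / (real n)\<^sup>2" for i J
    proof -
      let ?C = "{v. \<kappa> v = i}"
      let ?m = "stat ((lazy n ^^ T) (f J)) ?C x"
      have "Re ?m = (\<Sum>j\<in>UNIV. Re ((lazy n ^^ T) (f J) j) * real (colour_cnt \<kappa> i x j))"
        by (simp add: stat_def colour_cnt_def)
      also have "\<dots> \<ge> (\<Sum>j\<in>UNIV. 3 / (4 * ?d) * real (colour_cnt \<kappa> i x j))"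
        by (intro sum_mono mult_right_mono q) auto
      also have "(\<Sum>j\<in>UNIV. 3 / (4 * ?d) * real (colour_cnt \<kappa> i x j)) = 3 / (4 * ?d) * n"
        unfolding sum_distrib_left[symmetric] of_nat_sum[symmetric] sum_colour_cnt_stacks[OF x] cls ..
      finally have m: "Re ?m \<ge> 3 / (4 * ?d) * n" .
      have n1: "real n \<ge> 1" using n_pos by simp
      have "norm ((lazy n ^^ s) (f J) j) \<le> 1" for s j by (rule lazy_funpow_le[OF n1]) (simp add: f_def)
      from stat_law_deviation[OF x this, of T ?C]
      have v: "measure_pmf.expectation (law T x) (\<lambda>y. (norm (stat (f J) ?C y - ?m))\<^sup>2) \<le> T * (2 * ?d)\<^sup>2" by simp
      have "?P {y. real (colour_cnt \<kappa> i y J) < n / (2 * ?d)} \<le> ?P {y. norm (stat (f J) ?C y - ?m) \<ge> n / (4 * ?d)}"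
      proof (rule measure_pmf.finite_measure_mono)
        show "{y. real (colour_cnt \<kappa> i y J) < n / (2 * ?d)} \<subseteq> {y. norm (stat (f J) ?C y - ?m) \<ge> n / (4 * ?d)}"
        proof clarify
          fix y assume a: "real (colour_cnt \<kappa> i y J) < n / (2 * ?d)"
          have "Re ?m - real (colour_cnt \<kappa> i y J) \<le> norm (stat (f J) ?C y - ?m)"
            using abs_Re_le_cmod[of "stat (f J) ?C y - ?m"] by (simp add: st colour_cnt_def)
          moreover have "3 / (4 * ?d) * n - n / (2 * ?d) = n / (4 * ?d)" by (simp add: field_simps)
          ultimately show "n / (4 * ?d) \<le> norm (stat (f J) ?C y - ?m)" using a m by linarith
        qed
      qed simp
      also have "\<dots> \<le> measure_pmf.expectation (law T x) (\<lambda>y. (norm (stat (f J) ?C y - ?m))\<^sup>2) / (n / (4 * ?d))\<^sup>2"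
        by (rule markov_norm2[OF finite_set_law]) (use n_pos in simp)
      also have "\<dots> \<le> T * (2 * ?d)\<^sup>2 / (n / (4 * ?d))\<^sup>2" using v by (rule divide_right_mono) simp
      also have "\<dots> = 64 * ?d ^ 4 * T / (real n)\<^sup>2"
        using n_pos by (simp add: power2_eq_square power4_eq_xxxx field_simps)
      finally show ?thesis .
    qed
    have Bad: "?Bad = (\<Union>ij\<in>UNIV. {y. real (colour_cnt \<kappa> (fst ij) y (snd ij)) < n / (2 * ?d)})"
      by (simp add: set_eq_iff split_paired_Ex)
    have "?P ?Bad \<le> (\<Sum>ij\<in>UNIV. ?P {y. real (colour_cnt \<kappa> (fst ij) y (snd ij)) < n / (2 * ?d)})"
      unfolding Bad by (rule measure_pmf.finite_measure_subadditive_finite) auto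
    also have "\<dots> \<le> (\<Sum>ij\<in>(UNIV :: ('d \<times> 'd) set). 64 * ?d ^ 4 * T / (real n)\<^sup>2)" by (intro sum_mono one)
    also have "\<dots> = 64 * ?d ^ 6 * T / (real n)\<^sup>2" by (simp add: power_numeral_reduce)
    finally show ?thesis .
  qed
  note int = integrable_measure_pmf_finite[OF finite_set_law]
  have "measure_pmf.prob (law k x) ?Bad = measure_pmf.expectation (law (k - T + T) x) (indicator ?Bad)" using k by simp
  also have "\<dots> = measure_pmf.expectation (law (k - T) x) (\<lambda>y. measure_pmf.expectation (law T y) (indicator ?Bad))"
    unfolding law_add by (rule expectation_bind_finite[OF finite_set_law finite_set_law])
  also have "\<dots> \<le> measure_pmf.expectation (law (k - T) x) (\<lambda>_. 64 * ?d ^ 6 * T / (real n)\<^sup>2)"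
    using set_law[OF x] base by (intro integral_mono_AE int AE_pmfI) auto
  finally show ?thesis by simp
qed

text \<open>Averaging \<open>h\<close> over all relabellings that preserve the initial stacks yields
  a function of the colour counts. The expectations stay the same, since such relabellings fix the
  contents of \<open>x\<close> and the uniform law. Thus \<open>d\<close> colours are enough to test
  the contents.\<close>

lemma colour_average_fun:
  fixes h :: "('d \<Rightarrow> nat list) \<Rightarrow> real"
  assumes x: "x \<in> X" and h: "contents_fun id h" and h01: "\<And>y. 0 \<le> h y" "\<And>y. h y \<le> 1"
  defines "\<kappa> \<equiv> (\<lambda>v. THE j. v \<in> set (x j))"
  shows "\<exists>\<phi>. contents_fun \<kappa> \<phi> \<and> (\<forall>y. \<bar>\<phi> y\<bar> \<le> 1) \<and>
     (\<forall>k. measure_pmf.expectation (law k x) \<phi> = measure_pmf.expectation (law k x) h) \<and>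
     measure_pmf.expectation U0 \<phi> = measure_pmf.expectation U0 h \<and>
     (\<forall>i. card {c. c < CARD('d) * n \<and> \<kappa> c = i} = n)"
proof -
  let ?V = "{..<CARD('d) * n}"
  have \<kappa>: "\<kappa> v = j" if "v \<in> set (x j)" for v j
    unfolding \<kappa>_def using that arrangements_disjoint[OF x] by (intro the_equality) auto
  have Vx: "?V = (\<Union>j. set (x j))" using x unfolding arrangements_iff by blast
  have xj: "v \<in> set (x j) \<longleftrightarrow> v \<in> ?V \<and> \<kappa> v = j" for v j using \<kappa> Vx by blast
  define G where "G = {g. g permutes ?V \<and> (\<forall>v\<in>?V. \<kappa> (g v) = \<kappa> v)}"
  have finG: "finite G" unfolding G_def by (rule finite_subset[OF _ finite_permutations[of ?V]]) auto
  have idG: "id \<in> G" by (simp add: G_def permutes_id)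
  have cG: "real (card G) > 0" using finG idG by (auto simp: card_gt_0_iff)
  have rel: "relabel f (relabel g y) = relabel (f \<circ> g) y" for f g y by (simp add: relabel_def)
  have Gcomp: "f \<circ> g \<in> G" if "f \<in> G" "g \<in> G" for f g
    using that permutes_in_image[of g ?V] by (auto simp: G_def permutes_compose)
  define \<phi> where "\<phi> y = (\<Sum>g\<in>G. h (relabel g y)) / card G" for y
  have \<phi>1: "\<bar>\<phi> y\<bar> \<le> 1" for y
  proof -
    have "(\<Sum>g\<in>G. h (relabel g y)) \<le> (\<Sum>g\<in>G. 1)" by (intro sum_mono h01)
    then show ?thesis using cG h01 by (simp add: \<phi>_def sum_nonneg divide_le_eq)
  qed
  have \<phi>G: "\<phi> (relabel g0 y) = \<phi> y" if g0: "g0 \<in> G" for g0 y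
  proof -
    have inj: "inj_on (\<lambda>g. g \<circ> g0) G"
    proof (rule inj_onI)
      fix f g assume "f \<circ> g0 = g \<circ> g0"
      moreover have "surj g0" using g0 permutes_surj[of g0 ?V] unfolding G_def by blast
      ultimately show "f = g" unfolding surj_def fun_eq_iff comp_apply by metis
    qed
    have "(\<lambda>g. g \<circ> g0) ` G = G" using Gcomp[OF _ g0] by (intro endo_inj_surj[OF finG _ inj]) auto
    then have "bij_betw (\<lambda>g. g \<circ> g0) G G" using inj by (simp add: bij_betw_def)
    then have "(\<Sum>g\<in>G. h (relabel (g \<circ> g0) y)) = (\<Sum>g\<in>G. h (relabel g y))"
      by (rule sum.reindex_bij_betw)
    then show ?thesis by (simp add: \<phi>_def rel)
  qed
  have \<phi>id: "\<phi> y = \<phi> z" if "y \<in> X" "z \<in> X" "contents id y = contents id z" for y z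
  proof -
    have "h (relabel g y) = h (relabel g z)" if g: "g \<in> G" for g
    proof -
      have "contents id (relabel g w) = (\<lambda>j. image_mset g (contents id w j))" for w
        by (simp add: contents_def relabel_def)
      then have "contents id (relabel g y) = contents id (relabel g z)" using \<open>contents id y = contents id z\<close> by simp
      moreover have "relabel g y \<in> X" "relabel g z \<in> X" using g \<open>y \<in> X\<close> \<open>z \<in> X\<close> relabel_X by (auto simp: G_def)
      ultimately show ?thesis using h unfolding contents_fun_def by blast
    qed
    then show ?thesis by (simp add: \<phi>_def)
  qed
  have \<phi>\<kappa>: "contents_fun \<kappa> \<phi>"
    unfolding contents_fun_def
  proof (intro ballI impI)
    fix y z assume y: "y \<in> X" and z: "z \<in> X" and e: "contents \<kappa> y = contents \<kappa> z"
    note ly = arrangements_length[OF y] and lz = arrangements_length[OF z]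
    have "\<exists>\<theta>. \<theta> permutes {..<n} \<and> (\<forall>p<n. \<kappa> (y j ! p) = \<kappa> (z j ! \<theta> p))" for j
    proof -
      obtain \<theta> where th: "bij_betw \<theta> {..<n} {..<n}"
        "card {p. p < n \<and> \<kappa> (y j ! p) \<noteq> \<kappa> (z j ! \<theta> p)} \<le> size (mset (map \<kappa> (y j)) - mset (map \<kappa> (z j)))"
        using colour_matching_exists[of "y j" n "z j" \<kappa>] ly lz by blast
      have "mset (map \<kappa> (y j)) = mset (map \<kappa> (z j))" using fun_cong[OF e, of j] by (simp add: contents_def)
      with th have e: "{p. p < n \<and> \<kappa> (y j ! p) \<noteq> \<kappa> (z j ! \<theta> p)} = {}" by simp
      define \<theta>' where "\<theta>' p = (if p < n then \<theta> p else p)" for p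
      have "bij_betw \<theta>' {..<n} {..<n}" using th(1) bij_betw_cong[of "{..<n}" \<theta>' \<theta> "{..<n}"] by (simp add: \<theta>'_def)
      then have "\<theta>' permutes {..<n}" by (intro bij_imp_permutes) (auto simp: \<theta>'_def)
      moreover have "\<forall>p<n. \<kappa> (y j ! p) = \<kappa> (z j ! \<theta>' p)" using e by (auto simp: \<theta>'_def)
      ultimately show ?thesis by blast
    qed
    then obtain \<theta> where \<theta>: "\<And>j. \<theta> j permutes {..<n}" and match: "\<And>j p. p < n \<Longrightarrow> \<kappa> (y j ! p) = \<kappa> (z j ! \<theta> j p)"
      by metis
    \<comment> \<open>Rearranging \<open>z\<close> within its stacks makes its colours agree with
      those of \<open>y\<close> in every position; the relabelling from \<open>y\<close> to
      \<open>z'\<close> then preserves colours.\<close>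
    define z' where "z' j = permute_list (\<theta> j) (z j)" for j
    have ms: "mset (z' j) = mset (z j)" for j unfolding z'_def using \<theta> lz by (simp add: mset_permute_list)
    have z'X: "z' \<in> X" using fiber_arrangements[OF z, of z'] ms by (simp add: fiber_def)
    have zn: "z' j ! p = z j ! \<theta> j p" if "p < n" for j p
      using that \<theta>[of j] lz by (simp add: z'_def permute_list_nth)
    obtain g where g: "g permutes ?V" "\<And>j. map g (y j) = z' j" using relabelling_exists[OF y z'X] by blast
    have "g \<in> G"
      unfolding G_def
    proof (intro CollectI conjI ballI g(1))
      fix v assume "v \<in> ?V"
      then have "v \<in> (\<Union>j. set (y j))" using y unfolding arrangements_iff by simp
      then obtain j p where v: "p < n" "v = y j ! p" using ly by (auto simp: in_set_conv_nth)
      have "g v = z' j ! p" using v ly g(2)[of j] by (metis nth_map)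
      then show "\<kappa> (g v) = \<kappa> v" using match[OF v(1)] zn[OF v(1)] v(2) by simp
    qed
    moreover have "relabel g y = z'" using g(2) by (auto simp: relabel_def)
    ultimately have "\<phi> z' = \<phi> y" using \<phi>G by metis
    moreover have "\<phi> z' = \<phi> z" by (rule \<phi>id[OF z'X z]) (simp add: contents_def ms)
    ultimately show "\<phi> y = \<phi> z" by simp
  qed
  have law: "measure_pmf.expectation (law k x) \<phi> = measure_pmf.expectation (law k x) h" for k
  proof -
    note int = integrable_measure_pmf_finite[OF finite_set_law]
    have "measure_pmf.expectation (law k x) (\<lambda>y. h (relabel g y)) = measure_pmf.expectation (law k x) h" if g: "g \<in> G" for g
    proof (rule expectation_relabel[OF x _ _ h, symmetric])
      show gp: "g permutes ?V" using g by (simp add: G_def)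
      show "contents id (relabel g x) = contents id x"
      proof
        fix j
        have "g ` set (x j) \<subseteq> set (x j)"
        proof
          fix w assume "w \<in> g ` set (x j)"
          then obtain v where v: "v \<in> set (x j)" "w = g v" by blast
          then have "v \<in> ?V" "\<kappa> v = j" using xj by blast+
          then have "g v \<in> ?V" "\<kappa> (g v) = j" using g permutes_in_image[OF gp, of v] unfolding G_def by blast+
          then show "w \<in> set (x j)" using xj v by blast
        qed
        moreover have ing: "inj_on g (set (x j))" using gp by (meson permutes_inj inj_on_subset subset_UNIV)
        ultimately have "g ` set (x j) = set (x j)" by (simp add: endo_inj_surj)
        moreover have "distinct (map g (x j))" using ing arrangements_distinct[OF x] by (simp add: distinct_map)
        ultimately have "mset (map g (x j)) = mset (x j)"
          using arrangements_distinct[OF x] by (metis list.set_map set_eq_iff_mset_eq_distinct)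
        then show "contents id (relabel g x) j = contents id x j" by (simp add: contents_def relabel_def)
      qed
    qed
    then have "(\<Sum>g\<in>G. measure_pmf.expectation (law k x) (\<lambda>y. h (relabel g y))) = card G * measure_pmf.expectation (law k x) h" by simp
    moreover have "measure_pmf.expectation (law k x) (\<lambda>y. \<Sum>g\<in>G. h (relabel g y)) = (\<Sum>g\<in>G. measure_pmf.expectation (law k x) (\<lambda>y. h (relabel g y)))"
      by (rule Bochner_Integration.integral_sum) (rule int)
    ultimately show ?thesis using cG by (simp add: \<phi>_def[abs_def])
  qed
  have unif: "measure_pmf.expectation U0 \<phi> = measure_pmf.expectation U0 h"
  proof -
    have fU: "finite (set_pmf U0)" by (simp add: set_U0 finite_arrangements)
    note int = integrable_measure_pmf_finite[OF fU]
    have "measure_pmf.expectation U0 (\<lambda>y. h (relabel g y)) = measure_pmf.expectation U0 h" if g: "g \<in> G" for g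
    proof -
      have gp: "g permutes ?V" using g by (simp add: G_def)
      have inj: "inj_on (relabel g) X"
      proof (rule inj_onI, rule ext)
        fix y z j assume "relabel g y = relabel g z"
        then have "map g (y j) = map g (z j)" unfolding relabel_def by meson
        then show "y j = z j" using permutes_inj[OF gp] by (simp add: inj_map_eq_map)
      qed
      have "relabel g ` X = X" by (rule endo_inj_surj[OF finite_arrangements _ inj]) (use relabel_X gp in auto)
      then have "map_pmf (relabel g) U0 = U0"
        using map_pmf_of_set_inj[OF inj arrangements_nonempty finite_arrangements] by (simp add: U0_def)
      then show ?thesis by (metis integral_map_pmf)
    qed
    then have "(\<Sum>g\<in>G. measure_pmf.expectation U0 (\<lambda>y. h (relabel g y))) = card G * measure_pmf.expectation U0 h" by simp
    moreover have "measure_pmf.expectation U0 (\<lambda>y. \<Sum>g\<in>G. h (relabel g y)) = (\<Sum>g\<in>G. measure_pmf.expectation U0 (\<lambda>y. h (relabel g y)))"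
      by (rule Bochner_Integration.integral_sum) (rule int)
    ultimately show ?thesis using cG by (simp add: \<phi>_def[abs_def])
  qed
  have "card {c. c < CARD('d) * n \<and> \<kappa> c = i} = n" for i
  proof -
    have "{c. c < CARD('d) * n \<and> \<kappa> c = i} = set (x i)" using xj[of _ i] by auto
    then show ?thesis using distinct_card[OF arrangements_distinct[OF x, of i]] arrangements_length[OF x] by simp
  qed
  then show ?thesis using \<phi>\<kappa> \<phi>1 law unif by blast
qed

text \<open>After \<open>k\<close> coupled steps the colour counts of two starts have an expected
  distance of at most \<open>D\<close>. The last \<open>T\<close> steps act as a smoothing kernel,
  for which this distance costs a multiple of \<open>D * sqrt T / n\<close>; the other term comes
  from atypical colour counts.\<close>

lemma contents_mixing:
  fixes h :: "('d \<Rightarrow> nat list) \<Rightarrow> real"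
  assumes x: "x \<in> X" and h: "contents_fun id h" and h01: "\<And>y. 0 \<le> h y" "\<And>y. h y \<le> 1"
    and eq: "\<And>a J. norm ((lazy n ^^ T) (\<lambda>j. of_bool (j = J)) a - 1 / of_nat CARD('d)) \<le> 1 / (4 * CARD('d))"
    and k: "T \<le> k" and n8: "real n \<ge> 8 * CARD('d)"
    and D: "\<And>\<kappa> y. y \<in> X \<Longrightarrow> measure_pmf.expectation (pair_law \<kappa> k (x, y)) (discrepancy \<kappa>) \<le> D"
  shows "\<bar>measure_pmf.expectation (law (k + T) x) h - measure_pmf.expectation U0 h\<bar> \<le>
    256 * (real CARD('d)) ^ 6 * (T / (real n)\<^sup>2 + D * sqrt T / n)"
proof -
  let ?d = "real CARD('d)"
  define \<kappa> where "\<kappa> = (\<lambda>v. THE j. v \<in> set (x j))"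
  obtain \<phi> where \<phi>: "contents_fun \<kappa> \<phi>" and \<phi>1: "\<And>y. \<bar>\<phi> y\<bar> \<le> 1"
    and \<phi>l: "\<And>k. measure_pmf.expectation (law k x) \<phi> = measure_pmf.expectation (law k x) h"
    and \<phi>u: "measure_pmf.expectation U0 \<phi> = measure_pmf.expectation U0 h"
    and cls: "\<And>i. card {c. c < CARD('d) * n \<and> \<kappa> c = i} = n"
    using colour_average_fun[OF x h h01] unfolding \<kappa>_def by blast
  define \<psi> where "\<psi> y = measure_pmf.expectation (law T y) \<phi>" for y
  define k0 :: 'd where "k0 = undefined"
  define p where "p J = Re ((lazy n ^^ T) (\<lambda>j. of_bool (j = J)) k0)" for J
  define c where "c = 1 / (2 * ?d)"
  have c: "c > 0" by (simp add: c_def)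
  have pc: "p J \<ge> c" for J
  proof -
    have "\<bar>Re ((lazy n ^^ T) (\<lambda>j. of_bool (j = J)) k0 - 1 / of_nat CARD('d))\<bar> \<le> 1 / (4 * ?d)"
      using order_trans[OF abs_Re_le_cmod eq[of J k0]] by simp
    then have "\<bar>p J - 1 / ?d\<bar> \<le> 1 / (4 * ?d)" by (simp add: p_def)
    moreover have "1 / ?d - 1 / (4 * ?d) \<ge> c" by (simp add: c_def field_simps)
    ultimately show ?thesis by linarith
  qed
  have p1: "p J \<le> 1" for J
  proof -
    have "norm ((lazy n ^^ T) (\<lambda>j. of_bool (j = J)) k0) \<le> 1"
      by (rule lazy_funpow_le) (use n_pos in simp_all)
    then show ?thesis unfolding p_def using complex_Re_le_cmod order_trans by blast
  qed
  \<comment> \<open>About half of the threshold \<open>n / (2 d)\<close> for typical counts: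
    \<open>l + 1\<close> stays below the threshold, and \<open>l\<close> is still of order
    \<open>n\<close>.\<close>
  define l where "l = nat \<lfloor>n / (4 * ?d)\<rfloor>"
  have n2: "n / (4 * ?d) \<ge> 2" using n8 by (simp add: field_simps)
  have l_le: "real l \<le> n / (4 * ?d)" and l_gt: "real l > n / (4 * ?d) - 1"
    using n2 by (simp_all add: l_def)
  have l0: "l > 0" using l_gt n2 by simp
  have l_ge: "real l \<ge> n / (8 * ?d)"
  proof -
    have "n / (4 * ?d) - 1 \<ge> n / (8 * ?d)" using n8 by (simp add: field_simps)
    then show ?thesis using l_gt by linarith
  qed
  have l_bulk: "colour_cnt \<kappa> i y j \<ge> l + 1" if "\<not> real (colour_cnt \<kappa> i y j) < n / (2 * CARD('d))" for i j y
  proof -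
    have "n / (2 * ?d) = n / (4 * ?d) + n / (4 * ?d)" by (simp add: field_simps)
    then have "real (l + 1) \<le> real (colour_cnt \<kappa> i y j)" using that l_le n2 by simp
    then show ?thesis by (simp only: of_nat_le_iff)
  qed
  define \<epsilon> where "\<epsilon> = 8 * ?d ^ 3 * sqrt T / (l * c\<^sup>2)"
  have \<epsilon>0: "\<epsilon> \<ge> 0" by (simp add: \<epsilon>_def)
  have \<epsilon>: "\<epsilon> \<le> 256 * ?d ^ 6 * sqrt T / n"
  proof -
    have "\<epsilon> \<le> 8 * ?d ^ 3 * sqrt T / (n / (8 * ?d) * c\<^sup>2)"
      unfolding \<epsilon>_def using l_ge l0 n_pos c by (intro divide_left_mono mult_right_mono) (auto intro!: mult_pos_pos)
    also have "\<dots> = 256 * ?d ^ 6 * sqrt T / n"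
      by (simp add: c_def power2_eq_square power3_eq_cube power_numeral_reduce)
    finally show ?thesis .
  qed
  define Bad where "Bad = {y. \<exists>i j. real (colour_cnt \<kappa> i y j) < n / (2 * CARD('d))}"
  define \<beta> where "\<beta> = 64 * ?d ^ 6 * T / (real n)\<^sup>2"
  have bad: "measure_pmf.prob (law k y) Bad \<le> \<beta>" if "y \<in> X" for y
    unfolding Bad_def \<beta>_def by (rule bulk_probability[OF that cls eq k])
  have \<psi>1: "\<bar>\<psi> y\<bar> \<le> 1" for y
  proof -
    have "\<bar>\<psi> y\<bar> \<le> measure_pmf.expectation (law T y) (\<lambda>z. \<bar>\<phi> z\<bar>)" unfolding \<psi>_def by (rule integral_abs_bound)
    also have "\<dots> \<le> measure_pmf.expectation (law T y) (\<lambda>_. 1)"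
      by (intro integral_mono integrable_measure_pmf_finite finite_set_law \<phi>1)
    finally show ?thesis by simp
  qed
  have pairwise: "\<bar>measure_pmf.expectation (law (k + T) x) \<phi> - measure_pmf.expectation (law (k + T) y) \<phi>\<bar> \<le> 4 * \<beta> + D * \<epsilon>" if y: "y \<in> X" for y
  proof -
    let ?E = "measure_pmf.expectation (pair_law \<kappa> k (x, y))"
    note int = integrable_measure_pmf_finite[OF finite_pair_law]
    have marg: "map_pmf fst (pair_law \<kappa> k (x, y)) = law k x" "map_pmf snd (pair_law \<kappa> k (x, y)) = law k y"
      using pair_law_marginals[of "(x, y)" \<kappa> k] x y by auto
    have ex: "measure_pmf.expectation (law (k + T) z) \<phi> = measure_pmf.expectation (law k z) \<psi>" for z
      unfolding law_add \<psi>_def by (rule expectation_bind_finite[OF finite_set_law finite_set_law])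
    have "measure_pmf.expectation (law k x) \<psi> = ?E (\<lambda>z. \<psi> (fst z))" "measure_pmf.expectation (law k y) \<psi> = ?E (\<lambda>z. \<psi> (snd z))"
      unfolding marg[symmetric] by simp_all
    then have "\<bar>measure_pmf.expectation (law (k + T) x) \<phi> - measure_pmf.expectation (law (k + T) y) \<phi>\<bar> = \<bar>?E (\<lambda>z. \<psi> (fst z) - \<psi> (snd z))\<bar>"
      by (simp add: ex int)
    also have "\<dots> \<le> ?E (\<lambda>z. \<bar>\<psi> (fst z) - \<psi> (snd z)\<bar>)" by (rule integral_abs_bound)
    \<comment> \<open>Typical pairs are joined by a path of swaps; for the others the trivial bound
      2 is used.\<close>
    also have "\<dots> \<le> ?E (\<lambda>z. 2 * indicator Bad (fst z) + 2 * indicator Bad (snd z) + discrepancy \<kappa> z * \<epsilon>)"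
    proof (intro integral_mono_AE int AE_pmfI)
      fix z assume "z \<in> set_pmf (pair_law \<kappa> k (x, y))"
      then have z: "fst z \<in> X" "snd z \<in> X" using set_pair_law[of "(x, y)" \<kappa> k] x y by auto
      have d0: "discrepancy \<kappa> z * \<epsilon> \<ge> 0" using \<epsilon>0 by (simp add: discrepancy_def sum_nonneg)
      show "\<bar>\<psi> (fst z) - \<psi> (snd z)\<bar> \<le> 2 * indicator Bad (fst z) + 2 * indicator Bad (snd z) + discrepancy \<kappa> z * \<epsilon>"
      proof (cases "fst z \<in> Bad \<or> snd z \<in> Bad")
        case True
        have "\<bar>\<psi> (fst z) - \<psi> (snd z)\<bar> \<le> 2" using \<psi>1[of "fst z"] \<psi>1[of "snd z"] by linarith
        moreover have "(2::real) \<le> 2 * indicator Bad (fst z) + 2 * indicator Bad (snd z)" using True by (auto simp: indicator_def)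
        ultimately show ?thesis using d0 by linarith
      next
        case False
        then have "\<And>i j. colour_cnt \<kappa> i (fst z) j \<ge> l + 1" "\<And>i j. colour_cnt \<kappa> i (snd z) j \<ge> l + 1"
          using l_bulk unfolding Bad_def by blast+
        then have "\<bar>\<psi> (fst z) - \<psi> (snd z)\<bar> \<le> discrepancy \<kappa> (fst z, snd z) * \<epsilon>"
          unfolding \<psi>_def \<epsilon>_def by (intro swap_path[OF z(2) \<phi> \<phi>1 l0 _ c p_def pc p1 z(1)]) auto
        then show ?thesis using False by simp
      qed
    qed
    also have "\<dots> = 2 * ?E (\<lambda>z. indicator Bad (fst z)) + 2 * ?E (\<lambda>z. indicator Bad (snd z)) + ?E (discrepancy \<kappa>) * \<epsilon>"
      by (simp add: int)
    also have "?E (\<lambda>z. indicator Bad (fst z)) = measure_pmf.prob (law k x) Bad"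
      unfolding marg(1)[symmetric] integral_map_pmf[symmetric] by simp
    also have "?E (\<lambda>z. indicator Bad (snd z)) = measure_pmf.prob (law k y) Bad"
      unfolding marg(2)[symmetric] integral_map_pmf[symmetric] by simp
    also have "2 * measure_pmf.prob (law k x) Bad + 2 * measure_pmf.prob (law k y) Bad + ?E (discrepancy \<kappa>) * \<epsilon> \<le> 2 * \<beta> + 2 * \<beta> + D * \<epsilon>"
      using bad[OF x] bad[OF y] D[OF y, of \<kappa>] \<epsilon>0 by (intro add_mono mult_left_mono mult_right_mono) auto
    finally show ?thesis by simp
  qed
  have fU: "finite (set_pmf U0)" by (simp add: set_U0 finite_arrangements)
  note intU = integrable_measure_pmf_finite[OF fU]
  \<comment> \<open>Stationarity writes the uniform law as an average over starting points
    \<open>y\<close>, to which the pairwise bound applies.\<close>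
  have "measure_pmf.expectation U0 \<phi> = measure_pmf.expectation (bind_pmf U0 (law (k + T))) \<phi>" by (simp only: bind_U0_law)
  also have "\<dots> = measure_pmf.expectation U0 (\<lambda>y. measure_pmf.expectation (law (k + T) y) \<phi>)"
    by (rule expectation_bind_finite[OF fU finite_set_law])
  finally have "\<bar>measure_pmf.expectation (law (k + T) x) \<phi> - measure_pmf.expectation U0 \<phi>\<bar> =
     \<bar>measure_pmf.expectation U0 (\<lambda>y. measure_pmf.expectation (law (k + T) x) \<phi> - measure_pmf.expectation (law (k + T) y) \<phi>)\<bar>"
    by (simp add: intU)
  also have "\<dots> \<le> measure_pmf.expectation U0 (\<lambda>y. \<bar>measure_pmf.expectation (law (k + T) x) \<phi> - measure_pmf.expectation (law (k + T) y) \<phi>\<bar>)"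
    by (rule integral_abs_bound)
  also have "\<dots> \<le> measure_pmf.expectation U0 (\<lambda>_. 4 * \<beta> + D * \<epsilon>)"
    by (intro integral_mono_AE intU AE_pmfI pairwise) (simp add: set_U0)
  also have "\<dots> = 4 * \<beta> + D * \<epsilon>" by simp
  also have "\<dots> \<le> 4 * \<beta> + D * (256 * ?d ^ 6 * sqrt T / n)"
  proof -
    have "0 \<le> measure_pmf.expectation (pair_law \<kappa> k (x, x)) (discrepancy \<kappa>)"
      by (intro integral_nonneg_AE AE_pmfI) (simp add: discrepancy_def sum_nonneg)
    then have "D \<ge> 0" using D[OF x, of \<kappa>] by linarith
    then show ?thesis using mult_left_mono[OF \<epsilon>] by simp
  qed
  also have "\<dots> = 256 * ?d ^ 6 * (T / (real n)\<^sup>2 + D * sqrt T / n)"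
    by (simp add: \<beta>_def algebra_simps)
  finally show ?thesis by (simp add: \<phi>l \<phi>u)
qed

end

section \<open>An event that detects non-uniformity\<close>

lemma power_sum_le:
  fixes b :: real
  assumes "0 \<le> b" "b < 1"
  shows "(\<Sum>s<k. b ^ s) \<le> 1 / (1 - b)"
proof -
  have "(\<Sum>s<k. b ^ s) = (1 - b ^ k) / (1 - b)" using assms by (simp add: sum_gp_strict)
  also have "\<dots> \<le> 1 / (1 - b)" using assms by (intro divide_right_mono) auto
  finally show ?thesis .
qed

context doubly_stochastic
begin

lemma normalised_eigenvector:
  assumes "l \<in> nonconst_eigenvalues"
  shows "\<exists>v i0. cop v = (\<lambda>i. l * v i) \<and> v i0 = 1 \<and> (\<forall>i. norm (v i) \<le> 1)"
proof -
  obtain v where v: "cop v = (\<lambda>i. l * v i)" and ne: "\<exists>i j. v i \<noteq> v j"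
    using assms by (auto simp: nonconst_eigenvalues_def)
  have "Max (range (\<lambda>i. norm (v i))) \<in> range (\<lambda>i. norm (v i))" by (rule Max_in) auto
  then obtain i0 where "norm (v i0) = Max (range (\<lambda>i. norm (v i)))" by force
  then have i0: "norm (v i) \<le> norm (v i0)" for i by simp
  have "v i0 \<noteq> 0"
  proof
    assume "v i0 = 0"
    then have "v i = 0" for i using i0[of i] by simp
    then show False using ne by simp
  qed
  moreover have "cop (\<lambda>i. v i / v i0) = (\<lambda>i. l * (v i / v i0))"
  proof
    fix i
    have "cop (\<lambda>i. v i / v i0) i = cop v i / v i0" by (simp add: cop_def sum_divide_distrib)
    then show "cop (\<lambda>i. v i / v i0) i = l * (v i / v i0)" by (simp add: v)
  qed
  ultimately show ?thesis using i0 by (intro exI[of _ "\<lambda>i. v i / v i0"] exI[of _ i0]) (auto simp: norm_divide)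
qed

lemma lazy_funpow_eigenvector:
  assumes "cop v = (\<lambda>i. l * v i)"
  shows "(lazy n ^^ k) v = (\<lambda>i. (1 + (l - 1) / of_real n) ^ k * v i)"
proof (induction k)
  case (Suc k)
  have "cop (\<lambda>i. c * v i) i = c * cop v i" for c i by (simp add: cop_def sum_distrib_left mult_ac)
  then have "lazy n (\<lambda>i. c * v i) = (\<lambda>i. (1 + (l - 1) / of_real n) * c * v i)" for c
    unfolding lazy_def by (auto simp: assms algebra_simps diff_divide_distrib add_divide_distrib)
  then show ?case by (simp add: Suc.IH)
qed simp

end

context stack_shuffle
begin

lemma stat_scale: "stat (\<lambda>i. c * f i) B y = c * stat f B y"
  by (simp add: stat_def sum_distrib_left mult.assoc)

text \<open>The event is that the statistic has modulus at least \<open>R\<close>. The same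
  \<open>V\<close> serves twice: in stationarity the second moment reproduces itself up to the
  factor \<open>norm \<beta>\<close> squared and a one-step variance, and from \<open>x\<close> the
  variances of all steps add up to the corresponding geometric series.\<close>

lemma eigenvector_event:
  assumes d: "CARD('d) \<ge> 2" and irr: "irreducible_matrix (single_ball_matrix \<mu>)" and x: "x \<in> X"
  defines "g \<equiv> spectral_gap (single_ball_matrix \<mu>)"
  defines "V \<equiv> 4 * (real CARD('d))\<^sup>2 * n / g"
  assumes n: "real n \<ge> 4 / g" and R: "R > 0"
  shows "\<exists>A. measure_pmf.prob U0 A \<le> V / R\<^sup>2 \<and>
    (\<forall>k. (1 - g / n) ^ k * n \<ge> 2 * R \<longrightarrow> measure_pmf.prob (law k x) A \<ge> 1 - V / R\<^sup>2)"
proof -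
  let ?d = "real CARD('d)"
  have g: "g > 0" unfolding g_def by (rule spectral_gap_pos[OF d irr])
  have n0: "real n > 0" using n_pos by simp
  obtain l where l: "l \<in> nonconst_eigenvalues" and lg: "1 - Re l = g"
    using spectral_gap_attained[OF d] unfolding g_def by blast
  obtain v i0 where v: "cop v = (\<lambda>i. l * v i)" and i0: "v i0 = 1" and v1: "\<And>i. norm (v i) \<le> 1"
    using normalised_eigenvector[OF l] by blast
  define \<beta> where "\<beta> = 1 + (l - 1) / of_real (real n)"
  have lz: "(lazy n ^^ k) v = (\<lambda>i. \<beta> ^ k * v i)" for k unfolding \<beta>_def by (rule lazy_funpow_eigenvector[OF v])
  have lz1: "lazy n v = (\<lambda>i. \<beta> * v i)" using lz[of 1] by simp
  have g2: "g \<le> 2" using eigenvalue_norm_le_1[OF l] abs_Re_le_cmod[of l] lg by linarith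
  have ng: "4 \<le> g * n" using n g by (simp add: field_simps)
  \<comment> \<open>For \<open>n \<ge> 4 / g\<close> half of the first-order decay absorbs the
    quadratic error.\<close>
  have b2: "(norm \<beta>)\<^sup>2 \<le> 1 - g / n"
  proof -
    have "4 / (real n)\<^sup>2 \<le> g / n" using ng n0 by (simp add: power2_eq_square field_simps)
    then show ?thesis using eigenvalue_shift_norm2[OF l n0] lg unfolding \<beta>_def by simp
  qed
  have gn: "0 < g / n" "1 / (1 - (norm \<beta>)\<^sup>2) \<le> n / g"
  proof -
    show gn: "0 < g / n" using g n0 by simp
    have "g / n \<le> 1 - (norm \<beta>)\<^sup>2" using b2 by simp
    then have "1 / (1 - (norm \<beta>)\<^sup>2) \<le> 1 / (g / n)" using gn by (intro divide_left_mono mult_pos_pos) linarith+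
    then show "1 / (1 - (norm \<beta>)\<^sup>2) \<le> n / g" by simp
  qed
  have b1: "(norm \<beta>)\<^sup>2 < 1" using b2 gn(1) by linarith
  have bge: "norm \<beta> \<ge> 1 - g / n"
  proof -
    have "Re l - 1 = - g" using lg by simp
    then show ?thesis using complex_Re_le_cmod[of \<beta>] by (simp add: \<beta>_def Re_divide_of_real)
  qed
  have gn1: "0 \<le> 1 - g / n"
  proof -
    have "2 \<le> 4 / g" using g g2 by (simp add: field_simps)
    then have "g \<le> n" using n g2 by linarith
    then show ?thesis using n0 by (simp add: field_simps)
  qed
  \<comment> \<open>At \<open>i0\<close> the eigenvector is 1, its largest modulus, so the statistic
    starts at its extreme value \<open>n\<close>.\<close>
  define B where "B = set (x i0)"
  have cnt: "cnt B x j = (if j = i0 then n else 0)" for j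
  proof -
    have "{k. k < n \<and> x j ! k \<in> B} = (if j = i0 then {..<n} else {})"
    proof (cases "j = i0")
      case True
      then show ?thesis using arrangements_length[OF x] by (auto simp: B_def)
    next
      case False
      then have "x j ! k \<notin> B" if "k < n" for k
        using arrangements_disjoint[OF x] arrangements_length[OF x] that nth_mem unfolding B_def by metis
      then show ?thesis using False by auto
    qed
    then show ?thesis by (simp add: cnt_eq_card[OF arrangements_length[OF x]])
  qed
  have Sx: "stat v B x = of_nat n"
    by (simp add: stat_def cnt i0 if_distrib[where f = of_nat] if_distrib[where f = "\<lambda>z. _ * z"] cong: if_cong)
  define A where "A = {y. norm (stat v B y) \<ge> R}"
  have fU: "finite (set_pmf U0)" by (simp add: set_U0 finite_arrangements)
  have "measure_pmf.prob U0 A \<le> V / R\<^sup>2"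
  proof -
    let ?M = "measure_pmf.expectation U0 (\<lambda>y. (norm (stat v B y))\<^sup>2)"
    note int = integrable_measure_pmf_finite[OF fU]
    have "?M = measure_pmf.expectation (bind_pmf U0 K) (\<lambda>y. (norm (stat v B y))\<^sup>2)" by (simp only: bind_U0_K)
    also have "\<dots> = measure_pmf.expectation U0 (\<lambda>y. measure_pmf.expectation (K y) (\<lambda>z. (norm (stat v B z))\<^sup>2))"
      by (rule expectation_bind_finite[OF fU finite_set_K])
    also have "\<dots> \<le> measure_pmf.expectation U0 (\<lambda>y. (norm \<beta>)\<^sup>2 * (norm (stat v B y))\<^sup>2 + (2 * ?d)\<^sup>2)"
    proof (intro integral_mono_AE int AE_pmfI)
      fix y assume "y \<in> set_pmf U0"
      then have "y \<in> X" by (simp add: set_U0)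
      from stat_step_deviation[where f = v, OF this v1, where B = B and a = 0]
      show "measure_pmf.expectation (K y) (\<lambda>z. (norm (stat v B z))\<^sup>2) \<le> (norm \<beta>)\<^sup>2 * (norm (stat v B y))\<^sup>2 + (2 * ?d)\<^sup>2"
        by (simp add: lz1 stat_scale norm_mult power_mult_distrib)
    qed
    also have "\<dots> = (norm \<beta>)\<^sup>2 * ?M + (2 * ?d)\<^sup>2" by (simp add: int)
    finally have "?M * (1 - (norm \<beta>)\<^sup>2) \<le> (2 * ?d)\<^sup>2" by (simp add: algebra_simps)
    then have "?M \<le> (2 * ?d)\<^sup>2 * (1 / (1 - (norm \<beta>)\<^sup>2))" using b1 by (simp add: pos_le_divide_eq)
    also have "\<dots> \<le> (2 * ?d)\<^sup>2 * (n / g)" using gn(2) by (intro mult_left_mono) auto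
    also have "\<dots> = V" by (simp add: V_def power_mult_distrib)
    finally have "?M / R\<^sup>2 \<le> V / R\<^sup>2" by (rule divide_right_mono) simp
    then show ?thesis using markov_norm2[OF fU R, of "stat v B"] unfolding A_def by linarith
  qed
  moreover have "measure_pmf.prob (law k x) A \<ge> 1 - V / R\<^sup>2" if k: "(1 - g / n) ^ k * n \<ge> 2 * R" for k
  proof -
    let ?m = "stat ((lazy n ^^ k) v) B x"
    let ?P = "measure_pmf.prob (law k x)"
    have m: "norm ?m \<ge> 2 * R"
    proof -
      have "norm ?m = norm \<beta> ^ k * n" by (simp add: lz stat_scale Sx norm_mult norm_power)
      also have "\<dots> \<ge> (1 - g / n) ^ k * n" using bge gn1 by (intro mult_right_mono power_mono) auto
      finally show ?thesis using k by linarith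
    qed
    have "norm ((lazy n ^^ s) v j) \<le> norm \<beta> ^ s" for s j
      using v1[of j] mult_left_mono[of "norm (v j)" 1 "norm \<beta> ^ s"] by (simp add: lz norm_mult norm_power)
    from stat_law_deviation[OF x this, where k = k and B = B]
    have "measure_pmf.expectation (law k x) (\<lambda>y. (norm (stat v B y - ?m))\<^sup>2) \<le> (\<Sum>s<k. (2 * ?d * norm \<beta> ^ s)\<^sup>2)" by simp
    also have "\<dots> = (2 * ?d)\<^sup>2 * (\<Sum>s<k. ((norm \<beta>)\<^sup>2) ^ s)"
      by (simp add: sum_distrib_left power_mult_distrib power_even_eq mult.commute flip: power_mult)
    also have "\<dots> \<le> (2 * ?d)\<^sup>2 * (1 / (1 - (norm \<beta>)\<^sup>2))"
      by (intro mult_left_mono power_sum_le b1) auto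
    also have "\<dots> \<le> (2 * ?d)\<^sup>2 * (n / g)" using gn(2) by (intro mult_left_mono) auto
    also have "\<dots> = V" by (simp add: V_def power_mult_distrib)
    finally have v: "measure_pmf.expectation (law k x) (\<lambda>y. (norm (stat v B y - ?m))\<^sup>2) / R\<^sup>2 \<le> V / R\<^sup>2"
      by (rule divide_right_mono) simp
    have "?P (- A) \<le> ?P {y. norm (stat v B y - ?m) \<ge> R}"
    proof (rule measure_pmf.finite_measure_mono)
      show "- A \<subseteq> {y. norm (stat v B y - ?m) \<ge> R}"
      proof
        fix y assume "y \<in> - A"
        then have "norm (stat v B y) < R" by (simp add: A_def)
        moreover have "norm ?m - norm (stat v B y) \<le> norm (stat v B y - ?m)" by (metis norm_minus_commute norm_triangle_ineq2)
        ultimately show "y \<in> {y. norm (stat v B y - ?m) \<ge> R}" using m by simp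
      qed
    qed simp
    also have "\<dots> \<le> V / R\<^sup>2" using markov_norm2[OF finite_set_law R, of k x "\<lambda>y. stat v B y - ?m"] v by linarith
    finally have "?P (- A) \<le> V / R\<^sup>2" .
    moreover have "?P A = 1 - ?P (- A)" using measure_pmf.prob_compl[of A "law k x"] by (simp add: Compl_eq_Diff_UNIV)
    ultimately show ?thesis by simp
  qed
  ultimately show ?thesis by blast
qed

end

section \<open>Continuous time and asymptotics\<close>

text \<open>The variance of the Poisson distribution, computed from factorial moments by shifting
  the exponential series.\<close>

lemma poisson_second_moment_sums:
  fixes t :: real
  shows "(\<lambda>k. t ^ k / fact k * exp (- t) * (real k - t)\<^sup>2) sums t"
proof -
  have e: "(\<lambda>k. t ^ k / fact k) sums exp t" using exp_converges[of t] by (simp add: divide_inverse mult.commute)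
  have shift: "(\<lambda>k. real k * a k) sums s" if "(\<lambda>k. real (Suc k) * a (Suc k)) sums s" for a s
    using sums_Suc[of "\<lambda>k. real k * a k" s] that by simp
  have s1: "(\<lambda>k. real k * (t ^ k / fact k)) sums (t * exp t)"
  proof (rule shift)
    have eq: "real (Suc k) * (t ^ Suc k / fact (Suc k)) = t * (t ^ k / fact k)" for k by (simp add: field_simps del: of_nat_Suc)
    show "(\<lambda>k. real (Suc k) * (t ^ Suc k / fact (Suc k))) sums (t * exp t)" unfolding eq by (rule sums_mult[OF e])
  qed
  have s2: "(\<lambda>k. real k * (real (k - 1) * (t ^ k / fact k))) sums (t * (t * exp t))"
  proof (rule shift)
    have eq: "real (Suc k) * (real (Suc k - 1) * (t ^ Suc k / fact (Suc k))) = t * (real k * (t ^ k / fact k))" for k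
      by (simp add: field_simps del: of_nat_Suc)
    show "(\<lambda>k. real (Suc k) * (real (Suc k - 1) * (t ^ Suc k / fact (Suc k)))) sums (t * (t * exp t))"
      unfolding eq by (rule sums_mult[OF s1])
  qed
  have eq: "t ^ k / fact k * exp (- t) * (real k - t)\<^sup>2 =
     exp (- t) * (real k * (real (k - 1) * (t ^ k / fact k)) + (1 - 2 * t) * (real k * (t ^ k / fact k)) + t\<^sup>2 * (t ^ k / fact k))" for k
  proof -
    have "real k * real (k - 1) = (real k)\<^sup>2 - real k" by (cases k) (simp_all add: power2_eq_square algebra_simps)
    then have sq: "(real k - t)\<^sup>2 = real k * real (k - 1) + (1 - 2 * t) * real k + t\<^sup>2" by (simp add: power2_diff algebra_simps)
    have "w * E * (a * b + c * a + h) = E * (a * (b * w) + c * (a * w) + h * w)" for w E a b c h :: real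
      by (simp add: algebra_simps)
    from this show ?thesis unfolding sq .
  qed
  have "exp (- t) * (t * (t * exp t) + (1 - 2 * t) * (t * exp t) + t\<^sup>2 * exp t) = (exp (- t) * exp t) * t"
    by (simp add: power2_eq_square algebra_simps)
  also have "\<dots> = t" by (simp flip: exp_add)
  finally show ?thesis
    unfolding eq using sums_mult[OF sums_add[OF sums_add[OF s2 sums_mult[OF s1, of "1 - 2 * t"]] sums_mult[OF e, of "t\<^sup>2"]], of "exp (- t)"] by simp
qed

lemma poisson_deviation:
  fixes t s :: real
  assumes t: "t > 0" and s: "s > 0"
  shows "measure_pmf.prob (poisson_pmf t) {k. \<bar>real k - t\<bar> \<ge> s} \<le> t / s\<^sup>2"
proof -
  let ?A = "{k. \<bar>real k - t\<bar> \<ge> s}"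
  have "emeasure (measure_pmf (poisson_pmf t)) ?A = (\<integral>\<^sup>+k. indicator ?A k \<partial>measure_pmf (poisson_pmf t))" by simp
  also have "\<dots> \<le> (\<integral>\<^sup>+k. ennreal ((real k - t)\<^sup>2 / s\<^sup>2) \<partial>measure_pmf (poisson_pmf t))"
  proof (rule nn_integral_mono)
    fix k
    have "1 \<le> (real k - t)\<^sup>2 / s\<^sup>2" if "\<bar>real k - t\<bar> \<ge> s"
      using power_mono[of s "\<bar>real k - t\<bar>" 2] that s by (simp add: field_simps)
    then show "indicator ?A k \<le> ennreal ((real k - t)\<^sup>2 / s\<^sup>2)"
      by (auto simp: indicator_def simp flip: ennreal_1 intro!: ennreal_leI)
  qed
  also have "\<dots> = (\<Sum>k. ennreal (t ^ k / fact k * exp (- t) * (real k - t)\<^sup>2 / s\<^sup>2))"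
    using t by (simp add: nn_integral_measure_pmf nn_integral_count_space_nat flip: ennreal_mult)
  also have "\<dots> = ennreal (t / s\<^sup>2)"
    by (rule suminf_ennreal_eq[OF _ sums_divide[OF poisson_second_moment_sums]]) (use t in simp)
  finally show ?thesis using t by (simp add: measure_pmf.emeasure_eq_measure)
qed

lemma prob_bind_pmf: "measure_pmf.prob (bind_pmf p f) A = measure_pmf.expectation p (\<lambda>x. measure_pmf.prob (f x) A)"
proof -
  have "emeasure (measure_pmf (bind_pmf p f)) A = (\<integral>\<^sup>+x. ennreal (measure_pmf.prob (f x) A) \<partial>measure_pmf p)"
    by (simp flip: measure_pmf.emeasure_eq_measure)
  also have "\<dots> = ennreal (measure_pmf.expectation p (\<lambda>x. measure_pmf.prob (f x) A))"
    by (intro nn_integral_eq_integral measure_pmf.integrable_const_bound[where B = 1]) auto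
  finally show ?thesis by (simp add: measure_pmf.emeasure_eq_measure integral_nonneg_AE)
qed

lemma tv_dist_le: "(\<And>A. \<bar>measure_pmf.prob p A - measure_pmf.prob q A\<bar> \<le> e) \<Longrightarrow> tv_dist p q \<le> e"
  unfolding tv_dist_def by (rule cSUP_least) auto

lemma tv_dist_ge: "measure_pmf.prob p A - measure_pmf.prob q A \<le> tv_dist p q"
proof -
  have "\<bar>measure_pmf.prob p A - measure_pmf.prob q A\<bar> \<le> 1" for A
    using measure_pmf.prob_le_1[of p A] measure_pmf.prob_le_1[of q A] measure_nonneg[of "measure_pmf p" A] measure_nonneg[of "measure_pmf q" A]
    by linarith
  then have "bdd_above (range (\<lambda>A. \<bar>measure_pmf.prob p A - measure_pmf.prob q A\<bar>))" by (auto intro!: bdd_aboveI)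
  then have "\<bar>measure_pmf.prob p A - measure_pmf.prob q A\<bar> \<le> tv_dist p q" unfolding tv_dist_def by (rule cSUP_upper2) auto
  then show ?thesis by linarith
qed

text \<open>Chebyshev's inequality guarantees more than \<open>t - s\<close> steps except with
  probability \<open>t / s^2\<close>, and on the exceptional event any difference of probabilities
  is at most 1.\<close>

lemma tv_dist_continuous_le:
  assumes t: "t > 0" and e: "\<And>k A. real k \<ge> k0 \<Longrightarrow> \<bar>measure_pmf.prob (((\<lambda>p. bind_pmf p K) ^^ k) (return_pmf x)) A - measure_pmf.prob u A\<bar> \<le> e"
    and k0: "k0 \<le> t - s" "s > 0"
  shows "tv_dist (continuous_time_law K x t) u \<le> e + t / s\<^sup>2"
proof (rule tv_dist_le)
  fix A
  let ?l = "\<lambda>k. ((\<lambda>p. bind_pmf p K) ^^ k) (return_pmf x)"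
  let ?E = "measure_pmf.expectation (poisson_pmf t)"
  let ?B = "{k. \<bar>real k - t\<bar> \<ge> s}"
  have int: "integrable (measure_pmf (poisson_pmf t)) f" if "\<And>k. \<bar>f k\<bar> \<le> b" for f :: "nat \<Rightarrow> real" and b
    using that by (intro measure_pmf.integrable_const_bound[where B = b]) auto
  have p1: "\<bar>measure_pmf.prob (?l k) A\<bar> \<le> 1" for k by simp
  have d1: "\<bar>measure_pmf.prob (?l k) A - measure_pmf.prob u A\<bar> \<le> 1" for k
    using measure_pmf.prob_le_1[of "?l k" A] measure_pmf.prob_le_1[of u A] measure_nonneg[of "measure_pmf (?l k)" A] measure_nonneg[of "measure_pmf u" A]
    by linarith
  obtain k :: nat where "real k \<ge> k0" using real_arch_simple by blast
  then have e0: "e \<ge> 0" using e[of k A] by linarith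
  have "measure_pmf.prob (continuous_time_law K x t) A - measure_pmf.prob u A = ?E (\<lambda>k. measure_pmf.prob (?l k) A) - measure_pmf.prob u A"
    using t by (simp add: continuous_time_law_def prob_bind_pmf)
  also have "\<dots> = ?E (\<lambda>k. measure_pmf.prob (?l k) A - measure_pmf.prob u A)"
    using int[of "\<lambda>k. measure_pmf.prob (?l k) A" 1] by simp
  finally have "\<bar>measure_pmf.prob (continuous_time_law K x t) A - measure_pmf.prob u A\<bar> \<le> ?E (\<lambda>k. \<bar>measure_pmf.prob (?l k) A - measure_pmf.prob u A\<bar>)"
    using integral_abs_bound[of "measure_pmf (poisson_pmf t)" "\<lambda>k. measure_pmf.prob (?l k) A - measure_pmf.prob u A"] by simp
  also have "\<dots> \<le> ?E (\<lambda>k. e + indicator ?B k)"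
  proof (rule integral_mono)
    show "integrable (measure_pmf (poisson_pmf t)) (\<lambda>k. \<bar>measure_pmf.prob (?l k) A - measure_pmf.prob u A\<bar>)"
      using d1 by (intro int[of _ 1]) simp
    show "integrable (measure_pmf (poisson_pmf t)) (\<lambda>k. e + indicator ?B k)"
      using e0 by (intro int[of _ "e + 1"]) (auto simp: indicator_def)
    fix k
    show "\<bar>measure_pmf.prob (?l k) A - measure_pmf.prob u A\<bar> \<le> e + indicator ?B k"
    proof (cases "k \<in> ?B")
      case True
      then show ?thesis using d1[of k] e0 by simp
    next
      case False
      then have "real k \<ge> k0" using k0 by auto
      then show ?thesis using e[of k A] False by simp
    qed
  qed
  also have "\<dots> = e + measure_pmf.prob (poisson_pmf t) ?B"
    using int[of "indicator ?B" 1] by simp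
  also have "\<dots> \<le> e + t / s\<^sup>2" using poisson_deviation[OF t k0(2)] by simp
  finally show "\<bar>measure_pmf.prob (continuous_time_law K x t) A - measure_pmf.prob u A\<bar> \<le> e + t / s\<^sup>2" .
qed

lemma tv_dist_continuous_ge:
  assumes t: "t \<ge> 0" and s: "s > 0" and u: "measure_pmf.prob u A \<le> e"
    and e: "\<And>k. real k \<le> t + s \<Longrightarrow> measure_pmf.prob (((\<lambda>p. bind_pmf p K) ^^ k) (return_pmf x)) A \<ge> 1 - e"
  shows "tv_dist (continuous_time_law K x t) u \<ge> 1 - 2 * e - t / s\<^sup>2"
proof -
  let ?l = "\<lambda>k. ((\<lambda>p. bind_pmf p K) ^^ k) (return_pmf x)"
  have e0: "e \<ge> 0" using u measure_nonneg[of "measure_pmf u" A] by linarith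
  have "measure_pmf.prob (continuous_time_law K x t) A \<ge> 1 - e - t / s\<^sup>2"
  proof (cases "t > 0")
    case True
    let ?E = "measure_pmf.expectation (poisson_pmf t)"
    let ?B = "{k. \<bar>real k - t\<bar> \<ge> s}"
    have int: "integrable (measure_pmf (poisson_pmf t)) f" if "\<And>k. \<bar>f k\<bar> \<le> b" for f :: "nat \<Rightarrow> real" and b
      using that by (intro measure_pmf.integrable_const_bound[where B = b]) auto
    have "1 - e - t / s\<^sup>2 \<le> (1 - e) - measure_pmf.prob (poisson_pmf t) ?B"
      using poisson_deviation[OF True s] by simp
    also have "\<dots> = ?E (\<lambda>k. (1 - e) - indicator ?B k)"
      using int[of "indicator ?B" 1] by simp
    also have "\<dots> \<le> ?E (\<lambda>k. measure_pmf.prob (?l k) A)"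
    proof (rule integral_mono)
      show "integrable (measure_pmf (poisson_pmf t)) (\<lambda>k. (1 - e) - indicator ?B k)"
        using e0 by (intro int[of _ "e + 1"]) (auto simp: indicator_def)
      show "integrable (measure_pmf (poisson_pmf t)) (\<lambda>k. measure_pmf.prob (?l k) A)"
        by (intro int[of _ 1]) simp
      fix k
      show "(1 - e) - indicator ?B k \<le> measure_pmf.prob (?l k) A"
      proof (cases "k \<in> ?B")
        case True
        then have "(1 - e) - indicator ?B k \<le> (0::real)" using e0 by simp
        then show ?thesis using measure_nonneg order_trans by blast
      next
        case False
        then show ?thesis using e[of k] by auto
      qed
    qed
    finally show ?thesis using True by (simp add: continuous_time_law_def prob_bind_pmf)
  next
    case False
    then have "t = 0" using t by simp
    then show ?thesis using e[of 0] s by (simp add: continuous_time_law_def)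
  qed
  then show ?thesis using u tv_dist_ge[of "continuous_time_law K x t" A u] by linarith
qed

lemma power_le_exp:
  fixes b :: real
  assumes "0 \<le> 1 - b"
  shows "(1 - b) ^ k \<le> exp (- (b * k))"
proof -
  have "(1 - b) ^ k \<le> exp (- b) ^ k" using assms exp_ge_add_one_self[of "- b"] by (intro power_mono) auto
  also have "\<dots> = exp (- (b * k))" by (simp add: mult.commute flip: exp_of_nat_mult)
  finally show ?thesis .
qed

section \<open>Rates with logarithmic weights\<close>

text \<open>The case \<open>L = ln n\<close>. The rate falls short of \<open>g / n\<close> by about
  \<open>1 / (n ln n)\<close>, so over \<open>M n ln n\<close> steps the loss is a bounded factor,
  absorbed by \<open>exp (M + 1)\<close>. \<open>M \<ge> 1 / (2 g)\<close> brings \<open>n\<close>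
  down to \<open>sqrt n\<close>; \<open>g * C \<ge> m + 1\<close> pays for the distortion
  \<open>L ^ m\<close> and for one more \<open>ln n\<close>, which puts the discrepancy below
  \<open>sqrt n\<close>.\<close>

lemma coupling_bound_asymptotics:
  fixes g M C c d :: real and m :: nat
  assumes g: "g > 0" and M: "M \<ge> 1 / (2 * g)" and C: "C > 0" "g * C \<ge> m + 1" and c: "c \<ge> 0" and d: "d > 0"
  defines "b \<equiv> real m * 4 ^ m"
  shows "\<forall>\<^sub>F n in sequentially. \<forall>k.
     1 / 2 \<le> 1 - g / real n + 2 / (real n)\<^sup>2 + 1 / (n * ln n) \<and> 1 - g / n + 2 / (real n)\<^sup>2 + 1 / (n * ln n) < 1 \<and>
     (real k \<ge> M * (n * ln n) + C * (n * ln (ln n)) - c * n \<longrightarrow>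
      d * ((1 - g / n + 2 / (real n)\<^sup>2 + 1 / (n * ln n)) ^ k * (n * sqrt (d ^ 3 * (m * 4 ^ m * ln n ^ (2 * m))))
         + 4 * d ^ 3 * (m * 4 ^ m * ln n ^ (2 * m)) / (n * (1 - (1 - g / n + 2 / (real n)\<^sup>2 + 1 / (n * ln n)))))
      \<le> d * sqrt (d ^ 3 * b) * exp (g * c + M + 1) * sqrt n / ln n + 8 * d ^ 4 * b / g * ln n ^ (2 * m))"
proof -
  have M0: "M > 0" using M g by (smt (verit) divide_pos_pos)
  have "\<forall>\<^sub>F n in sequentially. 1 / 2 \<le> 1 - g / real n + 2 / (real n)\<^sup>2 + 1 / (n * ln n)" using g by real_asymp
  moreover have "\<forall>\<^sub>F n in sequentially. 2 / real n + 1 / ln n \<le> g / 2" using g by real_asymp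
  moreover have "\<forall>\<^sub>F n in sequentially. (2 / real n + 1 / ln n) * (M * ln n + C * ln (ln n)) \<le> M + 1"
    using M0 C by real_asymp
  moreover have "\<forall>\<^sub>F n in sequentially. real n \<ge> 1 \<and> ln n \<ge> 1 \<and> ln (ln n) \<ge> 0"
    by (intro eventually_conj; real_asymp)
  ultimately show ?thesis
  proof eventually_elim
    case (elim n)
    define L where "L = ln (real n)"
    define \<eta> where "\<eta> = 2 / real n + 1 / L"
    define u where "u = g - \<eta>"
    have n: "real n \<ge> 1" and L: "L \<ge> 1" "ln L \<ge> 0" using elim(4) by (simp_all add: L_def)
    have \<eta>: "\<eta> \<ge> 0" "\<eta> \<le> g / 2" "\<eta> * (M * L + C * ln L) \<le> M + 1"
      using n L elim(2,3) by (simp_all add: \<eta>_def L_def)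
    have u: "u \<ge> g / 2" "u > 0" using \<eta> g by (simp_all add: u_def)
    have r: "1 - g / n + 2 / (real n)\<^sup>2 + 1 / (n * ln n) = 1 - u / n"
      using n L by (simp add: u_def \<eta>_def L_def field_simps power2_eq_square)
    have r2: "1 / 2 \<le> 1 - u / n" using elim(1) unfolding r .
    have r1: "1 - u / n < 1" using u n by simp
    have main: "d * ((1 - u / n) ^ k * (n * sqrt (d ^ 3 * (m * 4 ^ m * L ^ (2 * m)))) + 4 * d ^ 3 * (m * 4 ^ m * L ^ (2 * m)) / (n * (1 - (1 - u / n))))
      \<le> d * sqrt (d ^ 3 * b) * exp (g * c + M + 1) * sqrt n / L + 8 * d ^ 4 * b / g * L ^ (2 * m)"
      if k: "real k \<ge> M * (n * L) + C * (n * ln L) - c * n" for k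
    proof -
      have b0: "b \<ge> 0" by (simp add: b_def)
      have "(1 - u / n) ^ k \<le> exp (- (u / n * k))" by (rule power_le_exp) (use r2 in linarith)
      also have "\<dots> \<le> exp (g * c + M + 1 - ln n / 2 - (m + 1) * ln L)"
      proof -
        have "u / n * (M * (n * L) + C * (n * ln L) - c * n) \<le> u / n * k" using k u n by (intro mult_left_mono) auto
        moreover have "u / n * (M * (n * L) + C * (n * ln L) - c * n) = g * M * L + g * C * ln L - g * c - \<eta> * (M * L + C * ln L) + \<eta> * c"
          using n by (simp add: u_def field_simps)
        moreover have "1 / 2 * L \<le> g * M * L" using M g L by (intro mult_right_mono) (auto simp: field_simps)
        moreover have "(m + 1) * ln L \<le> g * C * ln L" using C(2) L by (intro mult_right_mono) auto
        moreover have "\<eta> * c \<ge> 0" using \<eta> c by simp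
        ultimately have "g * c + M + 1 - L / 2 - (m + 1) * ln L \<ge> - (u / n * k)" using \<eta>(3) by linarith
        then show ?thesis by (simp add: L_def)
      qed
      also have "\<dots> = exp (g * c + M + 1) / (sqrt n * L ^ (m + 1))"
      proof -
        have "exp (ln n / 2) = sqrt n" using n by (simp add: ln_sqrt[symmetric])
        moreover have "exp ((m + 1) * ln L) = L ^ (m + 1)" using L exp_of_nat_mult[of "m + 1" "ln L"] by simp
        ultimately show ?thesis by (simp only: exp_diff divide_divide_eq_left)
      qed
      finally have rk: "(1 - u / n) ^ k \<le> exp (g * c + M + 1) / (sqrt n * L ^ (m + 1))" .
      have sq: "sqrt (d ^ 3 * (m * 4 ^ m * L ^ (2 * m))) = sqrt (d ^ 3 * b) * L ^ m"
      proof -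
        have "d ^ 3 * (m * 4 ^ m * L ^ (2 * m)) = (d ^ 3 * b) * (L ^ m)\<^sup>2" by (simp add: b_def power_even_eq)
        then have "sqrt (d ^ 3 * (m * 4 ^ m * L ^ (2 * m))) = sqrt (d ^ 3 * b) * sqrt ((L ^ m)\<^sup>2)"
          by (simp only: real_sqrt_mult)
        moreover have "sqrt ((L ^ m)\<^sup>2) = L ^ m" using L by simp
        ultimately show ?thesis by simp
      qed
      have "(1 - u / n) ^ k * (n * (sqrt (d ^ 3 * b) * L ^ m)) \<le> exp (g * c + M + 1) / (sqrt n * L ^ (m + 1)) * (n * (sqrt (d ^ 3 * b) * L ^ m))"
        using rk d b0 L n by (intro mult_right_mono) auto
      also have "\<dots> = sqrt (d ^ 3 * b) * exp (g * c + M + 1) * (n / sqrt n) * (L ^ m / L ^ (m + 1))" by (simp add: field_simps)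
      also have "\<dots> = sqrt (d ^ 3 * b) * exp (g * c + M + 1) * sqrt n / L"
      proof -
        have "n / sqrt n = sqrt n" by (simp add: real_div_sqrt)
        moreover have "L ^ m / L ^ (m + 1) = 1 / L" using L by simp
        ultimately show ?thesis by simp
      qed
      finally have 1: "d * ((1 - u / n) ^ k * (n * sqrt (d ^ 3 * (m * 4 ^ m * L ^ (2 * m))))) \<le> d * (sqrt (d ^ 3 * b) * exp (g * c + M + 1) * sqrt n / L)"
        unfolding sq using d by (intro mult_left_mono) auto
      have "4 * d ^ 3 * (m * 4 ^ m * L ^ (2 * m)) / (n * (1 - (1 - u / n))) = 4 * d ^ 3 * b * L ^ (2 * m) / u"
        using n by (simp add: b_def mult_ac)
      also have "\<dots> \<le> 4 * d ^ 3 * b * L ^ (2 * m) / (g / 2)"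
        using u g d b0 L by (intro divide_left_mono) auto
      finally have 2: "d * (4 * d ^ 3 * (m * 4 ^ m * L ^ (2 * m)) / (n * (1 - (1 - u / n)))) \<le> d * (4 * d ^ 3 * b * L ^ (2 * m) / (g / 2))"
        using d by (intro mult_left_mono) auto
      have 3: "d * (4 * d ^ 3 * b * L ^ (2 * m) / (g / 2)) = 8 * d ^ 4 * b / g * L ^ (2 * m)" by (simp add: power_numeral_reduce)
      have 4: "d * (sqrt (d ^ 3 * b) * exp (g * c + M + 1) * sqrt n / L) = d * sqrt (d ^ 3 * b) * exp (g * c + M + 1) * sqrt n / L" by simp
      show ?thesis unfolding distrib_left[of d] by (rule order_trans[OF add_mono[OF 1 2]]) (simp only: 3 4 order_refl)
    qed
    show ?case unfolding L_def[symmetric] r[folded L_def] using r1 r2 main by blast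
  qed
qed

context stack_shuffle
begin

text \<open>The entropy of the order decays over all \<open>k + T\<close> steps, the coupling uses
  the first \<open>k\<close>, and the smoothing uses the last \<open>T\<close>.\<close>

lemma law_mixing:
  fixes L q D r :: real and m :: nat
  assumes x: "x \<in> X" and q: "\<And>i. q \<le> measure_pmf.prob \<mu> {\<sigma>. i \<in> act \<sigma>}" "q \<le> 1"
    and ls: "mean_zero_minimal ls" "ls \<noteq> []" and L: "L \<ge> 1"
    and eq: "\<And>a J. norm ((lazy n ^^ T) (\<lambda>j. of_bool (j = J)) a - 1 / of_nat CARD('d)) \<le> 1 / (4 * CARD('d))"
    and k: "T \<le> k" and n8: "real n \<ge> 8 * CARD('d)"
  defines "m \<equiv> length ls"
  defines "r \<equiv> 1 - spectral_gap (single_ball_matrix \<mu>) / n + 2 / (real n)\<^sup>2 + 1 / (n * L)"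
  assumes r: "1/2 \<le> r" "r < 1"
    and D: "CARD('d) * (r ^ k * (n * sqrt ((real CARD('d)) ^ 3 * (m * 4 ^ m * L ^ (2 * m)))) + 4 * (real CARD('d)) ^ 3 * (m * 4 ^ m * L ^ (2 * m)) / (n * (1 - r))) \<le> D"
  shows "\<bar>measure_pmf.prob (law (k + T) x) A - measure_pmf.prob U0 A\<bar> \<le>
    4 * sqrt ((1 - q / n) ^ (k + T) * (CARD('d) * (n * ln n))) + 256 * (real CARD('d)) ^ 6 * (T / (real n)\<^sup>2 + D * sqrt T / n)"
proof -
  let ?h = "\<lambda>y. measure_pmf.prob (pmf_of_set (fiber y)) A"
  have h: "contents_fun id ?h"
    unfolding contents_fun_def
  proof (intro ballI impI)
    fix y z :: "'d \<Rightarrow> nat list"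
    assume "contents id y = contents id z"
    then have "fiber y = fiber z" by (auto simp: fiber_iff_contents)
    then show "?h y = ?h z" by simp
  qed
  have "measure_pmf.expectation (pair_law \<kappa> k (x, y)) (discrepancy \<kappa>) \<le> D" if "y \<in> X" for \<kappa> :: "nat \<Rightarrow> 'd" and y
    using coupling_bound[OF x that ls L, of \<kappa> k] r D unfolding m_def r_def by linarith
  from contents_mixing[OF x h _ _ eq k n8 this]
  have "\<bar>measure_pmf.expectation (law (k + T) x) ?h - measure_pmf.expectation U0 ?h\<bar> \<le> 256 * (real CARD('d)) ^ 6 * (T / (real n)\<^sup>2 + D * sqrt T / n)"
    by simp
  then show ?thesis using prob_diff_le_contents[OF x q, of "k + T" A] by linarith
qed

end

section \<open>Bounds on the mixing time\<close>

lemma mixing_time_le: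
  assumes "finite S" "S \<noteq> {}" "t \<ge> 0" "\<And>x. x \<in> S \<Longrightarrow> tv_dist (continuous_time_law K x t) (pmf_of_set S) \<le> e"
  shows "mixing_time K S e \<le> ereal t"
  unfolding mixing_time_def by (rule INF_lower) (use assms in auto)

lemma mixing_time_ge:
  assumes "finite S" "x \<in> S" and tv: "\<And>t. 0 \<le> t \<Longrightarrow> t < t0 \<Longrightarrow> tv_dist (continuous_time_law K x t) (pmf_of_set S) > e"
  shows "ereal t0 \<le> mixing_time K S e"
  unfolding mixing_time_def
proof (rule INF_greatest)
  fix t assume t: "t \<in> {t. 0 \<le> t \<and> (MAX x\<in>S. tv_dist (continuous_time_law K x t) (pmf_of_set S)) \<le> e}"
  have "tv_dist (continuous_time_law K x t) (pmf_of_set S) \<le> (MAX x\<in>S. tv_dist (continuous_time_law K x t) (pmf_of_set S))"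
    using assms by (intro Max_ge) auto
  then have "tv_dist (continuous_time_law K x t) (pmf_of_set S) \<le> e" using t by simp
  then show "ereal t0 \<le> ereal t" using tv[of t] t by (simp add: not_less[symmetric]) (meson not_less)
qed

lemma shuffle_mixing_time_upper:
  fixes \<mu> :: "('d::finite \<Rightarrow> 'd) pmf" and act and q \<epsilon> :: real
  defines "g \<equiv> spectral_gap (single_ball_matrix \<mu>)"
  assumes d: "CARD('d) \<ge> 2" and perm: "set_pmf \<mu> \<subseteq> {\<sigma>. \<sigma> permutes UNIV}"
    and irr: "irreducible_matrix (single_ball_matrix \<mu>)"
    and act: "\<And>\<sigma> i. \<sigma> i \<noteq> i \<Longrightarrow> i \<in> act \<sigma>" "\<And>\<sigma> i. \<sigma> permutes UNIV \<Longrightarrow> \<sigma> i \<in> act \<sigma> \<longleftrightarrow> i \<in> act \<sigma>"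
    and q: "\<And>i. q \<le> measure_pmf.prob \<mu> {\<sigma>. i \<in> act \<sigma>}" "0 < q" "q \<le> 1" and \<epsilon>: "0 < \<epsilon>"
  shows "\<exists>C::real. \<forall>\<^sub>F n in sequentially. mixing_time (shuffle_step act n \<mu>) (arrangements n) \<epsilon> \<le>
    ereal (max (1 / (2 * g)) (1 / q) * (n * ln n) + C * (n * ln (ln n)))"
proof -
  let ?U = "single_ball_matrix \<mu>"
  let ?d = "real CARD('d)"
  have loc: "stack_shuffle act \<mu> n" if "n > 0" for n using that perm act by unfold_locales auto
  \<comment> \<open>The spectral facts concern \<open>\<mu>\<close> alone; the instance with stacks
    of size 1 supplies them for all sizes.\<close>
  interpret S1: stack_shuffle act \<mu> 1 by (rule loc) simp
  have g: "g > 0" unfolding g_def by (rule S1.spectral_gap_pos[OF d irr])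
  obtain ls where ls: "S1.mean_zero_minimal ls" using S1.mean_zero_minimal_exists by blast
  have ne: "ls \<noteq> []" by (rule S1.mean_zero_minimal_nonempty[OF ls d])
  define m where "m = length ls"
  have m0: "m > 0" using ne by (simp add: m_def)
  obtain C0 N0 :: real where C0: "C0 > 0" and N0: "N0 > 0"
    and equi: "\<And>n k a J. n \<ge> N0 \<Longrightarrow> real k \<ge> C0 * n \<Longrightarrow>
      norm ((S1.lazy n ^^ k) (\<lambda>j. of_bool (j = J)) a - 1 / of_nat CARD('d)) \<le> 1 / (4 * CARD('d))"
    using S1.lazy_equidistribution[OF d irr] by metis
  define M where "M = max (1 / (2 * g)) (1 / q)"
  have M: "M \<ge> 1 / (2 * g)" "M \<ge> 1 / q" by (simp_all add: M_def)
  have M0: "M > 0" using M(2) q(2) by (smt (verit) divide_pos_pos)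
  \<comment> \<open>The first summand serves the coupling. The second gives
    \<open>exp (- q k / n)\<close> an additional factor \<open>1 / (ln n)^2\<close>, which beats the
    initial entropy of order \<open>n ln n\<close>.\<close>
  define C where "C = (m + 1) / g + 2 / q"
  have "(m + 1) / g > 0" "2 / q > 0" using g q by simp_all
  then have "C > 0" unfolding C_def by linarith
  moreover have "g * C \<ge> m + 1" "q * C \<ge> 2" using g q by (simp_all add: C_def field_simps)
  ultimately have C: "C > 0" "g * C \<ge> m + 1" "q * C \<ge> 2" by auto
  define c where "c = C0 + 2"
  have c0: "c \<ge> 0" and d0: "?d > 0" using C0 by (simp_all add: c_def)
  define b where "b = real m * 4 ^ m"
  have b0: "b > 0" using m0 by (simp add: b_def)
  define c2 where "c2 = ?d * sqrt (?d ^ 3 * b) * exp (g * c + M + 1)"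
  define c3 where "c3 = 8 * ?d ^ 4 * b / g"
  have c23: "c2 > 0" "c3 > 0" using b0 g by (simp_all add: c2_def c3_def)
  define D where "D n = c2 * sqrt (real n) / ln n + c3 * ln n ^ (2 * m)" for n :: nat
  \<comment> \<open>The four errors: order within the stacks, atypical colour counts, swaps, and
    Poisson deviation.\<close>
  define e where "e = (\<lambda>n::nat. 4 * sqrt (?d * exp q / ln n) + 256 * ?d ^ 6 * ((C0 * n + 1) / (real n)\<^sup>2)
      + 256 * ?d ^ 6 * (D n * sqrt (C0 * n + 1) / n) + (M * (n * ln n) + C * (n * ln (ln n))) / (real n)\<^sup>2)"
  have e: "e \<longlonglongrightarrow> 0"
  proof -
    have dq: "?d * exp q > 0" by simp
    have 1: "(\<lambda>n. 4 * sqrt (?d * exp q / ln (real n))) \<longlonglongrightarrow> 0" using dq by real_asymp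
    have 2: "(\<lambda>n. (C0 * n + 1) / (real n)\<^sup>2) \<longlonglongrightarrow> 0" using C0 by real_asymp
    have 3: "(\<lambda>n. D n * sqrt (C0 * n + 1) / n) \<longlonglongrightarrow> 0" unfolding D_def using C0 c23 by real_asymp
    have 4: "(\<lambda>n. (M * (n * ln n) + C * (n * ln (ln n))) / (real n)\<^sup>2) \<longlonglongrightarrow> 0" using M0 C by real_asymp
    show ?thesis
      unfolding e_def using tendsto_add[OF tendsto_add[OF tendsto_add[OF 1 tendsto_mult_right_zero[OF 2, of "256 * ?d ^ 6"]] tendsto_mult_right_zero[OF 3, of "256 * ?d ^ 6"]] 4] by simp
  qed
  have "\<forall>\<^sub>F n in sequentially. e n < \<epsilon>" by (rule order_tendstoD(2)[OF e \<epsilon>])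
  moreover have "\<forall>\<^sub>F n in sequentially. real n \<ge> N0 \<and> real n \<ge> 8 * ?d"
    by (intro eventually_conj; real_asymp)
  moreover have "\<forall>\<^sub>F n in sequentially. ln (real n) \<ge> 1 \<and> ln (ln (real n)) \<ge> 0" by (intro eventually_conj; real_asymp)
  moreover have "\<forall>\<^sub>F n in sequentially. M * (n * ln n) + C * (n * ln (ln n)) - n - 2 * (C0 * n + 1) \<ge> 0" using M0 C C0 by real_asymp
  moreover note coupling_bound_asymptotics[OF g M(1) C(1,2) c0 d0]
  ultimately have "\<forall>\<^sub>F n in sequentially. mixing_time (shuffle_step act n \<mu>) (arrangements n) \<epsilon> \<le>
    ereal (M * (n * ln n) + C * (n * ln (ln n)))"
  proof eventually_elim
    case (elim n)
    define L where "L = ln (real n)"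
    have n8: "real n \<ge> 8 * ?d" using elim(2) by simp
    have n8': "real n \<ge> real (8 * CARD('d))" using n8 by simp
    have n: "n > 0" using n8 d0 by (cases n) auto
    interpret stack_shuffle act \<mu> n by (rule loc[OF n])
    have L: "L \<ge> 1" "ln L \<ge> 0" using elim(3) by (simp_all add: L_def)
    define T where "T = nat \<lceil>C0 * n\<rceil>"
    have T: "real T \<ge> C0 * n" "real T \<le> C0 * n + 1" using C0 by (simp_all add: T_def)
    define t where "t = M * (n * L) + C * (n * ln L)"
    have t2: "t - n \<ge> 2 * (C0 * n + 1)" using elim(4) by (simp add: t_def L_def)
    have t0: "t > 0" using t2 C0 n by (smt (verit) mult_nonneg_nonneg of_nat_0_le_iff)
    note as = elim(5)[folded L_def]
    have D: "D n \<ge> 0" using c23 L by (simp add: D_def L_def)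
    have disc: "\<bar>measure_pmf.prob (law k x) A - measure_pmf.prob U0 A\<bar> \<le> e n - t / (real n)\<^sup>2"
      if x: "x \<in> X" and k: "real k \<ge> t - n" for k x A
    proof -
      have "real (2 * T) \<le> real k" using T(2) t2 k by simp
      then have Tk: "T \<le> k" "T \<le> k - T" by linarith+
      define k' where "k' = k - T"
      have k': "k = k' + T" using Tk by (simp add: k'_def)
      have "c * n = C0 * n + 2 * n" by (simp add: c_def algebra_simps)
      then have "real k' \<ge> M * (n * L) + C * (n * ln L) - c * n"
        using k k' T(2) n unfolding t_def[symmetric] by (simp add: of_nat_add)
      then have r: "1 / 2 \<le> 1 - g / real n + 2 / (real n)\<^sup>2 + 1 / (n * L)" "1 - g / n + 2 / (real n)\<^sup>2 + 1 / (n * L) < 1"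
        and bd: "?d * ((1 - g / n + 2 / (real n)\<^sup>2 + 1 / (n * L)) ^ k' * (n * sqrt (?d ^ 3 * (m * 4 ^ m * L ^ (2 * m))))
         + 4 * ?d ^ 3 * (m * 4 ^ m * L ^ (2 * m)) / (n * (1 - (1 - g / n + 2 / (real n)\<^sup>2 + 1 / (n * L))))) \<le> D n"
        using as[rule_format, of k'] C0 unfolding D_def c2_def c3_def b_def L_def[symmetric] c_def by auto
      have eq: "norm ((S1.lazy n ^^ T) (\<lambda>j. of_bool (j = J)) a - 1 / of_nat CARD('d)) \<le> 1 / (4 * CARD('d))" for a J
        by (rule equi) (use elim(2) T in auto)
      have "\<bar>measure_pmf.prob (law (k' + T) x) A - measure_pmf.prob U0 A\<bar> \<le>
         4 * sqrt ((1 - q / n) ^ (k' + T) * (?d * (n * ln n))) + 256 * ?d ^ 6 * (T / (real n)\<^sup>2 + D n * sqrt T / n)"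
        by (rule law_mixing[OF x q(1) q(3) ls ne L(1) eq _ n8' r[unfolded g_def] bd[unfolded g_def m_def]]) (use Tk k' in simp)
      moreover have "4 * sqrt ((1 - q / n) ^ k * (?d * (n * ln n))) \<le> 4 * sqrt (?d * exp q / ln n)"
      proof -
        have "q / n \<le> 1" using q(3) n by (simp add: field_simps)
        then have "(1 - q / n) ^ k \<le> exp (- (q / n * k))" by (intro power_le_exp) simp
        also have "\<dots> \<le> exp (q - L - 2 * ln L)"
        proof -
          have "q / n * (t - n) \<le> q / n * k" using k q n by (intro mult_left_mono) auto
          moreover have "q / n * (t - n) = q * M * L + q * C * ln L - q" using n by (simp add: t_def field_simps)
          moreover have "1 * L \<le> q * M * L" using M(2) q L by (intro mult_right_mono) (auto simp: field_simps)
          moreover have "2 * ln L \<le> q * C * ln L" using C(3) L by (intro mult_right_mono) auto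
          ultimately show ?thesis by simp
        qed
        also have "\<dots> = exp q / (n * L\<^sup>2)"
        proof -
          have "exp L = n" using n by (simp add: L_def)
          moreover have "exp (2 * ln L) = L\<^sup>2" using L exp_of_nat_mult[of 2 "ln L"] by simp
          ultimately show ?thesis by (simp only: exp_diff divide_divide_eq_left)
        qed
        finally have "(1 - q / n) ^ k * (?d * (n * L)) \<le> exp q / (n * L\<^sup>2) * (?d * (n * L))"
          using L by (intro mult_right_mono) auto
        also have "\<dots> = ?d * exp q / L" using n L by (simp add: power2_eq_square field_simps)
        finally show ?thesis by (simp add: L_def)
      qed
      moreover have "256 * ?d ^ 6 * (T / (real n)\<^sup>2 + D n * sqrt T / n) \<le> 256 * ?d ^ 6 * ((C0 * n + 1) / (real n)\<^sup>2 + D n * sqrt (C0 * n + 1) / n)"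
        using T D n by (intro mult_left_mono add_mono divide_right_mono mult_mono) auto
      moreover have "e n - t / (real n)\<^sup>2 = 4 * sqrt (?d * exp q / ln n) + 256 * ?d ^ 6 * ((C0 * n + 1) / (real n)\<^sup>2 + D n * sqrt (C0 * n + 1) / n)"
        by (simp add: e_def t_def L_def distrib_left)
      ultimately show ?thesis unfolding k' by linarith
    qed
    show ?case
      unfolding L_def[symmetric] t_def[symmetric]
    proof (rule mixing_time_le[OF finite_arrangements arrangements_nonempty])
      show "0 \<le> t" using t0 by simp
      fix x :: "'d \<Rightarrow> nat list" assume x: "x \<in> X"
      have "tv_dist (continuous_time_law K x t) U0 \<le> (e n - t / (real n)\<^sup>2) + t / (real n)\<^sup>2"
        by (rule tv_dist_continuous_le[OF t0, of "t - n"]) (use disc[OF x] n in \<open>auto simp: law_eq\<close>)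
      then show "tv_dist (continuous_time_law K x t) (pmf_of_set X) \<le> \<epsilon>" using elim(1) by (simp add: U0_def)
    qed
  qed
  then show ?thesis unfolding M_def by blast
qed

lemma shuffle_mixing_time_lower:
  fixes \<mu> :: "('d::finite \<Rightarrow> 'd) pmf" and act and \<epsilon> :: real
  defines "g \<equiv> spectral_gap (single_ball_matrix \<mu>)"
  assumes d: "CARD('d) \<ge> 2" and perm: "set_pmf \<mu> \<subseteq> {\<sigma>. \<sigma> permutes UNIV}"
    and irr: "irreducible_matrix (single_ball_matrix \<mu>)"
    and act: "\<And>\<sigma> i. \<sigma> i \<noteq> i \<Longrightarrow> i \<in> act \<sigma>" "\<And>\<sigma> i. \<sigma> permutes UNIV \<Longrightarrow> \<sigma> i \<in> act \<sigma> \<longleftrightarrow> i \<in> act \<sigma>"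
    and \<epsilon>: "\<epsilon> < 1"
  shows "\<exists>C::real. \<forall>\<^sub>F n in sequentially.
    ereal (n * ln n / (2 * g) - C * n) \<le> mixing_time (shuffle_step act n \<mu>) (arrangements n) \<epsilon>"
proof -
  let ?d = "real CARD('d)"
  have loc: "stack_shuffle act \<mu> n" if "n > 0" for n using that perm act by unfold_locales auto
  interpret S1: stack_shuffle act \<mu> 1 by (rule loc) simp
  have g: "g > 0" unfolding g_def by (rule S1.spectral_gap_pos[OF d irr])
  \<comment> \<open>Both probabilities of the event err by at most \<open>\<delta>\<close>, and the
    Poisson error is below \<open>2 * \<delta>\<close>; together this leaves a distance above
    \<open>1 - 4 * \<delta>\<close>, which is \<open>\<epsilon>\<close>.\<close>
  define \<delta> where "\<delta> = (1 - \<epsilon>) / 4"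
  have \<delta>: "\<delta> > 0" using \<epsilon> by (simp add: \<delta>_def)
  \<comment> \<open>With \<open>R = \<rho> * sqrt n\<close> the bound \<open>V / R^2\<close> for the
    event equals \<open>\<delta>\<close>.\<close>
  define \<rho> where "\<rho> = sqrt (4 * ?d\<^sup>2 / (g * \<delta>))"
  have \<rho>: "\<rho> > 0" using g \<delta> by (simp add: \<rho>_def)
  \<comment> \<open>The 1 allows for \<open>n\<close> extra Poisson steps, the 2 for the quadratic
    term of \<open>ln (1 - g / n)\<close>, and the logarithm for the threshold
    \<open>2 * R\<close>.\<close>
  define C where "C = 1 + (2 + ln (2 * \<rho>)) / g"
  have "(\<lambda>n. ((1 / (2 * g)) * (n * ln n) + \<bar>C\<bar> * n) / (real n)\<^sup>2) \<longlonglongrightarrow> 0"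
  proof -
    have "1 / (2 * g) > 0" using g by simp
    then have "(\<lambda>n. (1 / (2 * g)) * (n * ln n) / (real n)\<^sup>2) \<longlonglongrightarrow> 0" by real_asymp
    moreover have "(\<lambda>n. c * n / (real n)\<^sup>2) \<longlonglongrightarrow> 0" for c :: real by real_asymp
    from this[of "\<bar>C\<bar>"] have "(\<lambda>n. \<bar>C\<bar> * n / (real n)\<^sup>2) \<longlonglongrightarrow> 0" .
    ultimately show ?thesis using tendsto_add by (fastforce simp: add_divide_distrib)
  qed
  from order_tendstoD(2)[OF this, of "2 * \<delta>"]
  have "\<forall>\<^sub>F n in sequentially. ((1 / (2 * g)) * (n * ln n) + \<bar>C\<bar> * n) / (real n)\<^sup>2 < 2 * \<delta>" using \<delta> by simp
  moreover have "\<forall>\<^sub>F n in sequentially. real n \<ge> 4 / g \<and> real n \<ge> 2 * g \<and> real n \<ge> 1"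
    by (intro eventually_conj; real_asymp)
  moreover have "\<forall>\<^sub>F n in sequentially. (g / n)\<^sup>2 * ((1 / (2 * g)) * (n * ln n) + \<bar>C\<bar> * n + n) \<le> 1"
  proof -
    have "1 / (2 * g) > 0" using g by simp
    then show ?thesis using g abs_ge_zero[of C] by real_asymp
  qed
  ultimately have "\<forall>\<^sub>F n in sequentially.
    ereal (n * ln n / (2 * g) - C * n) \<le> mixing_time (shuffle_step act n \<mu>) (arrangements n) \<epsilon>"
  proof eventually_elim
    case (elim n)
    have n1: "real n \<ge> 1" "n > 0" and ng: "real n \<ge> 4 / g" "real n \<ge> 2 * g" using elim(2) by auto
    interpret stack_shuffle act \<mu> n by (rule loc[OF n1(2)])
    obtain x where x: "x \<in> X" using arrangements_nonempty by blast
    define R where "R = \<rho> * sqrt n"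
    have R: "R > 0" using \<rho> n1 by (simp add: R_def)
    have VR: "4 * ?d\<^sup>2 * n / g / R\<^sup>2 = \<delta>"
    proof -
      have "R\<^sup>2 = 4 * ?d\<^sup>2 / (g * \<delta>) * n" using g \<delta> by (simp add: R_def \<rho>_def power_mult_distrib)
      then show ?thesis using g \<delta> n1 by simp
    qed
    obtain A where A: "measure_pmf.prob U0 A \<le> \<delta>"
      and Ak: "\<And>k. (1 - g / n) ^ k * n \<ge> 2 * R \<Longrightarrow> measure_pmf.prob (law k x) A \<ge> 1 - \<delta>"
      using eigenvector_event[OF d irr x ng(1)[unfolded g_def] R] unfolding g_def[symmetric] VR by blast
    let ?t0 = "n * ln n / (2 * g) - C * n"
    have bound: "(1 - g / n) ^ k * n \<ge> 2 * R" if k: "real k \<le> ?t0 + n" for k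
    proof -
      define u where "u = g / n"
      have u: "0 < u" "u \<le> 1 / 2" using g n1 ng by (simp_all add: u_def field_simps)
      have kk: "real k \<le> (1 / (2 * g)) * (n * ln n) + \<bar>C\<bar> * n + n"
      proof -
        have "- C * n \<le> \<bar>C\<bar> * n" by (intro mult_right_mono) auto
        then show ?thesis using k by simp
      qed
      have "u * k \<le> u * (?t0 + n)" using k u by (intro mult_left_mono) auto
      also have "\<dots> = ln n / 2 - 2 - ln (2 * \<rho>)" using g n1 by (simp add: u_def C_def field_simps)
      finally have 1: "u * k \<le> ln n / 2 - 2 - ln (2 * \<rho>)" .
      have "u\<^sup>2 * k \<le> u\<^sup>2 * ((1 / (2 * g)) * (n * ln n) + \<bar>C\<bar> * n + n)" using kk by (intro mult_left_mono) auto
      then have 2: "u\<^sup>2 * k \<le> 1" using elim(3) unfolding u_def by linarith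
      have "ln (1 - u) \<ge> - u - 2 * u\<^sup>2" using u by (intro ln_one_minus_pos_lower_bound) auto
      then have l: "ln (1 - u) * k \<ge> (- u - 2 * u\<^sup>2) * k" by (intro mult_right_mono) auto
      have "2 * \<rho> / sqrt n = exp (ln (2 * \<rho>) - ln n / 2)"
        using \<rho> n1 by (simp add: exp_diff ln_sqrt[symmetric])
      also have "\<dots> \<le> exp (k * ln (1 - u))" using 1 2 l by (simp add: algebra_simps)
      also have "\<dots> = (1 - u) ^ k" using u by (simp add: exp_of_nat_mult)
      finally have "2 * \<rho> / sqrt n * n \<le> (1 - u) ^ k * n" by (rule mult_right_mono) simp
      moreover have "2 * \<rho> / sqrt n * n = 2 * \<rho> * (n / sqrt n)" by simp
      moreover have "n / sqrt n = sqrt n" by (simp add: real_div_sqrt)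
      ultimately show ?thesis by (simp add: R_def u_def)
    qed
    show ?case
    proof (rule mixing_time_ge[OF finite_arrangements x])
      fix t :: real assume t: "0 \<le> t" "t < ?t0"
      have "t \<le> (1 / (2 * g)) * (n * ln n) + \<bar>C\<bar> * n"
      proof -
        have "- C * n \<le> \<bar>C\<bar> * n" by (intro mult_right_mono) auto
        then show ?thesis using t by simp
      qed
      then have "t / (real n)\<^sup>2 \<le> ((1 / (2 * g)) * (n * ln n) + \<bar>C\<bar> * n) / (real n)\<^sup>2" by (rule divide_right_mono) simp
      then have tn: "t / (real n)\<^sup>2 < 2 * \<delta>" using elim(1) by simp
      have "1 - 2 * \<delta> - t / (real n)\<^sup>2 \<le> tv_dist (continuous_time_law K x t) U0"
      proof (rule tv_dist_continuous_ge[OF t(1) _ A])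
        show "0 < real n" using n1 by simp
        fix k :: nat assume "real k \<le> t + n"
        then show "1 - \<delta> \<le> measure_pmf.prob (((\<lambda>p. bind_pmf p K) ^^ k) (return_pmf x)) A"
          unfolding law_eq using t by (intro Ak bound) simp
      qed
      moreover have "4 * \<delta> = 1 - \<epsilon>" by (simp add: \<delta>_def)
      ultimately show "\<epsilon> < tv_dist (continuous_time_law K x t) (pmf_of_set X)" using tn unfolding U0_def by linarith
    qed
  qed
  then show ?thesis by blast
qed

lemma shuffle_mixing_time:
  fixes \<mu> :: "('d::finite \<Rightarrow> 'd) pmf" and act and q \<epsilon> :: real
  defines "g \<equiv> spectral_gap (single_ball_matrix \<mu>)"
  assumes "CARD('d) \<ge> 2" "set_pmf \<mu> \<subseteq> {\<sigma>. \<sigma> permutes UNIV}" "irreducible_matrix (single_ball_matrix \<mu>)"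
    and "\<And>\<sigma> i. \<sigma> i \<noteq> i \<Longrightarrow> i \<in> act \<sigma>" "\<And>\<sigma> i. \<sigma> permutes UNIV \<Longrightarrow> \<sigma> i \<in> act \<sigma> \<longleftrightarrow> i \<in> act \<sigma>"
    and "\<And>i. q \<le> measure_pmf.prob \<mu> {\<sigma>. i \<in> act \<sigma>}" "0 < q" "q \<le> 1" and "0 < \<epsilon> \<and> \<epsilon> < 1"
  shows "\<exists>f \<in> O(\<lambda>n. real n). \<exists>h \<in> O(\<lambda>n. real n * ln (ln (real n))). \<forall>\<^sub>F n in sequentially.
    ereal (real n * ln (real n) / (2 * g) - f n) \<le> mixing_time (shuffle_step act n \<mu>) (arrangements n) \<epsilon> \<and>
    mixing_time (shuffle_step act n \<mu>) (arrangements n) \<epsilon> \<le> ereal (max (1 / (2 * g)) (1 / q) * (real n * ln (real n)) + h n)"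
proof -
  obtain C :: real where C: "\<forall>\<^sub>F n in sequentially. ereal (n * ln n / (2 * g) - C * n) \<le> mixing_time (shuffle_step act n \<mu>) (arrangements n) \<epsilon>"
    using shuffle_mixing_time_lower[of \<mu> act \<epsilon>] assms unfolding g_def by blast
  obtain C' :: real where C': "\<forall>\<^sub>F n in sequentially. mixing_time (shuffle_step act n \<mu>) (arrangements n) \<epsilon> \<le>
      ereal (max (1 / (2 * g)) (1 / q) * (n * ln n) + C' * (n * ln (ln n)))"
    using shuffle_mixing_time_upper[of \<mu> act q \<epsilon>] assms unfolding g_def by blast
  show ?thesis
  proof (intro bexI)
    show "\<forall>\<^sub>F n in sequentially.
      ereal (real n * ln (real n) / (2 * g) - C * n) \<le> mixing_time (shuffle_step act n \<mu>) (arrangements n) \<epsilon> \<and>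
      mixing_time (shuffle_step act n \<mu>) (arrangements n) \<epsilon> \<le> ereal (max (1 / (2 * g)) (1 / q) * (real n * ln (real n)) + C' * (n * ln (ln n)))"
      using C C' by (rule eventually_conj)
  qed auto
qed

section \<open>Activity of the stacks in the two chains\<close>

lemma prob_moved_eq: "measure_pmf.prob \<mu> {\<sigma>. i \<in> {i. \<sigma> i \<noteq> i}} = 1 - single_ball_matrix \<mu> $ i $ i"
proof -
  have "{\<sigma>. i \<in> {i. \<sigma> i \<noteq> i}} = UNIV - {\<sigma>. \<sigma> i = i}" by auto
  then show ?thesis using measure_pmf.prob_compl[of "{\<sigma>. \<sigma> i = i}" \<mu>] by (simp add: single_ball_matrix_def)
qed

text \<open>A diagonal entry 1 would make the stack absorbing, so no power of \<open>U\<close> could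
  lead out of it. This makes \<open>q\<close> positive.\<close>

lemma (in doubly_stochastic) diagonal_less_1:
  assumes d: "CARD('d) \<ge> 2" and irr: "irreducible_matrix U"
  shows "U $ i $ i < 1"
proof (rule ccontr)
  assume ge: "\<not> U $ i $ i < 1"
  have off: "U $ i $ j = 0" if "j \<noteq> i" for j
  proof -
    have "U $ i $ i + U $ i $ j = (\<Sum>l\<in>{i, j}. U $ i $ l)" using that by simp
    also have "\<dots> \<le> (\<Sum>l\<in>UNIV. U $ i $ l)" by (rule sum_mono2) (auto simp: nonneg)
    finally show ?thesis using ge nonneg[of i j] row_sum[of i] by linarith
  qed
  have "CARD('d) \<noteq> 1" using d by simp
  then obtain j where j: "j \<noteq> i" by (metis UNIV_eq_I card_1_singleton_iff singletonI One_nat_def)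
  have "pw k $ i $ j = 0" for k
  proof (induction k)
    case 0
    then show ?case using j by (simp add: pw_def mat_def)
  next
    case (Suc k)
    have "pw (Suc k) $ i $ j = (\<Sum>l\<in>UNIV. U $ i $ l * pw k $ l $ j)" by (simp add: pw_Suc matrix_matrix_mult_def)
    also have "\<dots> = 0"
    proof (rule sum.neutral, rule ballI)
      fix l
      show "U $ i $ l * pw k $ l $ j = 0" using off[of l] Suc.IH by (cases "l = i") auto
    qed
    finally show ?case .
  qed
  then show False using irr by (auto simp: irreducible_matrix_def pw_def[symmetric] dest: spec2[of _ i j])
qed

theorem theorem1p7:
  fixes \<mu> :: "('d::finite \<Rightarrow> 'd) pmf"
    and U :: "real ^ 'd ^ 'd"
    and \<gamma> q :: real
  assumes "CARD('d) \<ge> 2"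
    and "set_pmf \<mu> \<subseteq> {\<sigma>. \<sigma> permutes UNIV}"
    and "U = single_ball_matrix \<mu>"
    and "irreducible_matrix U"
    and "\<gamma> = spectral_gap U"
    and "q = Min {1 - U $ i $ i | i. i \<in> UNIV}"
  shows
    "(\<forall>\<epsilon>::real. 0 < \<epsilon> \<and> \<epsilon> < 1 \<longrightarrow>
       (\<exists>f \<in> O(\<lambda>n. real n). \<exists>g \<in> O(\<lambda>n. real n * ln (ln (real n))). \<forall>\<^sub>F n in sequentially.
          ereal (real n * ln (real n) / (2 * \<gamma>) - f n)
            \<le> mixing_time (multi_stack_step n \<mu>) (arrangements n) \<epsilon> \<and>
          mixing_time (multi_stack_step n \<mu>) (arrangements n) \<epsilon>
            \<le> ereal (max (1 / (2 * \<gamma>)) 1 * (real n * ln (real n)) + g n)))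
     \<and>
     (\<forall>\<epsilon>::real. 0 < \<epsilon> \<and> \<epsilon> < 1 \<longrightarrow>
       (\<exists>f \<in> O(\<lambda>n. real n). \<exists>g \<in> O(\<lambda>n. real n * ln (ln (real n))). \<forall>\<^sub>F n in sequentially.
          ereal (real n * ln (real n) / (2 * \<gamma>) - f n)
            \<le> mixing_time (restricted_multi_stack_step n \<mu>) (arrangements n) \<epsilon> \<and>
          mixing_time (restricted_multi_stack_step n \<mu>) (arrangements n) \<epsilon>
            \<le> ereal (max (1 / (2 * \<gamma>)) (1 / q) * (real n * ln (real n)) + g n)))"
proof -
  interpret stack_shuffle "\<lambda>_. UNIV" \<mu> 1 using assms(2) by unfold_locales auto
  have irr: "irreducible_matrix (single_ball_matrix \<mu>)" using assms by simp
  have qs: "{1 - U $ i $ i | i. i \<in> UNIV} = range (\<lambda>i. 1 - U $ i $ i)" by auto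
  have q_le: "q \<le> 1 - U $ i $ i" for i unfolding assms(6) qs by (intro Min_le) auto
  have "q \<in> range (\<lambda>i. 1 - U $ i $ i)" unfolding assms(6) qs by (intro Min_in) auto
  then obtain i where "q = 1 - U $ i $ i" by blast
  then have q: "0 < q" "q \<le> 1"
    using diagonal_less_1[OF assms(1) irr, of i] nonneg[of i i] by (simp_all add: assms(3))
  have moved: "\<sigma> i \<in> {i. \<sigma> i \<noteq> i} \<longleftrightarrow> i \<in> {i. \<sigma> i \<noteq> i}" if "\<sigma> permutes UNIV" for \<sigma> :: "'d \<Rightarrow> 'd" and i
    using permutes_inj[OF that] by (auto dest: injD)
  show ?thesis
    unfolding multi_stack_step_def restricted_multi_stack_step_def assms(5) assms(3)
  proof (intro conjI allI impI)
    fix \<epsilon> :: real assume \<epsilon>: "0 < \<epsilon> \<and> \<epsilon> < 1"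
    \<comment> \<open>In the full shuffle every stack is active in each step, so the activity bound
      is 1.\<close>
    show "\<exists>f \<in> O(\<lambda>n. real n). \<exists>g \<in> O(\<lambda>n. real n * ln (ln (real n))). \<forall>\<^sub>F n in sequentially.
          ereal (real n * ln (real n) / (2 * spectral_gap (single_ball_matrix \<mu>)) - f n)
            \<le> mixing_time (shuffle_step (\<lambda>_. UNIV) n \<mu>) (arrangements n) \<epsilon> \<and>
          mixing_time (shuffle_step (\<lambda>_. UNIV) n \<mu>) (arrangements n) \<epsilon>
            \<le> ereal (max (1 / (2 * spectral_gap (single_ball_matrix \<mu>))) 1 * (real n * ln (real n)) + g n)"
      using shuffle_mixing_time[OF assms(1,2) irr, of "\<lambda>_. UNIV" 1, OF _ _ _ _ _ \<epsilon>] by simp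
    \<comment> \<open>In the restricted shuffle stack \<open>i\<close> is active with probability
      \<open>1 - U $ i $ i\<close>, and \<open>q\<close> is the least of these.\<close>
    show "\<exists>f \<in> O(\<lambda>n. real n). \<exists>g \<in> O(\<lambda>n. real n * ln (ln (real n))). \<forall>\<^sub>F n in sequentially.
          ereal (real n * ln (real n) / (2 * spectral_gap (single_ball_matrix \<mu>)) - f n)
            \<le> mixing_time (shuffle_step (\<lambda>\<sigma>. {i. \<sigma> i \<noteq> i}) n \<mu>) (arrangements n) \<epsilon> \<and>
          mixing_time (shuffle_step (\<lambda>\<sigma>. {i. \<sigma> i \<noteq> i}) n \<mu>) (arrangements n) \<epsilon>
            \<le> ereal (max (1 / (2 * spectral_gap (single_ball_matrix \<mu>))) (1 / q) * (real n * ln (real n)) + g n)"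
      by (rule shuffle_mixing_time[OF assms(1,2) irr _ moved _ q \<epsilon>])
        (use q_le in \<open>auto simp: prob_moved_eq[simplified] assms(3)\<close>)
  qed
qed

end
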